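(* Let $(S,\Omega)$ be a relative Sierpiński carpet and let $u:S\to\widehat{\mathbb R}$ be a (normalized) carpet-harmonic function. Then $u$ is continuous.
   Context: Relative Sierpiński carpets. Let $\Omega\subset\mathbb C$ be a connected open set and $\{Q_i\}_{i\in\mathbb N}$ open Jordan regions compactly contained in $\Omega$, with pairwise disjoint closures, such that $S:=\Omega\setminus\bigcup_iQ_i$ has empty interior and is locally connected. Then $(S,\Omega)$ is a relative Sierpiński carpet with peripheral disks $Q_i$. Standing assumptions on every relative Sierpiński carpet: (i) $\mathcal H^2(S)=0$; (ii) there is $K_0\ge1$ such that for each $i$ there are concentric balls $B(x,r)\subset Q_i\subset B(x,R)$ with $R/r\le K_0$; (iii) there is $K_1>0$ such that $\mathcal H^2(B(x,r)\cap Q_i)\ge K_1r^2$ for all $i$, $x\in Q_i$, $0<r<\operatorname{diam}(Q_i)$. $\mathcal H^m$ is Hausdorff measure normalized to agree with Lebesgue measure. Notation. $\widehat{\mathbb R}=\mathbb R\cup\{\pm\infty\}$. $V\subset\subset\Omega$: $\overline V$ is compact and contained in $\Omega$. $I_V=\{i:Q_i\cap V\ne\emptyset\}$. $S^\circ$: points of $S$ on no $\partial Q_i$. A path is a continuous map from a bounded interval to $\mathbb C$ with a continuous extension to the closed interval (also its image); it is open if the interval is open; subpaths are restrictions to subintervals. For $g:S\to\widehat{\mathbb R}$: $M_{Q_i}(g)=\sup_{\partial Q_i}g$, $m_{Q_i}(g)=\inf_{\partial Q_i}g$, $\operatorname{osc}_{Q_i}(g)=M_{Q_i}(g)-m_{Q_i}(g)$.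 Moduli of a path family $\Gamma$ in $\Omega$. $\mathrm{mod}_2(\Gamma)=\inf\int\lambda^2d\mathcal H^2$ over Borel $\lambda\ge0$ with $\int_\gamma\lambda\,ds\ge1$ for all $\gamma\in\Gamma$ (with $\int_\gamma\lambda\,ds:=\infty$ if $\gamma$ is not locally rectifiable). Weak modulus $\mathrm{mod}_w(\Gamma)=\inf\sum_i\rho(Q_i)^2$ over non-negative sequences for which there is $\Gamma_0\subset\Gamma$ with $\mathrm{mod}_2(\Gamma_0)=0$ and $\sum_{i:Q_i\cap\gamma\ne\emptyset}\rho(Q_i)\ge1$ for $\gamma\in\Gamma\setminus\Gamma_0$. Strong modulus $\mathrm{mod}_s(\Gamma)$: the same infimum over sequences satisfying this inequality for all $\gamma\in\Gamma$ with $\mathcal H^1(\gamma\cap S)=0$. Sobolev spaces. $\{\rho(Q_i)\}$ is a weak (strong) upper gradient of $g:S\to\widehat{\mathbb R}$ if there is $\Gamma_0$ with $\mathrm{mod}_w(\Gamma_0)=0$ ($\mathrm{mod}_s(\Gamma_0)=0$) such that for all paths $\gamma\subset\Omega$, $\gamma\notin\Gamma_0$, and $x,y\in\gamma\cap S$: $g(x),g(y)\neq\pm\infty$ and $|g(x)-g(y)|\le\sum_{i:Q_i\cap\gamma\ne\emptyset}\rho(Q_i)$. $g\in\mathcal W^{1,2}_{\mathrm{loc}}(S)$ if $M_{Q_i}(g),m_{Q_i}(g)$ are finite for all $i$, $\sum_{i\in I_B}M_{Q_i}(g)^2\operatorname{diam}(Q_i)^2<\infty$ and $\sum_{i\in I_B}\operatorname{osc}_{Q_i}(g)^2<\infty$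 for every ball $B\subset\subset\Omega$, and $\{\operatorname{osc}_{Q_i}(g)\}$ is an upper gradient of $g$; $g\in\mathcal W^{1,2}(S)$ if moreover the sums over all $i\in\mathbb N$ are finite. There is a weak and a strong version; the statement holds for each, with one version fixed throughout. Dirichlet energy: $D_V(g)=\sum_{i\in I_V}\operatorname{osc}_{Q_i}(g)^2$. $u\in\mathcal W^{1,2}_{\mathrm{loc}}(S)$ is carpet-harmonic if $D_V(u)\le D_V(u+\zeta)$ for every open $V\subset\subset\Omega$ and $\zeta\in\mathcal W^{1,2}(S)$ with $\zeta|_{S\setminus V}\equiv0$. Normalized functions. For $g\in\mathcal W^{1,2}_{\mathrm{loc}}(S)$ let $\hat g(Q_i)=M_{Q_i}(g)$. Let $\mathcal G_{\hat g}$ be the family of non-constant paths $\gamma\subset\Omega$ with: $\mathcal H^1(\gamma\cap S)=0$; for every subpath $\gamma'$ of $\gamma$ and $Q_{i_1},Q_{i_2}$ meeting $\gamma'$, $|\hat g(Q_{i_1})-\hat g(Q_{i_2})|\le\sum_{i:Q_i\cap\gamma'\neq\emptyset}\operatorname{osc}_{Q_i}(g)$; $\sum_{i:Q_i\cap\gamma'\ne\emptyset}\operatorname{osc}_{Q_i}(g)<\infty$ for subpaths $\gamma'\subset\subset\Omega$; and, if $\sum_{i\in\mathbb N}\operatorname{osc}_{Q_i}(g)^2<\infty$, also $\sum_{i:Q_i\cap\gamma\ne\emptyset}\operatorname{osc}_{Q_i}(g)<\infty$. A point $x\in S$ is accessible by $\gamma_0$ if $x\in\gamma_0\cap S^\circ$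 (put $\gamma=\gamma_0$), or there is an open subpath $\gamma$ of $\gamma_0$ with $x\in\overline\gamma\setminus\gamma$ and $\gamma\cap Q_{i_0}=\emptyset$ whenever $x\in\partial Q_{i_0}$. The normalized version $\tilde g$ of $g$ is: $\tilde g(x)=\liminf_{Q_i\to x,\,Q_i\cap\gamma\ne\emptyset}\hat g(Q_i)$ if $x$ is accessible by a path $\gamma_0\in\mathcal G_{\hat g}$, where $\gamma=\gamma_0$ if $x\in\gamma_0\cap S^\circ$, and otherwise $\gamma$ is an open subpath of $\gamma_0$ with $x\in\overline\gamma\setminus\gamma$ and $\gamma\cap Q_{i_0}=\emptyset$ whenever $x\in\partial Q_{i_0}$ (the value is independent of $\gamma$); for non-accessible $x\in\partial Q_{i_0}$, $\tilde g(x)=\liminf\tilde g(y)$ as $y\to x$ through accessible $y\in\partial Q_{i_0}$; for all other $x$, $\tilde g(x)=\liminf\tilde g(y)$ as $y\to x$ through accessible $y$. A function is normalized if it equals the normalized version of some function in the Sobolev space. Standing convention: carpet-harmonic functions are normalized. *)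

theory Defs
  imports "HOL-Analysis.Analysis"
begin

text \<open>
  Two-dimensional Hausdorff measure, normalized to agree with Lebesgue measure, is rendered by
  \<^const>\<open>lborel\<close> on the complex plane. One-dimensional Hausdorff (outer) measure is defined below.
  Sums of non-negative terms are unconditional sums in \<^typ>\<open>ennreal\<close>, so that they are always
  defined; extended functions on the carpet \<open>S\<close> are functions \<^typ>\<open>complex \<Rightarrow> ereal\<close> of which only
  the values on \<open>S\<close> matter.
\<close>

section \<open>Preliminaries\<close>

definition compactly_contained :: "complex set \<Rightarrow> complex set \<Rightarrow> bool" where
  "compactly_contained V \<Omega> \<longleftrightarrow> compact (closure V) \<and> closure V \<subseteq> \<Omega>"

definition jordan_region :: "complex set \<Rightarrow> bool" where
  "jordan_region U \<longleftrightarrow>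
     (\<exists>c. simple_path c \<and> pathfinish c = pathstart c \<and> U = inside (path_image c))"

text \<open>The sets of a covering have to be bounded, since \<^const>\<open>diameter\<close> of an unbounded set is 0.\<close>

definition hausdorff1 :: "complex set \<Rightarrow> ennreal" where
  "hausdorff1 A =
     (SUP \<delta>\<in>{0<..}. INF U\<in>{U :: nat \<Rightarrow> complex set.
          A \<subseteq> (\<Union>n. U n) \<and> (\<forall>n. bounded (U n) \<and> diameter (U n) \<le> \<delta>)}.
        \<Sum>n. ennreal (diameter (U n)))"


section \<open>Paths and line integrals\<close>

text \<open>A path is a pair of a domain interval and a function, of which only the values on the
  interval matter.\<close>

type_synonym planar_path = "real set \<times> (real \<Rightarrow> complex)"

definition is_planar_path :: "planar_path \<Rightarrow> bool" where
  "is_planar_path \<gamma> \<longleftrightarrow>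
     fst \<gamma> \<noteq> {} \<and> is_interval (fst \<gamma>) \<and> bounded (fst \<gamma>) \<and>
     (\<exists>f. continuous_on (closure (fst \<gamma>)) f \<and> (\<forall>t\<in>fst \<gamma>. f t = snd \<gamma> t))"

definition path_trace :: "planar_path \<Rightarrow> complex set" where
  "path_trace \<gamma> = snd \<gamma> ` fst \<gamma>"

definition nonconstant :: "planar_path \<Rightarrow> bool" where
  "nonconstant \<gamma> \<longleftrightarrow> \<not> (\<exists>c. \<forall>t\<in>fst \<gamma>. snd \<gamma> t = c)"

definition paths_in :: "complex set \<Rightarrow> planar_path set" where
  "paths_in \<Omega> = {\<gamma>. is_planar_path \<gamma> \<and> path_trace \<gamma> \<subseteq> \<Omega>}"

definition is_subpath :: "planar_path \<Rightarrow> planar_path \<Rightarrow> bool" where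
  "is_subpath \<gamma>' \<gamma> \<longleftrightarrow>
     fst \<gamma>' \<noteq> {} \<and> is_interval (fst \<gamma>') \<and> fst \<gamma>' \<subseteq> fst \<gamma> \<and> (\<forall>t\<in>fst \<gamma>'. snd \<gamma>' t = snd \<gamma> t)"

definition curve_length :: "(real \<Rightarrow> complex) \<Rightarrow> real \<Rightarrow> real \<Rightarrow> ennreal" where
  "curve_length f a b =
     (SUP ts\<in>{ts. sorted ts \<and> set ts \<subseteq> {a..b}}.
        \<Sum>k<length ts - 1. ennreal (dist (f (ts ! k)) (f (ts ! Suc k))))"

definition locally_rectifiable :: "planar_path \<Rightarrow> bool" where
  "locally_rectifiable \<gamma> \<longleftrightarrow>
     (\<forall>a\<in>fst \<gamma>. \<forall>b\<in>fst \<gamma>. a \<le> b \<longrightarrow> curve_length (snd \<gamma>) a b < \<infinity>)"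

text \<open>Arc-length parametrization of \<open>f\<close> on \<open>{a..b}\<close>; the choice is immaterial, because \<open>f\<close> is
  constant on intervals where the length function is constant.\<close>

definition arclength_param :: "(real \<Rightarrow> complex) \<Rightarrow> real \<Rightarrow> real \<Rightarrow> real \<Rightarrow> complex" where
  "arclength_param f a b s = f (SOME t. t \<in> {a..b} \<and> curve_length f a t = ennreal s)"

definition line_integral :: "(complex \<Rightarrow> ennreal) \<Rightarrow> planar_path \<Rightarrow> ennreal" where
  "line_integral w \<gamma> =
     (if locally_rectifiable \<gamma>
      then SUP (a, b)\<in>{(a, b). a \<in> fst \<gamma> \<and> b \<in> fst \<gamma> \<and> a \<le> b}.
             \<integral>\<^sup>+s\<in>{0..enn2real (curve_length (snd \<gamma>) a b)}.
                 w (arclength_param (snd \<gamma>) a b s) \<partial>lborel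
      else \<infinity>)"


section \<open>Relative Sierpinski carpets\<close>

definition carpet :: "complex set \<Rightarrow> (nat \<Rightarrow> complex set) \<Rightarrow> complex set" where
  "carpet \<Omega> Q = \<Omega> - (\<Union>i. Q i)"

definition carpet_core :: "complex set \<Rightarrow> (nat \<Rightarrow> complex set) \<Rightarrow> complex set" where
  "carpet_core \<Omega> Q = carpet \<Omega> Q - (\<Union>i. frontier (Q i))"

definition relative_sierpinski_carpet :: "complex set \<Rightarrow> (nat \<Rightarrow> complex set) \<Rightarrow> bool" where
  "relative_sierpinski_carpet \<Omega> Q \<longleftrightarrow>
     open \<Omega> \<and> connected \<Omega> \<and>
     (\<forall>i. jordan_region (Q i) \<and> compactly_contained (Q i) \<Omega>) \<and>
     disjoint_family (\<lambda>i. closure (Q i)) \<and>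
     interior (carpet \<Omega> Q) = {} \<and>
     locally connected (carpet \<Omega> Q) \<and>
     emeasure lborel (carpet \<Omega> Q) = 0 \<and>
     (\<exists>K\<^sub>0\<ge>1. \<forall>i. \<exists>x r R. 0 < r \<and> ball x r \<subseteq> Q i \<and> Q i \<subseteq> ball x R \<and> R / r \<le> K\<^sub>0) \<and>
     (\<exists>K\<^sub>1>0. \<forall>i. \<forall>x\<in>Q i. \<forall>r. 0 < r \<and> r < diameter (Q i) \<longrightarrow>
        emeasure lborel (ball x r \<inter> Q i) \<ge> ennreal (K\<^sub>1 * r\<^sup>2))"

definition disks_meeting :: "(nat \<Rightarrow> complex set) \<Rightarrow> complex set \<Rightarrow> nat set" where
  "disks_meeting Q V = {i. Q i \<inter> V \<noteq> {}}"

definition peri_max :: "(nat \<Rightarrow> complex set) \<Rightarrow> (complex \<Rightarrow> ereal) \<Rightarrow> nat \<Rightarrow> ereal" where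
  "peri_max Q g i = (SUP x\<in>frontier (Q i). g x)"

definition peri_min :: "(nat \<Rightarrow> complex set) \<Rightarrow> (complex \<Rightarrow> ereal) \<Rightarrow> nat \<Rightarrow> ereal" where
  "peri_min Q g i = (INF x\<in>frontier (Q i). g x)"

definition peri_osc :: "(nat \<Rightarrow> complex set) \<Rightarrow> (complex \<Rightarrow> ereal) \<Rightarrow> nat \<Rightarrow> ennreal" where
  "peri_osc Q g i = e2ennreal (peri_max Q g i - peri_min Q g i)"


section \<open>Moduli\<close>

definition mod2 :: "planar_path set \<Rightarrow> ennreal" where
  "mod2 \<Gamma> = (INF w\<in>{w\<in>borel_measurable borel. \<forall>\<gamma>\<in>\<Gamma>. line_integral w \<gamma> \<ge> 1}.
               \<integral>\<^sup>+z. (w z)\<^sup>2 \<partial>lborel)"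

definition mod_weak :: "(nat \<Rightarrow> complex set) \<Rightarrow> planar_path set \<Rightarrow> ennreal" where
  "mod_weak Q \<Gamma> =
     (INF \<rho>\<in>{\<rho> :: nat \<Rightarrow> real. (\<forall>i. \<rho> i \<ge> 0) \<and>
           (\<exists>\<Gamma>\<^sub>0\<subseteq>\<Gamma>. mod2 \<Gamma>\<^sub>0 = 0 \<and>
              (\<forall>\<gamma>\<in>\<Gamma> - \<Gamma>\<^sub>0. (\<Sum>\<^sub>\<infinity>i\<in>disks_meeting Q (path_trace \<gamma>). ennreal (\<rho> i)) \<ge> 1))}.
        \<Sum>i. ennreal ((\<rho> i)\<^sup>2))"

definition mod_strong ::
    "complex set \<Rightarrow> (nat \<Rightarrow> complex set) \<Rightarrow> planar_path set \<Rightarrow> ennreal" where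
  "mod_strong \<Omega> Q \<Gamma> =
     (INF \<rho>\<in>{\<rho> :: nat \<Rightarrow> real. (\<forall>i. \<rho> i \<ge> 0) \<and>
           (\<forall>\<gamma>\<in>\<Gamma>. hausdorff1 (path_trace \<gamma> \<inter> carpet \<Omega> Q) = 0 \<longrightarrow>
              (\<Sum>\<^sub>\<infinity>i\<in>disks_meeting Q (path_trace \<gamma>). ennreal (\<rho> i)) \<ge> 1)}.
        \<Sum>i. ennreal ((\<rho> i)\<^sup>2))"

datatype version = Weak | Strong

fun carpet_mod ::
    "version \<Rightarrow> complex set \<Rightarrow> (nat \<Rightarrow> complex set) \<Rightarrow> planar_path set \<Rightarrow> ennreal" where
  "carpet_mod Weak \<Omega> Q \<Gamma> = mod_weak Q \<Gamma>"
| "carpet_mod Strong \<Omega> Q \<Gamma> = mod_strong \<Omega> Q \<Gamma>"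


section \<open>Sobolev spaces and carpet-harmonic functions\<close>

text \<open>
  Constant paths have to be left out here: a family containing a constant path in
  \<^const>\<open>carpet_core\<close> has infinite modulus, so constant paths could not be exceptional and would
  exclude functions taking the values \<open>\<plusminus>\<infinity>\<close>.
\<close>

definition upper_gradient ::
    "version \<Rightarrow> complex set \<Rightarrow> (nat \<Rightarrow> complex set) \<Rightarrow> (nat \<Rightarrow> ennreal)
      \<Rightarrow> (complex \<Rightarrow> ereal) \<Rightarrow> bool" where
  "upper_gradient ver \<Omega> Q \<rho> g \<longleftrightarrow>
     (\<exists>\<Gamma>\<^sub>0\<subseteq>paths_in \<Omega>. carpet_mod ver \<Omega> Q \<Gamma>\<^sub>0 = 0 \<and>
        (\<forall>\<gamma>\<in>paths_in \<Omega> - \<Gamma>\<^sub>0. nonconstant \<gamma> \<longrightarrow>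
           (\<forall>x\<in>path_trace \<gamma> \<inter> carpet \<Omega> Q. \<forall>y\<in>path_trace \<gamma> \<inter> carpet \<Omega> Q.
              \<bar>g x\<bar> \<noteq> \<infinity> \<and> \<bar>g y\<bar> \<noteq> \<infinity> \<and>
              e2ennreal \<bar>g x - g y\<bar> \<le> (\<Sum>\<^sub>\<infinity>i\<in>disks_meeting Q (path_trace \<gamma>). \<rho> i))))"

definition sq_mass :: "(nat \<Rightarrow> complex set) \<Rightarrow> (complex \<Rightarrow> ereal) \<Rightarrow> nat set \<Rightarrow> ennreal" where
  "sq_mass Q g I = (\<Sum>\<^sub>\<infinity>i\<in>I. e2ennreal ((peri_max Q g i)\<^sup>2) * ennreal ((diameter (Q i))\<^sup>2))"

definition sq_osc :: "(nat \<Rightarrow> complex set) \<Rightarrow> (complex \<Rightarrow> ereal) \<Rightarrow> nat set \<Rightarrow> ennreal" where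
  "sq_osc Q g I = (\<Sum>\<^sub>\<infinity>i\<in>I. (peri_osc Q g i)\<^sup>2)"

definition sobolev_loc ::
    "version \<Rightarrow> complex set \<Rightarrow> (nat \<Rightarrow> complex set) \<Rightarrow> (complex \<Rightarrow> ereal) set" where
  "sobolev_loc ver \<Omega> Q =
     {g. (\<forall>i. \<bar>peri_max Q g i\<bar> \<noteq> \<infinity> \<and> \<bar>peri_min Q g i\<bar> \<noteq> \<infinity>) \<and>
         (\<forall>x r. 0 < r \<and> compactly_contained (ball x r) \<Omega> \<longrightarrow>
            sq_mass Q g (disks_meeting Q (ball x r)) < \<infinity> \<and>
            sq_osc Q g (disks_meeting Q (ball x r)) < \<infinity>) \<and>
         upper_gradient ver \<Omega> Q (peri_osc Q g) g}"

definition sobolev ::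
    "version \<Rightarrow> complex set \<Rightarrow> (nat \<Rightarrow> complex set) \<Rightarrow> (complex \<Rightarrow> ereal) set" where
  "sobolev ver \<Omega> Q =
     {g \<in> sobolev_loc ver \<Omega> Q. sq_mass Q g UNIV < \<infinity> \<and> sq_osc Q g UNIV < \<infinity>}"

definition dirichlet_energy ::
    "(nat \<Rightarrow> complex set) \<Rightarrow> complex set \<Rightarrow> (complex \<Rightarrow> ereal) \<Rightarrow> ennreal" where
  "dirichlet_energy Q V g = sq_osc Q g (disks_meeting Q V)"

text \<open>Only values on peripheral circles enter the energies, and these are finite for Sobolev
  functions; so no indeterminate sum \<open>\<infinity> - \<infinity>\<close> affects the energy of \<open>u + \<zeta>\<close>.\<close>

definition carpet_harmonic ::
    "version \<Rightarrow> complex set \<Rightarrow> (nat \<Rightarrow> complex set) \<Rightarrow> (complex \<Rightarrow> ereal) \<Rightarrow> bool" where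
  "carpet_harmonic ver \<Omega> Q u \<longleftrightarrow>
     u \<in> sobolev_loc ver \<Omega> Q \<and>
     (\<forall>V \<zeta>. open V \<and> compactly_contained V \<Omega> \<and> \<zeta> \<in> sobolev ver \<Omega> Q \<and>
            (\<forall>x\<in>carpet \<Omega> Q - V. \<zeta> x = 0) \<longrightarrow>
        dirichlet_energy Q V u \<le> dirichlet_energy Q V (\<lambda>x. u x + \<zeta> x))"


section \<open>Normalized functions\<close>

definition good_paths ::
    "complex set \<Rightarrow> (nat \<Rightarrow> complex set) \<Rightarrow> (complex \<Rightarrow> ereal) \<Rightarrow> planar_path set" where
  "good_paths \<Omega> Q g =
     {\<gamma>\<in>paths_in \<Omega>. nonconstant \<gamma> \<and>
        hausdorff1 (path_trace \<gamma> \<inter> carpet \<Omega> Q) = 0 \<and>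
        (\<forall>\<gamma>'. is_subpath \<gamma>' \<gamma> \<longrightarrow>
           (\<forall>i\<in>disks_meeting Q (path_trace \<gamma>'). \<forall>j\<in>disks_meeting Q (path_trace \<gamma>').
              e2ennreal \<bar>peri_max Q g i - peri_max Q g j\<bar>
                \<le> (\<Sum>\<^sub>\<infinity>k\<in>disks_meeting Q (path_trace \<gamma>'). peri_osc Q g k))) \<and>
        (\<forall>\<gamma>'. is_subpath \<gamma>' \<gamma> \<and> compactly_contained (path_trace \<gamma>') \<Omega> \<longrightarrow>
           (\<Sum>\<^sub>\<infinity>k\<in>disks_meeting Q (path_trace \<gamma>'). peri_osc Q g k) < \<infinity>) \<and>
        (sq_osc Q g UNIV < \<infinity> \<longrightarrow>
           (\<Sum>\<^sub>\<infinity>k\<in>disks_meeting Q (path_trace \<gamma>). peri_osc Q g k) < \<infinity>)}"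

text \<open>The point \<open>x\<close> is accessible by \<open>\<gamma>\<^sub>0\<close>, with \<open>\<gamma>\<close> the path along which it is approached.\<close>

definition accessible_along ::
    "complex set \<Rightarrow> (nat \<Rightarrow> complex set) \<Rightarrow> complex \<Rightarrow> planar_path \<Rightarrow> planar_path \<Rightarrow> bool" where
  "accessible_along \<Omega> Q x \<gamma>\<^sub>0 \<gamma> \<longleftrightarrow>
     (if x \<in> path_trace \<gamma>\<^sub>0 \<inter> carpet_core \<Omega> Q then \<gamma> = \<gamma>\<^sub>0
      else x \<in> carpet \<Omega> Q \<and> is_subpath \<gamma> \<gamma>\<^sub>0 \<and> open (fst \<gamma>) \<and>
           x \<in> closure (path_trace \<gamma>) - path_trace \<gamma> \<and>
           (\<forall>i. x \<in> frontier (Q i) \<longrightarrow> path_trace \<gamma> \<inter> Q i = {}))"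

definition accessible_points ::
    "complex set \<Rightarrow> (nat \<Rightarrow> complex set) \<Rightarrow> (complex \<Rightarrow> ereal) \<Rightarrow> complex set" where
  "accessible_points \<Omega> Q g = {x. \<exists>\<gamma>\<^sub>0\<in>good_paths \<Omega> Q g. \<exists>\<gamma>. accessible_along \<Omega> Q x \<gamma>\<^sub>0 \<gamma>}"

text \<open>The filter of the indices \<open>i\<close> with \<open>Q i\<close> tending to \<open>x\<close> and meeting \<open>\<gamma>\<close>.\<close>

definition disks_to_along :: "(nat \<Rightarrow> complex set) \<Rightarrow> complex \<Rightarrow> planar_path \<Rightarrow> nat filter" where
  "disks_to_along Q x \<gamma> =
     (INF \<epsilon>\<in>{0<..}. principal {i \<in> disks_meeting Q (path_trace \<gamma>). Q i \<subseteq> ball x \<epsilon>})"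

text \<open>The limit inferior does not depend on the path chosen here.\<close>

definition accessible_value ::
    "complex set \<Rightarrow> (nat \<Rightarrow> complex set) \<Rightarrow> (complex \<Rightarrow> ereal) \<Rightarrow> complex \<Rightarrow> ereal" where
  "accessible_value \<Omega> Q g x =
     Liminf (disks_to_along Q x
               (SOME \<gamma>. \<exists>\<gamma>\<^sub>0\<in>good_paths \<Omega> Q g. accessible_along \<Omega> Q x \<gamma>\<^sub>0 \<gamma>))
       (peri_max Q g)"

definition normalized_version ::
    "complex set \<Rightarrow> (nat \<Rightarrow> complex set) \<Rightarrow> (complex \<Rightarrow> ereal) \<Rightarrow> complex \<Rightarrow> ereal" where
  "normalized_version \<Omega> Q g x =
     (if x \<in> accessible_points \<Omega> Q g then accessible_value \<Omega> Q g x
      else if \<exists>i. x \<in> frontier (Q i) then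
        Liminf (at x within accessible_points \<Omega> Q g \<inter> frontier (Q (THE i. x \<in> frontier (Q i))))
          (accessible_value \<Omega> Q g)
      else Liminf (at x within accessible_points \<Omega> Q g) (accessible_value \<Omega> Q g))"

definition is_normalized ::
    "version \<Rightarrow> complex set \<Rightarrow> (nat \<Rightarrow> complex set) \<Rightarrow> (complex \<Rightarrow> ereal) \<Rightarrow> bool" where
  "is_normalized ver \<Omega> Q u \<longleftrightarrow>
     (\<exists>g\<in>sobolev_loc ver \<Omega> Q. \<forall>x\<in>carpet \<Omega> Q. u x = normalized_version \<Omega> Q g x)"

end

theory Submission
  imports Defs
begin

text \<open>
  Suppose that \<open>M\<close>, the maximum of \<open>u\<close> over a peripheral circle, did not converge along disks
  shrinking to a point \<open>x\<close> of the carpet: then it would lie below \<open>c\<close> and above \<open>c' > c\<close>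
  arbitrarily close to \<open>x\<close>. By minimality of the energy every component of a superlevel set of
  \<open>u\<close> reaches a fixed distance from \<open>x\<close>, since otherwise \<open>u\<close> could be cut off there; likewise for
  sublevel sets. Thus a continuum with values near \<open>c'\<close> or more and one with values near \<open>c\<close> or
  less both cross all small squares around \<open>x\<close>. As the oscillations are square summable and the
  disks are fat, on some of these squares the oscillations sum up to less than \<open>(c' - c) / 15\<close>,
  apart from a disk \<open>Q i\<close> with \<open>x\<close> on its boundary, and an upper gradient is available on the four
  sides. If \<open>x\<close> is on no peripheral circle, this is a contradiction. Otherwise, either \<open>u\<close> stays above \<open>c\<close>
  or below \<open>c'\<close> on the boundary of \<open>Q i\<close>, and \<open>Q i\<close> serves as one of the continua; or both continua
  avoid \<open>Q i\<close>, and planar topology (Janiszewski) joins them by an arc of the square outside \<open>Q i\<close>.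

  The limits so obtained depend continuously on \<open>x\<close>. If \<open>u\<close> is the normalized version of \<open>g\<close>, then
  \<open>u = g\<close> at points of generic axis-parallel lines that are on no peripheral circle; such points
  accumulate at every peripheral circle, so the maxima of \<open>g\<close> have the same limits as those of \<open>u\<close>.
  The normalized version takes exactly these limits as its values.
\<close>

section \<open>Partial sums of non-negative sequences\<close>

text \<open>Cutting \<open>u\<close> off on one component is legitimate only if the result is again
  a Sobolev function, that is, if its own oscillations form an upper gradient. What comes out
  directly is an estimate by multiples of the oscillations of \<open>u\<close>. The repair is that
  along a single path any weight with a finite sum improves to the oscillations themselves.
  Components are therefore formed with paths that obey the upper gradient inequality, not
  topologically. Minimality gives a contradiction at once only where the cut-off saves energy. What
  is left is a function that is constant on the component: the cut-off then takes two values, only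
  finitely many disks carry its jump, and these do not disconnect the plane. Squares replace circles
  because their sides are axis-parallel, so that Fubini's theorem in Cartesian coordinates takes
  care of the exceptional families. The 15 is 3 times 5: passing from disk to disk along a segment
  costs three sums of oscillations, and an arc of a square consists of at most five
  segments.\<close>

definition psum :: "(nat \<Rightarrow> ennreal) \<Rightarrow> nat set \<Rightarrow> ennreal" where
  "psum \<rho> I = (\<Sum>i. if i \<in> I then \<rho> i else 0)"

lemma psum_mono: "I \<subseteq> J \<Longrightarrow> (\<And>i. i \<in> I \<Longrightarrow> \<rho> i \<le> \<rho>' i) \<Longrightarrow> psum \<rho> I \<le> psum \<rho>' J"
  unfolding psum_def by (intro suminf_le) auto

lemma psum_mono_set: "I \<subseteq> J \<Longrightarrow> psum \<rho> I \<le> psum \<rho> J"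
  by (rule psum_mono) auto

lemma psum_add: "psum (\<lambda>i. \<rho> i + \<rho>' i) I = psum \<rho> I + psum \<rho>' I"
  unfolding psum_def by (subst suminf_add) (auto intro!: suminf_cong)

lemma psum_cmult: "psum (\<lambda>i. c * \<rho> i) I = c * psum \<rho> I"
  unfolding psum_def ennreal_suminf_cmult[symmetric] by (rule suminf_cong) simp

lemma psum_Un_disjoint: "I \<inter> J = {} \<Longrightarrow> psum \<rho> (I \<union> J) = psum \<rho> I + psum \<rho> J"
  unfolding psum_def by (subst suminf_add) (auto intro!: suminf_cong)

lemma psum_Un_le: "psum \<rho> (I \<union> J) \<le> psum \<rho> I + psum \<rho> J"
  unfolding psum_def by (subst suminf_add) (auto intro!: suminf_le)

lemma psum_finite: "finite I \<Longrightarrow> psum \<rho> I = sum \<rho> I"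
  unfolding psum_def by (subst suminf_finite[of I]) auto

lemma psum_ge: "i \<in> I \<Longrightarrow> \<rho> i \<le> psum \<rho> I"
  using psum_mono_set[of "{i}" I \<rho>] by (simp add: psum_finite)

lemma psum_sup: "psum \<rho> I = (SUP F\<in>{F. finite F \<and> F \<subseteq> I}. sum \<rho> F)"
proof (rule antisym)
  show "psum \<rho> I \<le> (SUP F\<in>{F. finite F \<and> F \<subseteq> I}. sum \<rho> F)"
    unfolding psum_def suminf_eq_SUP
  proof (rule SUP_least)
    fix n
    have "(\<Sum>i<n. if i \<in> I then \<rho> i else 0) = sum \<rho> ({..<n} \<inter> I)"
      by (simp add: sum.inter_restrict)
    also have "\<dots> \<le> (SUP F\<in>{F. finite F \<and> F \<subseteq> I}. sum \<rho> F)"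
      by (rule SUP_upper) auto
    finally show "(\<Sum>i<n. if i \<in> I then \<rho> i else 0) \<le> \<dots>" .
  qed
  show "(SUP F\<in>{F. finite F \<and> F \<subseteq> I}. sum \<rho> F) \<le> psum \<rho> I"
    by (rule SUP_least) (auto simp: psum_finite[symmetric] intro: psum_mono_set)
qed

text \<open>Connects the unconditional sums of the definitions with the series form, for which the
  exchange with integrals and with measures of countable unions is at hand.\<close>

lemma infsum_psum: "infsum \<rho> I = psum \<rho> I"
  unfolding psum_sup by (rule nonneg_infsum_complete) auto

text \<open>Mostly applied together with the closures of the disks in \<open>F\<close>: a finite
  union of them is closed, so it stays away from any point outside it, and the disks met near such a
  point belong to the small remainder.\<close>

lemma psum_tail:
  assumes "psum \<rho> I < \<infinity>" "\<epsilon> > 0"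
  shows "\<exists>F. finite F \<and> F \<subseteq> I \<and> psum \<rho> (I - F) < \<epsilon>"
proof (cases "psum \<rho> I = 0")
  case True
  then show ?thesis using assms by (intro exI[of _ "{}"]) simp
next
  case False
  have "\<exists>F. finite F \<and> F \<subseteq> I \<and> psum \<rho> I < sum \<rho> F + \<epsilon>"
  proof (cases "psum \<rho> I < \<epsilon>")
    case True
    then show ?thesis by (intro exI[of _ "{}"]) simp
  next
    case False
    have "psum \<rho> I - \<epsilon> < psum \<rho> I"
      using \<open>psum \<rho> I \<noteq> 0\<close> assms by (intro ennreal_between) (auto simp: zero_less_iff_neq_zero)
    then have "psum \<rho> I - \<epsilon> < (SUP F\<in>{F. finite F \<and> F \<subseteq> I}. sum \<rho> F)"
      unfolding psum_sup[symmetric] .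
    then obtain F where F: "finite F" "F \<subseteq> I" "psum \<rho> I - \<epsilon> < sum \<rho> F"
      unfolding less_SUP_iff by blast
    have "psum \<rho> I < sum \<rho> F + \<epsilon>"
    proof -
      have "\<epsilon> \<le> psum \<rho> I" "\<epsilon> < top" using False assms(1) by (auto simp: not_less top.not_eq_extremum)
      then show ?thesis using F(3) minus_less_iff_ennreal by blast
    qed
    then show ?thesis using F by blast
  qed
  then obtain F where F: "finite F" "F \<subseteq> I" "psum \<rho> I < sum \<rho> F + \<epsilon>" by blast
  have "psum \<rho> I = sum \<rho> F + psum \<rho> (I - F)"
    using psum_Un_disjoint[of F "I - F" \<rho>] F(2) by (simp add: Un_absorb1 psum_finite[OF F(1)])
  then have "sum \<rho> F + psum \<rho> (I - F) < sum \<rho> F + \<epsilon>"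
    using F(3) by (simp only:)
  then have "psum \<rho> (I - F) < \<epsilon>"
    using add_left_mono[of \<epsilon> "psum \<rho> (I - F)" "sum \<rho> F"] not_less by blast
  then show ?thesis using F by blast
qed

lemma disks_meeting_mono: "X \<subseteq> Y \<Longrightarrow> disks_meeting Q X \<subseteq> disks_meeting Q Y"
  by (auto simp: disks_meeting_def)

lemma psum_hit_mono: "X \<subseteq> Y \<Longrightarrow> psum \<rho> (disks_meeting Q X) \<le> psum \<rho> (disks_meeting Q Y)"
  by (intro psum_mono_set disks_meeting_mono)

text \<open>The Jordan curve theorem for peripheral disks; the last fact makes the connected
  exterior available as the complement of the closed disk.\<close>

lemma jordan_props:
  assumes "jordan_region U"
  obtains c where "simple_path c" "pathfinish c = pathstart c" "U = inside (path_image c)"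
    "frontier U = path_image c" "open U" "connected U" "bounded U" "U \<noteq> {}"
    "- closure U = outside (path_image c)"
proof -
  obtain c where c: "simple_path c" "pathfinish c = pathstart c" "U = inside (path_image c)"
    using assms by (auto simp: jordan_region_def)
  have "- closure U = outside (path_image c)"
  proof -
    have "closure U = inside (path_image c) \<union> path_image c"
      using Jordan_inside_outside[OF c(1,2)] c(3) by (simp add: closure_Un_frontier)
    then show ?thesis by (simp add: outside_inside Un_commute)
  qed
  then show ?thesis
    using Jordan_inside_outside[OF c(1,2)] c(3) by (intro that[OF c]) simp_all
qed

section \<open>Upper gradients along a single path\<close>

locale rel_carpet =
  fixes \<Omega> :: "complex set" and Q :: "nat \<Rightarrow> complex set"
  assumes car: "relative_sierpinski_carpet \<Omega> Q"
begin

abbreviation "S \<equiv> carpet \<Omega> Q"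
abbreviation "hit \<equiv> disks_meeting Q"

lemma open_Om: "open \<Omega>" and conn_Om: "connected \<Omega>"
  and jordan_Q: "jordan_region (Q i)" and cc_Q: "compactly_contained (Q i) \<Omega>"
  and disj_cl: "disjoint_family (\<lambda>i. closure (Q i))" and int_S: "interior S = {}"
  and null_S: "emeasure lborel S = 0"
  using car unfolding relative_sierpinski_carpet_def by simp_all

lemma open_Q: "open (Q i)" and conn_Q: "connected (Q i)" and ne_Q: "Q i \<noteq> {}"
  and bdd_Q: "bounded (Q i)"
proof -
  obtain c where "open (Q i)" "connected (Q i)" "bounded (Q i)" "Q i \<noteq> {}"
    using jordan_props[OF jordan_Q[of i]] by metis
  then show "open (Q i)" "connected (Q i)" "Q i \<noteq> {}" "bounded (Q i)" by blast+
qed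

lemma cl_Q_sub: "closure (Q i) \<subseteq> \<Omega>" and compact_cl_Q: "compact (closure (Q i))"
  using cc_Q[of i] by (auto simp: compactly_contained_def)

lemma cl_disj: "z \<in> closure (Q i) \<Longrightarrow> z \<in> closure (Q j) \<Longrightarrow> i = j"
  using disj_cl by (auto simp: disjoint_family_on_def)

lemma front_iff: "z \<in> frontier (Q i) \<longleftrightarrow> z \<in> closure (Q i) \<and> z \<notin> Q i"
  by (simp add: frontier_def interior_open open_Q)

lemma front_S: "frontier (Q i) \<subseteq> S"
proof
  fix z assume "z \<in> frontier (Q i)"
  then have z: "z \<in> closure (Q i)" "z \<notin> Q i" by (auto simp: front_iff)
  then have "z \<notin> Q j" for j
    using cl_disj[of z i j] closure_subset by blast
  then show "z \<in> S" using z cl_Q_sub by (auto simp: carpet_def)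
qed

lemma front_ne: "frontier (Q i) \<noteq> {}"
  using ne_Q[of i] bdd_Q[of i] not_bounded_UNIV by (auto simp: frontier_eq_empty)

lemma S_cl_front: "z \<in> S \<Longrightarrow> z \<in> closure (Q i) \<Longrightarrow> z \<in> frontier (Q i)"
  by (auto simp: front_iff carpet_def)

lemma S_sub: "S \<subseteq> \<Omega>"
  by (auto simp: carpet_def)

lemma S_not_Q: "z \<in> S \<Longrightarrow> z \<notin> Q i"
  by (auto simp: carpet_def)

lemma Om_cases: "z \<in> \<Omega> \<Longrightarrow> z \<in> S \<or> (\<exists>k. z \<in> Q k)"
  by (auto simp: carpet_def)

text \<open>The witness is the infimum of the times spent in the open disk: a limit of such times
  but not one itself, as otherwise slightly earlier times would belong to the disk as well. A path
  that never enters must end on the circle. Since the path up to \<open>c\<close> avoids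
  \<open>Q k\<close>, its sum of oscillations does not contain that of \<open>Q k\<close>.\<close>

lemma path_enters:
  fixes f :: "real \<Rightarrow> complex"
  assumes f: "continuous_on {a..b} f" and "a \<le> b" "f a \<notin> Q k" "f b \<in> closure (Q k)"
  shows "\<exists>c\<in>{a..b}. f c \<in> frontier (Q k) \<and> f ` {a..c} \<inter> Q k = {}"
proof (cases "f ` {a..b} \<inter> Q k = {}")
  case True
  moreover have "f b \<in> f ` {a..b}" using \<open>a \<le> b\<close> by simp
  ultimately have "f b \<notin> Q k" by blast
  then show ?thesis using True assms by (intro bexI[of _ b]) (auto simp: front_iff)
next
  case False
  define T where "T = {t\<in>{a..b}. f t \<in> Q k}"
  have T: "T \<noteq> {}" "bdd_below T" using False by (auto simp: T_def)
  define c where "c = Inf T"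
  have ac: "a \<le> c" unfolding c_def using T by (intro cInf_greatest) (auto simp: T_def)
  have cb: "c \<le> b" unfolding c_def using T by (metis (lifting) T_def atLeastAtMost_iff cInf_lower2 ex_in_conv mem_Collect_eq)
  have lo: "t \<notin> T" if "t < c" for t using that T cInf_lower unfolding c_def by fastforce
  have ccl: "c \<in> closure T" unfolding c_def using T closure_contains_Inf by blast
  have "f c \<in> closure (Q k)"
  proof -
    have "closure T \<subseteq> {a..b} \<inter> f -` closure (Q k)"
      using closure_subset[of "Q k"]
      by (intro closure_minimal continuous_closed_preimage[OF f]) (auto simp: T_def)
    then show ?thesis using ccl by auto
  qed
  moreover have "f c \<notin> Q k"
  proof
    assume fc: "f c \<in> Q k"
    then have "a < c" using ac assms(3) by (metis order_le_less)
    obtain e where e: "e > 0" "\<And>t. t \<in> {a..b} \<Longrightarrow> dist t c < e \<Longrightarrow> f t \<in> Q k"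
    proof -
      obtain d where d: "d>0" "ball (f c) d \<subseteq> Q k" using fc open_Q open_contains_ball by blast
      then obtain e where "e>0" "\<forall>t\<in>{a..b}. dist t c < e \<longrightarrow> dist (f t) (f c) < d"
        using f ac cb unfolding continuous_on_iff by (metis atLeastAtMost_iff)
      then show ?thesis using that[of e] d by (auto simp: dist_commute subset_iff)
    qed
    define t where "t = max a (c - e/2)"
    have "t \<in> {a..b}" "dist t c < e" "t < c" using e \<open>a < c\<close> cb by (auto simp: t_def dist_real_def max_def)
    then have "t \<in> T" using e by (auto simp: T_def)
    then show False using lo \<open>t < c\<close> by blast
  qed
  moreover have "f ` {a..c} \<inter> Q k = {}"
  proof -
    have "f t \<notin> Q k" if "t \<in> {a..c}" for t
      using that lo[of t] cb \<open>f c \<notin> Q k\<close> by (cases "t = c") (auto simp: T_def)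
    then show ?thesis by auto
  qed
  ultimately show ?thesis using ac cb by (intro bexI[of _ c]) (auto simp: front_iff)
qed

lemma path_leaves:
  fixes f :: "real \<Rightarrow> complex"
  assumes f: "continuous_on {a..b} f" and "a \<le> b" "f a \<in> closure (Q k)" "f b \<notin> Q k"
  shows "\<exists>c\<in>{a..b}. f c \<in> frontier (Q k) \<and> f ` {c..b} \<inter> Q k = {}"
proof -
  have "continuous_on {-b..-a} (\<lambda>t. f (- t))"
    by (intro continuous_on_compose2[OF f]) (auto intro!: continuous_intros)
  then obtain c where c: "c \<in> {-b..-a}" "f (-c) \<in> frontier (Q k)" "(\<lambda>t. f (-t)) ` {-b..c} \<inter> Q k = {}"
    using path_enters[of "-b" "-a" "\<lambda>t. f (-t)" k] assms by auto
  have "f ` {-c..b} \<inter> Q k = {}"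
  proof -
    have "f t \<notin> Q k" if "t \<in> {-c..b}" for t
    proof -
      have "-t \<in> {-b..c}" using that by auto
      then have "f (- (-t)) \<notin> Q k" using c(3) by (metis disjoint_iff image_eqI)
      then show ?thesis by simp
    qed
    then show ?thesis by auto
  qed
  then show ?thesis using c by (intro bexI[of _ "-c"]) auto
qed

section \<open>Maxima, minima and oscillations of real functions on peripheral circles\<close>

definition pM :: "(complex \<Rightarrow> real) \<Rightarrow> nat \<Rightarrow> real" where "pM v k = Sup (v ` frontier (Q k))"
definition pm :: "(complex \<Rightarrow> real) \<Rightarrow> nat \<Rightarrow> real" where "pm v k = Inf (v ` frontier (Q k))"
definition pO :: "(complex \<Rightarrow> real) \<Rightarrow> nat \<Rightarrow> real" where "pO v k = pM v k - pm v k"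
text \<open>Makes the real \<open>Sup\<close> and \<open>Inf\<close> above meaningful;
  \<open>sobolev_loc_peri\<close> supplies it for every function in the local Sobolev space.\<close>

definition pbdd :: "(complex \<Rightarrow> real) \<Rightarrow> bool" where "pbdd v \<longleftrightarrow> (\<forall>k. bounded (v ` frontier (Q k)))"

lemma pM_ge: "pbdd v \<Longrightarrow> z \<in> frontier (Q k) \<Longrightarrow> v z \<le> pM v k"
  unfolding pM_def pbdd_def by (intro cSup_upper) (auto dest: bounded_imp_bdd_above)

lemma pm_le: "pbdd v \<Longrightarrow> z \<in> frontier (Q k) \<Longrightarrow> pm v k \<le> v z"
  unfolding pm_def pbdd_def by (intro cInf_lower) (auto dest: bounded_imp_bdd_below)

lemma pM_least: "(\<And>z. z \<in> frontier (Q k) \<Longrightarrow> v z \<le> c) \<Longrightarrow> pM v k \<le> c"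
  unfolding pM_def using front_ne by (intro cSup_least) auto

lemma pm_greatest: "(\<And>z. z \<in> frontier (Q k) \<Longrightarrow> c \<le> v z) \<Longrightarrow> c \<le> pm v k"
  unfolding pm_def using front_ne by (intro cInf_greatest) auto

lemma pm_le_pM: "pbdd v \<Longrightarrow> pm v k \<le> pM v k"
  using front_ne[of k] pM_ge pm_le by (meson ex_in_conv order_trans)

lemma pO_nonneg: "pbdd v \<Longrightarrow> 0 \<le> pO v k"
  using pm_le_pM by (simp add: pO_def)

lemma pbdd_uminus: "pbdd v \<Longrightarrow> pbdd (\<lambda>z. - v z)"
  unfolding pbdd_def bounded_iff by auto

lemma pM_uminus: "pM (\<lambda>z. - v z) k = - pm v k"
  unfolding pM_def pm_def Inf_real_def by (simp add: image_image)

lemma pm_uminus: "pm (\<lambda>z. - v z) k = - pM v k"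
  unfolding pM_def pm_def Inf_real_def by (simp add: image_image)

lemma pO_uminus: "pO (\<lambda>z. - v z) k = pO v k"
  by (simp add: pO_def pM_uminus pm_uminus)

lemma pO_ge: "pbdd v \<Longrightarrow> z \<in> frontier (Q k) \<Longrightarrow> w \<in> frontier (Q k) \<Longrightarrow> \<bar>v z - v w\<bar> \<le> pO v k"
  using pM_ge pm_le unfolding pO_def by (smt (verit))

text \<open>The upper gradient inequality on every subpath of one path. The weight
  \<open>\<rho>\<close> is kept apart from \<open>v\<close> because a truncated function inherits an
  inequality with the oscillations of the original function; \<open>tame_self_improve\<close> later
  exchanges the weight for its own oscillations.\<close>

definition tame_by :: "(nat \<Rightarrow> ennreal) \<Rightarrow> (complex \<Rightarrow> real) \<Rightarrow> (real \<Rightarrow> complex) \<Rightarrow> real \<Rightarrow> real \<Rightarrow> bool" where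
  "tame_by \<rho> v f s t \<longleftrightarrow> continuous_on {s..t} f \<and> f ` {s..t} \<subseteq> \<Omega> \<and>
     (\<forall>a b. s \<le> a \<and> a \<le> b \<and> b \<le> t \<and> f a \<in> S \<and> f b \<in> S \<longrightarrow>
        ennreal \<bar>v (f a) - v (f b)\<bar> \<le> psum \<rho> (hit (f ` {a..b})))"

abbreviation "eO v \<equiv> (\<lambda>k. ennreal (pO v k))"
abbreviation "tame v \<equiv> tame_by (eO v) v"

lemma tame_byD: "tame_by \<rho> v f s t \<Longrightarrow> s \<le> a \<Longrightarrow> a \<le> b \<Longrightarrow> b \<le> t \<Longrightarrow> f a \<in> S \<Longrightarrow> f b \<in> S \<Longrightarrow>
   ennreal \<bar>v (f a) - v (f b)\<bar> \<le> psum \<rho> (hit (f ` {a..b}))"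
  by (auto simp: tame_by_def)

lemma tame_by_cont: "tame_by \<rho> v f s t \<Longrightarrow> continuous_on {s..t} f"
  and tame_by_Om: "tame_by \<rho> v f s t \<Longrightarrow> f ` {s..t} \<subseteq> \<Omega>"
  unfolding tame_by_def by blast+

lemma tame_by_sub: "tame_by \<rho> v f s t \<Longrightarrow> s \<le> s' \<Longrightarrow> t' \<le> t \<Longrightarrow> tame_by \<rho> v f s' t'"
  unfolding tame_by_def by (auto intro: continuous_on_subset)

lemma tame_by_uminus: "tame_by \<rho> v f s t \<Longrightarrow> tame_by \<rho> (\<lambda>z. - v z) f s t"
  unfolding tame_by_def by (auto simp: abs_minus_commute)

lemma image_uminus_compose: "(\<lambda>t. f (- t)) ` {a..b} = f ` {- b..- a :: real}"
proof -
  have "(\<lambda>t. f (- t)) ` {a..b} = f ` (uminus ` {a..b})" by (simp only: image_image)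
  then show ?thesis unfolding image_uminus_atLeastAtMost .
qed

lemma tame_by_reverse:
  assumes "tame_by \<rho> v f s t"
  shows "tame_by \<rho> v (\<lambda>r. f (- r)) (- t) (- s)"
  unfolding tame_by_def
proof (intro conjI allI impI)
  show "continuous_on {- t..- s} (\<lambda>r. f (- r))"
    by (intro continuous_on_compose2[OF tame_by_cont[OF assms]]) (auto intro!: continuous_intros)
  show "(\<lambda>r. f (- r)) ` {- t..- s} \<subseteq> \<Omega>"
    using tame_by_Om[OF assms] by (simp add: image_uminus_compose)
  fix a b assume ab: "- t \<le> a \<and> a \<le> b \<and> b \<le> - s \<and> f (- a) \<in> S \<and> f (- b) \<in> S"
  then show "ennreal \<bar>v (f (- a)) - v (f (- b))\<bar> \<le> psum \<rho> (hit ((\<lambda>r. f (- r)) ` {a..b}))"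
    using tame_byD[OF assms, of "-b" "-a"] unfolding image_uminus_compose
    by (auto simp: abs_minus_commute)
qed

text \<open>All but finitely many of the disks met carry less than \<open>\<epsilon>\<close>
  together. Those of the finitely many whose closure misses \<open>f \<tau>\<close> are at positive
  distance from it, so a short piece of the path around \<open>\<tau>\<close> does not meet them.
  The disk with \<open>f \<tau>\<close> in its closure, if there is one, has to be exempted.\<close>

lemma tail_small:
  fixes f :: "real \<Rightarrow> complex"
  assumes f: "continuous_on {s..t} f" and fin: "psum \<rho> (hit (f ` {s..t})) < \<infinity>"
    and \<tau>: "\<tau> \<in> {s..t}" and "\<epsilon> > 0"
  shows "\<exists>h>0. \<forall>a b. s \<le> a \<and> b \<le> t \<and> \<bar>a - \<tau>\<bar> < h \<and> \<bar>b - \<tau>\<bar> < h \<longrightarrow>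
           psum \<rho> {k \<in> hit (f ` {a..b}). f \<tau> \<notin> closure (Q k)} < \<epsilon>"
proof -
  obtain F where F: "finite F" "F \<subseteq> hit (f ` {s..t})" "psum \<rho> (hit (f ` {s..t}) - F) < \<epsilon>"
    using psum_tail[OF fin \<open>\<epsilon> > 0\<close>] by blast
  define G where "G = {k\<in>F. f \<tau> \<notin> closure (Q k)}"
  have "closed (\<Union>k\<in>G. closure (Q k))"
    using F by (intro closed_UN) (auto simp: G_def)
  moreover have "f \<tau> \<notin> (\<Union>k\<in>G. closure (Q k))" by (auto simp: G_def)
  ultimately obtain d where d: "d > 0" "ball (f \<tau>) d \<inter> (\<Union>k\<in>G. closure (Q k)) = {}"
    using open_contains_ball[of "- (\<Union>k\<in>G. closure (Q k))"] by (metis ComplI Compl_disjoint2 closed_def disjoint_eq_subset_Compl)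
  obtain h where h: "h > 0" "\<forall>r\<in>{s..t}. dist r \<tau> < h \<longrightarrow> dist (f r) (f \<tau>) < d"
    using f \<tau> d(1) unfolding continuous_on_iff by metis
  show ?thesis
  proof (intro exI[of _ h] conjI allI impI)
    show "h > 0" by fact
    fix a b assume ab: "s \<le> a \<and> b \<le> t \<and> \<bar>a - \<tau>\<bar> < h \<and> \<bar>b - \<tau>\<bar> < h"
    have "{k \<in> hit (f ` {a..b}). f \<tau> \<notin> closure (Q k)} \<subseteq> hit (f ` {s..t}) - F"
    proof
      fix k assume k: "k \<in> {k \<in> hit (f ` {a..b}). f \<tau> \<notin> closure (Q k)}"
      then obtain r where r: "r \<in> {a..b}" "f r \<in> Q k" unfolding disks_meeting_def by blast
      then have "dist (f r) (f \<tau>) < d" using ab h(2) by (auto simp: dist_real_def)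
      then have "f r \<notin> (\<Union>k\<in>G. closure (Q k))" using d(2) by (auto simp: dist_commute)
      then have "k \<notin> G" using r closure_subset by blast
      then show "k \<in> hit (f ` {s..t}) - F"
        using k r ab by (auto simp: G_def disks_meeting_def)
    qed
    then show "psum \<rho> {k \<in> hit (f ` {a..b}). f \<tau> \<notin> closure (Q k)} < \<epsilon>"
      using F(3) psum_mono_set order_le_less_trans by blast
  qed
qed

text \<open>\<open>v\<close> need not be continuous along the path, since a circle through
  \<open>f \<tau>\<close> may carry a large oscillation. But \<open>e\<close> avoids the range on
  that circle, so the whole circle would lie above \<open>e\<close>; the piece of the path before
  its first point on the circle sees only small oscillations, too little to climb there.\<close>

lemma sublevel_closed_left:
  assumes tb: "tame_by \<rho> v f s t" and fin: "psum \<rho> (hit (f ` {s..t})) < \<infinity>" and v: "pbdd v"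
    and e: "\<And>k. k \<in> hit (f ` {s..t}) \<Longrightarrow> e < pm v k \<or> pM v k < e"
    and \<tau>: "\<tau> \<in> {s..t}" "f \<tau> \<in> S"
    and ap: "\<And>h. h > 0 \<Longrightarrow> \<exists>a\<in>{s..\<tau>}. \<tau> - h < a \<and> f a \<in> S \<and> v (f a) \<le> e"
  shows "v (f \<tau>) \<le> e"
proof (rule ccontr)
  assume n: "\<not> v (f \<tau>) \<le> e"
  have cont: "continuous_on {s..t} f" by (rule tame_by_cont[OF tb])
  show False
  proof (cases "\<exists>k\<in>hit (f ` {s..t}). f \<tau> \<in> closure (Q k)")
    case True
    then obtain k where k: "k \<in> hit (f ` {s..t})" "f \<tau> \<in> closure (Q k)" by blast
    have fr: "f \<tau> \<in> frontier (Q k)" using S_cl_front \<tau> k by blast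
    have g: "e < pm v k" using e[OF k(1)] pM_ge[OF v fr] n by auto
    obtain h where h: "h > 0" "\<And>a b. s \<le> a \<Longrightarrow> b \<le> t \<Longrightarrow> \<bar>a - \<tau>\<bar> < h \<Longrightarrow> \<bar>b - \<tau>\<bar> < h \<Longrightarrow>
           psum \<rho> {k \<in> hit (f ` {a..b}). f \<tau> \<notin> closure (Q k)} < ennreal (pm v k - e)"
      using tail_small[OF cont fin \<tau>(1), of "ennreal (pm v k - e)"] g by auto
    obtain a where a: "a \<in> {s..\<tau>}" "\<tau> - h < a" "f a \<in> S" "v (f a) \<le> e" using ap[OF h(1)] by blast
    obtain c where c: "c \<in> {a..\<tau>}" "f c \<in> frontier (Q k)" "f ` {a..c} \<inter> Q k = {}"
      using path_enters[of a \<tau> f k] continuous_on_subset[OF cont, of "{a..\<tau>}"] a k \<tau> S_not_Q by auto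
    have "ennreal \<bar>v (f a) - v (f c)\<bar> \<le> psum \<rho> (hit (f ` {a..c}))"
      using a c \<tau> front_S by (intro tame_byD[OF tb]) auto
    also have "\<dots> \<le> psum \<rho> {k \<in> hit (f ` {a..c}). f \<tau> \<notin> closure (Q k)}"
    proof (rule psum_mono_set, rule subsetI)
      fix j assume j: "j \<in> hit (f ` {a..c})"
      then have "j \<noteq> k" using c(3) by (auto simp: disks_meeting_def)
      then show "j \<in> {k \<in> hit (f ` {a..c}). f \<tau> \<notin> closure (Q k)}"
        using j k cl_disj by auto
    qed
    also have "\<dots> < ennreal (pm v k - e)" using a c \<tau> h(1) by (intro h(2)) auto
    finally have "\<bar>v (f a) - v (f c)\<bar> < pm v k - e" by (simp add: ennreal_less_iff)
    then show False using a pm_le[OF v c(2)] by auto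
  next
    case False
    obtain h where h: "h > 0" "\<And>a b. s \<le> a \<Longrightarrow> b \<le> t \<Longrightarrow> \<bar>a - \<tau>\<bar> < h \<Longrightarrow> \<bar>b - \<tau>\<bar> < h \<Longrightarrow>
           psum \<rho> {k \<in> hit (f ` {a..b}). f \<tau> \<notin> closure (Q k)} < ennreal (v (f \<tau>) - e)"
      using tail_small[OF cont fin \<tau>(1), of "ennreal (v (f \<tau>) - e)"] n by auto
    obtain a where a: "a \<in> {s..\<tau>}" "\<tau> - h < a" "f a \<in> S" "v (f a) \<le> e" using ap[OF h(1)] by blast
    have "ennreal \<bar>v (f a) - v (f \<tau>)\<bar> \<le> psum \<rho> (hit (f ` {a..\<tau>}))"
      using a \<tau> by (intro tame_byD[OF tb]) auto
    also have "\<dots> \<le> psum \<rho> {k \<in> hit (f ` {a..\<tau>}). f \<tau> \<notin> closure (Q k)}"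
    proof (rule psum_mono_set, rule subsetI)
      fix j assume j: "j \<in> hit (f ` {a..\<tau>})"
      moreover have "hit (f ` {a..\<tau>}) \<subseteq> hit (f ` {s..t})"
        using a \<tau> by (intro disks_meeting_mono image_mono) auto
      ultimately show "j \<in> {k \<in> hit (f ` {a..\<tau>}). f \<tau> \<notin> closure (Q k)}"
        using False by auto
    qed
    also have "\<dots> < ennreal (v (f \<tau>) - e)" using a \<tau> h(1) by (intro h(2)) auto
    finally have "\<bar>v (f a) - v (f \<tau>)\<bar> < v (f \<tau>) - e" by (simp add: ennreal_less_iff)
    then show False using a by auto
  qed
qed

text \<open>Reversal of time together with a change of sign reduces this to the previous
  lemma.\<close>

lemma superlevel_closed_right:
  assumes tb: "tame_by \<rho> v f s t" and fin: "psum \<rho> (hit (f ` {s..t})) < \<infinity>" and v: "pbdd v"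
    and e: "\<And>k. k \<in> hit (f ` {s..t}) \<Longrightarrow> e < pm v k \<or> pM v k < e"
    and \<tau>: "\<tau> \<in> {s..t}" "f \<tau> \<in> S"
    and ap: "\<And>h. h > 0 \<Longrightarrow> \<exists>a\<in>{\<tau>..t}. a < \<tau> + h \<and> f a \<in> S \<and> e \<le> v (f a)"
  shows "e \<le> v (f \<tau>)"
proof -
  have "(\<lambda>z. - v z) ((\<lambda>r. f (- r)) (- \<tau>)) \<le> - e"
  proof (rule sublevel_closed_left[where \<rho> = \<rho> and s = "-t" and t = "-s" and v = "\<lambda>z. - v z"
        and f = "\<lambda>r. f (- r)" and \<tau> = "- \<tau>" and e = "- e"])
    show "tame_by \<rho> (\<lambda>z. - v z) (\<lambda>r. f (- r)) (- t) (- s)"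
      by (intro tame_by_uminus tame_by_reverse tb)
    show "psum \<rho> (hit ((\<lambda>r. f (- r)) ` {- t..- s})) < \<infinity>"
      using fin by (simp add: image_uminus_compose)
    show "pbdd (\<lambda>z. - v z)" by (rule pbdd_uminus[OF v])
    show "- e < pm (\<lambda>z. - v z) k \<or> pM (\<lambda>z. - v z) k < - e" if "k \<in> hit ((\<lambda>r. f (- r)) ` {- t..- s})" for k
      using e[of k] that by (auto simp: image_uminus_compose pm_uminus pM_uminus)
    show "\<exists>a\<in>{- t..- \<tau>}. - \<tau> - h < a \<and> f (- a) \<in> S \<and> - v (f (- a)) \<le> - e" if "h > 0" for h
    proof -
      obtain a where "a\<in>{\<tau>..t}" "a < \<tau> + h" "f a \<in> S" "e \<le> v (f a)" using ap[OF \<open>h > 0\<close>] by blast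
      then show ?thesis by (intro bexI[of _ "-a"]) auto
    qed
  qed (use \<tau> in auto)
  then show ?thesis by simp
qed

lemma S_times_closed:
  assumes "continuous_on {s..t} f" "f ` {s..t} \<subseteq> \<Omega>"
  shows "closed {r\<in>{s..t::real}. f r \<in> S}"
proof -
  have "{r\<in>{s..t}. f r \<in> S} = {s..t} \<inter> f -` (- (\<Union>i. Q i))"
    using assms(2) by (auto simp: carpet_def)
  moreover have "closed ({s..t} \<inter> f -` (- (\<Union>i. Q i)))"
    using open_Q by (intro continuous_closed_preimage assms closed_atLeastAtMost) auto
  ultimately show ?thesis by simp
qed

text \<open>Between the last time with value at most \<open>e\<close> and the next time with value
  at least \<open>e'\<close>, all values on the carpet lie strictly between the two levels. So each
  disk met there has such a value on its circle, and its range, which contains neither level, lies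
  in the gap.\<close>

lemma crossing:
  assumes tb: "tame_by \<rho> v f s t" and fin: "psum \<rho> (hit (f ` {s..t})) < \<infinity>" and v: "pbdd v"
    and e: "\<And>k. k \<in> hit (f ` {s..t}) \<Longrightarrow> e < pm v k \<or> pM v k < e"
    and e': "\<And>k. k \<in> hit (f ` {s..t}) \<Longrightarrow> e' < pm v k \<or> pM v k < e'"
    and st: "s \<le> t" "f s \<in> S" "f t \<in> S" "v (f s) \<le> e" "e < e'" "e' \<le> v (f t)"
  shows "ennreal (e' - e) \<le> psum \<rho> {k \<in> hit (f ` {s..t}). e < pm v k \<and> pM v k < e'}"
proof -
  have cont: "continuous_on {s..t} f" and sub: "f ` {s..t} \<subseteq> \<Omega>"
    by (rule tame_by_cont[OF tb], rule tame_by_Om[OF tb])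
  define Z where "Z = {r\<in>{s..t}. f r \<in> S}"
  have clZ: "closed Z" unfolding Z_def by (rule S_times_closed[OF cont sub])
  define L where "L = {a\<in>Z. v (f a) \<le> e}"
  define \<tau> where "\<tau> = Sup L"
  have L: "L \<noteq> {}" "bdd_above L" "L \<subseteq> Z" using st by (auto simp: L_def Z_def)
  have "\<tau> \<in> closure L" unfolding \<tau>_def using L by (intro closure_contains_Sup)
  then have \<tau>Z: "\<tau> \<in> Z" using L clZ by (meson closure_minimal subsetD)
  have up: "a \<le> \<tau>" if "a \<in> L" for a unfolding \<tau>_def using that L by (intro cSup_upper)
  have v\<tau>: "v (f \<tau>) \<le> e"
  proof (rule sublevel_closed_left[OF tb fin v e])
    fix h :: real assume "h > 0"
    then obtain a where "a \<in> L" "\<tau> - h < a" using L less_cSup_iff[of L "\<tau> - h"] by (auto simp: \<tau>_def)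
    then show "\<exists>a\<in>{s..\<tau>}. \<tau> - h < a \<and> f a \<in> S \<and> v (f a) \<le> e" using up by (auto simp: L_def Z_def)
  qed (use \<tau>Z in \<open>auto simp: Z_def\<close>)
  define U where "U = {a\<in>Z. \<tau> \<le> a \<and> e' \<le> v (f a)}"
  define \<sigma> where "\<sigma> = Inf U"
  have U: "U \<noteq> {}" "bdd_below U" "U \<subseteq> Z" using st \<tau>Z by (auto simp: U_def Z_def)
  have "\<sigma> \<in> closure U" unfolding \<sigma>_def using U by (intro closure_contains_Inf)
  then have \<sigma>Z: "\<sigma> \<in> Z" using U clZ by (meson closure_minimal subsetD)
  have lo: "\<sigma> \<le> a" if "a \<in> U" for a unfolding \<sigma>_def using that U by (intro cInf_lower)
  have \<tau>\<sigma>: "\<tau> \<le> \<sigma>" unfolding \<sigma>_def using U by (intro cInf_greatest) (auto simp: U_def)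
  have v\<sigma>: "e' \<le> v (f \<sigma>)"
  proof (rule superlevel_closed_right[OF tb fin v e'])
    fix h :: real assume "h > 0"
    then obtain a where "a \<in> U" "a < \<sigma> + h" using U cInf_less_iff[of U "\<sigma> + h"] by (auto simp: \<sigma>_def)
    then show "\<exists>a\<in>{\<sigma>..t}. a < \<sigma> + h \<and> f a \<in> S \<and> e' \<le> v (f a)" using lo by (auto simp: U_def Z_def)
  qed (use \<sigma>Z in \<open>auto simp: Z_def\<close>)
  have between: "e < v (f a) \<and> v (f a) < e'" if "a \<in> Z" "\<tau> < a" "a < \<sigma>" for a
  proof -
    have "a \<notin> L" "a \<notin> U" using that up[of a] lo[of a] by auto
    then show ?thesis using that by (simp add: L_def U_def not_le)
  qed
  have sub1: "hit (f ` {\<tau>..\<sigma>}) \<subseteq> hit (f ` {s..t})"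
    using \<tau>Z \<sigma>Z by (intro disks_meeting_mono image_mono) (auto simp: Z_def)
  have sub2: "hit (f ` {\<tau>..\<sigma>}) \<subseteq> {k \<in> hit (f ` {s..t}). e < pm v k \<and> pM v k < e'}"
  proof
    fix k assume k: "k \<in> hit (f ` {\<tau>..\<sigma>})"
    then obtain r where r: "r \<in> {\<tau>..\<sigma>}" "f r \<in> Q k" unfolding disks_meeting_def by blast
    have c1: "continuous_on {\<tau>..r} f" and c2: "continuous_on {r..\<sigma>} f"
      using \<tau>Z \<sigma>Z r by (auto simp: Z_def intro!: continuous_on_subset[OF cont])
    have n: "f \<tau> \<notin> Q k" "f \<sigma> \<notin> Q k" using \<tau>Z \<sigma>Z S_not_Q by (auto simp: Z_def)
    obtain l where l: "l \<in> {\<tau>..r}" "f l \<in> frontier (Q k)"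
      using path_enters[OF c1, of k] r n subsetD[OF closure_subset r(2)] by auto
    obtain l' where l': "l' \<in> {r..\<sigma>}" "f l' \<in> frontier (Q k)"
      using path_leaves[OF c2, of k] r n subsetD[OF closure_subset r(2)] by auto
    have neq: "l \<noteq> r" "l' \<noteq> r" using l l' r by (auto simp: front_iff)
    have lZ: "l \<in> Z" "l' \<in> Z" using l l' r \<tau>Z \<sigma>Z front_S by (auto simp: Z_def)
    have kk: "k \<in> hit (f ` {s..t})" using k sub1 by blast
    have b1: "pm v k \<le> v (f l)" "v (f l) \<le> pM v k" "pm v k \<le> v (f l')" "v (f l') \<le> pM v k"
      using pM_ge[OF v] pm_le[OF v] l l' by auto
    show "k \<in> {k \<in> hit (f ` {s..t}). e < pm v k \<and> pM v k < e'}"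
    proof (cases "l = \<tau> \<and> l' = \<sigma>")
      case True
      \<comment> \<open>Here the disk has both \<open>f \<tau>\<close> and \<open>f \<sigma>\<close>
        on its circle, so that its range would contain both levels.\<close>
      then have "pm v k \<le> e" "e' \<le> pM v k" using v\<tau> v\<sigma> b1 by auto
      then show ?thesis using e[OF kk] st by auto
    next
      case False
      have "\<exists>x. e < x \<and> x < e' \<and> pm v k \<le> x \<and> x \<le> pM v k"
      proof (cases "l = \<tau>")
        case True
        then have "\<tau> < l'" "l' < \<sigma>" using False l' r neq l by auto
        then show ?thesis using between[OF lZ(2)] b1 by blast
      next
        case False
        then have "\<tau> < l" "l < \<sigma>" using l r neq by auto
        then show ?thesis using between[OF lZ(1)] b1 by blast
      qed
      then show ?thesis using e[OF kk] e'[OF kk] kk by auto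
    qed
  qed
  have "ennreal (e' - e) \<le> ennreal \<bar>v (f \<tau>) - v (f \<sigma>)\<bar>" using v\<tau> v\<sigma> by (intro ennreal_leI) auto
  also have "\<dots> \<le> psum \<rho> (hit (f ` {\<tau>..\<sigma>}))"
    using \<tau>Z \<sigma>Z \<tau>\<sigma> by (intro tame_byD[OF tb]) (auto simp: Z_def)
  also have "\<dots> \<le> psum \<rho> {k \<in> hit (f ` {s..t}). e < pm v k \<and> pM v k < e'}"
    by (rule psum_mono_set[OF sub2])
  finally show ?thesis .
qed

text \<open>Removing finitely many disks from the sum costs nothing: the interval of a removed disk
  contains no point of \<open>E\<close>, so it cuts \<open>[a,b]\<close> into two pieces, and no
  disk is counted for both of them. Once all but a small tail is removed, the bound is as small as
  desired.\<close>

lemma uncovered_null: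
  fixes a b :: real and m M :: "nat \<Rightarrow> real"
  assumes Em: "E \<in> sets borel"
    and ex: "\<And>e e'. e \<in> E \<Longrightarrow> e' \<in> E \<Longrightarrow> e < e' \<Longrightarrow> ennreal (e' - e) \<le> psum \<rho> {k \<in> H. e < m k \<and> M k < e'}"
    and out: "\<And>e k. e \<in> E \<Longrightarrow> k \<in> H \<Longrightarrow> e < m k \<or> M k < e"
    and mM: "\<And>k. m k \<le> M k" and fin: "psum \<rho> H < \<infinity>" and "bounded E"
  shows "emeasure lborel E = 0"
proof -
  have step: "emeasure lborel (E \<inter> {a..b}) \<le> psum \<rho> {k \<in> H - F. a < m k \<and> M k < b}"
    if "finite F" "F \<subseteq> H" for F a b
    using that
  proof (induction F arbitrary: a b rule: finite_induct)
    case empty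
    show ?case
    proof (cases "E \<inter> {a..b} = {}")
      case True
      then show ?thesis by simp
    next
      case False
      define X where "X = E \<inter> {a..b}"
      have X: "X \<noteq> {}" "bdd_above X" "bdd_below X" using False by (auto simp: X_def)
      have "X \<subseteq> {Inf X..Sup X}" using X by (auto intro: cInf_lower cSup_upper)
      moreover have "Inf X \<le> Sup X" using X by (meson cInf_le_cSup)
      ultimately have "emeasure lborel X \<le> ennreal (Sup X - Inf X)"
        by (metis emeasure_lborel_Icc emeasure_mono atLeastAtMost_borel sets_lborel)
      \<comment> \<open>\<open>X\<close> need not contain its infimum and supremum, so the
        hypothesis is applied to points of \<open>X\<close> within \<open>\<epsilon>/2\<close> of
        them.\<close>
      also have "\<dots> \<le> psum \<rho> {k \<in> H. a < m k \<and> M k < b}"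
      proof (rule ennreal_le_epsilon)
        fix \<epsilon> :: real assume "0 < \<epsilon>" 
        obtain p where p: "p \<in> X" "p < Inf X + \<epsilon>/2" using X \<open>0 < \<epsilon>\<close> cInf_less_iff[of X "Inf X + \<epsilon>/2"] by auto
        obtain q where q: "q \<in> X" "Sup X - \<epsilon>/2 < q" using X \<open>0 < \<epsilon>\<close> less_cSup_iff[of X "Sup X - \<epsilon>/2"] by auto
        have "ennreal (q - p) \<le> psum \<rho> {k \<in> H. a < m k \<and> M k < b}"
        proof (cases "p < q")
          case True
          then have "ennreal (q - p) \<le> psum \<rho> {k \<in> H. p < m k \<and> M k < q}"
            using p q by (intro ex) (auto simp: X_def)
          also have "\<dots> \<le> psum \<rho> {k \<in> H. a < m k \<and> M k < b}"
            using p q by (intro psum_mono_set) (auto simp: X_def)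
          finally show ?thesis .
        next
          case False
          then show ?thesis by (simp add: ennreal_neg)
        qed
        moreover have "ennreal (Sup X - Inf X) \<le> ennreal (q - p) + ennreal \<epsilon>"
        proof (cases "p \<le> q")
          case True
          have "ennreal (Sup X - Inf X) \<le> ennreal ((q - p) + \<epsilon>)" using p q by (intro ennreal_leI) auto
          then show ?thesis using True \<open>0 < \<epsilon>\<close> by (simp add: ennreal_plus)
        next
          case False
          have "ennreal (Sup X - Inf X) \<le> ennreal \<epsilon>" using False p q by (intro ennreal_leI) auto
          then show ?thesis by (simp add: add_increasing)
        qed
        ultimately show "ennreal (Sup X - Inf X) \<le> psum \<rho> {k \<in> H. a < m k \<and> M k < b} + ennreal \<epsilon>"
          by (meson add_right_mono order_trans)
      qed
      finally show ?thesis by (simp add: X_def)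
    qed
  next
    case (insert k F)
    define b' where "b' = min b (m k)"
    define a' where "a' = max a (M k)"
    have kH: "k \<in> H" using insert by auto
    have "E \<inter> {a..b} \<subseteq> (E \<inter> {a..b'}) \<union> (E \<inter> {a'..b})"
      using out[OF _ kH] by (fastforce simp: a'_def b'_def)
    then have "emeasure lborel (E \<inter> {a..b}) \<le> emeasure lborel ((E \<inter> {a..b'}) \<union> (E \<inter> {a'..b}))"
      using Em by (intro emeasure_mono) auto
    also have "\<dots> \<le> emeasure lborel (E \<inter> {a..b'}) + emeasure lborel (E \<inter> {a'..b})"
      using Em by (intro emeasure_subadditive) auto
    also have "\<dots> \<le> psum \<rho> {j \<in> H - F. a < m j \<and> M j < b'} + psum \<rho> {j \<in> H - F. a' < m j \<and> M j < b}"
      using insert by (intro add_mono) auto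
    also have "\<dots> = psum \<rho> ({j \<in> H - F. a < m j \<and> M j < b'} \<union> {j \<in> H - F. a' < m j \<and> M j < b})"
    proof (rule psum_Un_disjoint[symmetric])
      \<comment> \<open>A disk counted on both sides would lie below \<open>m k\<close> and above
        \<open>M k\<close>.\<close>
      have "\<not> (M j < m k \<and> M k < m j)" for j using mM[of j] mM[of k] by auto
      then show "{j \<in> H - F. a < m j \<and> M j < b'} \<inter> {j \<in> H - F. a' < m j \<and> M j < b} = {}"
        by (auto simp: a'_def b'_def)
    qed
    also have "\<dots> \<le> psum \<rho> {j \<in> H - insert k F. a < m j \<and> M j < b}"
      using mM[of k] by (intro psum_mono_set) (auto simp: a'_def b'_def)
    finally show ?case .
  qed
  obtain c where c: "E \<subseteq> {-c..c}"
    using \<open>bounded E\<close> by (metis bounded_subset_cbox_symmetric cbox_interval)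
  have "emeasure lborel E \<le> 0 + ennreal \<epsilon>" if "\<epsilon> > 0" for \<epsilon> :: real
  proof -
    obtain F where F: "finite F" "F \<subseteq> H" "psum \<rho> (H - F) < ennreal \<epsilon>"
      using psum_tail[OF fin, of "ennreal \<epsilon>"] \<open>\<epsilon> > 0\<close> by auto
    have "emeasure lborel (E \<inter> {-c..c}) \<le> psum \<rho> {k \<in> H - F. -c < m k \<and> M k < c}"
      by (rule step[OF F(1,2)])
    also have "\<dots> \<le> psum \<rho> (H - F)" by (rule psum_mono_set) auto
    finally show ?thesis using F(3) c by (simp add: Int_absorb2)
  qed
  then have "emeasure lborel E \<le> 0" by (rule ennreal_le_epsilon)
  then show ?thesis by simp
qed

text \<open>The values not covered by the intervals between the minima and the maxima form a null set,
  because a path between two such values picks up at least their difference from the disks whose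
  interval lies between them.\<close>

theorem tame_self_improve:
  assumes tb: "tame_by \<rho> v f s t" and fin: "psum \<rho> (hit (f ` {s..t})) < \<infinity>" and v: "pbdd v"
  shows "tame v f s t"
proof -
  have main: "ennreal (v (f b) - v (f a)) \<le> psum (eO v) (hit (f ` {a..b}))"
    if tb: "tame_by \<rho> v f a b" and fin: "psum \<rho> (hit (f ` {a..b})) < \<infinity>" and v: "pbdd v"
      and ab: "a \<le> b" "f a \<in> S" "f b \<in> S" "v (f a) \<le> v (f b)" for v f a b
  proof -
    define H where "H = hit (f ` {a..b})"
    define E where "E = {v (f a)..v (f b)} - (\<Union>k\<in>H. {pm v k..pM v k})"
    have Em: "E \<in> sets borel" unfolding E_def by (intro sets.Diff sets.countable_UN') auto
    have "emeasure lborel E = 0"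
    proof (rule uncovered_null[OF Em, where \<rho> = \<rho> and H = H and m = "pm v" and M = "pM v"])
      show "ennreal (e' - e) \<le> psum \<rho> {k \<in> H. e < pm v k \<and> pM v k < e'}"
        if "e \<in> E" "e' \<in> E" "e < e'" for e e'
        unfolding H_def by (rule crossing[OF tb fin v]) (use that ab in \<open>auto simp: E_def H_def not_le\<close>)
      show "bounded E" by (rule bounded_subset[OF bounded_closed_interval[of "v (f a)" "v (f b)"]]) (auto simp: E_def)
    qed (use fin pm_le_pM[OF v] in \<open>auto simp: E_def H_def\<close>)
    have "ennreal (v (f b) - v (f a)) = emeasure lborel {v (f a)..v (f b)}" using ab by simp
    also have "\<dots> \<le> emeasure lborel (E \<union> (\<Union>k. if k \<in> H then {pm v k..pM v k} else {}))"
      using Em by (intro emeasure_mono) (auto simp: E_def)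
    also have "\<dots> \<le> emeasure lborel E + emeasure lborel (\<Union>k. if k \<in> H then {pm v k..pM v k} else {})"
      using Em by (intro emeasure_subadditive) auto
    also have "\<dots> \<le> 0 + (\<Sum>k. emeasure lborel (if k \<in> H then {pm v k..pM v k} else {}))"
      using \<open>emeasure lborel E = 0\<close> by (intro add_mono emeasure_subadditive_countably) auto
    also have "\<dots> = psum (eO v) H"
      unfolding psum_def using pm_le_pM[OF v] by (auto intro!: suminf_cong simp: pO_def)
    finally show ?thesis by (simp add: H_def)
  qed
  show ?thesis
    unfolding tame_by_def
  proof (intro conjI allI impI)
    show "continuous_on {s..t} f" "f ` {s..t} \<subseteq> \<Omega>"
      by (rule tame_by_cont[OF tb], rule tame_by_Om[OF tb])
    fix a b assume ab: "s \<le> a \<and> a \<le> b \<and> b \<le> t \<and> f a \<in> S \<and> f b \<in> S"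
    have t: "tame_by \<rho> v f a b" using tame_by_sub[OF tb] ab by auto
    have fi: "psum \<rho> (hit (f ` {a..b})) < \<infinity>"
      using fin by (rule order_le_less_trans[rotated]) (use ab in \<open>auto intro!: psum_hit_mono image_mono\<close>)
    show "ennreal \<bar>v (f a) - v (f b)\<bar> \<le> psum (eO v) (hit (f ` {a..b}))"
    proof (cases "v (f a) \<le> v (f b)")
      case True
      then show ?thesis using main[OF t fi v] ab by (simp add: abs_minus_commute)
    next
      case False
      then show ?thesis
        using main[OF tame_by_uminus[OF t] fi pbdd_uminus[OF v]] ab by (simp add: pO_uminus)
    qed
  qed
qed

end

section \<open>Squares around a boundary point of a Jordan region\<close>

definition nrm :: "complex \<Rightarrow> real" where "nrm z = max \<bar>Re z\<bar> \<bar>Im z\<bar>"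
text \<open>Boundary of a square, as the sphere of the maximum norm. Its four sides are
  axis-parallel, so statements about almost every line apply to almost every square.\<close>

definition sqr :: "complex \<Rightarrow> real \<Rightarrow> complex set" where "sqr x s = {z. nrm (z - x) = s}"

lemma nrm_le_cmod: "nrm z \<le> cmod z"
  by (simp add: nrm_def abs_Re_le_cmod abs_Im_le_cmod)

lemma cmod_le_nrm: "cmod z \<le> 2 * nrm z"
  using cmod_le[of z] by (simp add: nrm_def)

lemma nrm_nonneg: "0 \<le> nrm z"
  by (simp add: nrm_def)

lemma nrm_diff: "\<bar>nrm z - nrm w\<bar> \<le> nrm (z - w)"
  unfolding nrm_def minus_complex.sel by (smt (verit))

lemma continuous_on_nrm: "continuous_on X f \<Longrightarrow> continuous_on X (\<lambda>z. nrm (f z))"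
  unfolding nrm_def by (intro continuous_intros)

lemma nrm_scaleR: "nrm (c *\<^sub>R z) = \<bar>c\<bar> * nrm z"
  by (simp add: nrm_def abs_mult max_mult_distrib_left)

lemma nrm_pos: "z \<noteq> 0 \<Longrightarrow> 0 < nrm z"
  using cmod_le_nrm[of z] nrm_nonneg[of z] by (smt (verit) zero_less_norm_iff)

lemma closed_sqr: "closed (sqr x s)"
  unfolding sqr_def by (intro closed_Collect_eq continuous_on_nrm) (auto intro!: continuous_intros)

lemma sqr_sub_cball: "sqr x s \<subseteq> cball x (2 * s)"
  using cmod_le_nrm by (auto simp: sqr_def dist_norm norm_minus_commute)

lemma compact_sqr: "compact (sqr x s)"
  using closed_sqr sqr_sub_cball by (metis bounded_cball bounded_subset compact_eq_bounded_closed)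

lemma sqr_ball: "sqr x s \<inter> ball x s = {}"
proof -
  have "z \<notin> ball x s" if "z \<in> sqr x s" for z
    using that nrm_le_cmod[of "z - x"] by (auto simp: sqr_def dist_norm norm_minus_commute)
  then show ?thesis by blast
qed

lemma connected_meets_sqr:
  assumes "connected A" "p \<in> A" "q \<in> A" "nrm (p - x) < s" "s < nrm (q - x)"
  shows "A \<inter> sqr x s \<noteq> {}"
proof -
  have "connected ((\<lambda>z. nrm (z - x)) ` A)"
    by (intro connected_continuous_image assms continuous_on_nrm continuous_intros)
  then have "s \<in> (\<lambda>z. nrm (z - x)) ` A"
    using assms connectedD_interval[of "(\<lambda>z. nrm (z - x)) ` A" "nrm (p - x)" "nrm (q - x)" s] by auto
  then show ?thesis by (auto simp: sqr_def)
qed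

text \<open>Finitely many closed disks cover \<open>K\<close>, and paths inside \<open>U\<close>
  join their centres. Needed because Janiszewski's theorem asks for a connected
  intersection.\<close>

lemma compact_connected_superset:
  fixes U :: "complex set"
  assumes U: "open U" "connected U" and K: "compact K" "K \<subseteq> U"
  shows "\<exists>K'. compact K' \<and> connected K' \<and> K \<subseteq> K' \<and> K' \<subseteq> U"
proof (cases "K = {}")
  case True
  then show ?thesis by (intro exI[of _ "{}"]) auto
next
  case False
  have "\<forall>z\<in>K. \<exists>e>0. cball z e \<subseteq> U" using U K open_contains_cball by blast
  then obtain e where e: "\<And>z. z \<in> K \<Longrightarrow> e z > 0 \<and> cball z (e z) \<subseteq> U" by metis
  have "K \<subseteq> (\<Union>z\<in>K. ball z (e z))" using e by force
  then obtain D where D: "D \<subseteq> K" "finite D" "K \<subseteq> (\<Union>z\<in>D. ball z (e z))"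
    using compactE_image[OF K(1), of K "\<lambda>z. ball z (e z)"] by auto
  then obtain z0 where z0: "z0 \<in> D" using False by blast
  have "\<exists>g. path g \<and> path_image g \<subseteq> U \<and> pathstart g = z0 \<and> pathfinish g = z" if "z \<in> D" for z
  proof -
    have "z \<in> U" "z0 \<in> U" using that D(1) z0 K(2) by blast+
    then show ?thesis using connected_open_path_connected[OF U] unfolding path_connected_def by simp
  qed
  then obtain g where g: "\<And>z. z \<in> D \<Longrightarrow> path (g z) \<and> path_image (g z) \<subseteq> U \<and> pathstart (g z) = z0 \<and> pathfinish (g z) = z"
    by metis
  define P where "P z = path_image (g z) \<union> cball z (e z)" for z
  have P: "connected (P z)" "compact (P z)" "z0 \<in> P z" "P z \<subseteq> U" if "z \<in> D" for z
  proof -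
    have "z \<in> path_image (g z)" "z0 \<in> path_image (g z)"
      using g[OF that] pathfinish_in_path_image[of "g z"] pathstart_in_path_image[of "g z"] by auto
    moreover have "0 < e z" "cball z (e z) \<subseteq> U" using e that D by auto
    ultimately show "connected (P z)" "compact (P z)" "z0 \<in> P z" "P z \<subseteq> U"
      unfolding P_def using g[OF that]
      by (auto intro!: connected_Un compact_Un connected_path_image compact_path_image)
  qed
  show ?thesis
  proof (intro exI conjI)
    show "compact (\<Union>z\<in>D. P z)" using D P by (intro compact_UN) auto
    have "z0 \<in> \<Inter> (P ` D)" using P(3) by blast
    then show "connected (\<Union>z\<in>D. P z)" using P(1) by (intro connected_Union) auto
    show "K \<subseteq> (\<Union>z\<in>D. P z)" using D(3) by (force simp: P_def)
    show "(\<Union>z\<in>D. P z) \<subseteq> U" by (intro UN_least P(4))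
  qed
qed

lemma loop_from:
  assumes "simple_path c" "pathfinish c = pathstart c" "x \<in> path_image c"
  obtains c' where "simple_path c'" "path_image c' = path_image c" "pathstart c' = x" "pathfinish c' = x"
proof -
  obtain a where a: "a \<in> {0..1}" "x = c a" using assms by (auto simp: path_image_def)
  show ?thesis
  proof (rule that[of "shiftpath a c"])
    show "simple_path (shiftpath a c)" using assms a by (intro simple_path_shiftpath) auto
    show "path_image (shiftpath a c) = path_image c" using assms a by (intro path_image_shiftpath) auto
    show "pathstart (shiftpath a c) = x" using a by (auto simp: pathstart_shiftpath)
    show "pathfinish (shiftpath a c) = x" using a assms by (auto simp: pathfinish_shiftpath)
  qed
qed

text \<open>Supplies connected pieces of the Jordan curve for Janiszewski's theorem: both ends of
  the loop together form the arc near \<open>x\<close>, and simplicity keeps the rest away from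
  \<open>x\<close>.\<close>

lemma loop_ends:
  assumes c: "simple_path c" "pathstart c = x" "pathfinish c = x" and "r > 0"
  obtains J1 J2 where "compact J1" "connected J1" "J1 \<subseteq> ball x r"
    "compact J2" "connected J2" "x \<notin> J2" "path_image c = J1 \<union> J2"
proof -
  have cc: "continuous_on {0..1} c" using c simple_path_def path_def by blast
  have c01: "c 0 = x" "c 1 = x" using c by (auto simp: pathstart_def pathfinish_def)
  obtain d0 where d0: "d0 > 0" "\<And>t. t \<in> {0..1} \<Longrightarrow> dist t 0 < d0 \<Longrightarrow> dist (c t) x < r"
    using cc \<open>r > 0\<close> c01 unfolding continuous_on_iff by (metis atLeastAtMost_iff order_refl zero_le_one)
  obtain d1 where d1: "d1 > 0" "\<And>t. t \<in> {0..1} \<Longrightarrow> dist t 1 < d1 \<Longrightarrow> dist (c t) x < r"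
    using cc \<open>r > 0\<close> c01 unfolding continuous_on_iff by (metis atLeastAtMost_iff order_refl zero_le_one)
  define \<tau> where "\<tau> = min (1/3) (min d0 d1 / 2)"
  have \<tau>: "0 < \<tau>" "\<tau> \<le> 1/3" "\<tau> < d0" "\<tau> < d1" using d0 d1 by (auto simp: \<tau>_def min_def)
  define J1 where "J1 = c ` {0..\<tau>} \<union> c ` {1-\<tau>..1}"
  define J2 where "J2 = c ` {\<tau>..1-\<tau>}"
  have sub: "continuous_on {a..b} c" if "0 \<le> a" "b \<le> 1" for a b
    using that by (intro continuous_on_subset[OF cc]) auto
  show ?thesis
  proof (rule that[of J1 J2])
    show "compact J1" unfolding J1_def using \<tau> by (intro compact_Un compact_continuous_image sub) auto
    have "x \<in> c ` {0..\<tau>}" "x \<in> c ` {1-\<tau>..1}"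
      using c01 \<tau> by (auto simp: image_iff intro: bexI[of _ 0] bexI[of _ 1])
    then show "connected J1" unfolding J1_def using \<tau>
      by (intro connected_Un connected_continuous_image sub connected_Icc) auto
    show "J1 \<subseteq> ball x r"
    proof -
      have "dist (c t) x < r" if "t \<in> {0..\<tau>}" for t using that \<tau> by (intro d0(2)) auto
      moreover have "dist (c t) x < r" if "t \<in> {1-\<tau>..1}" for t
        using that \<tau> by (intro d1(2)) (auto simp: dist_real_def)
      ultimately show ?thesis by (auto simp: J1_def dist_commute)
    qed
    show "compact J2" "connected J2" unfolding J2_def using \<tau>
      by (intro compact_continuous_image connected_continuous_image sub; auto)+
    show "x \<notin> J2"
    proof
      assume "x \<in> J2"
      then obtain t where t: "t \<in> {\<tau>..1-\<tau>}" "c t = x" by (auto simp: J2_def)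
      have "t \<in> {0..1}" "0 \<in> {0..1::real}" "c t = c 0" using t c01 \<tau> by auto
      then have "t = 0 \<or> t = 1"
        using c(1) unfolding simple_path_def loop_free_def by blast
      then show False using t \<tau> by auto
    qed
    have "{0..1} = {0..\<tau>} \<union> {1-\<tau>..1} \<union> {\<tau>..1-\<tau>}" using \<tau> by auto
    then show "path_image c = J1 \<union> J2" by (simp add: path_image_def J1_def J2_def image_Un)
  qed
qed

text \<open>Otherwise Janiszewski's theorem would connect a near point and a far point in the complement of
  the square.\<close>

lemma square_not_split:
  assumes U: "jordan_region U" and x: "x \<in> frontier U" and "R > 0"
  obtains s0 where "s0 > 0" "s0 < R"
    "\<And>s. 0 < s \<Longrightarrow> s < s0 \<Longrightarrow> \<exists>\<delta>>0. \<forall>A B X Y. connected A \<and> connected B \<and> A \<inter> U = {} \<and> B \<inter> U = {} \<and>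
        A \<inter> ball x \<delta> \<noteq> {} \<and> B \<inter> ball x \<delta> \<noteq> {} \<and> \<not> A \<subseteq> ball x R \<and> \<not> B \<subseteq> ball x R \<and>
        closed X \<and> closed Y \<and> X \<inter> Y = {} \<and> sqr x s - U = X \<union> Y \<and> A \<inter> sqr x s \<subseteq> X \<and> B \<inter> sqr x s \<subseteq> Y \<longrightarrow> False"
proof -
  obtain c where c: "simple_path c" "pathfinish c = pathstart c" "U = inside (path_image c)"
    "frontier U = path_image c" "open U" "connected U" "bounded U" "- closure U = outside (path_image c)"
    using jordan_props[OF U] by metis
  obtain c' where c': "simple_path c'" "path_image c' = frontier U" "pathstart c' = x" "pathfinish c' = x"
    using loop_from[OF c(1,2)] x c(4) by metis
  define J where "J = frontier U"
  define O' where "O' = - closure U"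
  have J: "compact J" unfolding J_def c(4) using c(1) simple_path_imp_path by (intro compact_path_image)
  have O': "connected O'" "open O'" "J \<subseteq> closure O'" "O' \<inter> J = {}" "U \<inter> J = {}" "O' \<inter> U = {}" "- J = U \<union> O'"
  proof -
    show "connected O'" "J \<subseteq> closure O'" using Jordan_inside_outside[OF c(1,2)] c
      by (auto simp: O'_def J_def closure_Un_frontier)
    show "open O'" unfolding O'_def by (intro open_Compl closed_closure)
    show "O' \<inter> J = {}" by (auto simp: O'_def J_def frontier_def)
    show "U \<inter> J = {}" using c(5) by (auto simp: J_def frontier_def interior_open)
    show "O' \<inter> U = {}" using closure_subset by (auto simp: O'_def)
    show "- J = U \<union> O'" using closure_subset[of U] c(5) by (auto simp: O'_def J_def frontier_def interior_open)
  qed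
  obtain J1 J1' where J1: "compact J1" "connected J1" "J1 \<subseteq> ball x (R/2)"
    "compact J1'" "connected J1'" "x \<notin> J1'" "J = J1 \<union> J1'"
    using loop_ends[OF c'(1,3,4), of "R/2"] \<open>R > 0\<close> c'(2) J_def by (metis half_gt_zero)
  obtain d1 where d1: "d1 > 0" "ball x d1 \<inter> J1' = {}"
    using J1(4,6) compact_imp_closed open_contains_ball[of "- J1'"] by (metis ComplI Compl_disjoint2 disjoint_eq_subset_Compl open_Compl)
  \<comment> \<open>Then the square of size \<open>s\<close>, contained in
    \<open>cball x (2 * s)\<close>, misses \<open>J1'\<close> and lies in
    \<open>cball x (R/2)\<close>.\<close>
  define s0 where "s0 = min d1 R / 4"
  have s0: "s0 > 0" "s0 < R" using d1 \<open>R > 0\<close> by (auto simp: s0_def)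
  show ?thesis
  proof (rule that[OF s0])
    fix s assume s: "0 < s" "s < s0"
    define C where "C = sqr x s"
    have Cs: "C \<subseteq> ball x d1" "C \<subseteq> cball x (R/2)" "closed C"
      using sqr_sub_cball[of x s] s closed_sqr by (auto simp: C_def s0_def subset_iff)
    obtain J2' J2 where J2: "J2' \<subseteq> ball x s"
      "compact J2" "connected J2" "x \<notin> J2" "J = J2' \<union> J2"
      using loop_ends[OF c'(1,3,4), of s] s c'(2) J_def by metis
    obtain d2 where d2: "d2 > 0" "ball x d2 \<inter> J2 = {}"
      using J2 compact_imp_closed open_contains_ball[of "- J2"] by (metis ComplI Compl_disjoint2 disjoint_eq_subset_Compl open_Compl)
    define \<delta> where "\<delta> = min d2 s"
    have \<delta>: "\<delta> > 0" "ball x \<delta> \<inter> J2 = {}" "ball x \<delta> \<inter> C = {}"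
      using d2 s sqr_ball[of x s] by (auto simp: \<delta>_def C_def)
    \<comment> \<open>Close to \<open>x\<close> only the part \<open>J2'\<close> of the curve is
      present, and it does not reach the square. So the curve and \<open>J2 \<union> C\<close> meet
      in the connected set \<open>J2\<close>, and by Janiszewski adding \<open>C\<close> does not
      separate exterior points near \<open>x\<close>.\<close>
    have near: "connected_component (- (J \<union> C)) p p'" if "p \<in> O' \<inter> ball x \<delta>" "p' \<in> O' \<inter> ball x \<delta>" for p p'
    proof -
      have "J \<inter> (J2 \<union> C) = J2" using J2 sqr_ball[of x s] by (auto simp: C_def)
      moreover have "J \<union> (J2 \<union> C) = J \<union> C" using J2 by auto
      moreover have "connected_component (- J) p p'"
        unfolding connected_component_def using O' that by (intro exI[of _ O']) auto
      moreover have "connected_component (- (J2 \<union> C)) p p'"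
        unfolding connected_component_def using \<delta> that by (intro exI[of _ "ball x \<delta>"]) auto
      moreover have "closed (J2 \<union> C)" using J2 Cs(3) compact_imp_closed by blast
      moreover have "connected J2" using J2 by blast
      ultimately show ?thesis
        using Janiszewski[OF J, of "J2 \<union> C" p p'] by (simp only:)
    qed
    \<comment> \<open>Far from \<open>x\<close> the other decomposition serves: the square meets the
      curve only within \<open>J1\<close>, so \<open>J\<close> and \<open>J1 \<union> C\<close> meet
      in the connected set \<open>J1\<close>.\<close>
    have far: "connected_component (- (J \<union> C)) q q'" if "q \<in> O' - cball x (R/2)" "q' \<in> O' - cball x (R/2)" for q q'
    proof -
      have "J \<inter> (J1 \<union> C) = J1" using J1 Cs d1 by auto
      moreover have "J \<union> (J1 \<union> C) = J \<union> C" using J1 by auto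
      moreover have "connected_component (- J) q q'"
        unfolding connected_component_def using O' that by (intro exI[of _ O']) auto
      moreover have "connected_component (- (J1 \<union> C)) q q'"
      proof -
        have "connected (- cball x (R/2))"
          by (rule connected_complement_bounded_convex) auto
        then show ?thesis
          unfolding connected_component_def using that J1 Cs by (intro exI[of _ "- cball x (R/2)"]) auto
      qed
      moreover have "closed (J1 \<union> C)" using J1 Cs(3) compact_imp_closed by blast
      moreover have "connected J1" using J1 by blast
      ultimately show ?thesis
        using Janiszewski[OF J, of "J1 \<union> C" q q'] by (simp only:)
    qed
    \<comment> \<open>A connected set that avoids the curve and starts in the exterior stays there,
      so it avoids every part of \<open>U\<close>.\<close>
    have transfer: "connected_component (- (C \<union> K)) a b" if ct: "connected_component (- (J \<union> C)) a b" and aK: "a \<in> O'" "K \<subseteq> U" for a b K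
    proof -
      obtain W where W: "connected W" "W \<subseteq> - (J \<union> C)" "a \<in> W" "b \<in> W"
        using ct unfolding connected_component_def by metis
      have "W \<inter> U = {}"
      proof -
        have "W \<subseteq> U \<union> O'" using W(2) O'(7) by blast
        moreover have "U \<inter> O' \<inter> W = {}" using O'(6) by blast
        moreover have "O' \<inter> W \<noteq> {}" using W(3) aK(1) by blast
        ultimately show ?thesis using connectedD[OF W(1) c(5) O'(2)] by blast
      qed
      then show ?thesis unfolding connected_component_def using W aK by (intro exI[of _ W]) auto
    qed
    \<comment> \<open>\<open>A\<close> and \<open>B\<close> may touch the Jordan curve; their points
      are first moved into the exterior.\<close>
    have link: "\<exists>p1\<in>O' \<inter> G. connected_component (- (C \<union> K)) p p1"
      if "open G" "G \<inter> C = {}" "p \<in> G" "p \<notin> U" "closed K" "K \<subseteq> U" for G K p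
    proof -
      have "p \<in> closure O'" using that O' closure_subset[of O'] by blast
      have "open (G - K)" "p \<in> G - K" using that by (auto simp: open_Diff)
      then obtain e where e: "e > 0" "ball p e \<subseteq> G - K" using open_contains_ball by blast
      obtain p1 where p1: "p1 \<in> O'" "dist p1 p < e" using \<open>p \<in> closure O'\<close> e closure_approachable by blast
      have "connected_component (- (C \<union> K)) p p1"
        unfolding connected_component_def using e p1 that by (intro exI[of _ "ball p e"]) (auto simp: dist_commute)
      then show ?thesis using p1 e by (auto simp: dist_commute subset_iff)
    qed
    show "\<exists>\<delta>>0. \<forall>A B X Y. connected A \<and> connected B \<and> A \<inter> U = {} \<and> B \<inter> U = {} \<and>
        A \<inter> ball x \<delta> \<noteq> {} \<and> B \<inter> ball x \<delta> \<noteq> {} \<and> \<not> A \<subseteq> ball x R \<and> \<not> B \<subseteq> ball x R \<and>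
        closed X \<and> closed Y \<and> X \<inter> Y = {} \<and> sqr x s - U = X \<union> Y \<and> A \<inter> sqr x s \<subseteq> X \<and> B \<inter> sqr x s \<subseteq> Y \<longrightarrow> False"
    proof (intro exI[of _ \<delta>] conjI allI impI)
      show "\<delta> > 0" by fact
      fix A B X Y
      assume H: "connected A \<and> connected B \<and> A \<inter> U = {} \<and> B \<inter> U = {} \<and>
        A \<inter> ball x \<delta> \<noteq> {} \<and> B \<inter> ball x \<delta> \<noteq> {} \<and> \<not> A \<subseteq> ball x R \<and> \<not> B \<subseteq> ball x R \<and>
        closed X \<and> closed Y \<and> X \<inter> Y = {} \<and> sqr x s - U = X \<union> Y \<and> A \<inter> sqr x s \<subseteq> X \<and> B \<inter> sqr x s \<subseteq> Y"
      obtain p p' where p: "p \<in> A" "p \<in> ball x \<delta>" "p' \<in> B" "p' \<in> ball x \<delta>" using H by blast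
      obtain q q' where q: "q \<in> A" "q \<notin> ball x R" "q' \<in> B" "q' \<notin> ball x R" using H by blast
      have ns: "nrm (p - x) < s" "nrm (p' - x) < s"
        using p nrm_le_cmod[of "p - x"] nrm_le_cmod[of "p' - x"]
        by (auto simp: \<delta>_def dist_norm norm_minus_commute)
      have nq: "s < nrm (q - x)" "s < nrm (q' - x)"
        using q cmod_le_nrm[of "q - x"] cmod_le_nrm[of "q' - x"] s
        by (auto simp: s0_def dist_norm norm_minus_commute)
      have ne: "X \<noteq> {}" "Y \<noteq> {}"
        using connected_meets_sqr[of A p q x s] connected_meets_sqr[of B p' q' x s] H p q ns nq by blast+
      have cX: "compact X" "compact Y"
      proof -
        have "X \<subseteq> sqr x s" "Y \<subseteq> sqr x s" using H by blast+
        then show "compact X" "compact Y" using H compact_sqr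
          by (metis bounded_subset compact_eq_bounded_closed)+
      qed
      obtain d where d: "d > 0" "\<And>a b. a \<in> X \<Longrightarrow> b \<in> Y \<Longrightarrow> d \<le> dist a b"
        using separate_compact_closed[OF cX(1)] H by (metis (no_types, lifting))
      \<comment> \<open>Thicken \<open>X\<close> and \<open>Y\<close> within the square to disjoint
        closed sets. What remains of the square lies in \<open>U\<close> and is enclosed in a
        connected compact part of \<open>U\<close>, so that the two halves \<open>S1\<close> and
        \<open>S2\<close> below have a connected intersection.\<close>
      define X1 where "X1 = C \<inter> {z. infdist z X \<le> d/3}"
      define Y1 where "Y1 = C \<inter> {z. infdist z Y \<le> d/3}"
      define K where "K = C \<inter> {z. d/3 \<le> infdist z X} \<inter> {z. d/3 \<le> infdist z Y}"
      have cl: "closed {z. infdist z X \<le> d/3}" "closed {z. infdist z Y \<le> d/3}"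
           "closed {z. d/3 \<le> infdist z X}" "closed {z. d/3 \<le> infdist z Y}"
        by (intro closed_Collect_le continuous_intros)+
      have cK: "compact K" unfolding K_def C_def using cl compact_sqr
        by (intro compact_Int_closed) auto
      have "K \<subseteq> U"
      proof
        fix z assume z: "z \<in> K"
        then have "z \<notin> X" "z \<notin> Y" using d by (auto simp: K_def)
        then show "z \<in> U" using z H by (auto simp: K_def C_def)
      qed
      then obtain K' where K': "compact K'" "connected K'" "K \<subseteq> K'" "K' \<subseteq> U"
        using compact_connected_superset[OF c(5,6) cK] by blast
      have dX: "d \<le> infdist z X" if "z \<in> Y" for z
        using ne d that by (auto simp: infdist_def dist_commute intro!: cINF_greatest)
      have dY: "d \<le> infdist z Y" if "z \<in> X" for z
        using ne d that by (auto simp: infdist_def intro!: cINF_greatest)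
      have X1Y1: "X1 \<inter> Y1 = {}"
      proof (rule ccontr)
        assume "X1 \<inter> Y1 \<noteq> {}"
        then obtain z where z: "infdist z X \<le> d/3" "infdist z Y \<le> d/3" by (auto simp: X1_def Y1_def)
        obtain a where a: "a \<in> X" "infdist z X = dist z a" using infdist_attains_inf[of X z] ne H by auto
        obtain b where b: "b \<in> Y" "infdist z Y = dist z b" using infdist_attains_inf[of Y z] ne H by auto
        have "d \<le> dist a b" using d a b by auto
        also have "\<dots> \<le> dist z a + dist z b" by (metis dist_commute dist_triangle)
        finally show False using z a b d(1) by auto
      qed
      have AC: "A \<inter> Y1 = {}" "B \<inter> X1 = {}"
      proof -
        have "z \<notin> Y1" if "z \<in> A" for z
        proof
          assume "z \<in> Y1"
          then have "z \<in> X" using that H by (auto simp: Y1_def C_def)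
          then show False using dY[of z] \<open>z \<in> Y1\<close> d(1) by (auto simp: Y1_def)
        qed
        moreover have "z \<notin> X1" if "z \<in> B" for z
        proof
          assume "z \<in> X1"
          then have "z \<in> Y" using that H by (auto simp: X1_def C_def)
          then show False using dX[of z] \<open>z \<in> X1\<close> d(1) by (auto simp: X1_def)
        qed
        ultimately show "A \<inter> Y1 = {}" "B \<inter> X1 = {}" by blast+
      qed
      define S1 where "S1 = X1 \<union> K'"
      define S2 where "S2 = Y1 \<union> K'"
      have S12: "S1 \<union> S2 \<subseteq> C \<union> K'" "C \<subseteq> S1 \<union> S2" "S1 \<inter> S2 = K'"
        using X1Y1 K'(3) by (auto simp: S1_def S2_def X1_def Y1_def K_def)
      have mono: "connected_component (- S1) a b" "connected_component (- S2) a b"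
        if "connected_component (- (C \<union> K')) a b" for a b
        using that S12(1) connected_component_mono[of "- (C \<union> K')" "- S1"] connected_component_mono[of "- (C \<union> K')" "- S2"]
        by blast+
      have lk: "connected_component (- (C \<union> K')) a b"
        if G: "open G" "G \<inter> C = {}" and ab: "a \<in> G" "b \<in> G" "a \<notin> U" "b \<notin> U"
          and con: "\<And>p p'. p \<in> O' \<inter> G \<Longrightarrow> p' \<in> O' \<inter> G \<Longrightarrow> connected_component (- (J \<union> C)) p p'" for G a b
      proof -
        obtain a1 where a1: "a1 \<in> O' \<inter> G" "connected_component (- (C \<union> K')) a a1"
          using link[OF G ab(1,3), of K'] K' compact_imp_closed by blast
        obtain b1 where b1: "b1 \<in> O' \<inter> G" "connected_component (- (C \<union> K')) b b1"
          using link[OF G ab(2,4), of K'] K' compact_imp_closed by blast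
        have "connected_component (- (C \<union> K')) a1 b1"
          using transfer[OF con[OF a1(1) b1(1)]] a1 K' by auto
        then show ?thesis using a1 b1 connected_component_trans connected_component_sym by metis
      qed
      have pp: "connected_component (- (C \<union> K')) p p'"
        using near \<delta>(3) p H by (intro lk[of "ball x \<delta>"]) auto
      have qq: "connected_component (- (C \<union> K')) q' q"
      proof (rule lk[of "- cball x (R/2)"])
        show "q' \<in> - cball x (R/2)" "q \<in> - cball x (R/2)" using q \<open>R > 0\<close> by auto
        show "connected_component (- (J \<union> C)) p p'" if "p \<in> O' \<inter> - cball x (R / 2)" "p' \<in> O' \<inter> - cball x (R / 2)" for p p'
          using far that by auto
      qed (use Cs q H in auto)
      \<comment> \<open>\<open>A\<close> joins \<open>p\<close> to \<open>q\<close> off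
        \<open>S2\<close>. Off \<open>S1\<close> the way leads from \<open>p\<close> to
        \<open>p'\<close> near \<open>x\<close>, along \<open>B\<close> to \<open>q'\<close>, and
        from there to \<open>q\<close> far away. Janiszewski then joins \<open>p\<close> to
        \<open>q\<close> off the whole square, although the square separates them.\<close>
      have "connected_component (- S2) p q"
        unfolding connected_component_def using H p q AC K' by (intro exI[of _ A]) (auto simp: S2_def)
      moreover have "connected_component (- S1) p' q'"
        unfolding connected_component_def using H p q AC K' by (intro exI[of _ B]) (auto simp: S1_def)
      then have "connected_component (- S1) p q"
        using mono(1)[OF pp] mono(1)[OF qq] connected_component_trans by metis
      moreover have "compact S1" "closed S2" "connected (S1 \<inter> S2)"
      proof -
        show "compact S1" unfolding S1_def X1_def C_def using K' cl compact_sqr by (intro compact_Un compact_Int_closed) auto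
        show "closed S2" unfolding S2_def Y1_def C_def using K' cl closed_sqr compact_imp_closed by (intro closed_Un closed_Int) auto
        show "connected (S1 \<inter> S2)" using S12 K' by simp
      qed
      ultimately have "connected_component (- (S1 \<union> S2)) p q" by (intro Janiszewski)
      then obtain W where W: "connected W" "W \<subseteq> - (S1 \<union> S2)" "p \<in> W" "q \<in> W"
        unfolding connected_component_def by metis
      then show False using connected_meets_sqr[OF W(1,3,4) ns(1) nq(1)] S12(2) by (auto simp: C_def)
    qed
  qed
qed

text \<open>The point of the square in direction \<open>t\<close>, by radial projection. Angles
  range over the whole real line, so that an arc may start anywhere and make a full turn.\<close>

definition sqp :: "complex \<Rightarrow> real \<Rightarrow> real \<Rightarrow> complex" where
  "sqp x s t = x + (s / nrm (cis t)) *\<^sub>R cis t"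

lemma nrm_cis_pos: "0 < nrm (cis t)"
  by (rule nrm_pos) (simp add: cis_neq_zero)

lemma sqp_in_sqr: "0 \<le> s \<Longrightarrow> sqp x s t \<in> sqr x s"
  using nrm_cis_pos[of t] by (simp add: sqr_def sqp_def nrm_scaleR)

lemma continuous_sqp: "continuous_on X (sqp x s)"
  unfolding sqp_def using nrm_cis_pos
  by (intro continuous_intros continuous_on_nrm) (metis less_irrefl)

lemma sqp_surj:
  assumes "0 < s" "z \<in> sqr x s"
  shows "\<exists>t. t0 \<le> t \<and> t < t0 + 2 * pi \<and> sqp x s t = z"
proof -
  define w where "w = z - x"
  have w: "nrm w = s" "w \<noteq> 0" using assms by (auto simp: w_def sqr_def nrm_def)
  define a where "a = (Arg w - t0) / (2 * pi)"
  define t where "t = t0 + 2 * pi * frac a"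
  have t: "t0 \<le> t" "t < t0 + 2 * pi" using frac_ge_0[of a] frac_lt_1[of a] by (auto simp: t_def)
  have pa: "2 * pi * a = Arg w - t0" by (simp add: a_def)
  have "t = Arg w + 2 * pi * (- of_int \<lfloor>a\<rfloor>)"
    using pa by (simp add: t_def frac_def right_diff_distrib)
  then have "cis t = cis (Arg w) * cis (2 * pi * of_int (- \<lfloor>a\<rfloor>))" by (simp add: cis_mult)
  also have "cis (2 * pi * of_int (- \<lfloor>a\<rfloor>)) = 1" by (rule cis_multiple_2pi) auto
  finally have ct: "cis t = cis (Arg w)" by simp
  have "w = cmod w *\<^sub>R cis (Arg w)" using rcis_cmod_Arg[of w] by (simp add: rcis_def scaleR_conv_of_real)
  then have wt: "w = cmod w *\<^sub>R cis t" by (simp add: ct)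
  then have "s = cmod w * nrm (cis t)" using w(1) nrm_scaleR[of "cmod w" "cis t"] by simp
  then have "s / nrm (cis t) = cmod w" using nrm_cis_pos[of t] by (simp add: field_simps)
  then have "sqp x s t = z" using wt by (simp add: sqp_def w_def)
  then show ?thesis using t by blast
qed

lemma sqp_inj:
  assumes "0 < s" "sqp x s t = sqp x s t'" "\<bar>t - t'\<bar> < 2 * pi"
  shows "t = t'"
proof -
  have e: "(s / nrm (cis t)) *\<^sub>R cis t = (s / nrm (cis t')) *\<^sub>R cis t'" using assms by (simp add: sqp_def)
  then have "norm ((s / nrm (cis t)) *\<^sub>R cis t) = norm ((s / nrm (cis t')) *\<^sub>R cis t')" by simp
  then have "s / nrm (cis t) = s / nrm (cis t')"
    using assms nrm_cis_pos[of t] nrm_cis_pos[of t'] by simp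
  moreover have "s / nrm (cis t) \<noteq> 0" using assms nrm_cis_pos[of t] by simp
  ultimately have "cis t = cis t'" using e by (metis scaleR_left_imp_eq)
  then have "sin t = sin t' \<and> cos t = cos t'" by (simp add: complex_eq_iff)
  then obtain n :: int where n: "t = t' + 2 * pi * n" using sin_cos_eq_iff by blast
  then have "\<bar>2 * pi * real_of_int n\<bar> < 2 * pi" using assms by simp
  then have "\<bar>real_of_int n\<bar> < 1" by (simp add: abs_mult)
  then have "n = 0" by linarith
  then show ?thesis using n by simp
qed

text \<open>One parametrization for both directions: horizontal lines at height \<open>r\<close> if
  \<open>b\<close> holds, vertical lines at abscissa \<open>r\<close> otherwise; \<open>t\<close> is
  arc length.\<close>

definition pt :: "bool \<Rightarrow> real \<Rightarrow> real \<Rightarrow> complex" where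
  "pt b r t = (if b then Complex t r else Complex r t)"

definition sides :: "complex \<Rightarrow> real \<Rightarrow> (bool \<times> real) set" where
  "sides x s = {(False, Re x + s), (False, Re x - s), (True, Im x + s), (True, Im x - s)}"

lemma continuous_pt: "continuous_on X (pt b r)"
  unfolding pt_def by (cases b) (auto simp: Complex_eq intro!: continuous_intros)

text \<open>In the sector around the \<open>n\<close>-th quarter turn the maximum norm of
  \<open>cis t\<close> is the cosine of the angle to the sector axis, and dividing by it leaves the
  tangent as coordinate along the side.\<close>

lemma sqp_side:
  assumes t: "\<bar>t - real_of_int n * (pi/2)\<bar> \<le> pi/4"
  shows "sqp x s t = x + of_real s * (cis (real_of_int n * (pi/2)) * Complex 1 (tan (t - real_of_int n * (pi/2))))"
    and "cis (real_of_int n * (pi/2)) \<in> {1, \<i>, -1, -\<i>}"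
proof -
  define u where "u = t - real_of_int n * (pi/2)"
  define \<iota> where "\<iota> = cis (real_of_int n * (pi/2))"
  have u: "- (pi/4) \<le> u" "u \<le> pi/4" using t unfolding u_def[symmetric] by linarith+
  have "\<iota> ^ 4 = cis (real 4 * (real_of_int n * (pi/2)))"
    unfolding \<iota>_def by (rule Complex.DeMoivre)
  also have "real 4 * (real_of_int n * (pi/2)) = 2 * pi * of_int n" by simp
  finally have "\<iota> ^ 4 = cis (2 * pi * of_int n)" .
  then have "\<iota> ^ 4 = 1" by (simp add: cis_multiple_2pi)
  then have "(\<iota> - 1) * (\<iota> + 1) * (\<iota> - \<i>) * (\<iota> + \<i>) = 0"
    by (simp add: algebra_simps power4_eq_xxxx)
  then have i4: "\<iota> = 1 \<or> \<iota> = -1 \<or> \<iota> = \<i> \<or> \<iota> = - \<i>"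
    by (auto simp: add_eq_0_iff2)
  then show "cis (real_of_int n * (pi/2)) \<in> {1, \<i>, -1, -\<i>}" by (auto simp: \<iota>_def)
  have ct: "cis t = \<iota> * cis u" by (simp add: \<iota>_def u_def cis_mult)
  have nc: "nrm (cis t) = nrm (cis u)"
    unfolding ct using i4 by (auto simp: nrm_def max.commute)
  have cu: "cos u > 0" using u pi_gt_zero by (intro cos_gt_zero_pi) linarith+
  have "\<bar>tan u\<bar> \<le> 1"
  proof -
    have "tan u \<le> tan (pi/4)" using u pi_gt_zero by (intro tan_mono_le) linarith+
    moreover have "tan (- (pi/4)) \<le> tan u" using u pi_gt_zero by (intro tan_mono_le) linarith+
    ultimately show ?thesis by (simp add: tan_45 abs_le_iff)
  qed
  then have "\<bar>sin u\<bar> \<le> cos u" using cu by (simp add: tan_def field_simps abs_divide)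
  then have "nrm (cis t) = cos u" using cu nc by (simp add: nrm_def)
  then have "(s / nrm (cis t)) *\<^sub>R cis t = of_real s * (\<iota> * ((1 / cos u) *\<^sub>R cis u))"
    by (simp only:) (simp add: ct scaleR_conv_of_real)
  also have "(1 / cos u) *\<^sub>R cis u = Complex 1 (tan u)"
    using cu by (simp add: complex_eq_iff tan_def)
  finally show "sqp x s t = x + of_real s * (cis (real_of_int n * (pi/2)) * Complex 1 (tan (t - real_of_int n * (pi/2))))"
    by (simp add: sqp_def u_def \<iota>_def)
qed

text \<open>Intermediate values: the coordinate along the side has a connected image on the arc, so
  the arc covers the full segment between its end points.\<close>

lemma sqp_side_segment:
  assumes "0 < s" "t \<le> t'" "real_of_int n * (pi/2) - pi/4 \<le> t" "t' \<le> real_of_int n * (pi/2) + pi/4"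
  shows "\<exists>b r p q. (b, r) \<in> sides x s \<and> sqp x s t = pt b r p \<and> sqp x s t' = pt b r q \<and>
           pt b r ` {min p q..max p q} \<subseteq> sqp x s ` {t..t'}"
proof -
  define T where "T \<theta> = tan (\<theta> - real_of_int n * (pi/2))" for \<theta>
  define \<iota> where "\<iota> = cis (real_of_int n * (pi/2))"
  have rep: "sqp x s \<theta> = x + of_real s * (\<iota> * Complex 1 (T \<theta>))" and i4: "\<iota> \<in> {1, \<i>, -1, -\<i>}"
    if "\<theta> \<in> {t..t'}" for \<theta>
  proof -
    have "\<bar>\<theta> - real_of_int n * (pi/2)\<bar> \<le> pi/4" using that assms(3,4) unfolding atLeastAtMost_iff by linarith
    then show "sqp x s \<theta> = x + of_real s * (\<iota> * Complex 1 (T \<theta>))" "\<iota> \<in> {1, \<i>, -1, -\<i>}"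
      using sqp_side(1)[of \<theta> n x s] sqp_side(2)[of \<theta> n] unfolding T_def \<iota>_def by blast+
  qed
  obtain b r g where g: "(b, r) \<in> sides x s" "\<And>y. x + of_real s * (\<iota> * Complex 1 y) = pt b r (g y)"
     and gc: "g = (\<lambda>y. Im x + s * y) \<or> g = (\<lambda>y. Im x - s * y) \<or> g = (\<lambda>y. Re x + s * y) \<or> g = (\<lambda>y. Re x - s * y)"
  proof -
    have "\<iota> = 1 \<or> \<iota> = \<i> \<or> \<iota> = -1 \<or> \<iota> = -\<i>" using i4[of t] assms by auto
    then show ?thesis
    proof (elim disjE)
      assume "\<iota> = 1" then show ?thesis
        by (intro that[of False "Re x + s" "\<lambda>y. Im x + s * y"]) (auto simp: sides_def pt_def complex_eq_iff)
    next
      assume "\<iota> = \<i>" then show ?thesis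
        by (intro that[of True "Im x + s" "\<lambda>y. Re x - s * y"]) (auto simp: sides_def pt_def complex_eq_iff)
    next
      assume "\<iota> = -1" then show ?thesis
        by (intro that[of False "Re x - s" "\<lambda>y. Im x - s * y"]) (auto simp: sides_def pt_def complex_eq_iff)
    next
      assume "\<iota> = -\<i>" then show ?thesis
        by (intro that[of True "Im x - s" "\<lambda>y. Re x + s * y"]) (auto simp: sides_def pt_def complex_eq_iff)
    qed
  qed
  have "continuous_on {t..t'} T"
    unfolding T_def
  proof (intro continuous_intros ballI)
    fix \<theta> assume "\<theta> \<in> {t..t'}"
    then have "- (pi/2) < \<theta> - real_of_int n * (pi/2)" "\<theta> - real_of_int n * (pi/2) < pi/2"
      using assms(3,4) pi_gt_zero unfolding atLeastAtMost_iff by linarith+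
    then show "cos (\<theta> - real_of_int n * (pi/2)) \<noteq> 0" using cos_gt_zero_pi by fastforce
  qed
  then have contg: "continuous_on {t..t'} (\<lambda>\<theta>. g (T \<theta>))"
    using gc by (auto intro!: continuous_intros)
  have conn: "connected ((\<lambda>\<theta>. g (T \<theta>)) ` {t..t'})"
    by (intro connected_continuous_image contg) auto
  define p where "p = g (T t)"
  define q where "q = g (T t')"
  have "{min p q..max p q} \<subseteq> (\<lambda>\<theta>. g (T \<theta>)) ` {t..t'}"
  proof -
    have "p \<in> (\<lambda>\<theta>. g (T \<theta>)) ` {t..t'}" "q \<in> (\<lambda>\<theta>. g (T \<theta>)) ` {t..t'}"
      using assms by (auto simp: p_def q_def)
    then show ?thesis using connected_contains_Icc[OF conn] by (auto simp: min_def max_def)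
  qed
  then have "pt b r ` {min p q..max p q} \<subseteq> pt b r ` (\<lambda>\<theta>. g (T \<theta>)) ` {t..t'}"
    by (intro image_mono)
  also have "\<dots> = sqp x s ` {t..t'}"
    unfolding image_image using rep g(2) by (intro image_cong) auto
  finally have "pt b r ` {min p q..max p q} \<subseteq> sqp x s ` {t..t'}" .
  moreover have "sqp x s t = pt b r p" "sqp x s t' = pt b r q"
    using rep[of t] rep[of t'] g(2) assms by (auto simp: p_def q_def)
  ultimately show ?thesis using g(1) by blast
qed

text \<open>The angles of the square outside \<open>U\<close> form a compact set. If no interval in
  it joined angles of \<open>A\<close> to angles of \<open>B\<close>, the cut wire fence theorem
  would split it into two closed parts, and the square outside \<open>U\<close> with it, against
  \<open>square_not_split\<close>.\<close>

lemma square_arc: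
  assumes U: "jordan_region U" and x: "x \<in> frontier U" and "R > 0"
  obtains s0 where "s0 > 0" "s0 < R"
    "\<And>s. 0 < s \<Longrightarrow> s < s0 \<Longrightarrow> \<exists>\<delta>>0. \<forall>A B. compact A \<and> compact B \<and> connected A \<and> connected B \<and>
        A \<inter> U = {} \<and> B \<inter> U = {} \<and>
        A \<inter> ball x \<delta> \<noteq> {} \<and> B \<inter> ball x \<delta> \<noteq> {} \<and> \<not> A \<subseteq> ball x R \<and> \<not> B \<subseteq> ball x R \<longrightarrow>
        (\<exists>a b. a \<le> b \<and> b \<le> a + 2 * pi \<and> sqp x s ` {a..b} \<inter> U = {} \<and>
            (sqp x s a \<in> A \<and> sqp x s b \<in> B \<or> sqp x s a \<in> B \<and> sqp x s b \<in> A))"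
proof -
  obtain s0 where s0: "s0 > 0" "s0 < R"
    and ns: "\<And>s. 0 < s \<Longrightarrow> s < s0 \<Longrightarrow> \<exists>\<delta>>0. \<forall>A B X Y. connected A \<and> connected B \<and> A \<inter> U = {} \<and> B \<inter> U = {} \<and>
        A \<inter> ball x \<delta> \<noteq> {} \<and> B \<inter> ball x \<delta> \<noteq> {} \<and> \<not> A \<subseteq> ball x R \<and> \<not> B \<subseteq> ball x R \<and>
        closed X \<and> closed Y \<and> X \<inter> Y = {} \<and> sqr x s - U = X \<union> Y \<and> A \<inter> sqr x s \<subseteq> X \<and> B \<inter> sqr x s \<subseteq> Y \<longrightarrow> False"
    using square_not_split[OF U x \<open>R > 0\<close>] by blast
  have opU: "open U" using jordan_props[OF U] by metis
  show ?thesis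
  proof (rule that[of "min s0 (R/4)"])
    show "0 < min s0 (R/4)" "min s0 (R/4) < R" using s0 by auto
    fix s assume s: "0 < s" "s < min s0 (R/4)"
    obtain \<delta>' where \<delta>': "\<delta>' > 0" and nsd: "\<And>A B X Y. connected A \<Longrightarrow> connected B \<Longrightarrow> A \<inter> U = {} \<Longrightarrow> B \<inter> U = {} \<Longrightarrow>
        A \<inter> ball x \<delta>' \<noteq> {} \<Longrightarrow> B \<inter> ball x \<delta>' \<noteq> {} \<Longrightarrow> \<not> A \<subseteq> ball x R \<Longrightarrow> \<not> B \<subseteq> ball x R \<Longrightarrow>
        closed X \<Longrightarrow> closed Y \<Longrightarrow> X \<inter> Y = {} \<Longrightarrow> sqr x s - U = X \<union> Y \<Longrightarrow> A \<inter> sqr x s \<subseteq> X \<Longrightarrow> B \<inter> sqr x s \<subseteq> Y \<Longrightarrow> False"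
      using ns[of s] s by (metis min_less_iff_conj)
    define \<delta> where "\<delta> = min \<delta>' s"
    define \<sigma> where "\<sigma> = sqp x s"
    show "\<exists>\<delta>>0. \<forall>A B. compact A \<and> compact B \<and> connected A \<and> connected B \<and>
        A \<inter> U = {} \<and> B \<inter> U = {} \<and>
        A \<inter> ball x \<delta> \<noteq> {} \<and> B \<inter> ball x \<delta> \<noteq> {} \<and> \<not> A \<subseteq> ball x R \<and> \<not> B \<subseteq> ball x R \<longrightarrow>
        (\<exists>a b. a \<le> b \<and> b \<le> a + 2 * pi \<and> sqp x s ` {a..b} \<inter> U = {} \<and>
            (sqp x s a \<in> A \<and> sqp x s b \<in> B \<or> sqp x s a \<in> B \<and> sqp x s b \<in> A))"
      unfolding \<sigma>_def[symmetric]
    proof (rule exI[of _ \<delta>], intro conjI allI impI)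
      show "\<delta> > 0" using \<delta>' s by (simp add: \<delta>_def)
      fix A B
      assume "compact A \<and> compact B \<and> connected A \<and> connected B \<and> A \<inter> U = {} \<and> B \<inter> U = {} \<and>
        A \<inter> ball x \<delta> \<noteq> {} \<and> B \<inter> ball x \<delta> \<noteq> {} \<and> \<not> A \<subseteq> ball x R \<and> \<not> B \<subseteq> ball x R"
      then have cA: "compact A" "connected A" "A \<inter> U = {}" "A \<inter> ball x \<delta> \<noteq> {}" "\<not> A \<subseteq> ball x R"
        and cB: "compact B" "connected B" "B \<inter> U = {}" "B \<inter> ball x \<delta> \<noteq> {}" "\<not> B \<subseteq> ball x R" by blast+
      have meets: "A' \<inter> sqr x s \<noteq> {}" if "connected A'" "A' \<inter> ball x \<delta> \<noteq> {}" "\<not> A' \<subseteq> ball x R" for A'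
      proof -
        obtain p q where pq: "p \<in> A'" "p \<in> ball x \<delta>" "q \<in> A'" "q \<notin> ball x R" using \<open>A' \<inter> ball x \<delta> \<noteq> {}\<close> \<open>\<not> A' \<subseteq> ball x R\<close> by blast
        have "nrm (p - x) < s" using pq nrm_le_cmod[of "p - x"] by (auto simp: \<delta>_def dist_norm norm_minus_commute)
        moreover have "s < nrm (q - x)" using pq cmod_le_nrm[of "q - x"] s by (auto simp: dist_norm norm_minus_commute)
        ultimately show ?thesis using connected_meets_sqr[OF \<open>connected A'\<close>] pq by blast
      qed
      show "\<exists>a b. a \<le> b \<and> b \<le> a + 2 * pi \<and> \<sigma> ` {a..b} \<inter> U = {} \<and>
            (\<sigma> a \<in> A \<and> \<sigma> b \<in> B \<or> \<sigma> a \<in> B \<and> \<sigma> b \<in> A)"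
      proof (cases "sqr x s \<inter> U = {}")
        case True
        obtain p q where pq: "p \<in> A" "p \<in> sqr x s" "q \<in> B" "q \<in> sqr x s"
          using meets[OF cA(2,4,5)] meets[OF cB(2,4,5)] by blast
        obtain a where a: "\<sigma> a = p" using sqp_surj[OF s(1) pq(2)] unfolding \<sigma>_def by blast
        obtain b where b: "a \<le> b" "b < a + 2 * pi" "\<sigma> b = q" using sqp_surj[OF s(1) pq(4), of a] unfolding \<sigma>_def by blast
        have "\<sigma> ` {a..b} \<subseteq> sqr x s" using sqp_in_sqr[of s x] s by (auto simp: \<sigma>_def)
        then have "\<sigma> ` {a..b} \<inter> U = {}" using True by blast
        then show ?thesis using a b pq by (intro exI[of _ a] exI[of _ b]) auto
      next
        case False
        then obtain o' where o': "o' \<in> sqr x s" "o' \<in> U" by blast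
        \<comment> \<open>The circle of angles is cut open at a point of \<open>U\<close>; outside
          \<open>U\<close>, angles and points then correspond one to one.\<close>
        obtain t0 where t0: "\<sigma> t0 = o'" using sqp_surj[OF s(1) o'(1)] unfolding \<sigma>_def by blast
        have t1: "\<sigma> (t0 + 2 * pi) = o'"
        proof -
          have "cis (t0 + 2 * pi) = cis t0" by (simp add: complex_eq_iff)
          then show ?thesis using t0 by (simp add: \<sigma>_def sqp_def)
        qed
        have cont: "continuous_on X \<sigma>" for X unfolding \<sigma>_def by (rule continuous_sqp)
        define T where "T = {t0..t0 + 2 * pi} \<inter> \<sigma> -` (- U)"
        have Tc: "compact T"
        proof -
          have "closed T" unfolding T_def by (intro continuous_closed_preimage cont) (auto simp: opU)
          moreover have "bounded T" by (rule bounded_subset[OF bounded_closed_interval]) (auto simp: T_def)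
          ultimately show ?thesis by (simp add: compact_eq_bounded_closed)
        qed
        have T0: "t0 < t" "t < t0 + 2 * pi" if "t \<in> T" for t
        proof -
          have "\<sigma> t \<notin> U" "t0 \<le> t" "t \<le> t0 + 2 * pi" using that by (auto simp: T_def)
          then show "t0 < t" "t < t0 + 2 * pi" using t0 t1 o'(2) by (metis order_le_less)+
        qed
        have inj: "t = t'" if "t \<in> T" "t' \<in> T" "\<sigma> t = \<sigma> t'" for t t'
          using sqp_inj[OF s(1), of x t t'] that T0[OF that(1)] T0[OF that(2)] by (auto simp: \<sigma>_def)
        have surj: "\<exists>t\<in>T. \<sigma> t = z" if z: "z \<in> sqr x s" "z \<notin> U" for z
        proof -
          obtain t where "t0 \<le> t" "t < t0 + 2 * pi" "\<sigma> t = z" using sqp_surj[OF s(1) z(1)] unfolding \<sigma>_def by blast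
          then show ?thesis using z by (intro bexI[of _ t]) (auto simp: T_def)
        qed
        define TA where "TA = T \<inter> \<sigma> -` A"
        define TB where "TB = T \<inter> \<sigma> -` B"
        show ?thesis
        proof (rule ccontr)
          assume no: "\<not> ?thesis"
          have "separated_between (top_of_set T) TA TB"
          proof (rule cut_wire_fence_theorem)
            show "compact_space (top_of_set T)" using Tc by (simp add: compact_space_subtopology)
            show "Hausdorff_space (top_of_set T)" by (simp add: Hausdorff_space_subtopology)
            show "closedin (top_of_set T) TA" unfolding TA_def
              using cA(1) compact_imp_closed by (intro continuous_closedin_preimage cont)
            show "closedin (top_of_set T) TB" unfolding TB_def
              using cB(1) compact_imp_closed by (intro continuous_closedin_preimage cont)
            fix C assume "connectedin (top_of_set T) C"
            then have C: "connected C" "C \<subseteq> T" by (auto simp: connectedin_subtopology)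
            show "disjnt C TA \<or> disjnt C TB"
            proof (rule ccontr)
              assume "\<not> (disjnt C TA \<or> disjnt C TB)"
              then obtain a b where ab: "a \<in> C" "a \<in> TA" "b \<in> C" "b \<in> TB" by (auto simp: disjnt_def)
              have sub: "{min a b..max a b} \<subseteq> T"
                using connected_contains_Icc[OF C(1)] ab C(2) by (auto simp: min_def max_def)
              have "\<sigma> ` {min a b..max a b} \<inter> U = {}" using sub by (auto simp: T_def)
              moreover have "max a b \<le> min a b + 2 * pi" 
              proof -
                have "a \<in> T" "b \<in> T" using ab(1,3) C(2) by blast+
                then show ?thesis using T0[of a] T0[of b] unfolding min_def max_def by (smt (verit))
              qed
              moreover have "\<sigma> (min a b) \<in> A \<and> \<sigma> (max a b) \<in> B \<or> \<sigma> (min a b) \<in> B \<and> \<sigma> (max a b) \<in> A"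
                using ab by (auto simp: TA_def TB_def min_def max_def)
              moreover have "min a b \<le> max a b" by simp
              ultimately show False using no by blast
            qed
          qed
          then obtain V W where VW: "closedin (top_of_set T) V" "closedin (top_of_set T) W" "V \<union> W = T"
              "disjnt V W" "TA \<subseteq> V" "TB \<subseteq> W"
            by (auto simp: separated_between_alt)
          have cVW: "compact V" "compact W" using VW(1,2) Tc closedin_compact by blast+
          have h1: "A \<inter> ball x \<delta>' \<noteq> {}" "B \<inter> ball x \<delta>' \<noteq> {}" using cA(4) cB(4) by (auto simp: \<delta>_def)
          have h2: "closed (\<sigma> ` V)" "closed (\<sigma> ` W)"
              using cVW by (auto intro!: compact_imp_closed compact_continuous_image cont)
          have h3: "\<sigma> ` V \<inter> \<sigma> ` W = {}"
            proof -
              have False if "t \<in> V" "t' \<in> W" "\<sigma> t = \<sigma> t'" for t t'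
                using inj[of t t'] that VW(3,4) unfolding disjnt_def by blast
              then show ?thesis by blast
            qed
          have h4: "sqr x s - U = \<sigma> ` V \<union> \<sigma> ` W"
            proof -
              have "sqr x s - U = \<sigma> ` T"
              proof (rule antisym)
                show "sqr x s - U \<subseteq> \<sigma> ` T" using surj by blast
                show "\<sigma> ` T \<subseteq> sqr x s - U" using sqp_in_sqr[of s x] s by (auto simp: \<sigma>_def T_def)
              qed
              then show ?thesis using VW(3) by blast
            qed
          have h5: "A \<inter> sqr x s \<subseteq> \<sigma> ` V" using surj cA(3) VW(5) unfolding TA_def by blast
          have h6: "B \<inter> sqr x s \<subseteq> \<sigma> ` W" using surj cB(3) VW(6) unfolding TB_def by blast
          show False by (rule nsd[OF cA(2) cB(2) cA(3) cB(3) h1 cA(5) cB(5) h2 h3 h4 h5 h6])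
        qed
      qed
    qed
  qed
qed

section \<open>Differences of values along lines and arcs of squares\<close>

context rel_carpet
begin

text \<open>A relation, because inside a disk every number in the range of its circle counts as a
  value; arcs of squares may start and end inside disks.\<close>

definition val :: "(complex \<Rightarrow> real) \<Rightarrow> complex \<Rightarrow> real \<Rightarrow> bool" where
  "val v z r \<longleftrightarrow> z \<in> S \<and> r = v z \<or> (\<exists>k. z \<in> Q k \<and> pm v k \<le> r \<and> r \<le> pM v k)"

lemma val_ex: "pbdd v \<Longrightarrow> z \<in> \<Omega> \<Longrightarrow> \<exists>r. val v z r"
  using Om_cases pm_le_pM unfolding val_def by (metis order_refl)

lemma val_front: "pbdd v \<Longrightarrow> z \<in> frontier (Q k) \<Longrightarrow> pm v k \<le> r \<Longrightarrow> r \<le> pM v k \<Longrightarrow> \<bar>r - v z\<bar> \<le> pO v k"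
  using pM_ge pm_le unfolding pO_def by (smt (verit))

text \<open>The three sums pay for the passage from the starting point to the circle of its disk,
  for the way between two carpet points, and for the passage from a circle to the end point in its
  disk.\<close>

lemma tame_val:
  assumes tf: "tame v f a b" and v: "pbdd v" and ab: "a \<le> b" and r: "val v (f a) r" "val v (f b) r'"
  shows "ennreal \<bar>r - r'\<bar> \<le> 3 * psum (eO v) (hit (f ` {a..b}))"
proof -
  define P where "P = psum (eO v) (hit (f ` {a..b}))"
  have cont: "continuous_on {a..b} f" by (rule tame_by_cont[OF tf])
  have P1: "ennreal (pO v k) \<le> P" if "f t \<in> Q k" "t \<in> {a..b}" for k t
    unfolding P_def by (rule psum_ge) (use that in \<open>auto simp: disks_meeting_def\<close>)
  have P3: "x \<le> P \<Longrightarrow> x \<le> 3 * P" for x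
    by (metis (no_types) dual_order.trans mult.left_neutral mult_right_mono one_le_numeral zero_le)
  have step: "ennreal \<bar>r - r'\<bar> \<le> 3 * P"
    if "a \<le> c" "c \<le> d" "d \<le> b" "f c \<in> S" "f d \<in> S" "ennreal \<bar>r - v (f c)\<bar> \<le> P" "ennreal \<bar>v (f d) - r'\<bar> \<le> P" for c d
  proof -
    have "ennreal \<bar>v (f c) - v (f d)\<bar> \<le> psum (eO v) (hit (f ` {c..d}))"
      using that by (intro tame_byD[OF tf]) auto
    also have "\<dots> \<le> P" unfolding P_def using that by (intro psum_hit_mono image_mono) auto
    finally have m: "ennreal \<bar>v (f c) - v (f d)\<bar> \<le> P" .
    have "ennreal \<bar>r - r'\<bar> \<le> ennreal (\<bar>r - v (f c)\<bar> + \<bar>v (f c) - v (f d)\<bar> + \<bar>v (f d) - r'\<bar>)"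
      by (intro ennreal_leI) auto
    also have "\<dots> = ennreal \<bar>r - v (f c)\<bar> + ennreal \<bar>v (f c) - v (f d)\<bar> + ennreal \<bar>v (f d) - r'\<bar>"
      by (simp add: ennreal_plus)
    also have "\<dots> \<le> P + P + P" by (intro add_mono that m)
    also have "\<dots> = (1 + 1 + 1) * P" by (simp only: distrib_right mult_1)
    also have "(1 + 1 + 1 :: ennreal) = 3" by simp
    finally show ?thesis .
  qed
  show ?thesis unfolding P_def[symmetric]
  proof (cases "\<exists>k. f a \<in> Q k \<and> f b \<in> Q k")
    case True
    then obtain k where k: "f a \<in> Q k" "f b \<in> Q k" by blast
    have "pm v k \<le> r \<and> r \<le> pM v k" "pm v k \<le> r' \<and> r' \<le> pM v k"
      using r k cl_disj closure_subset S_not_Q unfolding val_def by (metis subsetD)+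
    then have "ennreal \<bar>r - r'\<bar> \<le> ennreal (pO v k)" by (intro ennreal_leI) (auto simp: pO_def)
    also have "\<dots> \<le> P" using P1[of a k] k ab by auto
    finally show "ennreal \<bar>r - r'\<bar> \<le> 3 * P" by (rule P3)
  next
    case False
    obtain c where c: "a \<le> c" "c \<le> b" "f c \<in> S" "ennreal \<bar>r - v (f c)\<bar> \<le> P"
    proof (cases "f a \<in> S")
      case True
      then have "r = v (f a)" using r(1) S_not_Q by (auto simp: val_def)
      then show ?thesis using True ab S_not_Q by (intro that[of a]) auto
    next
      case nS: False
      then obtain k where k: "f a \<in> Q k" "pm v k \<le> r" "r \<le> pM v k" using r(1) by (auto simp: val_def)
      then have "f b \<notin> Q k" using False by blast
      then obtain c where c: "c \<in> {a..b}" "f c \<in> frontier (Q k)"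
        using path_leaves[OF cont ab, of k] k closure_subset by blast
      have "ennreal \<bar>r - v (f c)\<bar> \<le> ennreal (pO v k)" using val_front[OF v c(2) k(2,3)] by (rule ennreal_leI)
      also have "\<dots> \<le> P" using P1[of a k] k ab by auto
      finally show ?thesis using that[of c] c front_S False by auto
    qed
    show "ennreal \<bar>r - r'\<bar> \<le> 3 * P"
    proof (cases "f b \<in> S")
      case True
      then have "r' = v (f b)" using r(2) S_not_Q by (auto simp: val_def)
      then show ?thesis using True c by (intro step[of c b]) auto
    next
      case nS: False
      then obtain k where k: "f b \<in> Q k" "pm v k \<le> r'" "r' \<le> pM v k" using r(2) by (auto simp: val_def)
      have "continuous_on {c..b} f" using cont c by (auto intro: continuous_on_subset)
      then obtain d where d: "d \<in> {c..b}" "f d \<in> frontier (Q k)"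
        using path_enters[of c b f k] c k closure_subset S_not_Q[OF c(3)] by blast
      have "ennreal \<bar>v (f d) - r'\<bar> \<le> ennreal (pO v k)"
        using val_front[OF v d(2) k(2,3)] by (intro ennreal_leI) (simp add: abs_minus_commute)
      also have "\<dots> \<le> P" using P1[of b k] k ab by auto
      finally show ?thesis using c d front_S by (intro step[of c d]) auto
    qed
  qed
qed

definition tame_line :: "(complex \<Rightarrow> real) \<Rightarrow> bool \<Rightarrow> real \<Rightarrow> bool" where
  "tame_line v b r \<longleftrightarrow> (\<forall>p q. p \<le> q \<and> pt b r ` {p..q} \<subseteq> \<Omega> \<longrightarrow> tame v (pt b r) p q)"

lemma tame_line_val:
  assumes "tame_line v b r" "pbdd v" "pt b r ` {min p q..max p q} \<subseteq> \<Omega>" "val v (pt b r p) y" "val v (pt b r q) y'"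
  shows "ennreal \<bar>y - y'\<bar> \<le> 3 * psum (eO v) (hit (pt b r ` {min p q..max p q}))"
proof (cases "p \<le> q")
  case True
  then show ?thesis using assms tame_val[of v "pt b r" p q y y'] by (auto simp: tame_line_def)
next
  case False
  then show ?thesis using assms tame_val[of v "pt b r" q p y' y] by (auto simp: tame_line_def min_def max_def abs_minus_commute)
qed

text \<open>An arc of at most a full turn runs through at most five quarter-turn sectors, since it
  may return to its first one. Each of these segments costs three sums, whence 15.\<close>

lemma square_val:
  assumes s: "0 < s" and tl: "\<And>b r. (b, r) \<in> sides x s \<Longrightarrow> tame_line v b r" and v: "pbdd v"
    and ab: "a \<le> b" "b \<le> a + 2 * pi" "sqp x s ` {a..b} \<subseteq> \<Omega>" "val v (sqp x s a) y" "val v (sqp x s b) y'"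
  shows "ennreal \<bar>y - y'\<bar> \<le> 15 * psum (eO v) (hit (sqp x s ` {a..b}))"
proof -
  \<comment> \<open>Index of the sector that contains the starting angle; sectors are centred at
    multiples of \<open>pi/2\<close>.\<close>
  define n where "n = \<lfloor>a / (pi/2) + 1/2\<rfloor>"
  have "real_of_int n \<le> a / (pi/2) + 1/2" "a / (pi/2) + 1/2 < real_of_int n + 1"
    unfolding n_def by linarith+
  then have n: "real_of_int n * (pi/2) - pi/4 \<le> a" "a < real_of_int n * (pi/2) + pi/4"
    using pi_gt_zero by (auto simp: field_simps)
  have step: "ennreal \<bar>y - y'\<bar> \<le> 3 * psum (eO v) (hit (sqp x s ` {c..d}))"
    if cd: "c \<le> d" "sqp x s ` {c..d} \<subseteq> \<Omega>" "real_of_int n * (pi/2) - pi/4 \<le> c" "d \<le> real_of_int n * (pi/2) + pi/4"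
      and y: "val v (sqp x s c) y" "val v (sqp x s d) y'" for c d y y' n
  proof -
    obtain b r p q where b: "(b, r) \<in> sides x s" "sqp x s c = pt b r p" "sqp x s d = pt b r q"
        "pt b r ` {min p q..max p q} \<subseteq> sqp x s ` {c..d}"
      using sqp_side_segment[OF s cd(1,3,4)] by blast
    have "ennreal \<bar>y - y'\<bar> \<le> 3 * psum (eO v) (hit (pt b r ` {min p q..max p q}))"
      using y b cd by (intro tame_line_val tl v) auto
    also have "\<dots> \<le> 3 * psum (eO v) (hit (sqp x s ` {c..d}))"
      using b(4) by (intro mult_left_mono psum_hit_mono) auto
    finally show ?thesis .
  qed
  have ind: "ennreal \<bar>y - y'\<bar> \<le> ennreal (3 * real (Suc k)) * psum (eO v) (hit (sqp x s ` {a..d}))"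
    if "a \<le> d" "sqp x s ` {a..d} \<subseteq> \<Omega>" "d \<le> real_of_int (n + int k) * (pi/2) + pi/4" "val v (sqp x s d) y'" for k d y'
    using that
  proof (induction k arbitrary: d y')
    case 0
    then show ?case using step[of a d n y y'] n ab(4) by simp
  next
    case (Suc k)
    define m where "m = real_of_int (n + int k) * (pi/2) + pi/4"
    show ?case
    proof (cases "d \<le> m")
      case True
      have "ennreal \<bar>y - y'\<bar> \<le> ennreal (3 * real (Suc k)) * psum (eO v) (hit (sqp x s ` {a..d}))"
        using Suc.prems True by (intro Suc.IH) (auto simp: m_def)
      also have "\<dots> \<le> ennreal (3 * real (Suc (Suc k))) * psum (eO v) (hit (sqp x s ` {a..d}))"
        by (intro mult_right_mono ennreal_leI) auto
      finally show ?thesis .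
    next
      case False
      have am: "a \<le> m"
      proof -
        have "0 \<le> real k * pi" by simp
        then have "real_of_int n * (pi/2) + pi/4 \<le> m" unfolding m_def by (auto simp: algebra_simps)
        then show ?thesis using n by linarith
      qed
      have sub1: "sqp x s ` {a..m} \<subseteq> sqp x s ` {a..d}" and sub2: "sqp x s ` {m..d} \<subseteq> sqp x s ` {a..d}"
        using False am by (auto intro!: image_mono)
      have "sqp x s m \<in> \<Omega>" using Suc.prems(2) am False by auto
      then obtain y1 where y1: "val v (sqp x s m) y1" using val_ex[OF v] by blast
      have "ennreal \<bar>y - y1\<bar> \<le> ennreal (3 * real (Suc k)) * psum (eO v) (hit (sqp x s ` {a..m}))"
        using am sub1 Suc.prems(2) y1 by (intro Suc.IH) (auto simp: m_def)
      also have "\<dots> \<le> ennreal (3 * real (Suc k)) * psum (eO v) (hit (sqp x s ` {a..d}))"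
        using sub1 by (intro mult_left_mono psum_hit_mono) auto
      finally have 1: "ennreal \<bar>y - y1\<bar> \<le> \<dots>" .
      have "ennreal \<bar>y1 - y'\<bar> \<le> 3 * psum (eO v) (hit (sqp x s ` {m..d}))"
        using False Suc.prems y1 sub2 by (intro step[of m d "n + int (Suc k)"]) (auto simp: m_def algebra_simps)
      also have "\<dots> \<le> 3 * psum (eO v) (hit (sqp x s ` {a..d}))"
        using sub2 by (intro mult_left_mono psum_hit_mono) auto
      finally have 2: "ennreal \<bar>y1 - y'\<bar> \<le> \<dots>" .
      have "ennreal \<bar>y - y'\<bar> \<le> ennreal (\<bar>y - y1\<bar> + \<bar>y1 - y'\<bar>)" by (intro ennreal_leI) auto
      also have "\<dots> = ennreal \<bar>y - y1\<bar> + ennreal \<bar>y1 - y'\<bar>" by (simp add: ennreal_plus)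
      also have "\<dots> \<le> ennreal (3 * real (Suc k)) * psum (eO v) (hit (sqp x s ` {a..d})) + ennreal 3 * psum (eO v) (hit (sqp x s ` {a..d}))"
        using 1 2 by (intro add_mono) auto
      also have "\<dots> = (ennreal (3 * real (Suc k)) + ennreal 3) * psum (eO v) (hit (sqp x s ` {a..d}))"
        by (rule distrib_right[symmetric])
      also have "ennreal (3 * real (Suc k)) + ennreal 3 = ennreal (3 * real (Suc (Suc k)))"
        by (subst ennreal_plus[symmetric]) (auto simp: algebra_simps)
      finally show ?thesis .
    qed
  qed
  have "b \<le> real_of_int (n + int 4) * (pi/2) + pi/4" using ab n by (auto simp: algebra_simps)
  then have "ennreal \<bar>y - y'\<bar> \<le> ennreal (3 * real (Suc 4)) * psum (eO v) (hit (sqp x s ` {a..b}))"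
    using ab by (intro ind) auto
  then show ?thesis by simp
qed

end

section \<open>Areas of the disks\<close>

lemma psum_finite_ge:
  assumes "psum \<rho> I < \<infinity>" "c > 0"
  shows "finite {i\<in>I. c \<le> \<rho> i}"
proof -
  obtain F where F: "finite F" "F \<subseteq> I" "psum \<rho> (I - F) < c" using psum_tail[OF assms] by blast
  have "{i\<in>I. c \<le> \<rho> i} \<subseteq> F"
  proof
    fix i assume i: "i \<in> {i\<in>I. c \<le> \<rho> i}"
    show "i \<in> F"
    proof (rule ccontr)
      assume "i \<notin> F"
      then have "\<rho> i \<le> psum \<rho> (I - F)" using i by (intro psum_ge) auto
      then show False using i F(3) by auto
    qed
  qed
  then show ?thesis using F finite_subset by blast
qed

lemma distr_pt: "distr (lborel :: (real \<times> real) measure) borel (\<lambda>(r, t). pt b r t) = (lborel :: complex measure)"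
proof -
  have meas: "(\<lambda>(r, t). pt b r t) \<in> borel_measurable borel"
    unfolding pt_def Complex_eq case_prod_beta by (cases b) (auto intro!: borel_measurable_continuous_onI continuous_intros)
  show ?thesis
  proof (rule lborel_eqI[symmetric])
    fix l u :: complex assume lu: "\<And>b. b \<in> Basis \<Longrightarrow> l \<bullet> b \<le> u \<bullet> b"
    have lu': "Re l \<le> Re u" "Im l \<le> Im u" using lu[of 1] lu[of \<i>] by (auto simp: Basis_complex_def inner_complex_def)
    have "emeasure (distr (lborel :: (real \<times> real) measure) borel (\<lambda>(r, t). pt b r t)) (box l u) =
        emeasure lborel ((\<lambda>(r, t). pt b r t) -` box l u)"
      using meas by (subst emeasure_distr) auto
    also have "(\<lambda>(r, t). pt b r t) -` box l u =
        (if b then {Im l<..<Im u} \<times> {Re l<..<Re u} else {Re l<..<Re u} \<times> {Im l<..<Im u})"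
      by (auto simp: pt_def box_def Basis_complex_def inner_complex_def)
    also have "emeasure lborel \<dots> = ennreal ((Re u - Re l) * (Im u - Im l))"
      unfolding lborel_prod[symmetric] using lu'
      by (simp add: lborel.emeasure_pair_measure_Times ennreal_mult mult.commute)
    also have "\<dots> = ennreal (\<Prod>b\<in>Basis. (u - l) \<bullet> b)"
      by (simp add: Basis_complex_def inner_complex_def)
    finally show "emeasure (distr (lborel :: (real \<times> real) measure) borel (\<lambda>(r, t). pt b r t)) (box l u) =
        ennreal (\<Prod>b\<in>Basis. (u - l) \<bullet> b)" .
  qed simp
qed

lemma measurable_pt_pair: "(\<lambda>(r, t). pt b r t) \<in> borel_measurable (borel :: (real \<times> real) measure)"
  unfolding pt_def Complex_eq case_prod_beta by (cases b) (auto intro!: borel_measurable_continuous_onI continuous_intros)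

lemma measurable_pt: "pt b r \<in> borel_measurable borel"
  using continuous_pt by (rule borel_measurable_continuous_onI)

lemma nn_integral_pt:
  assumes "F \<in> borel_measurable borel"
  shows "(\<integral>\<^sup>+z. F z \<partial>lborel) = (\<integral>\<^sup>+r. \<integral>\<^sup>+t. F (pt b r t) \<partial>lborel \<partial>lborel)"
proof -
  have m: "(\<lambda>p. F (case p of (r, t) \<Rightarrow> pt b r t)) \<in> borel_measurable (lborel \<Otimes>\<^sub>M lborel)"
    unfolding lborel_prod using measurable_compose[OF measurable_pt_pair assms, of b] by simp
  have "(\<integral>\<^sup>+z. F z \<partial>lborel) = (\<integral>\<^sup>+p. F (case p of (r, t) \<Rightarrow> pt b r t) \<partial>lborel)"
    unfolding distr_pt[of b, symmetric] using assms measurable_pt_pair by (subst nn_integral_distr) auto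
  also have "\<dots> = (\<integral>\<^sup>+r. \<integral>\<^sup>+t. F (pt b r t) \<partial>lborel \<partial>lborel)"
    unfolding lborel_prod[symmetric] using m by (subst lborel.nn_integral_fst[symmetric]) auto
  finally show ?thesis .
qed

lemma measurable_inner_pt:
  assumes "F \<in> borel_measurable borel"
  shows "(\<lambda>r. \<integral>\<^sup>+t. F (pt b r t) \<partial>lborel) \<in> borel_measurable borel"
proof -
  have m: "(\<lambda>p. F (case p of (r, t) \<Rightarrow> pt b r t)) \<in> borel_measurable (lborel \<Otimes>\<^sub>M lborel)"
    unfolding lborel_prod using measurable_compose[OF measurable_pt_pair assms, of b] by simp
  have "(\<lambda>r. \<integral>\<^sup>+t. F (case (r, t) of (r, t) \<Rightarrow> pt b r t) \<partial>lborel) \<in> borel_measurable lborel"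
    by (rule lborel.borel_measurable_nn_integral_fst[OF m])
  then show ?thesis by simp
qed

text \<open>Works with outer estimates, since sets of exceptional lines are not known to be
  measurable.\<close>

lemma AE_from_small:
  assumes "\<And>e::real. e > 0 \<Longrightarrow> \<exists>B\<in>sets lborel. N \<subseteq> B \<and> emeasure lborel B \<le> ennreal e"
  shows "AE x in lborel. x \<notin> (N :: 'a :: euclidean_space set)"
proof -
  have "\<forall>n::nat. \<exists>B\<in>sets lborel. N \<subseteq> B \<and> emeasure lborel B \<le> ennreal (1 / real (Suc n))"
    using assms by simp
  then obtain B where B: "\<And>n. B n \<in> sets lborel" "\<And>n. N \<subseteq> B n" "\<And>n. emeasure lborel (B n) \<le> ennreal (1 / real (Suc n))"
    by metis
  have "emeasure lborel (\<Inter>n. B n) \<le> 0 + ennreal e" if "e > 0" for e :: real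
  proof -
    obtain n where n: "1 / real (Suc n) < e" using \<open>e > 0\<close> nat_approx_posE by blast
    have "emeasure lborel (\<Inter>n. B n) \<le> emeasure lborel (B n)" using B by (intro emeasure_mono) auto
    also have "\<dots> \<le> ennreal (1 / real (Suc n))" by fact
    also have "\<dots> \<le> ennreal e" using n by (intro ennreal_leI) simp
    finally show ?thesis by simp
  qed
  then have "emeasure lborel (\<Inter>n. B n) \<le> 0" by (rule ennreal_le_epsilon)
  then have "(\<Inter>n. B n) \<in> null_sets lborel" using B by auto
  then show ?thesis using B by (intro AE_I'[of "\<Inter>n. B n"]) auto
qed

context rel_carpet
begin

abbreviation "dm i \<equiv> diameter (Q i)"

lemma dm_pos: "0 < dm i"
proof -
  obtain z where z: "z \<in> Q i" using ne_Q by blast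
  then obtain e where e: "e > 0" "ball z e \<subseteq> Q i" using open_Q open_contains_ball by blast
  have "z + of_real (e/2) \<in> ball z e" using e by (simp add: dist_norm)
  then have "dist z (z + of_real (e/2)) \<le> dm i" using z e bdd_Q by (intro diameter_bounded_bound) auto
  then show ?thesis using e by (simp add: dist_norm)
qed

lemma dm_bound: "z \<in> Q i \<Longrightarrow> w \<in> Q i \<Longrightarrow> dist z w \<le> dm i"
  using bdd_Q by (rule diameter_bounded_bound)

text \<open>By the lower area bound each disk meeting the ball fills a fixed proportion of a ball of
  radius comparable to \<open>min (dm i) R\<close>, and these portions are disjoint subsets of a
  square of side \<open>4 * R\<close>. With plain diameters the bound would fail for large disks
  that merely touch the ball.\<close>

lemma area_bound:
  obtains C where "C > 0"
    "\<And>z R. R > 0 \<Longrightarrow> psum (\<lambda>i. ennreal ((min (dm i) R)\<^sup>2)) (hit (ball z R)) \<le> ennreal (C * R\<^sup>2)"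
proof -
  obtain K where K: "K > 0" "\<And>i x r. x \<in> Q i \<Longrightarrow> 0 < r \<Longrightarrow> r < dm i \<Longrightarrow>
      ennreal (K * r\<^sup>2) \<le> emeasure lborel (ball x r \<inter> Q i)"
    using car unfolding relative_sierpinski_carpet_def by blast
  have main: "psum (\<lambda>i. ennreal ((min (dm i) R)\<^sup>2)) (hit (ball z R)) \<le> ennreal (64 / K * R\<^sup>2)" if R: "R > 0" for z R
  proof -
    define I where "I = hit (ball z R)"
    have "\<forall>i\<in>I. \<exists>y. y \<in> Q i \<and> y \<in> ball z R" by (auto simp: I_def disks_meeting_def)
    then obtain y where y: "\<And>i. i \<in> I \<Longrightarrow> y i \<in> Q i \<and> y i \<in> ball z R" by metis
    \<comment> \<open>Half of the minimum, to be strictly below the diameter as the area condition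
      requires.\<close>
    define r where "r i = min (dm i) R / 2" for i
    have r: "0 < r i" "r i < dm i" "r i < R" for i using dm_pos[of i] R by (auto simp: r_def min_def)
    define B where "B i = (if i \<in> I then ball (y i) (r i) \<inter> Q i else {})" for i
    have B: "B i \<in> sets borel" for i unfolding B_def using open_Q by auto
    have disj: "disjoint_family B"
      unfolding disjoint_family_on_def B_def using cl_disj closure_subset by (auto; blast)
    have sub: "B i \<subseteq> cbox (z - Complex (2*R) (2*R)) (z + Complex (2*R) (2*R))" for i
    proof
      fix w assume w: "w \<in> B i"
      then have i: "i \<in> I" "w \<in> ball (y i) (r i)" by (auto simp: B_def split: if_splits)
      have "dist z w \<le> dist z (y i) + dist (y i) w" by (rule dist_triangle)
      also have "\<dots> < R + R" using y[OF i(1)] i(2) r[of i] by (intro add_strict_mono) auto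
      finally have "cmod (w - z) < 2 * R" by (simp add: dist_norm norm_minus_commute)
      then have "\<bar>Re w - Re z\<bar> \<le> 2 * R" "\<bar>Im w - Im z\<bar> \<le> 2 * R"
        using abs_Re_le_cmod[of "w - z"] abs_Im_le_cmod[of "w - z"] by auto
      then show "w \<in> cbox (z - Complex (2*R) (2*R)) (z + Complex (2*R) (2*R))"
        by (auto simp: cbox_def Basis_complex_def inner_complex_def abs_le_iff)
    qed
    have "ennreal (K / 4) * psum (\<lambda>i. ennreal ((min (dm i) R)\<^sup>2)) I = psum (\<lambda>i. ennreal (K * (r i)\<^sup>2)) I"
      unfolding psum_cmult[symmetric]
      by (rule arg_cong[where f = "\<lambda>\<rho>. psum \<rho> I"], rule ext)
         (use K in \<open>simp add: r_def power_divide ennreal_mult[symmetric]\<close>)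
    also have "\<dots> \<le> (\<Sum>i. emeasure lborel (B i))"
      unfolding psum_def using y K r by (intro suminf_le) (auto simp: B_def)
    also have "\<dots> = emeasure lborel (\<Union>i. B i)"
      using B disj by (intro suminf_emeasure) auto
    also have "\<dots> \<le> emeasure lborel (cbox (z - Complex (2*R) (2*R)) (z + Complex (2*R) (2*R)))"
      using sub by (intro emeasure_mono) auto
    also have "\<dots> = ennreal (16 * R\<^sup>2)"
      using R by (subst emeasure_lborel_cbox_eq) (auto simp: Basis_complex_def inner_complex_def power2_eq_square)
    finally have *: "ennreal (K / 4) * psum (\<lambda>i. ennreal ((min (dm i) R)\<^sup>2)) I \<le> ennreal (16 * R\<^sup>2)" .
    have "psum (\<lambda>i. ennreal ((min (dm i) R)\<^sup>2)) I = ennreal (4 / K) * (ennreal (K / 4) * psum (\<lambda>i. ennreal ((min (dm i) R)\<^sup>2)) I)"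
      using K by (simp add: mult.assoc[symmetric] ennreal_mult[symmetric])
    also have "\<dots> \<le> ennreal (4 / K) * ennreal (16 * R\<^sup>2)" by (intro mult_left_mono *) auto
    also have "\<dots> = ennreal (64 / K * R\<^sup>2)" using K by (simp add: ennreal_mult[symmetric])
    finally show ?thesis by (simp add: I_def)
  qed
  show ?thesis using K main by (intro that[of "64 / K"]) auto
qed

lemma finite_big:
  assumes "e > 0"
  shows "finite {i \<in> hit (ball z R). e \<le> dm i}"
proof (cases "R > 0")
  case True
  obtain C where C: "C > 0" "\<And>z R. R > 0 \<Longrightarrow> psum (\<lambda>i. ennreal ((min (dm i) R)\<^sup>2)) (hit (ball z R)) \<le> ennreal (C * R\<^sup>2)"
    using area_bound by blast
  have "finite {i \<in> hit (ball z R). ennreal ((min e R)\<^sup>2) \<le> ennreal ((min (dm i) R)\<^sup>2)}"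
    using C(2)[OF True, of z] True assms by (intro psum_finite_ge) (auto simp: order_le_less_trans)
  moreover have "{i \<in> hit (ball z R). e \<le> dm i} \<subseteq> {i \<in> hit (ball z R). ennreal ((min e R)\<^sup>2) \<le> ennreal ((min (dm i) R)\<^sup>2)}"
    using True assms by (auto intro!: ennreal_leI power_mono)
  ultimately show ?thesis by (rule rev_finite_subset)
next
  case False
  then have e: "ball z R = {}" by simp
  have "hit (ball z R) = {}" unfolding e disks_meeting_def by simp
  then show ?thesis by simp
qed

lemma dm_sq_sum: "psum (\<lambda>i. ennreal ((dm i)\<^sup>2)) (hit (ball z R)) < \<infinity>"
proof (cases "R > 0")
  case True
  obtain C where C: "C > 0" "\<And>z R. R > 0 \<Longrightarrow> psum (\<lambda>i. ennreal ((min (dm i) R)\<^sup>2)) (hit (ball z R)) \<le> ennreal (C * R\<^sup>2)"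
    using area_bound by blast
  define I where "I = hit (ball z R)"
  define F where "F = {i\<in>I. R \<le> dm i}"
  have F: "finite F" using finite_big[OF True, of z R] by (simp add: F_def I_def)
  have "psum (\<lambda>i. ennreal ((dm i)\<^sup>2)) I \<le> psum (\<lambda>i. ennreal ((dm i)\<^sup>2)) (F \<union> (I - F))"
    by (rule psum_mono_set) auto
  also have "\<dots> \<le> psum (\<lambda>i. ennreal ((dm i)\<^sup>2)) F + psum (\<lambda>i. ennreal ((dm i)\<^sup>2)) (I - F)"
    by (rule psum_Un_le)
  also have "\<dots> \<le> (\<Sum>i\<in>F. ennreal ((dm i)\<^sup>2)) + psum (\<lambda>i. ennreal ((min (dm i) R)\<^sup>2)) I"
    using F by (intro add_mono psum_mono) (auto simp: psum_finite F_def)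
  also have "\<dots> \<le> (\<Sum>i\<in>F. ennreal ((dm i)\<^sup>2)) + ennreal (C * R\<^sup>2)"
    using C(2)[OF True] by (intro add_mono) (auto simp: I_def)
  also have "\<dots> < \<infinity>" using F by (simp add: sum_ennreal)
  finally show ?thesis by (simp add: I_def)
next
  case False
  then have e: "ball z R = {}" by simp
  have "hit (ball z R) = {}" unfolding e disks_meeting_def by simp
  then show ?thesis by (simp add: psum_finite)
qed

text \<open>Only finitely many disks near \<open>x\<close> are not small, and those whose closure
  misses \<open>x\<close> keep a positive distance from it.\<close>

lemma small_near:
  assumes "e > 0"
  shows "\<exists>\<delta>>0. \<forall>i\<in>hit (ball x \<delta>). x \<notin> closure (Q i) \<longrightarrow> Q i \<subseteq> ball x e"
proof -
  define F where "F = {i \<in> hit (ball x 1). e/2 \<le> dm i \<and> x \<notin> closure (Q i)}"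
  have F: "finite F" by (rule finite_subset[OF _ finite_big[of "e/2" x 1]]) (use assms in \<open>auto simp: F_def\<close>)
  have "closed (\<Union>i\<in>F. closure (Q i))" using F by (intro closed_UN) auto
  then have "open (- (\<Union>i\<in>F. closure (Q i)))" by (rule open_Compl)
  moreover have "x \<in> - (\<Union>i\<in>F. closure (Q i))" by (auto simp: F_def)
  ultimately obtain d where d: "d > 0" "ball x d \<subseteq> - (\<Union>i\<in>F. closure (Q i))" using open_contains_ball by blast
  define \<delta> where "\<delta> = min (min d 1) (e/2)"
  have "\<delta> > 0" using d assms by (simp add: \<delta>_def)
  moreover have "Q i \<subseteq> ball x e" if i: "i \<in> hit (ball x \<delta>)" "x \<notin> closure (Q i)" for i
  proof -
    obtain y where y: "y \<in> Q i" "dist x y < \<delta>" using i by (auto simp: disks_meeting_def)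
    have "y \<notin> closure (Q i)" if "i \<in> F" using d y that by (auto simp: \<delta>_def subset_iff)
    then have "i \<notin> F" using y closure_subset by blast
    moreover have "i \<in> hit (ball x 1)" using y by (auto simp: disks_meeting_def \<delta>_def)
    ultimately have "dm i < e/2" using i by (auto simp: F_def)
    show ?thesis
    proof
      fix w assume "w \<in> Q i"
      then have "dist y w \<le> dm i" using y dm_bound by blast
      then have "dist x w < \<delta> + e/2" using y \<open>dm i < e/2\<close> dist_triangle[of x w y] by linarith
      then show "w \<in> ball x e" by (simp add: \<delta>_def)
    qed
  qed
  ultimately show ?thesis by blast
qed

end

section \<open>Hausdorff measure and line integrals on axis-parallel lines\<close>

lemma dist_pt: "dist (pt b r s) (pt b r t) = \<bar>s - t\<bar>"
  by (auto simp: pt_def dist_norm cmod_def)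

lemma dist_pt_cross: "\<bar>r - r'\<bar> \<le> dist (pt b r s) (pt b r' t)"
  using abs_Re_le_cmod[of "pt b r s - pt b r' t"] abs_Im_le_cmod[of "pt b r s - pt b r' t"]
  by (auto simp: pt_def dist_norm split: if_splits)

lemma dist_pt_le: "dist (pt b r s) (pt b r' t) \<le> \<bar>r - r'\<bar> + \<bar>s - t\<bar>"
  using cmod_le[of "pt b r s - pt b r' t"] by (auto simp: pt_def dist_norm)

text \<open>Outer regularity encloses \<open>N\<close> in an open set of small length, and the
  covering lemma covers \<open>N\<close> by countably many non-overlapping intervals inside that
  set, so that their lengths add up to no more.\<close>

lemma hausdorff1_null_line:
  assumes N: "N \<in> sets lborel" "emeasure lborel N = 0" "N \<subseteq> {p..q}"
  shows "hausdorff1 (pt b r ` N) = 0"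
proof -
  have *: "(INF U\<in>{U :: nat \<Rightarrow> complex set. pt b r ` N \<subseteq> (\<Union>n. U n) \<and> (\<forall>n. bounded (U n) \<and> diameter (U n) \<le> \<delta>)}.
        \<Sum>n. ennreal (diameter (U n))) \<le> 0 + ennreal e" if "\<delta> > 0" "e > 0" for \<delta> e :: real
  proof -
    have "N \<in> sets lebesgue" using N(1) by simp
    then obtain G where G: "open G" "N \<subseteq> G" "G - N \<in> lmeasurable" "emeasure lebesgue (G - N) < ennreal e"
      using sets_lebesgue_outer_open[OF _ \<open>e > 0\<close>] by blast
    have "emeasure lborel G \<le> emeasure lborel (G - N) + emeasure lborel N"
    proof -
      have "G = (G - N) \<union> N" using G(2) by blast
      then show ?thesis using N G(1) by (metis emeasure_subadditive sets.Diff borel_open sets_lborel)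
    qed
    moreover have "emeasure lborel (G - N) = emeasure lebesgue (G - N)"
      using N G(1) by (simp add: emeasure_completion main_part_sets)
    ultimately have Ge: "emeasure lborel G \<le> ennreal e" using G(4) N(2) by simp
    \<comment> \<open>The gauge keeps every covering interval inside \<open>G\<close> and no longer
      than \<open>\<delta>\<close>. Off \<open>G\<close> any ball will do, as the tags lie in
      \<open>N\<close>.\<close>
    define g where "g x = (if x \<in> G then ball x (\<delta>/2) \<inter> G else ball x 1)" for x
    have "gauge g" unfolding g_def gauge_def using \<open>\<delta> > 0\<close> G(1) by auto
    have "\<exists>\<D>. countable \<D> \<and> (\<forall>K\<in>\<D>. \<exists>c d. K = cbox c d) \<and>
        pairwise (\<lambda>A B. interior A \<inter> interior B = {}) \<D> \<and> (\<forall>K\<in>\<D>. \<exists>x\<in>N \<inter> K. K \<subseteq> g x) \<and> N \<subseteq> \<Union>\<D>"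
    proof (cases "N = {}")
      case True
      then show ?thesis by (intro exI[of _ "{}"]) simp
    next
      case False
      then have "p \<le> q" using N(3) by force
      then have b: "N \<subseteq> cbox (p - 1) (q + 1)" "box (p - 1) (q + 1) \<noteq> {}" using N(3) by auto
      show ?thesis
      proof (rule covering_lemma[OF b \<open>gauge g\<close>])
        fix \<D>
        assume "countable \<D>" "\<And>K. K \<in> \<D> \<Longrightarrow> interior K \<noteq> {} \<and> (\<exists>c d. K = cbox c d)"
          "pairwise (\<lambda>A B. interior A \<inter> interior B = {}) \<D>" "\<And>K. K \<in> \<D> \<Longrightarrow> \<exists>x\<in>N \<inter> K. K \<subseteq> g x" "N \<subseteq> \<Union>\<D>"
        then show ?thesis by (intro exI[of _ \<D>]) simp
      qed
    qed
    then obtain \<D> where D: "countable \<D>" "\<forall>K\<in>\<D>. \<exists>c d. K = cbox c d"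
        "pairwise (\<lambda>A B. interior A \<inter> interior B = {}) \<D>" "\<forall>K\<in>\<D>. \<exists>x\<in>N \<inter> K. K \<subseteq> g x" "N \<subseteq> \<Union>\<D>"
      by (elim exE conjE)
    have Dg: "K \<subseteq> G \<and> (\<exists>x. K \<subseteq> ball x (\<delta>/2))" if "K \<in> \<D>" for K
    proof -
      obtain x where "x \<in> N" "K \<subseteq> g x" using D(4) \<open>K \<in> \<D>\<close> by blast
      then show ?thesis using G(2) by (auto simp: g_def split: if_splits)
    qed
    define V where "V n = (if n \<in> to_nat_on \<D> ` \<D> then from_nat_into \<D> n else {})" for n
    have V: "V n = {} \<or> V n \<in> \<D>" for n
      using D(1) by (auto simp: V_def)
    have cover: "N \<subseteq> (\<Union>n. V n)"
    proof
      fix x assume "x \<in> N"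
      then obtain K where K: "K \<in> \<D>" "x \<in> K" using D(5) by blast
      then have "V (to_nat_on \<D> K) = K" using D(1) by (auto simp: V_def)
      then show "x \<in> (\<Union>n. V n)" using K by blast
    qed
    have dis: "disjoint_family (\<lambda>n. interior (V n))"
      unfolding disjoint_family_on_def
    proof (intro ballI impI)
      fix m n :: nat assume "m \<noteq> n"
      show "interior (V m) \<inter> interior (V n) = {}"
      proof (cases "m \<in> to_nat_on \<D> ` \<D> \<and> n \<in> to_nat_on \<D> ` \<D>")
        case True
        then obtain K L where KL: "K \<in> \<D>" "L \<in> \<D>" "m = to_nat_on \<D> K" "n = to_nat_on \<D> L" by blast
        then have "V m = K" "V n = L" "K \<noteq> L" using D(1) \<open>m \<noteq> n\<close> by (auto simp: V_def)
        then show ?thesis using D(3) KL by (auto simp: pairwise_def)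
      next
        case False
        then show ?thesis by (auto simp: V_def)
      qed
    qed
    have dm: "ennreal (diameter (pt b r ` V n)) \<le> emeasure lborel (interior (V n)) \<and>
        diameter (pt b r ` V n) \<le> \<delta> \<and> bounded (pt b r ` V n)" for n
    proof (cases "V n = {}")
      case True
      then show ?thesis using \<open>\<delta> > 0\<close> by simp
    next
      case False
      then have Vn: "V n \<in> \<D>" using V by blast
      then obtain c d where cd: "V n = cbox c d" using D(2) by blast
      then have "c \<le> d" using False by auto
      obtain x where x: "V n \<subseteq> ball x (\<delta>/2)" using Dg[OF Vn] by blast
      have 1: "diameter (pt b r ` V n) \<le> d - c"
        using \<open>c \<le> d\<close> cd by (intro diameter_le) (auto simp: dist_pt[unfolded dist_norm])
      have "d - c \<le> \<delta>"
      proof -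
        have "c \<in> ball x (\<delta>/2)" "d \<in> ball x (\<delta>/2)" using x cd \<open>c \<le> d\<close> by auto
        then have "\<bar>x - c\<bar> < \<delta>/2" "\<bar>x - d\<bar> < \<delta>/2" unfolding mem_ball dist_real_def by blast+
        then show ?thesis by linarith
      qed
      moreover have "bounded (pt b r ` V n)"
        unfolding cd by (intro compact_imp_bounded compact_continuous_image continuous_pt) auto
      moreover have "ennreal (d - c) = emeasure lborel (interior (V n))"
        using cd \<open>c \<le> d\<close> by simp
      ultimately show ?thesis using 1 by (metis ennreal_leI order_trans)
    qed
    have "(INF U\<in>{U :: nat \<Rightarrow> complex set. pt b r ` N \<subseteq> (\<Union>n. U n) \<and> (\<forall>n. bounded (U n) \<and> diameter (U n) \<le> \<delta>)}.
        \<Sum>n. ennreal (diameter (U n))) \<le> (\<Sum>n. ennreal (diameter (pt b r ` V n)))"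
    proof (rule INF_lower)
      have "pt b r ` N \<subseteq> (\<Union>n. pt b r ` V n)" using cover by blast
      then show "(\<lambda>n. pt b r ` V n) \<in> {U. pt b r ` N \<subseteq> (\<Union>n. U n) \<and> (\<forall>n. bounded (U n) \<and> diameter (U n) \<le> \<delta>)}"
        using dm by simp
    qed
    also have "\<dots> \<le> (\<Sum>n. emeasure lborel (interior (V n)))"
      using dm by (intro suminf_le) auto
    also have "\<dots> = emeasure lborel (\<Union>n. interior (V n))"
      using dis by (intro suminf_emeasure) auto
    also have "\<dots> \<le> emeasure lborel G"
    proof (rule emeasure_mono)
      have "interior (V n) \<subseteq> G" for n using V[of n] Dg[of "V n"] interior_subset by auto
      then show "(\<Union>n. interior (V n)) \<subseteq> G" by blast
    qed (use G in auto)
    finally show ?thesis using Ge by simp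
  qed
  have "(INF U\<in>{U :: nat \<Rightarrow> complex set. pt b r ` N \<subseteq> (\<Union>n. U n) \<and> (\<forall>n. bounded (U n) \<and> diameter (U n) \<le> \<delta>)}.
        \<Sum>n. ennreal (diameter (U n))) \<le> 0" if "\<delta> > 0" for \<delta>
    by (rule ennreal_le_epsilon, rule *[OF that])
  then have "hausdorff1 (pt b r ` N) \<le> 0"
    unfolding hausdorff1_def by (intro SUP_least) auto
  then show ?thesis by simp
qed

text \<open>A covering of \<open>A\<close> turns into a covering of its image by intervals of no
  larger diameter. Applied to the coordinate along a line and to the maximum-norm distance from
  \<open>x\<close>: almost every point of a generic line is off the carpet, and on almost every
  square so is every point of a good path.\<close>

lemma hausdorff1_null_lipschitz:
  assumes A: "hausdorff1 A = 0" and lip: "\<And>z w. \<bar>\<phi> z - \<phi> w\<bar> \<le> dist z w"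
  shows "AE s in lborel. s \<notin> \<phi> ` A"
proof (rule AE_from_small)
  fix e :: real assume "e > 0"
  have "(INF U\<in>{U :: nat \<Rightarrow> complex set. A \<subseteq> (\<Union>n. U n) \<and> (\<forall>n. bounded (U n) \<and> diameter (U n) \<le> 1)}.
        \<Sum>n. ennreal (diameter (U n))) \<le> hausdorff1 A"
    unfolding hausdorff1_def by (rule SUP_upper2[of 1]) auto
  then have "(INF U\<in>{U :: nat \<Rightarrow> complex set. A \<subseteq> (\<Union>n. U n) \<and> (\<forall>n. bounded (U n) \<and> diameter (U n) \<le> 1)}.
        \<Sum>n. ennreal (diameter (U n))) < ennreal e" using A \<open>e > 0\<close> by simp
  then obtain U :: "nat \<Rightarrow> complex set" where U: "A \<subseteq> (\<Union>n. U n)" "\<And>n. bounded (U n)"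
      "(\<Sum>n. ennreal (diameter (U n))) < ennreal e"
    unfolding INF_less_iff by blast
  define B where "B n = (if U n = {} then {} else {Inf (\<phi> ` U n)..Sup (\<phi> ` U n)})" for n
  have B: "\<phi> ` U n \<subseteq> B n \<and> emeasure lborel (B n) \<le> ennreal (diameter (U n)) \<and> B n \<in> sets borel" for n
  proof (cases "U n = {}")
    case True
    then show ?thesis by (simp add: B_def)
  next
    case False
    have le: "\<bar>\<phi> z - \<phi> w\<bar> \<le> diameter (U n)" if "z \<in> U n" "w \<in> U n" for z w
      using lip[of z w] diameter_bounded_bound[OF U(2) that] by linarith
    obtain z where z: "z \<in> U n" using False by blast
    have bd: "bdd_above (\<phi> ` U n)" "bdd_below (\<phi> ` U n)"
      using le[OF z] by (auto intro!: bdd_aboveI[of _ "\<phi> z + diameter (U n)"] bdd_belowI[of _ "\<phi> z - diameter (U n)"]) (smt (verit))+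
    have "Sup (\<phi> ` U n) \<le> Inf (\<phi> ` U n) + diameter (U n)"
    proof (rule cSup_least)
      fix y assume "y \<in> \<phi> ` U n"
      then obtain w where w: "w \<in> U n" "y = \<phi> w" by blast
      have "y - diameter (U n) \<le> Inf (\<phi> ` U n)"
        using le[OF w(1)] w False by (intro cInf_greatest) (auto, smt (verit))
      then show "y \<le> Inf (\<phi> ` U n) + diameter (U n)" by simp
    qed (use False in auto)
    moreover have "Inf (\<phi> ` U n) \<le> Sup (\<phi> ` U n)"
      using z bd by (meson cInf_lower cSup_upper imageI order_trans)
    ultimately have "emeasure lborel (B n) \<le> ennreal (diameter (U n))"
      using False by (auto simp: B_def intro!: ennreal_leI)
    moreover have "\<phi> ` U n \<subseteq> B n"
      using bd False by (auto simp: B_def intro!: cInf_lower cSup_upper imageI)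
    moreover have "B n \<in> sets borel" by (simp add: B_def)
    ultimately show ?thesis by blast
  qed
  have "emeasure lborel (\<Union>n. B n) \<le> (\<Sum>n. emeasure lborel (B n))"
    using B by (intro emeasure_subadditive_countably) auto
  also have "\<dots> \<le> (\<Sum>n. ennreal (diameter (U n)))" using B by (intro suminf_le) auto
  also have "\<dots> \<le> ennreal e" using U(3) by simp
  finally show "\<exists>B\<in>sets lborel. \<phi> ` A \<subseteq> B \<and> emeasure lborel B \<le> ennreal e"
    using B U(1) by (intro bexI[of _ "\<Union>n. B n"]) (auto, blast)
qed

lemma curve_length_pt:
  assumes "a \<le> c"
  shows "curve_length (pt b r) a c = ennreal (c - a)"
proof (rule antisym)
  have tele: "(\<Sum>k<length ts - 1. dist (pt b r (ts ! k)) (pt b r (ts ! Suc k))) \<le> c - a"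
    if "sorted ts" "set ts \<subseteq> {a..c}" for ts
  proof (cases "ts = []")
    case True
    then show ?thesis using assms by simp
  next
    case False
    have "(\<Sum>k<length ts - 1. dist (pt b r (ts ! k)) (pt b r (ts ! Suc k))) = (\<Sum>k<length ts - 1. ts ! Suc k - ts ! k)"
    proof (rule sum.cong)
      fix k assume "k \<in> {..<length ts - 1}"
      then have "ts ! k \<le> ts ! Suc k" using that(1) by (intro sorted_nth_mono) auto
      then show "dist (pt b r (ts ! k)) (pt b r (ts ! Suc k)) = ts ! Suc k - ts ! k" by (simp add: dist_pt)
    qed simp
    also have "\<dots> = ts ! (length ts - 1) - ts ! 0" by (rule sum_lessThan_telescope)
    also have "\<dots> \<le> c - a"
    proof -
      have "ts ! (length ts - 1) \<in> set ts" "ts ! 0 \<in> set ts" using False by auto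
      then have "ts ! (length ts - 1) \<in> {a..c}" "ts ! 0 \<in> {a..c}" using that(2) by blast+
      then show ?thesis by auto
    qed
    finally show ?thesis .
  qed
  show "curve_length (pt b r) a c \<le> ennreal (c - a)"
    unfolding curve_length_def
    by (rule SUP_least) (use tele in \<open>auto simp: sum_ennreal intro!: ennreal_leI\<close>)
  have "ennreal (c - a) = (\<Sum>k<length [a, c] - 1. ennreal (dist (pt b r ([a, c] ! k)) (pt b r ([a, c] ! Suc k))))"
    using assms by (simp add: dist_pt)
  also have "\<dots> \<le> curve_length (pt b r) a c"
    unfolding curve_length_def by (rule SUP_upper) (use assms in auto)
  finally show "ennreal (c - a) \<le> curve_length (pt b r) a c" .
qed

lemma line_integral_pt:
  assumes w: "w \<in> borel_measurable borel" and "p \<le> q"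
  shows "line_integral w ({p..q}, pt b r) \<le> (\<integral>\<^sup>+t\<in>{p..q}. w (pt b r t) \<partial>lborel)"
proof -
  have rect: "locally_rectifiable ({p..q}, pt b r)"
    by (auto simp: locally_rectifiable_def curve_length_pt)
  have "(\<integral>\<^sup>+s\<in>{0..enn2real (curve_length (pt b r) a c)}. w (arclength_param (pt b r) a c s) \<partial>lborel)
      \<le> (\<integral>\<^sup>+t\<in>{p..q}. w (pt b r t) \<partial>lborel)" if ac: "p \<le> a" "a \<le> c" "c \<le> q" for a c
  proof -
    have al: "arclength_param (pt b r) a c s = pt b r (a + s)" if s: "s \<in> {0..c - a}" for s
    proof -
      have "(SOME t. t \<in> {a..c} \<and> curve_length (pt b r) a t = ennreal s) = a + s"
      proof (rule some_equality)
        show "a + s \<in> {a..c} \<and> curve_length (pt b r) a (a + s) = ennreal s"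
          using s by (auto simp: curve_length_pt)
        fix t assume "t \<in> {a..c} \<and> curve_length (pt b r) a t = ennreal s"
        then show "t = a + s" using s by (auto simp: curve_length_pt)
      qed
      then show ?thesis by (simp add: arclength_param_def)
    qed
    have "(\<integral>\<^sup>+s\<in>{0..enn2real (curve_length (pt b r) a c)}. w (arclength_param (pt b r) a c s) \<partial>lborel)
        = (\<integral>\<^sup>+s. w (pt b r (a + s)) * indicator {a..c} (a + s) \<partial>lborel)"
      using ac al by (intro nn_integral_cong) (auto simp: curve_length_pt indicator_def)
    also have "\<dots> = (\<integral>\<^sup>+t. w (pt b r t) * indicator {a..c} t \<partial>lborel)"
      using measurable_compose[OF measurable_pt w, of b r]
      by (subst nn_integral_real_affine[of _ 1 a]) auto
    also have "\<dots> \<le> (\<integral>\<^sup>+t\<in>{p..q}. w (pt b r t) \<partial>lborel)"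
      using ac by (intro nn_integral_mono) (auto simp: indicator_def)
    finally show ?thesis .
  qed
  then show ?thesis
    unfolding line_integral_def using rect by (auto intro!: SUP_least)
qed

section \<open>Almost every axis-parallel line is unexceptional\<close>

definition rect :: "bool \<Rightarrow> real \<Rightarrow> real \<Rightarrow> real \<Rightarrow> real \<Rightarrow> complex set" where
  "rect b r0 r1 t0 t1 = (\<Union>r\<in>{r0..r1}. pt b r ` {t0..t1})"

lemma rect_bounded: "\<exists>R. rect b r0 r1 t0 t1 \<subseteq> ball 0 R"
proof -
  have "z \<in> ball 0 (\<bar>r0\<bar> + \<bar>r1\<bar> + \<bar>t0\<bar> + \<bar>t1\<bar> + 1)" if z: "z \<in> rect b r0 r1 t0 t1" for z
  proof -
    obtain r t where rt: "r \<in> {r0..r1}" "t \<in> {t0..t1}" "z = pt b r t" using z unfolding rect_def by blast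
    have "pt b 0 0 = 0" by (simp add: pt_def complex_eq_iff)
    then have "dist 0 z \<le> \<bar>r\<bar> + \<bar>t\<bar>" using dist_pt_le[of b 0 0 r t] rt by simp
    also have "\<dots> < \<bar>r0\<bar> + \<bar>r1\<bar> + \<bar>t0\<bar> + \<bar>t1\<bar> + 1" using rt by auto
    finally show ?thesis by simp
  qed
  then show ?thesis by blast
qed

context rel_carpet
begin

text \<open>Every segment in the open set \<open>\<Omega>\<close> lies in a rectangle in
  \<open>\<Omega>\<close> with rational corners, and there are countably many of these; so
  exceptional lines may be estimated in one rectangle at a time.\<close>

lemma AE_lines:
  assumes "\<And>r0 r1 t0 t1. r0 < r1 \<Longrightarrow> t0 < t1 \<Longrightarrow> rect b r0 r1 t0 t1 \<subseteq> \<Omega> \<Longrightarrow>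
     AE r in lborel. r \<in> {r0..r1} \<longrightarrow> (\<forall>p q. t0 \<le> p \<and> p \<le> q \<and> q \<le> t1 \<longrightarrow> P r p q)"
  shows "AE r in lborel. \<forall>p q. p \<le> q \<and> pt b r ` {p..q} \<subseteq> \<Omega> \<longrightarrow> P r p q"
proof -
  have "AE r in lborel. \<forall>x\<in>\<rat> \<times> \<rat> \<times> \<rat> \<times> \<rat>. case x of (r0, r1, t0, t1) \<Rightarrow>
      r0 < r1 \<and> t0 < t1 \<and> rect b r0 r1 t0 t1 \<subseteq> \<Omega> \<longrightarrow> r \<in> {r0..r1} \<longrightarrow> (\<forall>p q. t0 \<le> p \<and> p \<le> q \<and> q \<le> t1 \<longrightarrow> P r p q)"
  proof (rule AE_ball_countable[THEN iffD2])
    show "countable (\<rat> \<times> \<rat> \<times> \<rat> \<times> \<rat> :: (real \<times> real \<times> real \<times> real) set)"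
      by (intro countable_SIGMA countable_rat)
    show "\<forall>x\<in>\<rat> \<times> \<rat> \<times> \<rat> \<times> \<rat>. AE r in lborel. case x of (r0, r1, t0, t1) \<Rightarrow>
      r0 < r1 \<and> t0 < t1 \<and> rect b r0 r1 t0 t1 \<subseteq> \<Omega> \<longrightarrow> r \<in> {r0..r1} \<longrightarrow> (\<forall>p q. t0 \<le> p \<and> p \<le> q \<and> q \<le> t1 \<longrightarrow> P r p q)"
    proof safe
      fix r0 r1 t0 t1 :: real
      show "AE r in lborel. r0 < r1 \<and> t0 < t1 \<and> rect b r0 r1 t0 t1 \<subseteq> \<Omega> \<longrightarrow> r \<in> {r0..r1} \<longrightarrow> (\<forall>p q. t0 \<le> p \<and> p \<le> q \<and> q \<le> t1 \<longrightarrow> P r p q)"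
        using assms[of r0 r1 t0 t1] by (cases "r0 < r1 \<and> t0 < t1 \<and> rect b r0 r1 t0 t1 \<subseteq> \<Omega>") auto
    qed
  qed
  then show ?thesis
  proof (rule eventually_mono)
    fix r assume H: "\<forall>x\<in>\<rat> \<times> \<rat> \<times> \<rat> \<times> \<rat>. case x of (r0, r1, t0, t1) \<Rightarrow>
      r0 < r1 \<and> t0 < t1 \<and> rect b r0 r1 t0 t1 \<subseteq> \<Omega> \<longrightarrow> r \<in> {r0..r1} \<longrightarrow> (\<forall>p q. t0 \<le> p \<and> p \<le> q \<and> q \<le> t1 \<longrightarrow> P r p q)"
    show "\<forall>p q. p \<le> q \<and> pt b r ` {p..q} \<subseteq> \<Omega> \<longrightarrow> P r p q"
    proof (intro allI impI)
      fix p q assume pq: "p \<le> q \<and> pt b r ` {p..q} \<subseteq> \<Omega>"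
      have "compact (pt b r ` {p..q})" by (intro compact_continuous_image continuous_pt) auto
      then obtain e where e: "e > 0" "(\<Union>x\<in>pt b r ` {p..q}. ball x e) \<subseteq> \<Omega>"
        using compact_subset_open_imp_ball_epsilon_subset[of "pt b r ` {p..q}" \<Omega>] open_Om pq by metis
      obtain r0 where r0: "r0 \<in> \<rat>" "r - e/2 < r0" "r0 < r" using Rats_dense_in_real[of "r - e/2" r] e by auto
      obtain r1 where r1: "r1 \<in> \<rat>" "r < r1" "r1 < r + e/2" using Rats_dense_in_real[of r "r + e/2"] e by auto
      obtain t0 where t0: "t0 \<in> \<rat>" "p - e/2 < t0" "t0 < p" using Rats_dense_in_real[of "p - e/2" p] e by auto
      obtain t1 where t1: "t1 \<in> \<rat>" "q < t1" "t1 < q + e/2" using Rats_dense_in_real[of q "q + e/2"] e by auto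
      have "rect b r0 r1 t0 t1 \<subseteq> \<Omega>"
      proof
        fix z assume "z \<in> rect b r0 r1 t0 t1"
        then obtain r' t' where z: "r' \<in> {r0..r1}" "t' \<in> {t0..t1}" "z = pt b r' t'" by (auto simp: rect_def)
        define t'' where "t'' = max p (min q t')"
        have "t'' \<in> {p..q}" using pq by (auto simp: t''_def)
        moreover have "\<bar>t'' - t'\<bar> < e/2" using z t0 t1 pq by (auto simp: t''_def max_def min_def)
        moreover have "\<bar>r - r'\<bar> < e/2" using z(1) r0 r1 unfolding abs_less_iff by auto
        ultimately have "t'' \<in> {p..q}" "dist (pt b r t'') z < e"
          using dist_pt_le[of b r t'' r' t'] unfolding z(3) by auto
        then have "z \<in> (\<Union>x\<in>pt b r ` {p..q}. ball x e)" by auto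
        then show "z \<in> \<Omega>" using e(2) by blast
      qed
      then show "P r p q" using H r0 r1 t0 t1 pq by force
    qed
  qed
qed

text \<open>An interval of length \<open>dm i\<close> that contains the projection of the disk to
  the axis of line positions; easier to measure than the projection itself.\<close>

definition prj :: "bool \<Rightarrow> nat \<Rightarrow> real set" where
  "prj b i = (let \<alpha> = Inf {r. \<exists>t. pt b r t \<in> Q i} in {\<alpha>..\<alpha> + dm i})"

lemma prj_mem:
  assumes "pt b r t \<in> Q i"
  shows "r \<in> prj b i"
proof -
  define X where "X = {r. \<exists>t. pt b r t \<in> Q i}"
  have le: "\<bar>r - r'\<bar> \<le> dm i" if r': "r' \<in> X" for r'
  proof -
    obtain t' where "pt b r' t' \<in> Q i" using r' by (auto simp: X_def)
    then show ?thesis using dist_pt_cross[of r r' b t t'] dm_bound[OF assms] by fastforce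
  qed
  have X: "r \<in> X" using assms by (auto simp: X_def)
  have "bdd_below X" using le by (intro bdd_belowI[of _ "r - dm i"]) (smt (verit))
  then have "Inf X \<le> r" using X by (intro cInf_lower)
  moreover have "r - dm i \<le> Inf X" using X le by (intro cInf_greatest) (auto, smt (verit))
  ultimately show ?thesis by (simp add: prj_def X_def[symmetric] Let_def)
qed

text \<open>A measurable upper bound, as a function of the line, for the sum of
  \<open>\<rho>\<close> over the disks in \<open>I\<close> met by the line; its integral is computed
  exactly.\<close>

definition lsum :: "bool \<Rightarrow> (nat \<Rightarrow> ennreal) \<Rightarrow> nat set \<Rightarrow> real \<Rightarrow> ennreal" where
  "lsum b \<rho> I r = psum (\<lambda>i. \<rho> i * indicator (prj b i) r) I"

lemma prj_sets [measurable]: "prj b i \<in> sets borel"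
  by (simp add: prj_def Let_def)

lemma lsum_measurable: "lsum b \<rho> I \<in> borel_measurable borel"
  unfolding lsum_def psum_def by measurable

lemma lsum_integral: "(\<integral>\<^sup>+r. lsum b \<rho> I r \<partial>lborel) = psum (\<lambda>i. \<rho> i * ennreal (dm i)) I"
proof -
  have "(\<integral>\<^sup>+r. lsum b \<rho> I r \<partial>lborel) = (\<Sum>i. \<integral>\<^sup>+r. (if i \<in> I then \<rho> i * indicator (prj b i) r else 0) \<partial>lborel)"
    unfolding lsum_def psum_def by (rule nn_integral_suminf) measurable
  also have "\<dots> = psum (\<lambda>i. \<rho> i * ennreal (dm i)) I"
    unfolding psum_def
  proof (rule suminf_cong)
    fix i
    show "(\<integral>\<^sup>+r. (if i \<in> I then \<rho> i * indicator (prj b i) r else 0) \<partial>lborel) = (if i \<in> I then \<rho> i * ennreal (dm i) else 0)"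
      using dm_pos[of i] by (simp add: prj_def Let_def nn_integral_cmult_indicator)
  qed
  finally show ?thesis .
qed

lemma lsum_ge:
  assumes "hit (pt b r ` T) \<subseteq> I"
  shows "psum \<rho> (hit (pt b r ` T)) \<le> lsum b \<rho> I r"
  unfolding lsum_def
proof (rule psum_mono[OF assms])
  fix i assume "i \<in> hit (pt b r ` T)"
  then obtain t where "pt b r t \<in> Q i" by (auto simp: disks_meeting_def)
  then show "\<rho> i \<le> \<rho> i * indicator (prj b i) r" using prj_mem by simp
qed

lemma amgm:
  fixes x y \<eta> :: real
  assumes "\<eta> > 0" "0 \<le> x" "0 \<le> y"
  shows "x * y \<le> (1 / (2 * \<eta>)) * x\<^sup>2 + (\<eta> / 2) * y\<^sup>2"
proof -
  have "0 \<le> (x - \<eta> * y)\<^sup>2" by simp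
  then show ?thesis using assms by (simp add: field_simps power2_eq_square)
qed

lemma psum_amgm:
  assumes "\<eta> > 0" "\<And>i. 0 \<le> x i" "\<And>i. 0 \<le> y i"
  shows "psum (\<lambda>i. ennreal (x i) * ennreal (y i)) I \<le>
    ennreal (1 / (2 * \<eta>)) * psum (\<lambda>i. ennreal ((x i)\<^sup>2)) I + ennreal (\<eta> / 2) * psum (\<lambda>i. ennreal ((y i)\<^sup>2)) I"
  unfolding psum_cmult[symmetric] psum_add[symmetric]
proof (rule psum_mono)
  fix i
  show "ennreal (x i) * ennreal (y i) \<le> ennreal (1 / (2 * \<eta>)) * ennreal ((x i)\<^sup>2) + ennreal (\<eta> / 2) * ennreal ((y i)\<^sup>2)"
    using assms amgm[of \<eta> "x i" "y i"]
    by (simp add: ennreal_mult[symmetric] ennreal_plus[symmetric] del: ennreal_plus)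
qed simp

text \<open>Integrated over all lines, each weight is multiplied by a diameter. Squares of weights
  and of diameters are both summable, so the integral is finite and almost every line has a finite
  sum.\<close>

lemma AE_line_sum_finite:
  assumes \<rho>: "\<And>i. 0 \<le> \<rho> i" and loc: "\<And>r0 r1 t0 t1. rect b r0 r1 t0 t1 \<subseteq> \<Omega> \<Longrightarrow>
      psum (\<lambda>i. ennreal ((\<rho> i)\<^sup>2)) (hit (rect b r0 r1 t0 t1)) < \<infinity>"
  shows "AE r in lborel. \<forall>p q. p \<le> q \<and> pt b r ` {p..q} \<subseteq> \<Omega> \<longrightarrow> psum (\<lambda>i. ennreal (\<rho> i)) (hit (pt b r ` {p..q})) < \<infinity>"
proof (rule AE_lines)
  fix r0 r1 t0 t1 :: real assume sub: "rect b r0 r1 t0 t1 \<subseteq> \<Omega>"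
  define I where "I = hit (rect b r0 r1 t0 t1)"
  obtain R where "rect b r0 r1 t0 t1 \<subseteq> ball 0 R" using rect_bounded by blast
  then have "psum (\<lambda>i. ennreal ((dm i)\<^sup>2)) I < \<infinity>"
    using dm_sq_sum[of 0 R] unfolding I_def by (meson disks_meeting_mono order_le_less_trans psum_mono_set)
  moreover have "psum (\<lambda>i. ennreal ((\<rho> i)\<^sup>2)) I < \<infinity>" using loc[OF sub] by (simp add: I_def)
  ultimately have "psum (\<lambda>i. ennreal (\<rho> i) * ennreal (dm i)) I < \<infinity>"
  proof -
    have fin: "ennreal c * X < \<infinity>" if "X < \<infinity>" for c X
      using that by (simp add: ennreal_mult_less_top)
    have "psum (\<lambda>i. ennreal (\<rho> i) * ennreal (dm i)) I \<le>
        ennreal (1 / (2 * 1)) * psum (\<lambda>i. ennreal ((\<rho> i)\<^sup>2)) I + ennreal (1 / 2) * psum (\<lambda>i. ennreal ((dm i)\<^sup>2)) I"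
      using \<rho> dm_pos by (intro psum_amgm) (auto intro: less_imp_le)
    also have "\<dots> < \<infinity>"
      using fin[OF \<open>psum (\<lambda>i. ennreal ((dm i)\<^sup>2)) I < \<infinity>\<close>] fin[OF \<open>psum (\<lambda>i. ennreal ((\<rho> i)\<^sup>2)) I < \<infinity>\<close>]
      unfolding infinity_ennreal_def ennreal_add_less_top by blast
    finally show ?thesis .
  qed
  then have "(\<integral>\<^sup>+r. lsum b (\<lambda>i. ennreal (\<rho> i)) I r \<partial>lborel) \<noteq> \<infinity>" by (simp add: lsum_integral)
  then have "AE r in lborel. lsum b (\<lambda>i. ennreal (\<rho> i)) I r \<noteq> \<infinity>"
    using lsum_measurable by (intro nn_integral_PInf_AE) auto
  then show "AE r in lborel. r \<in> {r0..r1} \<longrightarrow> (\<forall>p q. t0 \<le> p \<and> p \<le> q \<and> q \<le> t1 \<longrightarrow>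
      psum (\<lambda>i. ennreal (\<rho> i)) (hit (pt b r ` {p..q})) < \<infinity>)"
  proof (rule eventually_mono, intro impI allI)
    fix r p q assume H: "lsum b (\<lambda>i. ennreal (\<rho> i)) I r \<noteq> \<infinity>" "r \<in> {r0..r1}" "t0 \<le> p \<and> p \<le> q \<and> q \<le> t1"
    have "pt b r ` {p..q} \<subseteq> rect b r0 r1 t0 t1" using H by (force simp: rect_def)
    then have "psum (\<lambda>i. ennreal (\<rho> i)) (hit (pt b r ` {p..q})) \<le> lsum b (\<lambda>i. ennreal (\<rho> i)) I r"
      unfolding I_def by (intro lsum_ge disks_meeting_mono)
    then show "psum (\<lambda>i. ennreal (\<rho> i)) (hit (pt b r ` {p..q})) < \<infinity>"
      using H(1) by (simp add: top.not_eq_extremum order_le_less_trans)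
  qed
qed

lemma S_borel: "S \<in> sets borel"
proof -
  have "S = \<Omega> \<inter> - (\<Union>i. Q i)" by (auto simp: carpet_def)
  then show ?thesis using open_Om open_Q by (simp add: sets.Int borel_open borel_closed open_UN)
qed

text \<open>The carpet has area zero, so by Fubini almost every line meets it in a set of Lebesgue
  measure zero, which has length zero.\<close>

lemma AE_line_H1:
  "AE r in lborel. \<forall>p q. hausdorff1 (pt b r ` {p..q} \<inter> S) = 0"
proof -
  have "(\<integral>\<^sup>+r. \<integral>\<^sup>+t. indicator S (pt b r t) \<partial>lborel \<partial>lborel) = (\<integral>\<^sup>+z. indicator S z \<partial>lborel)"
    using S_borel by (intro nn_integral_pt[symmetric]) auto
  also have "\<dots> = 0" using null_S S_borel by simp
  finally have z: "(\<integral>\<^sup>+r. \<integral>\<^sup>+t. indicator S (pt b r t) \<partial>lborel \<partial>lborel) = 0" .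
  have "(\<lambda>r. \<integral>\<^sup>+t. indicator S (pt b r t) \<partial>lborel) \<in> borel_measurable borel"
    using S_borel by (intro measurable_inner_pt) auto
  then have "AE r in lborel. (\<integral>\<^sup>+t. indicator S (pt b r t) \<partial>lborel) = (0::ennreal)"
    using z by (subst (asm) nn_integral_0_iff_AE) auto
  then show ?thesis
  proof (rule eventually_mono, intro allI)
    fix r p q assume r0: "(\<integral>\<^sup>+t. indicator S (pt b r t) \<partial>lborel) = (0::ennreal)"
    have m: "pt b r -` S \<in> sets borel"
      using measurable_sets[OF measurable_pt S_borel, of b r] by simp
    have "(\<integral>\<^sup>+t. indicator S (pt b r t) \<partial>lborel) = (\<integral>\<^sup>+t. indicator (pt b r -` S) t \<partial>lborel :: ennreal)"
      by (intro nn_integral_cong) (auto simp: indicator_def)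
    then have "emeasure lborel (pt b r -` S) = 0" using r0 m by simp
    then have "emeasure lborel ({p..q} \<inter> pt b r -` S) = 0"
      using m by (metis Int_lower2 emeasure_mono le_zero_eq sets_lborel)
    then have "hausdorff1 (pt b r ` ({p..q} \<inter> pt b r -` S)) = 0"
      using m by (intro hausdorff1_null_line[of _ p q]) auto
    moreover have "pt b r ` ({p..q} \<inter> pt b r -` S) = pt b r ` {p..q} \<inter> S" by auto
    ultimately show "hausdorff1 (pt b r ` {p..q} \<inter> S) = 0" by simp
  qed
qed

end

lemma ennreal_lin:
  "0 \<le> a \<Longrightarrow> 0 \<le> b \<Longrightarrow> 0 \<le> c \<Longrightarrow> 0 \<le> d \<Longrightarrow> ennreal a * ennreal b + ennreal c * ennreal d = ennreal (a * b + c * d)"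
  by (simp add: ennreal_mult ennreal_plus)

lemma pt_in_rect: "pt b r t \<in> rect b r0 r1 t0 t1 \<longleftrightarrow> r \<in> {r0..r1} \<and> t \<in> {t0..t1}"
  by (cases b) (auto simp: rect_def pt_def image_iff)

lemma compact_rect: "compact (rect b r0 r1 t0 t1)"
proof -
  have "rect b r0 r1 t0 t1 = (\<lambda>(r, t). pt b r t) ` ({r0..r1} \<times> {t0..t1})" by (auto simp: rect_def)
  moreover have "continuous_on ({r0..r1} \<times> {t0..t1}) (\<lambda>(r, t). pt b r t)"
    unfolding pt_def Complex_eq case_prod_beta by (cases b) (auto intro!: continuous_intros)
  ultimately show ?thesis by (auto intro!: compact_continuous_image compact_Times)
qed

lemma rect_sets [measurable]: "rect b r0 r1 t0 t1 \<in> sets borel"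
  using compact_imp_closed[OF compact_rect] by (rule borel_closed)

context rel_carpet
begin

lemma markov_lsum: 
  "{r. 1 \<le> lsum b \<rho> I r} \<in> sets lborel" "emeasure lborel {r. 1 \<le> lsum b \<rho> I r} \<le> psum (\<lambda>i. \<rho> i * ennreal (dm i)) I"
proof -
  show m: "{r. 1 \<le> lsum b \<rho> I r} \<in> sets lborel"
    using lsum_measurable[of b \<rho> I] by measurable
  have "emeasure lborel {r\<in>UNIV. 1 \<le> 1 * lsum b \<rho> I r} \<le> 1 * (\<integral>\<^sup>+r\<in>UNIV. lsum b \<rho> I r \<partial>lborel)"
    using lsum_measurable by (intro nn_integral_Markov_inequality) auto
  then show "emeasure lborel {r. 1 \<le> lsum b \<rho> I r} \<le> psum (\<lambda>i. \<rho> i * ennreal (dm i)) I"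
    by (simp add: lsum_integral)
qed

lemma small_lsum_set:
  assumes "psum (\<lambda>i. ennreal ((dm i)\<^sup>2)) I < \<infinity>" "e > (0::real)"
  shows "\<exists>\<eta>>0. \<forall>\<rho>. (\<forall>i. 0 \<le> \<rho> i) \<and> (\<Sum>i. ennreal ((\<rho> i)\<^sup>2)) < ennreal \<eta> \<longrightarrow>
     emeasure lborel {r. 1 \<le> lsum b (\<lambda>i. ennreal (\<rho> i)) I r} \<le> ennreal e"
proof -
  obtain D where D: "D \<ge> 0" "psum (\<lambda>i. ennreal ((dm i)\<^sup>2)) I = ennreal D"
    using assms(1) by (cases "psum (\<lambda>i. ennreal ((dm i)\<^sup>2)) I") auto
  \<comment> \<open>Chosen so that both terms of the weighted arithmetic-geometric inequality are at
    most \<open>e/2\<close> when the energy of \<open>\<rho>\<close> is below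
    \<open>e * \<theta>\<close>.\<close>
  define \<theta> where "\<theta> = e / (D + 1)"
  have \<theta>: "\<theta> > 0" "\<theta> / 2 * D \<le> e / 2" using D assms by (auto simp: \<theta>_def field_simps)
  have "emeasure lborel {r. 1 \<le> lsum b (\<lambda>i. ennreal (\<rho> i)) I r} \<le> ennreal e"
    if \<rho>: "\<forall>i. 0 \<le> \<rho> i" "(\<Sum>i. ennreal ((\<rho> i)\<^sup>2)) < ennreal (e * \<theta>)" for \<rho>
  proof -
    have "emeasure lborel {r. 1 \<le> lsum b (\<lambda>i. ennreal (\<rho> i)) I r} \<le> psum (\<lambda>i. ennreal (\<rho> i) * ennreal (dm i)) I"
      by (rule markov_lsum)
    also have "\<dots> \<le> ennreal (1 / (2 * \<theta>)) * psum (\<lambda>i. ennreal ((\<rho> i)\<^sup>2)) I + ennreal (\<theta> / 2) * psum (\<lambda>i. ennreal ((dm i)\<^sup>2)) I"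
      using \<rho> \<theta> dm_pos by (intro psum_amgm) (auto intro: less_imp_le)
    also have "\<dots> \<le> ennreal (1 / (2 * \<theta>)) * ennreal (e * \<theta>) + ennreal (\<theta> / 2) * ennreal D"
    proof (intro add_mono mult_left_mono)
      have "psum (\<lambda>i. ennreal ((\<rho> i)\<^sup>2)) I \<le> (\<Sum>i. ennreal ((\<rho> i)\<^sup>2))"
        unfolding psum_def by (intro suminf_le) auto
      then show "psum (\<lambda>i. ennreal ((\<rho> i)\<^sup>2)) I \<le> ennreal (e * \<theta>)" using \<rho>(2) by simp
    qed (use D in auto)
    also have "\<dots> = ennreal (1 / (2 * \<theta>) * (e * \<theta>) + \<theta> / 2 * D)"
      using \<theta> assms D by (intro ennreal_lin) auto
    also have "\<dots> \<le> ennreal e" using \<theta> by (intro ennreal_leI) (auto simp: field_simps)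
    finally show ?thesis .
  qed
  then show ?thesis using \<theta> assms by (intro exI[of _ "e * \<theta>"]) auto
qed

text \<open>A weight \<open>w\<close> of small energy integrates to at least 1 over each segment of
  the family. The arithmetic-geometric inequality on the rectangle makes its integral over all lines
  small, and Markov's inequality bounds the set of such lines.\<close>

lemma mod2_null_lines:
  assumes G: "mod2 \<Gamma> = 0" and rt: "t0 < t1" "r0 < r1" and "e > (0::real)"
  shows "\<exists>B\<in>sets lborel. {r\<in>{r0..r1}. \<exists>p q. t0 \<le> p \<and> p \<le> q \<and> q \<le> t1 \<and> ({p..q}, pt b r) \<in> \<Gamma>} \<subseteq> B
      \<and> emeasure lborel B \<le> ennreal e"
proof -
  define A where "A = (r1 - r0) * (t1 - t0)"
  have A: "A > 0" using rt by (simp add: A_def)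
  define \<theta> where "\<theta> = e / A"
  have \<theta>: "\<theta> > 0" using A \<open>e > 0\<close> by (simp add: \<theta>_def)
  have "mod2 \<Gamma> < ennreal (e * \<theta>)" using G \<theta> \<open>e > 0\<close> by simp
  then obtain w where w: "w \<in> borel_measurable borel" "\<And>\<gamma>. \<gamma> \<in> \<Gamma> \<Longrightarrow> line_integral w \<gamma> \<ge> 1"
      "(\<integral>\<^sup>+z. (w z)\<^sup>2 \<partial>lborel) < ennreal (e * \<theta>)"
    unfolding mod2_def INF_less_iff by auto
  define g where "g r = (\<integral>\<^sup>+t. w (pt b r t) * indicator {t0..t1} t \<partial>lborel) * indicator {r0..r1} r" for r
  have meas1: "(\<lambda>z. w z * indicator (rect b r0 r1 t0 t1) z) \<in> borel_measurable borel"
    using w(1) by measurable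
  have ind: "indicator (rect b r0 r1 t0 t1) (pt b r t) = (indicator {t0..t1} t * indicator {r0..r1} r :: ennreal)" for r t
    by (auto simp: indicator_def pt_in_rect)
  have geq: "g r = (\<integral>\<^sup>+t. w (pt b r t) * indicator (rect b r0 r1 t0 t1) (pt b r t) \<partial>lborel)" for r
  proof -
    have "(\<lambda>t. w (pt b r t) * indicator {t0..t1} t) \<in> borel_measurable lborel"
      using measurable_compose[OF measurable_pt w(1), of b r] by simp
    then show ?thesis unfolding g_def ind
      by (subst nn_integral_multc[symmetric]) (auto simp: mult.assoc)
  qed
  have gm: "g \<in> borel_measurable borel"
    unfolding geq[abs_def] by (rule measurable_inner_pt[OF meas1])
  have gi: "(\<integral>\<^sup>+r. g r \<partial>lborel) \<le> ennreal e"
  proof -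
    have "(\<integral>\<^sup>+r. g r \<partial>lborel) = (\<integral>\<^sup>+z. w z * indicator (rect b r0 r1 t0 t1) z \<partial>lborel)"
      unfolding geq by (rule nn_integral_pt[OF meas1, symmetric])
    also have "\<dots> \<le> (\<integral>\<^sup>+z. ennreal (1 / (2 * \<theta>)) * (w z)\<^sup>2 + ennreal (\<theta> / 2) * indicator (rect b r0 r1 t0 t1) z \<partial>lborel)"
    proof (rule nn_integral_mono)
      fix z
      show "w z * indicator (rect b r0 r1 t0 t1) z \<le> ennreal (1 / (2 * \<theta>)) * (w z)\<^sup>2 + ennreal (\<theta> / 2) * indicator (rect b r0 r1 t0 t1) z"
      proof (cases "w z")
        case (real x)
        then have "ennreal x * ennreal 1 \<le> ennreal (1 / (2 * \<theta>)) * ennreal (x\<^sup>2) + ennreal (\<theta> / 2) * ennreal (1\<^sup>2)"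
          using amgm[OF \<theta>, of x 1] \<theta>
          by (simp add: ennreal_mult[symmetric] ennreal_plus[symmetric] del: ennreal_plus)
        then show ?thesis using real by (auto simp: indicator_def ennreal_power)
      next
        case top
        then show ?thesis using \<theta> by (auto simp: indicator_def power2_eq_square ennreal_mult_top ennreal_top_mult)
      qed
    qed
    also have "\<dots> = ennreal (1 / (2 * \<theta>)) * (\<integral>\<^sup>+z. (w z)\<^sup>2 \<partial>lborel) + ennreal (\<theta> / 2) * (\<integral>\<^sup>+z. 1 * indicator (rect b r0 r1 t0 t1) z \<partial>lborel)"
      using w(1) by (subst nn_integral_add) (auto simp: nn_integral_cmult)
    also have "(\<integral>\<^sup>+z. 1 * indicator (rect b r0 r1 t0 t1) z \<partial>lborel) = ennreal A"
    proof -
      have "(\<integral>\<^sup>+z. 1 * indicator (rect b r0 r1 t0 t1) z \<partial>lborel) =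
          (\<integral>\<^sup>+r. \<integral>\<^sup>+t. 1 * indicator (rect b r0 r1 t0 t1) (pt b r t) \<partial>lborel \<partial>lborel)"
        by (intro nn_integral_pt) auto
      also have "\<dots> = (\<integral>\<^sup>+r. ennreal (t1 - t0) * indicator {r0..r1} r \<partial>lborel)"
        unfolding ind using rt by (intro nn_integral_cong) (simp add: nn_integral_multc)
      also have "\<dots> = ennreal A" using rt by (simp add: nn_integral_cmult ennreal_mult[symmetric] A_def mult.commute)
      finally show ?thesis .
    qed
    also have "ennreal (1 / (2 * \<theta>)) * (\<integral>\<^sup>+z. (w z)\<^sup>2 \<partial>lborel) + ennreal (\<theta> / 2) * ennreal A \<le>
        ennreal (1 / (2 * \<theta>)) * ennreal (e * \<theta>) + ennreal (\<theta> / 2) * ennreal A"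
      using w(3) by (intro add_mono mult_left_mono) auto
    also have "\<dots> = ennreal (1 / (2 * \<theta>) * (e * \<theta>) + \<theta> / 2 * A)"
      using \<theta> \<open>e > 0\<close> A by (intro ennreal_lin) auto
    also have "1 / (2 * \<theta>) * (e * \<theta>) + \<theta> / 2 * A = e"
    proof -
      have "\<theta> * A = e" using A by (simp add: \<theta>_def)
      then show ?thesis using \<theta> by (simp add: field_simps)
    qed
    finally show ?thesis .
  qed
  have "emeasure lborel {r\<in>UNIV. 1 \<le> 1 * g r} \<le> 1 * (\<integral>\<^sup>+r\<in>UNIV. g r \<partial>lborel)"
    using gm by (intro nn_integral_Markov_inequality) auto
  then have "emeasure lborel {r. 1 \<le> g r} \<le> ennreal e" using gi by simp
  moreover have "{r. 1 \<le> g r} \<in> sets lborel" using gm by measurable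
  moreover have "1 \<le> g r" if "r \<in> {r0..r1}" "t0 \<le> p" "p \<le> q" "q \<le> t1" "({p..q}, pt b r) \<in> \<Gamma>" for r p q
  proof -
    have "1 \<le> line_integral w ({p..q}, pt b r)" using w(2) that by blast
    also have "\<dots> \<le> (\<integral>\<^sup>+t\<in>{p..q}. w (pt b r t) \<partial>lborel)" by (rule line_integral_pt[OF w(1) that(3)])
    also have "\<dots> \<le> (\<integral>\<^sup>+t. w (pt b r t) * indicator {t0..t1} t \<partial>lborel)"
      using that by (intro nn_integral_mono) (auto simp: indicator_def)
    finally show ?thesis using that(1) by (simp add: g_def)
  qed
  ultimately show ?thesis by (intro bexI[of _ "{r. 1 \<le> g r}"]) auto
qed

text \<open>Admissible weights of small energy have a large sum only on a set of lines of small
  measure. The strong modulus constrains only paths meeting the carpet in length zero, which almost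
  all lines do; the weak one leaves out a family with vanishing \<open>mod2\<close>, handled by
  \<open>mod2_null_lines\<close>.\<close>

theorem AE_line_unexceptional:
  assumes G: "carpet_mod ver \<Omega> Q \<Gamma> = 0"
  shows "AE r in lborel. \<forall>p q. p \<le> q \<and> pt b r ` {p..q} \<subseteq> \<Omega> \<longrightarrow> ({p..q}, pt b r) \<notin> \<Gamma>"
proof (rule AE_lines)
  fix r0 r1 t0 t1 :: real assume rt: "r0 < r1" "t0 < t1" and sub: "rect b r0 r1 t0 t1 \<subseteq> \<Omega>"
  define I where "I = hit (rect b r0 r1 t0 t1)"
  obtain R where "rect b r0 r1 t0 t1 \<subseteq> ball 0 R" using rect_bounded by blast
  then have D: "psum (\<lambda>i. ennreal ((dm i)\<^sup>2)) I < \<infinity>"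
    using dm_sq_sum[of 0 R] unfolding I_def by (meson disks_meeting_mono order_le_less_trans psum_mono_set)
  have le: "psum \<rho> (hit (path_trace ({p..q}, pt b r))) \<le> lsum b \<rho> I r"
    if "r \<in> {r0..r1}" "t0 \<le> p" "p \<le> q" "q \<le> t1" for \<rho> r p q
  proof -
    have "pt b r ` {p..q} \<subseteq> rect b r0 r1 t0 t1" using that by (force simp: rect_def)
    then show ?thesis unfolding I_def path_trace_def fst_conv snd_conv by (intro lsum_ge disks_meeting_mono)
  qed
  define N where "N = {r\<in>{r0..r1}. \<exists>p q. t0 \<le> p \<and> p \<le> q \<and> q \<le> t1 \<and> ({p..q}, pt b r) \<in> \<Gamma> \<and>
       hausdorff1 (path_trace ({p..q}, pt b r) \<inter> S) = 0}"
  have "AE r in lborel. r \<notin> N"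
  proof (rule AE_from_small)
    fix e :: real assume "e > 0"
    obtain \<eta> where \<eta>: "\<eta> > 0" "\<And>\<rho>. (\<forall>i. 0 \<le> \<rho> i) \<Longrightarrow> (\<Sum>i. ennreal ((\<rho> i)\<^sup>2)) < ennreal \<eta> \<Longrightarrow>
      emeasure lborel {r. 1 \<le> lsum b (\<lambda>i. ennreal (\<rho> i)) I r} \<le> ennreal (e/2)"
      using small_lsum_set[OF D half_gt_zero[OF \<open>e > 0\<close>], of b] by blast
    show "\<exists>B\<in>sets lborel. N \<subseteq> B \<and> emeasure lborel B \<le> ennreal e"
    proof (cases ver)
      case Strong
      then have "mod_strong \<Omega> Q \<Gamma> < ennreal \<eta>" using G \<eta> by simp
      then obtain \<rho> where \<rho>: "\<forall>i. 0 \<le> \<rho> i" "\<And>\<gamma>. \<gamma> \<in> \<Gamma> \<Longrightarrow> hausdorff1 (path_trace \<gamma> \<inter> S) = 0 \<Longrightarrow>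
          psum (\<lambda>i. ennreal (\<rho> i)) (hit (path_trace \<gamma>)) \<ge> 1" "(\<Sum>i. ennreal ((\<rho> i)\<^sup>2)) < ennreal \<eta>"
        unfolding mod_strong_def INF_less_iff infsum_psum by blast
      have "N \<subseteq> {r. 1 \<le> lsum b (\<lambda>i. ennreal (\<rho> i)) I r}"
      proof
        fix r assume "r \<in> N"
        then obtain p q where pq: "r \<in> {r0..r1}" "t0 \<le> p" "p \<le> q" "q \<le> t1" "({p..q}, pt b r) \<in> \<Gamma>"
            "hausdorff1 (path_trace ({p..q}, pt b r) \<inter> S) = 0" by (auto simp: N_def)
        then show "r \<in> {r. 1 \<le> lsum b (\<lambda>i. ennreal (\<rho> i)) I r}"
          using \<rho>(2)[OF pq(5,6)] le[OF pq(1-4), of "\<lambda>i. ennreal (\<rho> i)"] by (auto intro: order_trans)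
      qed
      moreover have "emeasure lborel {r. 1 \<le> lsum b (\<lambda>i. ennreal (\<rho> i)) I r} \<le> ennreal e"
        using \<eta>(2)[OF \<rho>(1,3)] \<open>e > 0\<close> by (intro order_trans[OF _ ennreal_leI[of "e/2" e]]) auto
      ultimately show ?thesis using markov_lsum(1) by blast
    next
      case Weak
      then have "mod_weak Q \<Gamma> < ennreal \<eta>" using G \<eta> by simp
      then obtain \<rho> \<Gamma>\<^sub>0 where \<rho>: "\<forall>i. 0 \<le> \<rho> i" "mod2 \<Gamma>\<^sub>0 = 0" "\<And>\<gamma>. \<gamma> \<in> \<Gamma> - \<Gamma>\<^sub>0 \<Longrightarrow>
          psum (\<lambda>i. ennreal (\<rho> i)) (hit (path_trace \<gamma>)) \<ge> 1" "(\<Sum>i. ennreal ((\<rho> i)\<^sup>2)) < ennreal \<eta>"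
        unfolding mod_weak_def INF_less_iff infsum_psum by blast
      obtain B where B: "B \<in> sets lborel" "{r\<in>{r0..r1}. \<exists>p q. t0 \<le> p \<and> p \<le> q \<and> q \<le> t1 \<and> ({p..q}, pt b r) \<in> \<Gamma>\<^sub>0} \<subseteq> B"
          "emeasure lborel B \<le> ennreal (e/2)"
        using mod2_null_lines[OF \<rho>(2) rt(2,1) half_gt_zero[OF \<open>e > 0\<close>], of b] by blast
      define B' where "B' = {r. 1 \<le> lsum b (\<lambda>i. ennreal (\<rho> i)) I r} \<union> B"
      have "N \<subseteq> B'"
      proof
        fix r assume "r \<in> N"
        then obtain p q where pq: "r \<in> {r0..r1}" "t0 \<le> p" "p \<le> q" "q \<le> t1" "({p..q}, pt b r) \<in> \<Gamma>"
          by (auto simp: N_def)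
        show "r \<in> B'"
        proof (cases "({p..q}, pt b r) \<in> \<Gamma>\<^sub>0")
          case True
          then show ?thesis using B(2) pq by (auto simp: B'_def)
        next
          case False
          then show ?thesis
            using \<rho>(3)[of "({p..q}, pt b r)"] le[OF pq(1-4), of "\<lambda>i. ennreal (\<rho> i)"] pq(5)
            by (auto simp: B'_def intro: order_trans)
        qed
      qed
      moreover have "emeasure lborel B' \<le> ennreal e"
      proof -
        have "emeasure lborel B' \<le> emeasure lborel {r. 1 \<le> lsum b (\<lambda>i. ennreal (\<rho> i)) I r} + emeasure lborel B"
          unfolding B'_def using B markov_lsum(1) by (intro emeasure_subadditive)
        also have "\<dots> \<le> ennreal (e/2) + ennreal (e/2)" using \<eta>(2)[OF \<rho>(1,4)] B by (intro add_mono)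
        also have "\<dots> = ennreal e" using \<open>e > 0\<close> by (subst ennreal_plus[symmetric]) auto
        finally show ?thesis .
      qed
      moreover have "B' \<in> sets lborel" unfolding B'_def using B markov_lsum(1) by (intro sets.Un)
      ultimately show ?thesis by blast
    qed
  qed
  with AE_line_H1[of b]
  show "AE r in lborel. r \<in> {r0..r1} \<longrightarrow> (\<forall>p q. t0 \<le> p \<and> p \<le> q \<and> q \<le> t1 \<longrightarrow> ({p..q}, pt b r) \<notin> \<Gamma>)"
    by (rule eventually_elim2) (auto simp: N_def path_trace_def)
qed

section \<open>Sobolev functions as real functions\<close>

text \<open>\<open>real_of_ereal\<close> sends infinite values to 0. This does no harm: values of
  Sobolev functions are finite on peripheral circles and at the carpet points of non-constant
  unexceptional paths.\<close>

definition rl :: "(complex \<Rightarrow> ereal) \<Rightarrow> complex \<Rightarrow> real" where "rl f z = real_of_ereal (f z)"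

lemma peri_finite:
  assumes "\<bar>peri_max Q f k\<bar> \<noteq> \<infinity>" "\<bar>peri_min Q f k\<bar> \<noteq> \<infinity>"
  shows "z \<in> frontier (Q k) \<Longrightarrow> f z = ereal (rl f z)"
    and "peri_max Q f k = ereal (pM (rl f) k)" and "peri_min Q f k = ereal (pm (rl f) k)"
    and "peri_osc Q f k = ennreal (pO (rl f) k)" and "bounded (rl f ` frontier (Q k))"
proof -
  obtain a where a: "peri_max Q f k = ereal a" using assms(1) by (cases "peri_max Q f k") auto
  obtain b where b: "peri_min Q f k = ereal b" using assms(2) by (cases "peri_min Q f k") auto
  have le: "ereal b \<le> f z" "f z \<le> ereal a" if "z \<in> frontier (Q k)" for z
    unfolding a[symmetric] b[symmetric] peri_max_def peri_min_def using that by (auto intro: SUP_upper INF_lower)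
  have fr: "f z = ereal (rl f z)" if "z \<in> frontier (Q k)" for z
    using le[OF that] by (cases "f z") (auto simp: rl_def)
  then show "z \<in> frontier (Q k) \<Longrightarrow> f z = ereal (rl f z)" .
  have bl: "b \<le> rl f z" "rl f z \<le> a" if "z \<in> frontier (Q k)" for z
    using le[OF that] fr[OF that] by (metis ereal_less_eq(3))+
  show "bounded (rl f ` frontier (Q k))"
    using bl by (intro boundedI[of _ "\<bar>a\<bar> + \<bar>b\<bar>"]) (auto, smt (verit))
  have "(SUP z\<in>frontier (Q k). f z) = (SUP z\<in>frontier (Q k). ereal (rl f z))" using fr by (intro SUP_cong) auto
  also have "\<dots> = ereal (SUP z\<in>frontier (Q k). rl f z)"
    using a fr front_ne[of k] by (intro ereal_SUP[symmetric]) (auto simp: peri_max_def cong: SUP_cong)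
  finally show M: "peri_max Q f k = ereal (pM (rl f) k)" by (simp add: peri_max_def pM_def)
  have "(INF z\<in>frontier (Q k). f z) = (INF z\<in>frontier (Q k). ereal (rl f z))" using fr by (intro INF_cong) auto
  also have "\<dots> = ereal (INF z\<in>frontier (Q k). rl f z)"
    using b fr front_ne[of k] by (intro ereal_INF[symmetric]) (auto simp: peri_min_def cong: INF_cong)
  finally show m: "peri_min Q f k = ereal (pm (rl f) k)" by (simp add: peri_min_def pm_def)
  show "peri_osc Q f k = ennreal (pO (rl f) k)"
    unfolding peri_osc_def M m by (simp add: pO_def ennreal.abs_eq[symmetric] e2ennreal_ereal)
qed

lemma rl_ereal [simp]: "rl (\<lambda>z. ereal (g z)) = g"
  by (auto simp: rl_def)

lemma peri_ereal:
  assumes "pbdd g"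
  shows "peri_max Q (\<lambda>z. ereal (g z)) k = ereal (pM g k)" "peri_min Q (\<lambda>z. ereal (g z)) k = ereal (pm g k)"
    "peri_osc Q (\<lambda>z. ereal (g z)) k = ennreal (pO g k)"
proof -
  have up: "ereal (g z) \<le> ereal (pM g k)" and lo: "ereal (pm g k) \<le> ereal (g z)" if "z \<in> frontier (Q k)" for z
    using pM_ge[OF assms that] pm_le[OF assms that] by auto
  obtain z where z: "z \<in> frontier (Q k)" using front_ne by blast
  have "peri_max Q (\<lambda>z. ereal (g z)) k \<le> ereal (pM g k)" "ereal (pm g k) \<le> peri_max Q (\<lambda>z. ereal (g z)) k"
    unfolding peri_max_def using up lo z by (auto intro: SUP_least intro!: SUP_upper2[OF z])
  then have 1: "\<bar>peri_max Q (\<lambda>z. ereal (g z)) k\<bar> \<noteq> \<infinity>" by (cases "peri_max Q (\<lambda>z. ereal (g z)) k") auto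
  have "peri_min Q (\<lambda>z. ereal (g z)) k \<le> ereal (pM g k)" "ereal (pm g k) \<le> peri_min Q (\<lambda>z. ereal (g z)) k"
    unfolding peri_min_def using up lo z by (auto intro: INF_greatest intro!: INF_lower2[OF z])
  then have 2: "\<bar>peri_min Q (\<lambda>z. ereal (g z)) k\<bar> \<noteq> \<infinity>" by (cases "peri_min Q (\<lambda>z. ereal (g z)) k") auto
  show "peri_max Q (\<lambda>z. ereal (g z)) k = ereal (pM g k)" "peri_min Q (\<lambda>z. ereal (g z)) k = ereal (pm g k)"
    "peri_osc Q (\<lambda>z. ereal (g z)) k = ennreal (pO g k)"
    using peri_finite(2,3,4)[OF 1 2] by simp_all
qed

lemma sobolev_loc_peri:
  assumes "f \<in> sobolev_loc ver \<Omega> Q"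
  shows "z \<in> frontier (Q k) \<Longrightarrow> f z = ereal (rl f z)" "peri_max Q f k = ereal (pM (rl f) k)"
    "peri_min Q f k = ereal (pm (rl f) k)" "peri_osc Q f k = ennreal (pO (rl f) k)" "pbdd (rl f)"
proof -
  have fin: "\<bar>peri_max Q f k\<bar> \<noteq> \<infinity>" "\<bar>peri_min Q f k\<bar> \<noteq> \<infinity>" for k
    using assms by (auto simp: sobolev_loc_def)
  show "z \<in> frontier (Q k) \<Longrightarrow> f z = ereal (rl f z)" "peri_max Q f k = ereal (pM (rl f) k)"
    "peri_min Q f k = ereal (pm (rl f) k)" "peri_osc Q f k = ennreal (pO (rl f) k)"
    by (rule peri_finite[OF fin]; assumption)+
  show "pbdd (rl f)" unfolding pbdd_def using peri_finite(5)[OF fin] by blast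
qed

lemma ball_cc: "cball x r \<subseteq> \<Omega> \<Longrightarrow> 0 < r \<Longrightarrow> compactly_contained (ball x r) \<Omega>"
  by (simp add: compactly_contained_def)

lemma sobolev_loc_sums:
  assumes f: "f \<in> sobolev_loc ver \<Omega> Q" and c: "cball x r \<subseteq> \<Omega>"
  shows "psum (\<lambda>k. ennreal ((pO (rl f) k)\<^sup>2)) (hit (ball x r)) < \<infinity>"
    "psum (\<lambda>k. ennreal ((pM (rl f) k * dm k)\<^sup>2)) (hit (ball x r)) < \<infinity>"
proof -
  have "psum (\<lambda>k. ennreal ((pO (rl f) k)\<^sup>2)) (hit (ball x r)) < \<infinity> \<and>
    psum (\<lambda>k. ennreal ((pM (rl f) k * dm k)\<^sup>2)) (hit (ball x r)) < \<infinity>"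
  proof (cases "r > 0")
    case True
    then have "sq_osc Q f (hit (ball x r)) < \<infinity>" "sq_mass Q f (hit (ball x r)) < \<infinity>"
      using f ball_cc[OF c] by (auto simp: sobolev_loc_def)
    moreover have "(peri_osc Q f k)\<^sup>2 = ennreal ((pO (rl f) k)\<^sup>2)" for k
      using sobolev_loc_peri[OF f] pO_nonneg by (simp add: ennreal_power)
    moreover have "e2ennreal ((peri_max Q f k)\<^sup>2) * ennreal ((dm k)\<^sup>2) = ennreal ((pM (rl f) k * dm k)\<^sup>2)" for k
      using sobolev_loc_peri(2)[OF f]
      by (simp add: e2ennreal_ereal power2_eq_square ennreal_mult[symmetric] mult_ac)
    ultimately show ?thesis by (simp add: sq_osc_def sq_mass_def infsum_psum)
  next
    case False
    then have e: "ball x r = {}" by simp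
    have "hit (ball x r) = {}" unfolding e disks_meeting_def by simp
    then show ?thesis by (simp add: psum_finite)
  qed
  then show "psum (\<lambda>k. ennreal ((pO (rl f) k)\<^sup>2)) (hit (ball x r)) < \<infinity>"
    "psum (\<lambda>k. ennreal ((pM (rl f) k * dm k)\<^sup>2)) (hit (ball x r)) < \<infinity>" by blast+
qed

end

context rel_carpet
begin

lemma compact_osc_sum:
  assumes f: "f \<in> sobolev_loc ver \<Omega> Q" and K: "compact K" "K \<subseteq> \<Omega>"
  shows "psum (\<lambda>k. ennreal ((pO (rl f) k)\<^sup>2)) (hit K) < \<infinity>"
proof -
  have "\<forall>z\<in>K. \<exists>e>0. cball z e \<subseteq> \<Omega>" using K open_Om open_contains_cball by blast
  then obtain e where e: "\<And>z. z \<in> K \<Longrightarrow> e z > 0 \<and> cball z (e z) \<subseteq> \<Omega>" by metis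
  have "K \<subseteq> (\<Union>z\<in>K. ball z (e z))" using e by force
  then obtain D where D: "D \<subseteq> K" "finite D" "K \<subseteq> (\<Union>z\<in>D. ball z (e z))"
    using compactE_image[OF K(1), of K "\<lambda>z. ball z (e z)"] by auto
  have "psum (\<lambda>k. ennreal ((pO (rl f) k)\<^sup>2)) (hit (\<Union>z\<in>D. ball z (e z))) < \<infinity>"
    using D(2,1)
  proof (induction D rule: finite_induct)
    case empty
    then show ?case by (simp add: disks_meeting_def psum_finite)
  next
    case (insert z D)
    have "hit (\<Union>z\<in>insert z D. ball z (e z)) = hit (ball z (e z)) \<union> hit (\<Union>z\<in>D. ball z (e z))"
      by (auto simp: disks_meeting_def)
    then have "psum (\<lambda>k. ennreal ((pO (rl f) k)\<^sup>2)) (hit (\<Union>z\<in>insert z D. ball z (e z))) \<le>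
       psum (\<lambda>k. ennreal ((pO (rl f) k)\<^sup>2)) (hit (ball z (e z))) + psum (\<lambda>k. ennreal ((pO (rl f) k)\<^sup>2)) (hit (\<Union>z\<in>D. ball z (e z)))"
      by (simp only: psum_Un_le)
    also have "\<dots> < \<infinity>"
      using sobolev_loc_sums(1)[OF f, of z "e z"] e insert unfolding infinity_ennreal_def ennreal_add_less_top by simp
    finally show ?case .
  qed
  then show ?thesis using psum_hit_mono[OF D(3)] by (rule order_le_less_trans[rotated])
qed

text \<open>Collects what almost every axis-parallel line satisfies for a Sobolev function, so that
  one generic choice of a line serves all purposes.\<close>

definition gline :: "(complex \<Rightarrow> real) \<Rightarrow> bool \<Rightarrow> real \<Rightarrow> bool" where
  "gline v b r \<longleftrightarrow> tame_line v b r \<and>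
     (\<forall>p q. p \<le> q \<and> pt b r ` {p..q} \<subseteq> \<Omega> \<longrightarrow> psum (eO v) (hit (pt b r ` {p..q})) < \<infinity>) \<and>
     (\<forall>p q. hausdorff1 (pt b r ` {p..q} \<inter> S) = 0)"

lemma pt_eq_iff [simp]: "pt b r p = pt b r q \<longleftrightarrow> p = q"
  by (auto simp: pt_def)

lemma sobolev_upper_gradient:
  assumes f: "f \<in> sobolev_loc ver \<Omega> Q"
  obtains \<Gamma> where "\<Gamma> \<subseteq> paths_in \<Omega>" "carpet_mod ver \<Omega> Q \<Gamma> = 0"
    "\<And>\<gamma> x y. \<gamma> \<in> paths_in \<Omega> \<Longrightarrow> \<gamma> \<notin> \<Gamma> \<Longrightarrow> nonconstant \<gamma> \<Longrightarrow> x \<in> path_trace \<gamma> \<Longrightarrow> x \<in> S \<Longrightarrow> y \<in> path_trace \<gamma> \<Longrightarrow> y \<in> S \<Longrightarrow>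
       ennreal \<bar>rl f x - rl f y\<bar> \<le> psum (eO (rl f)) (hit (path_trace \<gamma>))"
proof -
  have "upper_gradient ver \<Omega> Q (peri_osc Q f) f" using f by (simp add: sobolev_loc_def)
  then obtain \<Gamma> where G: "\<Gamma> \<subseteq> paths_in \<Omega>" "carpet_mod ver \<Omega> Q \<Gamma> = 0"
    "\<forall>\<gamma>\<in>paths_in \<Omega> - \<Gamma>. nonconstant \<gamma> \<longrightarrow> (\<forall>x\<in>path_trace \<gamma> \<inter> S. \<forall>y\<in>path_trace \<gamma> \<inter> S.
       \<bar>f x\<bar> \<noteq> \<infinity> \<and> \<bar>f y\<bar> \<noteq> \<infinity> \<and> e2ennreal \<bar>f x - f y\<bar> \<le> (\<Sum>\<^sub>\<infinity>i\<in>hit (path_trace \<gamma>). peri_osc Q f i))"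
    unfolding upper_gradient_def by (elim exE conjE)
  show ?thesis
  proof (rule that[OF G(1,2)])
    fix \<gamma> x y
    assume "\<gamma> \<in> paths_in \<Omega>" "\<gamma> \<notin> \<Gamma>" "nonconstant \<gamma>" "x \<in> path_trace \<gamma>" "x \<in> S" "y \<in> path_trace \<gamma>" "y \<in> S"
    then have *: "\<bar>f x\<bar> \<noteq> \<infinity>" "\<bar>f y\<bar> \<noteq> \<infinity>" "e2ennreal \<bar>f x - f y\<bar> \<le> (\<Sum>\<^sub>\<infinity>i\<in>hit (path_trace \<gamma>). peri_osc Q f i)"
      using G(3) by simp_all
    have "peri_osc Q f = eO (rl f)" using sobolev_loc_peri(4)[OF f] by blast
    moreover have "e2ennreal \<bar>f x - f y\<bar> = ennreal \<bar>rl f x - rl f y\<bar>"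
      using *(1,2) by (cases "f x"; cases "f y") (auto simp: rl_def e2ennreal_ereal)
    ultimately show "ennreal \<bar>rl f x - rl f y\<bar> \<le> psum (eO (rl f)) (hit (path_trace \<gamma>))"
      using *(3) by (simp add: infsum_psum)
  qed
qed

lemma AE_gline:
  assumes f: "f \<in> sobolev_loc ver \<Omega> Q"
  shows "AE r in lborel. gline (rl f) b r"
proof -
  obtain \<Gamma> where G: "\<Gamma> \<subseteq> paths_in \<Omega>" "carpet_mod ver \<Omega> Q \<Gamma> = 0"
    "\<And>\<gamma> x y. \<gamma> \<in> paths_in \<Omega> \<Longrightarrow> \<gamma> \<notin> \<Gamma> \<Longrightarrow> nonconstant \<gamma> \<Longrightarrow> x \<in> path_trace \<gamma> \<Longrightarrow> x \<in> S \<Longrightarrow> y \<in> path_trace \<gamma> \<Longrightarrow> y \<in> S \<Longrightarrow>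
       ennreal \<bar>rl f x - rl f y\<bar> \<le> psum (eO (rl f)) (hit (path_trace \<gamma>))"
    by (rule sobolev_upper_gradient[OF f]) blast
  have t: "AE r in lborel. tame_line (rl f) b r"
    using AE_line_unexceptional[OF G(2), of b]
  proof (rule eventually_mono)
    fix r assume r: "\<forall>p q. p \<le> q \<and> pt b r ` {p..q} \<subseteq> \<Omega> \<longrightarrow> ({p..q}, pt b r) \<notin> \<Gamma>"
    show "tame_line (rl f) b r"
      unfolding tame_line_def tame_by_def
    proof (intro allI impI conjI)
      fix p q assume pq: "p \<le> q \<and> pt b r ` {p..q} \<subseteq> \<Omega>"
      show "continuous_on {p..q} (pt b r)" by (rule continuous_pt)
      show "pt b r ` {p..q} \<subseteq> \<Omega>" using pq by blast
      fix a c assume ac: "p \<le> a \<and> a \<le> c \<and> c \<le> q \<and> pt b r a \<in> S \<and> pt b r c \<in> S"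
      show "ennreal \<bar>rl f (pt b r a) - rl f (pt b r c)\<bar> \<le> psum (eO (rl f)) (hit (pt b r ` {a..c}))"
      proof (cases "a = c")
        case True
        then show ?thesis by simp
      next
        case False
        define \<gamma> where "\<gamma> = ({a..c}, pt b r)"
        have sub: "pt b r ` {a..c} \<subseteq> \<Omega>" using pq ac by (meson atLeastatMost_subset_iff image_mono order_trans)
        have "\<gamma> \<in> paths_in \<Omega>" "\<gamma> \<notin> \<Gamma>"
          using sub r ac unfolding \<gamma>_def paths_in_def is_planar_path_def path_trace_def
          by (auto simp: is_interval_cc intro!: exI[of _ "pt b r"] continuous_pt)
        moreover have "nonconstant \<gamma>"
          unfolding nonconstant_def \<gamma>_def
        proof
          assume "\<exists>d. \<forall>t\<in>fst ({a..c}, pt b r). snd ({a..c}, pt b r) t = d"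
          then have "pt b r a = pt b r c" using ac by (metis atLeastAtMost_iff fst_conv order_refl snd_conv)
          then show False using False by simp
        qed
        moreover have "pt b r a \<in> path_trace \<gamma>" "pt b r c \<in> path_trace \<gamma>"
          using ac by (auto simp: \<gamma>_def path_trace_def)
        ultimately have "ennreal \<bar>rl f (pt b r a) - rl f (pt b r c)\<bar> \<le> psum (eO (rl f)) (hit (path_trace \<gamma>))"
          using ac by (intro G(3)) simp_all
        then show ?thesis by (simp add: \<gamma>_def path_trace_def)
      qed
    qed
  qed
  have s: "AE r in lborel. \<forall>p q. p \<le> q \<and> pt b r ` {p..q} \<subseteq> \<Omega> \<longrightarrow> psum (eO (rl f)) (hit (pt b r ` {p..q})) < \<infinity>"
  proof (rule AE_line_sum_finite)
    show "0 \<le> pO (rl f) i" for i using pO_nonneg sobolev_loc_peri(5)[OF f] by blast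
    show "psum (\<lambda>i. ennreal ((pO (rl f) i)\<^sup>2)) (hit (rect b r0 r1 t0 t1)) < \<infinity>"
      if "rect b r0 r1 t0 t1 \<subseteq> \<Omega>" for r0 r1 t0 t1
      by (rule compact_osc_sum[OF f compact_rect that])
  qed
  show ?thesis
    unfolding gline_def using t s AE_line_H1[of b] by eventually_elim blast
qed

lemma gline_tame: "gline v b r \<Longrightarrow> p \<le> q \<Longrightarrow> pt b r ` {p..q} \<subseteq> \<Omega> \<Longrightarrow> tame v (pt b r) p q"
  by (simp add: gline_def tame_line_def)

lemma gline_sum: "gline v b r \<Longrightarrow> p \<le> q \<Longrightarrow> pt b r ` {p..q} \<subseteq> \<Omega> \<Longrightarrow> psum (eO v) (hit (pt b r ` {p..q})) < \<infinity>"
  by (simp add: gline_def)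

lemma AE_dense:
  fixes a b :: real
  assumes "AE r in lborel. P r" "a < b"
  shows "\<exists>r. a < r \<and> r < b \<and> P r"
proof (rule ccontr)
  assume "\<not> ?thesis"
  then have "AE r in lborel. r \<notin> {a<..<b}" using assms(1) by (auto elim!: eventually_mono)
  then have "{r\<in>space lborel. \<not> r \<notin> {a<..<b}} \<in> null_sets lborel" by (subst (asm) AE_iff_null) auto
  moreover have "{r\<in>space lborel. \<not> r \<notin> {a<..<b}} = {a<..<b}" by auto
  ultimately have "emeasure lborel {a<..<b} = 0" by (metis null_setsD1)
  then show False using assms(2) by simp
qed

section \<open>Squares with small sums of oscillations\<close>

lemma tail_near:
  assumes fin: "psum \<rho> (hit (ball x r)) < \<infinity>" and "r > 0" "\<epsilon> > 0"
  shows "\<exists>\<delta>>0. \<delta> \<le> r \<and> psum \<rho> {k \<in> hit (ball x \<delta>). x \<notin> closure (Q k)} < \<epsilon>"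
proof -
  obtain F where F: "finite F" "F \<subseteq> hit (ball x r)" "psum \<rho> (hit (ball x r) - F) < \<epsilon>"
    using psum_tail[OF fin \<open>\<epsilon> > 0\<close>] by blast
  define G where "G = {k\<in>F. x \<notin> closure (Q k)}"
  have "closed (\<Union>k\<in>G. closure (Q k))" using F by (intro closed_UN) (auto simp: G_def)
  then have "open (- (\<Union>k\<in>G. closure (Q k)))" by (rule open_Compl)
  moreover have "x \<in> - (\<Union>k\<in>G. closure (Q k))" by (auto simp: G_def)
  ultimately obtain d where d: "d > 0" "ball x d \<subseteq> - (\<Union>k\<in>G. closure (Q k))" using open_contains_ball by blast
  have "{k \<in> hit (ball x (min d r)). x \<notin> closure (Q k)} \<subseteq> hit (ball x r) - F"
  proof
    fix k assume k: "k \<in> {k \<in> hit (ball x (min d r)). x \<notin> closure (Q k)}"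
    then obtain y where y: "y \<in> Q k" "y \<in> ball x d" "y \<in> ball x r" by (auto simp: disks_meeting_def)
    have "k \<notin> G" using y d(2) closure_subset by blast
    then show "k \<in> hit (ball x r) - F" using y k by (auto simp: disks_meeting_def G_def)
  qed
  then have "psum \<rho> {k \<in> hit (ball x (min d r)). x \<notin> closure (Q k)} < \<epsilon>"
    using F(3) psum_mono_set order_le_less_trans by blast
  then show ?thesis using d \<open>r > 0\<close> by (intro exI[of _ "min d r"]) auto
qed

text \<open>Radial analogue of \<open>prj\<close>, for the maximum-norm distance from
  \<open>x\<close>. Cutting at \<open>R\<close> bounds its length by \<open>min (dm k) R\<close>,
  the quantity controlled by \<open>area_bound\<close>.\<close>

definition rprj :: "complex \<Rightarrow> real \<Rightarrow> nat \<Rightarrow> real set" where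
  "rprj x R k = (let \<alpha> = Inf ((\<lambda>z. nrm (z - x)) ` Q k) in {\<alpha>..\<alpha> + dm k}) \<inter> {0..R}"

lemma rprj_sets [measurable]: "rprj x R k \<in> sets borel"
  by (simp add: rprj_def Let_def)

lemma rprj_emeasure:
  assumes "R > 0"
  shows "emeasure lborel (rprj x R k) \<le> ennreal (min (dm k) R)"
proof -
  define \<alpha> where "\<alpha> = Inf ((\<lambda>z. nrm (z - x)) ` Q k)"
  have "emeasure lborel (rprj x R k) \<le> emeasure lborel {\<alpha>..\<alpha> + dm k}"
    "emeasure lborel (rprj x R k) \<le> emeasure lborel {0..R}"
    by (auto intro!: emeasure_mono simp: rprj_def \<alpha>_def Let_def)
  then show ?thesis using dm_pos[of k] assms by (auto simp: min_def)
qed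

lemma rprj_mem:
  assumes "z \<in> Q k" "nrm (z - x) \<le> R"
  shows "nrm (z - x) \<in> rprj x R k"
proof -
  define X where "X = (\<lambda>z. nrm (z - x)) ` Q k"
  have le: "\<bar>nrm (z - x) - r'\<bar> \<le> dm k" if r': "r' \<in> X" for r'
  proof -
    obtain z' where z': "z' \<in> Q k" "r' = nrm (z' - x)" using r' by (auto simp: X_def)
    have "\<bar>nrm (z - x) - nrm (z' - x)\<bar> \<le> nrm (z - z')" using nrm_diff[of "z - x" "z' - x"] by simp
    also have "\<dots> \<le> dist z z'" unfolding dist_norm by (rule nrm_le_cmod)
    also have "\<dots> \<le> dm k" using assms z' by (intro dm_bound)
    finally show ?thesis using z' by simp
  qed
  have X: "nrm (z - x) \<in> X" using assms by (auto simp: X_def)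
  have "bdd_below X" using nrm_nonneg by (auto simp: X_def intro!: bdd_belowI[of _ 0])
  then have "Inf X \<le> nrm (z - x)" using X by (intro cInf_lower)
  moreover have "nrm (z - x) - dm k \<le> Inf X" using X le by (intro cInf_greatest) (auto, smt (verit))
  ultimately show ?thesis using assms nrm_nonneg by (simp add: rprj_def X_def[symmetric] Let_def)
qed

text \<open>A single scale suffices: the small oscillations are square summable near \<open>x\<close>, while by the area
  bound the squares of the diameters sum up to the square of the scale.\<close>

lemma good_square:
  assumes v: "pbdd v" and fin: "psum (\<lambda>k. ennreal ((pO v k)\<^sup>2)) (hit (ball x r)) < \<infinity>"
    and "r > 0" "\<epsilon> > 0" and P: "AE s in lborel. P s"
  shows "\<exists>s. 0 < s \<and> s < r \<and> P s \<and> psum (eO v) {k \<in> hit (sqr x s). x \<notin> closure (Q k)} < ennreal \<epsilon>"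
proof (rule ccontr)
  assume no: "\<not> ?thesis"
  obtain C where C: "C > 0" "\<And>z R. R > 0 \<Longrightarrow> psum (\<lambda>i. ennreal ((min (dm i) R)\<^sup>2)) (hit (ball z R)) \<le> ennreal (C * R\<^sup>2)"
    using area_bound by blast
  \<comment> \<open>With this tail and the weight \<open>\<epsilon> / (8 * C * R)\<close> in the
    arithmetic-geometric inequality both terms become \<open>\<epsilon> * R / 4\<close>, while
    failure on almost all squares of size below \<open>R\<close> would force the integral of
    \<open>g\<close> to be at least \<open>\<epsilon> * R\<close>.\<close>
  obtain \<delta> where \<delta>: "\<delta> > 0" "\<delta> \<le> r" "psum (\<lambda>k. ennreal ((pO v k)\<^sup>2)) {k \<in> hit (ball x \<delta>). x \<notin> closure (Q k)} < ennreal (\<epsilon>\<^sup>2 / (16 * C))"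
    using tail_near[OF fin \<open>r > 0\<close>, of "ennreal (\<epsilon>\<^sup>2 / (16 * C))"] C \<open>\<epsilon> > 0\<close> by auto
  define R where "R = \<delta> / 2"
  have R: "R > 0" using \<delta> by (simp add: R_def)
  define H where "H = {k \<in> hit (ball x \<delta>). x \<notin> closure (Q k)}"
  define g where "g s = psum (\<lambda>k. ennreal (pO v k) * indicator (rprj x R k) s) H" for s
  have lower: "AE s in lborel. ennreal \<epsilon> * indicator {0<..<R} s \<le> g s"
    using P
  proof (rule eventually_mono)
    fix s assume "P s"
    show "ennreal \<epsilon> * indicator {0<..<R} s \<le> g s"
    proof (cases "s \<in> {0<..<R}")
      case True
      then have "ennreal \<epsilon> \<le> psum (eO v) {k \<in> hit (sqr x s). x \<notin> closure (Q k)}"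
        using no \<open>P s\<close> \<delta> by (auto simp: R_def not_less)
      also have "\<dots> \<le> g s"
        unfolding g_def
      proof (rule psum_mono)
        have "sqr x s \<subseteq> ball x \<delta>" using sqr_sub_cball[of x s] True by (auto simp: R_def subset_iff)
        then show "{k \<in> hit (sqr x s). x \<notin> closure (Q k)} \<subseteq> H"
          using disks_meeting_mono[of "sqr x s" "ball x \<delta>" Q] by (auto simp: H_def)
        fix k assume "k \<in> {k \<in> hit (sqr x s). x \<notin> closure (Q k)}"
        then obtain z where "z \<in> Q k" "nrm (z - x) = s" by (auto simp: disks_meeting_def sqr_def)
        then have "s \<in> rprj x R k" using rprj_mem[of z k x R] True by auto
        then show "ennreal (pO v k) \<le> ennreal (pO v k) * indicator (rprj x R k) s" by simp
      qed
      finally show ?thesis using True by simp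
    next
      case False
      then show ?thesis by simp
    qed
  qed
  have "ennreal (\<epsilon> * R) = (\<integral>\<^sup>+s. ennreal \<epsilon> * indicator {0<..<R} s \<partial>lborel)"
    using R \<open>\<epsilon> > 0\<close> by (simp add: nn_integral_cmult ennreal_mult)
  also have "\<dots> \<le> (\<integral>\<^sup>+s. g s \<partial>lborel)" by (rule nn_integral_mono_AE[OF lower])
  also have "\<dots> = (\<Sum>k. \<integral>\<^sup>+s. (if k \<in> H then ennreal (pO v k) * indicator (rprj x R k) s else 0) \<partial>lborel)"
    unfolding g_def psum_def by (rule nn_integral_suminf) measurable
  also have "\<dots> \<le> psum (\<lambda>k. ennreal (pO v k) * ennreal (min (dm k) R)) H"
    unfolding psum_def
  proof (rule suminf_le)
    fix k
    show "(\<integral>\<^sup>+s. (if k \<in> H then ennreal (pO v k) * indicator (rprj x R k) s else 0) \<partial>lborel)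
       \<le> (if k \<in> H then ennreal (pO v k) * ennreal (min (dm k) R) else 0)"
      using rprj_emeasure[OF R, of x k] by (simp add: nn_integral_cmult_indicator mult_left_mono)
  qed auto
  also have "\<dots> \<le> ennreal (1 / (2 * (\<epsilon> / (8 * C * R)))) * psum (\<lambda>k. ennreal ((pO v k)\<^sup>2)) H
      + ennreal (\<epsilon> / (8 * C * R) / 2) * psum (\<lambda>k. ennreal ((min (dm k) R)\<^sup>2)) H"
    using C R \<open>\<epsilon> > 0\<close> pO_nonneg[OF v] dm_pos by (intro psum_amgm) (auto intro: less_imp_le)
  also have "\<dots> \<le> ennreal (1 / (2 * (\<epsilon> / (8 * C * R)))) * ennreal (\<epsilon>\<^sup>2 / (16 * C))
      + ennreal (\<epsilon> / (8 * C * R) / 2) * ennreal (C * \<delta>\<^sup>2)"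
  proof (intro add_mono mult_left_mono)
    show "psum (\<lambda>k. ennreal ((pO v k)\<^sup>2)) H \<le> ennreal (\<epsilon>\<^sup>2 / (16 * C))" using \<delta>(3) by (simp add: H_def)
    have "psum (\<lambda>k. ennreal ((min (dm k) R)\<^sup>2)) H \<le> psum (\<lambda>k. ennreal ((min (dm k) \<delta>)\<^sup>2)) (hit (ball x \<delta>))"
      using \<delta>(1) dm_pos by (intro psum_mono ennreal_leI power_mono) (auto simp: H_def R_def min_def intro: less_imp_le)
    also have "\<dots> \<le> ennreal (C * \<delta>\<^sup>2)" by (rule C(2)[OF \<delta>(1)])
    finally show "psum (\<lambda>k. ennreal ((min (dm k) R)\<^sup>2)) H \<le> ennreal (C * \<delta>\<^sup>2)" .
  qed auto
  also have "\<dots> = ennreal (1 / (2 * (\<epsilon> / (8 * C * R))) * (\<epsilon>\<^sup>2 / (16 * C)) + \<epsilon> / (8 * C * R) / 2 * (C * \<delta>\<^sup>2))"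
    using C R \<open>\<epsilon> > 0\<close> by (intro ennreal_lin) auto
  also have "1 / (2 * (\<epsilon> / (8 * C * R))) * (\<epsilon>\<^sup>2 / (16 * C)) + \<epsilon> / (8 * C * R) / 2 * (C * \<delta>\<^sup>2) = \<epsilon> * R / 2"
  proof -
    have "\<delta> = 2 * R" by (simp add: R_def)
    then show ?thesis using C R \<open>\<epsilon> > 0\<close> by (simp add: field_simps power2_eq_square)
  qed
  finally have "\<epsilon> * R \<le> \<epsilon> * R / 2" using R \<open>\<epsilon> > 0\<close> by (subst (asm) ennreal_le_iff) auto
  then show False using R \<open>\<epsilon> > 0\<close> by simp
qed

text \<open>Janiszewski's theorem adds one closed disk at a time; its intersection with the others
  is empty, hence connected. In \<open>reach_exit\<close> this provides a way around finitely many
  disks.\<close>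

lemma complement_disks_connected:
  assumes "finite K"
  shows "connected (- (\<Union>k\<in>K. closure (Q k)))"
  using assms
proof (induction K rule: finite_induct)
  case empty
  have "connected (UNIV :: complex set)" by (intro convex_connected convex_UNIV)
  then show ?case by simp
next
  case (insert k K)
  have "connected (- (closure (Q k) \<union> (\<Union>k\<in>K. closure (Q k))))"
  proof (rule Janiszewski_connected)
    show "compact (closure (Q k))" by (rule compact_cl_Q)
    show "closed (\<Union>k\<in>K. closure (Q k))" using insert by (intro closed_UN) auto
    have "closure (Q k) \<inter> (\<Union>k\<in>K. closure (Q k)) = {}" using insert(2) cl_disj by blast
    then show "connected (closure (Q k) \<inter> (\<Union>k\<in>K. closure (Q k)))" by simp
    obtain c where "simple_path c" "pathfinish c = pathstart c" "- closure (Q k) = outside (path_image c)"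
      using jordan_props[OF jordan_Q[of k]] by metis
    then show "connected (- closure (Q k))" using Jordan_inside_outside by metis
    show "connected (- (\<Union>k\<in>K. closure (Q k)))" by (rule insert.IH)
  qed
  then show ?case by simp
qed

end

section \<open>Exceptional families\<close>

lemma hausdorff1_mono: "A \<subseteq> B \<Longrightarrow> hausdorff1 A \<le> hausdorff1 B"
  unfolding hausdorff1_def by (intro SUP_mono' INF_superset_mono) auto

lemma line_integral_mono:
  assumes "I \<subseteq> J"
  shows "line_integral w (I, f) \<le> line_integral w (J, f)"
proof (cases "locally_rectifiable (J, f)")
  case True
  then have "locally_rectifiable (I, f)" using assms by (auto simp: locally_rectifiable_def)
  then show ?thesis using True assms
    unfolding line_integral_def by (auto intro!: SUP_subset_mono)
next
  case False
  then show ?thesis by (simp add: line_integral_def)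
qed

text \<open>A weight with integral at least 1 over a subpath has it over the whole path.\<close>

lemma mod2_null_subpaths:
  assumes "mod2 \<Gamma> = 0"
  shows "mod2 {\<gamma> \<in> \<Delta>. \<exists>I. I \<subseteq> fst \<gamma> \<and> (I, snd \<gamma>) \<in> \<Gamma>} = 0"
proof -
  have "mod2 {\<gamma> \<in> \<Delta>. \<exists>I. I \<subseteq> fst \<gamma> \<and> (I, snd \<gamma>) \<in> \<Gamma>} \<le> mod2 \<Gamma>"
    unfolding mod2_def
  proof (rule INF_superset_mono, rule subsetI)
    fix w assume w: "w \<in> {w \<in> borel_measurable borel. \<forall>\<gamma>\<in>\<Gamma>. 1 \<le> line_integral w \<gamma>}"
    have "1 \<le> line_integral w \<gamma>" if I: "I \<subseteq> fst \<gamma>" "(I, snd \<gamma>) \<in> \<Gamma>" for \<gamma> I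
      using w I line_integral_mono[OF I(1), of w "snd \<gamma>"] by (force intro: order_trans)
    then show "w \<in> {w \<in> borel_measurable borel. \<forall>\<gamma>\<in>{\<gamma> \<in> \<Delta>. \<exists>I. I \<subseteq> fst \<gamma> \<and> (I, snd \<gamma>) \<in> \<Gamma>}. 1 \<le> line_integral w \<gamma>}"
      using w by blast
  qed simp
  then show ?thesis using assms by simp
qed

lemma ennreal_finite_ex: "x < \<infinity> \<Longrightarrow> \<exists>t\<ge>0. x = ennreal t"
  by (cases x) auto

context rel_carpet
begin

lemma trace_sub: "I \<subseteq> fst \<gamma> \<Longrightarrow> path_trace (I, snd \<gamma>) \<subseteq> path_trace \<gamma>"
  by (auto simp: path_trace_def)

text \<open>After this enlargement, unexceptional paths have only unexceptional subpaths and finite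
  sums of \<open>\<rho>\<close>. Where the sum of \<open>\<rho>\<close> is infinite, so is that of
  each positive multiple, and such multiples have arbitrarily small energy.\<close>

lemma null_enlarge:
  assumes G: "carpet_mod ver \<Omega> Q \<Gamma> = 0" and \<rho>: "\<And>i. 0 \<le> \<rho> i" "(\<Sum>i. ennreal ((\<rho> i)\<^sup>2)) < \<infinity>"
  shows "carpet_mod ver \<Omega> Q {\<gamma> \<in> \<Delta>. (\<exists>I. I \<subseteq> fst \<gamma> \<and> (I, snd \<gamma>) \<in> \<Gamma>) \<or>
       psum (\<lambda>i. ennreal (\<rho> i)) (hit (path_trace \<gamma>)) = \<infinity>} = 0" (is "carpet_mod ver \<Omega> Q ?D = 0")
proof -
  obtain T where T: "T \<ge> 0" "(\<Sum>i. ennreal ((\<rho> i)\<^sup>2)) = ennreal T"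
    using ennreal_finite_ex[OF \<rho>(2)] by blast
  have "carpet_mod ver \<Omega> Q ?D \<le> 0 + ennreal \<eta>" if "\<eta> > 0" for \<eta> :: real
  proof -
    \<comment> \<open>Makes the energy of \<open>d * \<rho>\<close> at most
      \<open>\<eta> / 2\<close>; the maximum of this weight and a nearly optimal one for the old
      family serves both kinds of paths. The summand 1 avoids division by zero.\<close>
    define d where "d = sqrt (\<eta> / (2 * (T + 1)))"
    have d: "d > 0" "d\<^sup>2 * T \<le> \<eta> / 2" using T \<open>\<eta> > 0\<close> by (auto simp: d_def field_simps)
    have mix: "(\<Sum>i. ennreal ((max (\<sigma> i) (d * \<rho> i))\<^sup>2)) \<le> ennreal \<eta>"
      if \<sigma>: "\<And>i. 0 \<le> \<sigma> i" "(\<Sum>i. ennreal ((\<sigma> i)\<^sup>2)) < ennreal (\<eta> / 2)" for \<sigma>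
    proof -
      have "(\<Sum>i. ennreal ((max (\<sigma> i) (d * \<rho> i))\<^sup>2)) \<le> (\<Sum>i. ennreal ((\<sigma> i)\<^sup>2) + ennreal (d\<^sup>2) * ennreal ((\<rho> i)\<^sup>2))"
      proof (rule suminf_le)
        fix i
        have "(max (\<sigma> i) (d * \<rho> i))\<^sup>2 \<le> (\<sigma> i)\<^sup>2 + d\<^sup>2 * (\<rho> i)\<^sup>2"
          by (cases "\<sigma> i \<le> d * \<rho> i") (auto simp: max_def power_mult_distrib)
        then have "ennreal ((max (\<sigma> i) (d * \<rho> i))\<^sup>2) \<le> ennreal ((\<sigma> i)\<^sup>2 + d\<^sup>2 * (\<rho> i)\<^sup>2)" by (rule ennreal_leI)
        then show "ennreal ((max (\<sigma> i) (d * \<rho> i))\<^sup>2) \<le> ennreal ((\<sigma> i)\<^sup>2) + ennreal (d\<^sup>2) * ennreal ((\<rho> i)\<^sup>2)"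
          by (simp add: ennreal_plus ennreal_mult)
      qed auto
      also have "\<dots> = (\<Sum>i. ennreal ((\<sigma> i)\<^sup>2)) + ennreal (d\<^sup>2) * (\<Sum>i. ennreal ((\<rho> i)\<^sup>2))"
        by (subst suminf_add[symmetric]) auto
      also have "\<dots> \<le> ennreal (\<eta> / 2) + ennreal (d\<^sup>2) * ennreal T"
        using \<sigma>(2) T by (intro add_mono) auto
      also have "\<dots> = ennreal (\<eta> / 2 + d\<^sup>2 * T)" using T \<open>\<eta> > 0\<close> by (simp add: ennreal_plus ennreal_mult)
      also have "\<dots> \<le> ennreal \<eta>" using d by (intro ennreal_leI) auto
      finally show ?thesis .
    qed
    have inf1: "1 \<le> psum (\<lambda>i. ennreal (max (\<sigma> i) (d * \<rho> i))) X"
      if "psum (\<lambda>i. ennreal (\<rho> i)) X = \<infinity>" for X and \<sigma> :: "nat \<Rightarrow> real"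
    proof -
      have "\<infinity> = ennreal d * psum (\<lambda>i. ennreal (\<rho> i)) X" using d that by (simp add: ennreal_mult_top)
      also have "\<dots> = psum (\<lambda>i. ennreal d * ennreal (\<rho> i)) X" by (rule psum_cmult[symmetric])
      also have "\<dots> \<le> psum (\<lambda>i. ennreal (max (\<sigma> i) (d * \<rho> i))) X"
        using d \<rho>(1) by (intro psum_mono) (auto simp: ennreal_mult[symmetric] intro!: ennreal_leI)
      finally have "psum (\<lambda>i. ennreal (max (\<sigma> i) (d * \<rho> i))) X = \<infinity>" by (simp add: top.extremum_unique)
      then show ?thesis by simp
    qed
    have sub1: "1 \<le> psum (\<lambda>i. ennreal (max (\<sigma> i) (d * \<rho> i))) (hit (path_trace \<gamma>))"
      if "1 \<le> psum (\<lambda>i. ennreal (\<sigma> i)) (hit (path_trace (I, snd \<gamma>)))" "I \<subseteq> fst \<gamma>" for \<sigma> :: "nat \<Rightarrow> real" and I \<gamma>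
    proof -
      have "psum (\<lambda>i. ennreal (\<sigma> i)) (hit (path_trace (I, snd \<gamma>))) \<le> psum (\<lambda>i. ennreal (max (\<sigma> i) (d * \<rho> i))) (hit (path_trace \<gamma>))"
        using trace_sub[OF that(2)] by (intro psum_mono disks_meeting_mono ennreal_leI) auto
      then show ?thesis using that(1) by (rule order_trans[rotated])
    qed
    have nn: "0 \<le> max (\<sigma> i) (d * \<rho> i)" for \<sigma> :: "nat \<Rightarrow> real" and i
      using d \<rho>(1)[of i] by (simp add: le_max_iff_disj)
    show ?thesis
    proof (cases ver)
      case Strong
      then have "mod_strong \<Omega> Q \<Gamma> < ennreal (\<eta> / 2)" using G \<open>\<eta> > 0\<close> by simp
      then obtain \<sigma> where \<sigma>: "\<forall>i. 0 \<le> \<sigma> i" "\<And>\<gamma>. \<gamma> \<in> \<Gamma> \<Longrightarrow> hausdorff1 (path_trace \<gamma> \<inter> S) = 0 \<Longrightarrow>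
          psum (\<lambda>i. ennreal (\<sigma> i)) (hit (path_trace \<gamma>)) \<ge> 1" "(\<Sum>i. ennreal ((\<sigma> i)\<^sup>2)) < ennreal (\<eta> / 2)"
        unfolding mod_strong_def INF_less_iff infsum_psum by blast
      have adm: "1 \<le> psum (\<lambda>i. ennreal (max (\<sigma> i) (d * \<rho> i))) (hit (path_trace \<gamma>))"
        if \<gamma>: "\<gamma> \<in> ?D" "hausdorff1 (path_trace \<gamma> \<inter> S) = 0" for \<gamma>
      proof (cases "psum (\<lambda>i. ennreal (\<rho> i)) (hit (path_trace \<gamma>)) = \<infinity>")
        case True
        then show ?thesis by (rule inf1)
      next
        case False
        then obtain I where I: "I \<subseteq> fst \<gamma>" "(I, snd \<gamma>) \<in> \<Gamma>" using \<gamma>(1) by blast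
        have "hausdorff1 (path_trace (I, snd \<gamma>) \<inter> S) \<le> hausdorff1 (path_trace \<gamma> \<inter> S)"
          using trace_sub[OF I(1)] by (intro hausdorff1_mono) blast
        then have "hausdorff1 (path_trace (I, snd \<gamma>) \<inter> S) = 0" using \<gamma>(2) by simp
        then show ?thesis using \<sigma>(2)[OF I(2)] I(1) by (intro sub1)
      qed
      have "mod_strong \<Omega> Q ?D \<le> (\<Sum>i. ennreal ((max (\<sigma> i) (d * \<rho> i))\<^sup>2))"
        unfolding mod_strong_def infsum_psum using adm nn by (intro INF_lower) blast
      also have "\<dots> \<le> ennreal \<eta>" using \<sigma> by (intro mix) auto
      finally show ?thesis using Strong by simp
    next
      case Weak
      then have "mod_weak Q \<Gamma> < ennreal (\<eta> / 2)" using G \<open>\<eta> > 0\<close> by simp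
      then obtain \<sigma> \<Gamma>\<^sub>0 where \<sigma>: "\<forall>i. 0 \<le> \<sigma> i" "mod2 \<Gamma>\<^sub>0 = 0" "\<And>\<gamma>. \<gamma> \<in> \<Gamma> - \<Gamma>\<^sub>0 \<Longrightarrow>
          psum (\<lambda>i. ennreal (\<sigma> i)) (hit (path_trace \<gamma>)) \<ge> 1" "(\<Sum>i. ennreal ((\<sigma> i)\<^sup>2)) < ennreal (\<eta> / 2)"
        unfolding mod_weak_def INF_less_iff infsum_psum by blast
      define \<Gamma>\<^sub>1 where "\<Gamma>\<^sub>1 = {\<gamma> \<in> ?D. \<exists>I. I \<subseteq> fst \<gamma> \<and> (I, snd \<gamma>) \<in> \<Gamma>\<^sub>0}"
      have m1: "mod2 \<Gamma>\<^sub>1 = 0" unfolding \<Gamma>\<^sub>1_def by (rule mod2_null_subpaths[OF \<sigma>(2)])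
      have adm: "1 \<le> psum (\<lambda>i. ennreal (max (\<sigma> i) (d * \<rho> i))) (hit (path_trace \<gamma>))"
        if \<gamma>: "\<gamma> \<in> ?D - \<Gamma>\<^sub>1" for \<gamma>
      proof (cases "psum (\<lambda>i. ennreal (\<rho> i)) (hit (path_trace \<gamma>)) = \<infinity>")
        case True
        then show ?thesis by (rule inf1)
      next
        case False
        then obtain I where I: "I \<subseteq> fst \<gamma>" "(I, snd \<gamma>) \<in> \<Gamma>" using \<gamma> by blast
        then have "(I, snd \<gamma>) \<notin> \<Gamma>\<^sub>0" using \<gamma> unfolding \<Gamma>\<^sub>1_def by blast
        then show ?thesis using \<sigma>(3)[of "(I, snd \<gamma>)"] I by (intro sub1) auto
      qed
      have "mod_weak Q ?D \<le> (\<Sum>i. ennreal ((max (\<sigma> i) (d * \<rho> i))\<^sup>2))"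
        unfolding mod_weak_def infsum_psum
      proof (rule INF_lower, rule CollectI, intro conjI)
        show "\<forall>i. 0 \<le> max (\<sigma> i) (d * \<rho> i)" using nn by blast
        show "\<exists>\<Gamma>\<^sub>0\<subseteq>?D. mod2 \<Gamma>\<^sub>0 = 0 \<and> (\<forall>\<gamma>\<in>?D - \<Gamma>\<^sub>0. 1 \<le> psum (\<lambda>i. ennreal (max (\<sigma> i) (d * \<rho> i))) (hit (path_trace \<gamma>)))"
          using m1 adm by (intro exI[of _ \<Gamma>\<^sub>1] conjI ballI) (auto simp: \<Gamma>\<^sub>1_def)
      qed
      also have "\<dots> \<le> ennreal \<eta>" using \<sigma> by (intro mix) auto
      finally show ?thesis using Weak by simp
    qed
  qed
  then have "carpet_mod ver \<Omega> Q ?D \<le> 0" by (rule ennreal_le_epsilon)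
  then show ?thesis by simp
qed

lemma tame_by_swap:
  assumes "continuous_on {s..t} f" "f ` {s..t} \<subseteq> \<Omega>"
    "\<And>a b. s \<le> a \<Longrightarrow> a \<le> b \<Longrightarrow> b \<le> t \<Longrightarrow> f a \<in> S \<Longrightarrow> f b \<in> S \<Longrightarrow> ennreal \<bar>v (f a) - v (f b)\<bar> \<le> psum \<rho> (hit (f ` {a..b}))"
  shows "tame_by \<rho> v f s t"
  using assms unfolding tame_by_def by blast

lemma planar_path_cont:
  assumes "\<gamma> \<in> paths_in \<Omega>" "{a..b} \<subseteq> fst \<gamma>"
  shows "continuous_on {a..b} (snd \<gamma>)" "snd \<gamma> ` {a..b} \<subseteq> \<Omega>"
proof -
  obtain f where f: "continuous_on (closure (fst \<gamma>)) f" "\<And>t. t \<in> fst \<gamma> \<Longrightarrow> f t = snd \<gamma> t"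
    using assms(1) by (auto simp: paths_in_def is_planar_path_def)
  have "continuous_on {a..b} f" by (rule continuous_on_subset[OF f(1)]) (use assms(2) closure_subset in blast)
  then show "continuous_on {a..b} (snd \<gamma>)" using f(2) assms(2) by (subst continuous_on_cong[of _ _ _ f]) auto
  show "snd \<gamma> ` {a..b} \<subseteq> \<Omega>" using assms by (auto simp: paths_in_def path_trace_def)
qed

lemma path_interval:
  assumes "\<gamma> \<in> paths_in \<Omega>" "a \<in> fst \<gamma>" "b \<in> fst \<gamma>"
  shows "{a..b} \<subseteq> fst \<gamma>"
proof -
  have "is_interval (fst \<gamma>)" using assms(1) by (simp add: paths_in_def is_planar_path_def)
  then show ?thesis using assms(2,3) by (meson atLeastAtMost_iff mem_is_interval_1_I subsetI)
qed

lemma sub_path_in: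
  assumes "\<gamma> \<in> paths_in \<Omega>" "{a..b} \<subseteq> fst \<gamma>" "a \<le> b"
  shows "({a..b}, snd \<gamma>) \<in> paths_in \<Omega>"
  using planar_path_cont[OF assms(1,2)] assms
  unfolding paths_in_def is_planar_path_def path_trace_def
  by (auto simp: is_interval_cc intro!: exI[of _ "snd \<gamma>"])

text \<open>As no subpath is exceptional, the inequality can be applied to each subinterval
  separately; constant subpaths, which the upper gradient condition leaves out, are trivial.\<close>

lemma unexceptional_tame:
  assumes G: "\<And>\<gamma> x y. \<gamma> \<in> paths_in \<Omega> \<Longrightarrow> \<gamma> \<notin> \<Gamma> \<Longrightarrow> nonconstant \<gamma> \<Longrightarrow> x \<in> path_trace \<gamma> \<Longrightarrow> x \<in> S \<Longrightarrow> y \<in> path_trace \<gamma> \<Longrightarrow> y \<in> S \<Longrightarrow>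
       ennreal \<bar>v x - v y\<bar> \<le> psum \<rho> (hit (path_trace \<gamma>))"
    and \<gamma>: "\<gamma> \<in> paths_in \<Omega>" "\<And>I. I \<subseteq> fst \<gamma> \<Longrightarrow> (I, snd \<gamma>) \<notin> \<Gamma>" and st: "{s..t} \<subseteq> fst \<gamma>"
  shows "tame_by \<rho> v (snd \<gamma>) s t"
proof (rule tame_by_swap)
  show "continuous_on {s..t} (snd \<gamma>)" "snd \<gamma> ` {s..t} \<subseteq> \<Omega>" using planar_path_cont[OF \<gamma>(1) st] by auto
  fix a b assume ab: "s \<le> a" "a \<le> b" "b \<le> t" "snd \<gamma> a \<in> S" "snd \<gamma> b \<in> S"
  have sub: "{a..b} \<subseteq> fst \<gamma>" using st ab by (meson atLeastatMost_subset_iff order_trans)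
  show "ennreal \<bar>v (snd \<gamma> a) - v (snd \<gamma> b)\<bar> \<le> psum \<rho> (hit (snd \<gamma> ` {a..b}))"
  proof (cases "nonconstant ({a..b}, snd \<gamma>)")
    case True
    have "ennreal \<bar>v (snd \<gamma> a) - v (snd \<gamma> b)\<bar> \<le> psum \<rho> (hit (path_trace ({a..b}, snd \<gamma>)))"
      using ab True sub_path_in[OF \<gamma>(1) sub] \<gamma>(2)[OF sub] by (intro G) (auto simp: path_trace_def)
    then show ?thesis by (simp add: path_trace_def)
  next
    case False
    then obtain d where "\<And>t. t \<in> {a..b} \<Longrightarrow> snd \<gamma> t = d" by (auto simp: nonconstant_def)
    then have "snd \<gamma> a = snd \<gamma> b" using ab by simp
    then show ?thesis by simp
  qed
qed

text \<open>Made for test functions obtained from a Sobolev function \<open>f\<close> by truncation.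
  Energy carries over term by term, the mass is bounded by maxima and oscillations of
  \<open>f\<close> and by diameters, and the upper gradient property has to be checked only along
  tame paths with finite sums, since the others are exceptional by
  \<open>null_enlarge\<close>.\<close>

lemma sobolev_of_real:
  assumes f: "f \<in> sobolev_loc ver \<Omega> Q" and cb: "cball x R \<subseteq> \<Omega>" and h: "pbdd h"
    and hO: "\<And>k. pO h k \<le> pO (rl f) k"
    and hb: "\<And>k z. z \<in> frontier (Q k) \<Longrightarrow> \<bar>h z\<bar> \<le> \<bar>rl f z\<bar> + C"
    and h0: "\<And>k z. k \<notin> hit (ball x R) \<Longrightarrow> z \<in> frontier (Q k) \<Longrightarrow> h z = 0"
    and ht: "\<And>g s t. tame (rl f) g s t \<Longrightarrow>
        psum (\<lambda>k. ennreal (if k \<in> hit (ball x R) then pO (rl f) k else 0)) (hit (g ` {s..t})) < \<infinity> \<Longrightarrow> tame h g s t"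
  shows "(\<lambda>z. ereal (h z)) \<in> sobolev ver \<Omega> Q"
proof -
  define I where "I = hit (ball x R)"
  define v where "v = rl f"
  have v: "pbdd v" using sobolev_loc_peri(5)[OF f] by (simp add: v_def)
  have sO: "psum (\<lambda>k. ennreal ((pO v k)\<^sup>2)) I < \<infinity>" and sM: "psum (\<lambda>k. ennreal ((pM v k * dm k)\<^sup>2)) I < \<infinity>"
    using sobolev_loc_sums[OF f cb] by (auto simp: I_def v_def)
  have sD: "psum (\<lambda>k. ennreal ((dm k)\<^sup>2)) I < \<infinity>" unfolding I_def by (rule dm_sq_sum)
  obtain D where D: "D \<ge> 0" "psum (\<lambda>k. ennreal ((dm k)\<^sup>2)) I = ennreal D"
    using ennreal_finite_ex[OF sD] by blast
  \<comment> \<open>A summable family is bounded; this turns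
    \<open>(pO v k)\<^sup>2 * (dm k)\<^sup>2\<close> into a multiple of a summable term.\<close>
  have dD: "(dm k)\<^sup>2 \<le> D" if "k \<in> I" for k
    using psum_ge[OF that, of "\<lambda>k. ennreal ((dm k)\<^sup>2)"] D by simp
  have z: "pM h k = 0" "pO h k = 0" if "k \<notin> I" for k
  proof -
    have "h ` frontier (Q k) = {0}" using h0[of k] that front_ne[of k] by (auto simp: I_def image_iff)
    then show "pM h k = 0" "pO h k = 0" by (auto simp: pM_def pO_def pm_def)
  qed
  have osc: "sq_osc Q (\<lambda>z. ereal (h z)) J < \<infinity>" for J
  proof -
    have "sq_osc Q (\<lambda>z. ereal (h z)) J = psum (\<lambda>k. ennreal ((pO h k)\<^sup>2)) J"
      using pO_nonneg[OF h] by (simp add: sq_osc_def infsum_psum peri_ereal[OF h] ennreal_power)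
    also have "\<dots> \<le> psum (\<lambda>k. ennreal ((pO v k)\<^sup>2)) I"
      unfolding psum_def using z hO pO_nonneg[OF h] by (intro suminf_le) (auto intro!: ennreal_leI power_mono simp: v_def)
    finally show ?thesis using sO by simp
  qed
  have mass: "sq_mass Q (\<lambda>z. ereal (h z)) J < \<infinity>" for J
  proof -
    have bd: "(pM h k * dm k)\<^sup>2 \<le> 3 * (pM v k * dm k)\<^sup>2 + (3 * D) * (pO v k)\<^sup>2 + (3 * C\<^sup>2) * (dm k)\<^sup>2" if k: "k \<in> I" for k
    proof -
      have zb: "\<bar>h z\<bar> \<le> \<bar>pM v k\<bar> + pO v k + \<bar>C\<bar>" if "z \<in> frontier (Q k)" for z
        using hb[OF that] pM_ge[OF v that] pm_le[OF v that] by (simp add: v_def[symmetric] pO_def)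
      obtain z0 where z0: "z0 \<in> frontier (Q k)" using front_ne by blast
      have "pM h k \<le> \<bar>pM v k\<bar> + pO v k + \<bar>C\<bar>" using zb by (intro pM_least) (simp add: abs_le_iff)
      moreover have "- (\<bar>pM v k\<bar> + pO v k + \<bar>C\<bar>) \<le> pM h k" using zb[OF z0] pM_ge[OF h z0] by linarith
      ultimately have "\<bar>pM h k\<bar> \<le> \<bar>pM v k\<bar> + pO v k + \<bar>C\<bar>" by (simp add: abs_le_iff)
      then have "(pM h k)\<^sup>2 \<le> (\<bar>pM v k\<bar> + pO v k + \<bar>C\<bar>)\<^sup>2" by (simp add: abs_le_square_iff[symmetric])
      also have "\<dots> \<le> 3 * (pM v k)\<^sup>2 + 3 * (pO v k)\<^sup>2 + 3 * C\<^sup>2"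
      proof -
        have "(a + b + c)\<^sup>2 \<le> 3 * a\<^sup>2 + 3 * b\<^sup>2 + 3 * c\<^sup>2" for a b c :: real
        proof -
          have "0 \<le> (a - b)\<^sup>2 + (b - c)\<^sup>2 + (a - c)\<^sup>2" by simp
          then show ?thesis by (simp add: power2_eq_square algebra_simps)
        qed
        from this[of "\<bar>pM v k\<bar>" "pO v k" "\<bar>C\<bar>"] show ?thesis by simp
      qed
      finally have "(pM h k)\<^sup>2 * (dm k)\<^sup>2 \<le> (3 * (pM v k)\<^sup>2 + 3 * (pO v k)\<^sup>2 + 3 * C\<^sup>2) * (dm k)\<^sup>2"
        by (intro mult_right_mono) auto
      also have "\<dots> = 3 * (pM v k * dm k)\<^sup>2 + 3 * (pO v k)\<^sup>2 * (dm k)\<^sup>2 + 3 * C\<^sup>2 * (dm k)\<^sup>2"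
        by (simp add: algebra_simps power_mult_distrib)
      also have "3 * (pO v k)\<^sup>2 * (dm k)\<^sup>2 \<le> 3 * (pO v k)\<^sup>2 * D" using dD[OF k] by (intro mult_left_mono) auto
      finally show ?thesis by (simp add: power_mult_distrib mult_ac)
    qed
    have "sq_mass Q (\<lambda>z. ereal (h z)) J = psum (\<lambda>k. ennreal ((pM h k * dm k)\<^sup>2)) J"
      by (simp add: sq_mass_def infsum_psum peri_ereal[OF h] e2ennreal_ereal power2_eq_square ennreal_mult[symmetric] mult_ac)
    also have "\<dots> \<le> psum (\<lambda>k. ennreal 3 * ennreal ((pM v k * dm k)\<^sup>2) + ennreal (3 * D) * ennreal ((pO v k)\<^sup>2) + ennreal (3 * C\<^sup>2) * ennreal ((dm k)\<^sup>2)) I"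
      unfolding psum_def
    proof (rule suminf_le)
      fix k
      show "(if k \<in> J then ennreal ((pM h k * dm k)\<^sup>2) else 0) \<le>
        (if k \<in> I then ennreal 3 * ennreal ((pM v k * dm k)\<^sup>2) + ennreal (3 * D) * ennreal ((pO v k)\<^sup>2) + ennreal (3 * C\<^sup>2) * ennreal ((dm k)\<^sup>2) else 0)"
      proof (cases "k \<in> I")
        case True
        have "ennreal ((pM h k * dm k)\<^sup>2) \<le> ennreal (3 * (pM v k * dm k)\<^sup>2 + (3 * D) * (pO v k)\<^sup>2 + (3 * C\<^sup>2) * (dm k)\<^sup>2)"
          by (rule ennreal_leI[OF bd[OF True]])
        also have "\<dots> = ennreal 3 * ennreal ((pM v k * dm k)\<^sup>2) + ennreal (3 * D) * ennreal ((pO v k)\<^sup>2) + ennreal (3 * C\<^sup>2) * ennreal ((dm k)\<^sup>2)"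
          using D(1) by (simp add: ennreal_plus ennreal_mult)
        finally show ?thesis using True by simp
      next
        case False
        then show ?thesis using z(1) by simp
      qed
    qed auto
    also have "\<dots> = ennreal 3 * psum (\<lambda>k. ennreal ((pM v k * dm k)\<^sup>2)) I + ennreal (3 * D) * psum (\<lambda>k. ennreal ((pO v k)\<^sup>2)) I + ennreal (3 * C\<^sup>2) * psum (\<lambda>k. ennreal ((dm k)\<^sup>2)) I"
      by (simp only: psum_add psum_cmult)
    also have "\<dots> < \<infinity>"
    proof -
      have fin: "ennreal c * X < top" if "X < \<infinity>" for c X using that by (simp add: ennreal_mult_less_top)
      show ?thesis unfolding infinity_ennreal_def ennreal_add_less_top using fin[OF sM] fin[OF sO] fin[OF sD] by blast
    qed
    finally show ?thesis .
  qed
  define \<rho> where "\<rho> k = (if k \<in> I then pO v k else 0)" for k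
  obtain \<Gamma> where G: "\<Gamma> \<subseteq> paths_in \<Omega>" "carpet_mod ver \<Omega> Q \<Gamma> = 0"
    "\<And>\<gamma> x y. \<gamma> \<in> paths_in \<Omega> \<Longrightarrow> \<gamma> \<notin> \<Gamma> \<Longrightarrow> nonconstant \<gamma> \<Longrightarrow> x \<in> path_trace \<gamma> \<Longrightarrow> x \<in> S \<Longrightarrow> y \<in> path_trace \<gamma> \<Longrightarrow> y \<in> S \<Longrightarrow>
       ennreal \<bar>v x - v y\<bar> \<le> psum (eO v) (hit (path_trace \<gamma>))"
    unfolding v_def by (rule sobolev_upper_gradient[OF f]) blast
  define \<Delta> where "\<Delta> = {\<gamma> \<in> paths_in \<Omega>. (\<exists>I. I \<subseteq> fst \<gamma> \<and> (I, snd \<gamma>) \<in> \<Gamma>) \<or>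
       psum (\<lambda>i. ennreal (\<rho> i)) (hit (path_trace \<gamma>)) = \<infinity>}"
  have "carpet_mod ver \<Omega> Q \<Delta> = 0"
    unfolding \<Delta>_def
  proof (rule null_enlarge[OF G(2)])
    show "0 \<le> \<rho> i" for i using pO_nonneg[OF v] by (simp add: \<rho>_def)
    have "(\<Sum>i. ennreal ((\<rho> i)\<^sup>2)) = psum (\<lambda>k. ennreal ((pO v k)\<^sup>2)) I"
      unfolding psum_def by (intro suminf_cong) (simp add: \<rho>_def)
    then show "(\<Sum>i. ennreal ((\<rho> i)\<^sup>2)) < \<infinity>" using sO by simp
  qed
  have "upper_gradient ver \<Omega> Q (peri_osc Q (\<lambda>z. ereal (h z))) (\<lambda>z. ereal (h z))"
    unfolding upper_gradient_def
  proof (intro exI[of _ \<Delta>] conjI ballI impI)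
    show "\<Delta> \<subseteq> paths_in \<Omega>" by (auto simp: \<Delta>_def)
    show "carpet_mod ver \<Omega> Q \<Delta> = 0" by fact
    fix \<gamma> x y assume \<gamma>: "\<gamma> \<in> paths_in \<Omega> - \<Delta>" and xy: "x \<in> path_trace \<gamma> \<inter> S" "y \<in> path_trace \<gamma> \<inter> S"
    show "\<bar>ereal (h x)\<bar> \<noteq> \<infinity>" "\<bar>ereal (h y)\<bar> \<noteq> \<infinity>" by auto
    have main: "ennreal \<bar>h (snd \<gamma> a) - h (snd \<gamma> b)\<bar> \<le> psum (eO h) (hit (path_trace \<gamma>))"
      if ab: "a \<in> fst \<gamma>" "b \<in> fst \<gamma>" "a \<le> b" "snd \<gamma> a \<in> S" "snd \<gamma> b \<in> S" for a b
    proof -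
      have sub: "{a..b} \<subseteq> fst \<gamma>"
        using path_interval[OF DiffD1[OF \<gamma>]] ab(1,2) by blast
      have tr: "snd \<gamma> ` {a..b} \<subseteq> path_trace \<gamma>" using sub by (auto simp: path_trace_def)
      have "tame v (snd \<gamma>) a b"
      proof (rule unexceptional_tame[OF G(3) _ _ sub])
        show "\<gamma> \<in> paths_in \<Omega>" using \<gamma> by blast
        show "(I, snd \<gamma>) \<notin> \<Gamma>" if "I \<subseteq> fst \<gamma>" for I using \<gamma> that unfolding \<Delta>_def by blast
      qed
      moreover have "psum (\<lambda>k. ennreal (\<rho> k)) (hit (snd \<gamma> ` {a..b})) < \<infinity>"
      proof -
        have "psum (\<lambda>k. ennreal (\<rho> k)) (hit (snd \<gamma> ` {a..b})) \<le> psum (\<lambda>k. ennreal (\<rho> k)) (hit (path_trace \<gamma>))"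
          by (rule psum_hit_mono[OF tr])
        also have "\<dots> < \<infinity>"
        proof -
          have "psum (\<lambda>k. ennreal (\<rho> k)) (hit (path_trace \<gamma>)) \<noteq> \<infinity>" using \<gamma> unfolding \<Delta>_def by blast
          then show ?thesis by (simp add: top.not_eq_extremum)
        qed
        finally show ?thesis .
      qed
      ultimately have "tame h (snd \<gamma>) a b"
        unfolding v_def \<rho>_def I_def by (rule ht)
      then have "ennreal \<bar>h (snd \<gamma> a) - h (snd \<gamma> b)\<bar> \<le> psum (eO h) (hit (snd \<gamma> ` {a..b}))"
        using ab by (intro tame_byD) auto
      also have "\<dots> \<le> psum (eO h) (hit (path_trace \<gamma>))" by (rule psum_hit_mono[OF tr])
      finally show ?thesis .
    qed
    obtain a b where ab: "a \<in> fst \<gamma>" "b \<in> fst \<gamma>" "x = snd \<gamma> a" "y = snd \<gamma> b" "x \<in> S" "y \<in> S"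
      using xy by (auto simp: path_trace_def)
    have "ennreal \<bar>h x - h y\<bar> \<le> psum (eO h) (hit (path_trace \<gamma>))"
    proof (cases "a \<le> b")
      case True
      then show ?thesis using main[of a b] ab by simp
    next
      case False
      then show ?thesis using main[of b a] ab by (simp add: abs_minus_commute)
    qed
    moreover have "peri_osc Q (\<lambda>z. ereal (h z)) = eO h" using peri_ereal(3)[OF h] by blast
    ultimately show "e2ennreal \<bar>ereal (h x) - ereal (h y)\<bar> \<le> (\<Sum>\<^sub>\<infinity>i\<in>hit (path_trace \<gamma>). peri_osc Q (\<lambda>z. ereal (h z)) i)"
      by (simp add: infsum_psum e2ennreal_ereal)
  qed
  then show ?thesis
    unfolding sobolev_def sobolev_loc_def using osc mass by (simp add: peri_ereal[OF h])
qed

end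

section \<open>Superlevel components\<close>

context rel_carpet
begin

text \<open>In a disk the minimum over the circle has to exceed \<open>c\<close>, so that every
  value in the sense of \<open>val\<close> does.\<close>

definition above :: "(complex \<Rightarrow> real) \<Rightarrow> real \<Rightarrow> complex \<Rightarrow> bool" where
  "above v c w \<longleftrightarrow> w \<in> \<Omega> \<and> (w \<in> S \<longrightarrow> c < v w) \<and> (\<forall>k. w \<in> Q k \<longrightarrow> c < pm v k)"

text \<open>A substitute for the component of the superlevel set that contains \<open>z0\<close>.
  Steps run along tame paths, on which the function is controlled. Closed disks above the level are
  added as a whole, so that such a disk is reached entirely as soon as it is touched.\<close>

inductive reach :: "(complex \<Rightarrow> real) \<Rightarrow> real \<Rightarrow> complex \<Rightarrow> complex \<Rightarrow> bool" for v c z0 where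
  base: "reach v c z0 z0"
| path: "reach v c z0 (g a) \<Longrightarrow> tame v g s t \<Longrightarrow> a \<in> {s..t} \<Longrightarrow> b \<in> {s..t} \<Longrightarrow>
    (\<And>r. r \<in> {s..t} \<Longrightarrow> above v c (g r)) \<Longrightarrow> reach v c z0 (g b)"
| disk: "reach v c z0 z \<Longrightarrow> z \<in> closure (Q k) \<Longrightarrow> c < pm v k \<Longrightarrow> w \<in> closure (Q k) \<Longrightarrow> reach v c z0 w"

lemma above_disk:
  assumes "pbdd v" "c < pm v k" "w \<in> closure (Q k)"
  shows "above v c w"
  unfolding above_def
proof (intro conjI allI impI)
  show "w \<in> \<Omega>" using assms cl_Q_sub by blast
  show "c < v w" if "w \<in> S" using pm_le[OF assms(1) S_cl_front[OF that assms(3)]] assms(2) by linarith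
  show "c < pm v j" if "w \<in> Q j" for j
    using assms cl_disj[of w j k] that closure_subset[of "Q j"] by auto
qed

text \<open>Each step adjoins a compact connected set, a path or a closed disk, that meets what was
  collected before.\<close>

lemma reach_compact:
  assumes "reach v c z0 z" and v: "pbdd v" and z0: "above v c z0"
  shows "\<exists>C. compact C \<and> connected C \<and> z0 \<in> C \<and> z \<in> C \<and> (\<forall>w\<in>C. above v c w)"
  using assms(1)
proof induction
  case base
  then show ?case using z0 by (intro exI[of _ "{z0}"]) auto
next
  case (path g a s t b)
  then obtain C where C: "compact C" "connected C" "z0 \<in> C" "g a \<in> C" "\<forall>w\<in>C. above v c w" by blast
  have cont: "continuous_on {s..t} g" by (rule tame_by_cont[OF path(2)])
  have "g a \<in> C \<inter> g ` {s..t}" using C path by blast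
  then have "connected (C \<union> g ` {s..t})"
    using C cont by (intro connected_Un connected_continuous_image) auto
  moreover have "compact (C \<union> g ` {s..t})" using C cont by (intro compact_Un compact_continuous_image) auto
  ultimately show ?case using C path by (intro exI[of _ "C \<union> g ` {s..t}"]) auto
next
  case (disk z k w)
  then obtain C where C: "compact C" "connected C" "z0 \<in> C" "z \<in> C" "\<forall>w\<in>C. above v c w" by blast
  have "connected (C \<union> closure (Q k))"
    using C disk conn_Q by (intro connected_Un connected_imp_connected_closure) auto
  moreover have "compact (C \<union> closure (Q k))" using C compact_cl_Q by (intro compact_Un) auto
  ultimately show ?case using C disk above_disk[OF v] by (intro exI[of _ "C \<union> closure (Q k)"]) auto
qed

lemma reach_above: "reach v c z0 z \<Longrightarrow> pbdd v \<Longrightarrow> above v c z0 \<Longrightarrow> above v c z"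
  using reach_compact by blast

section \<open>Cutting off on a reached set\<close>

lemma first_sphere:
  fixes g :: "real \<Rightarrow> complex"
  assumes "continuous_on {a..b} g" "a \<le> b" "dist x (g a) < R" "R \<le> dist x (g b)"
  shows "\<exists>t\<in>{a..b}. dist x (g t) = R \<and> (\<forall>r\<in>{a..t}. dist x (g r) \<le> R)"
proof -
  have ivt: "\<exists>s\<in>{a..t}. dist x (g s) = R" if t: "t \<in> {a..b}" "R \<le> dist x (g t)" for t
    using IVT'[of "\<lambda>s. dist x (g s)" a R t] t assms(1,3)
    by (force intro!: continuous_intros intro: continuous_on_subset)
  define T where "T = {t\<in>{a..b}. dist x (g t) = R}"
  have "compact T"
  proof -
    have "T = {a..b} \<inter> (\<lambda>t. dist x (g t)) -` {R}" by (auto simp: T_def)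
    moreover have "closed ({a..b} \<inter> (\<lambda>t. dist x (g t)) -` {R})"
      using assms(1) by (intro continuous_closed_preimage continuous_intros) auto
    moreover have "bounded T" by (rule bounded_subset[OF bounded_closed_interval]) (auto simp: T_def)
    ultimately show ?thesis by (simp add: compact_eq_bounded_closed)
  qed
  moreover have "T \<noteq> {}" using ivt[of b] assms by (auto simp: T_def)
  ultimately obtain t where t: "t \<in> T" "\<And>s. s \<in> T \<Longrightarrow> t \<le> s" using compact_attains_inf by metis
  have "dist x (g r) \<le> R" if r: "r \<in> {a..t}" for r
  proof (rule ccontr)
    assume n: "\<not> dist x (g r) \<le> R"
    then obtain s where "s \<in> {a..r}" "dist x (g s) = R" using ivt[of r] r t by (auto simp: T_def)
    then have "t \<le> s" using r t by (intro t(2)) (auto simp: T_def)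
    then have "s = r" using r \<open>s \<in> {a..r}\<close> by auto
    then show False using n \<open>dist x (g s) = R\<close> by simp
  qed
  then show ?thesis using t by (auto simp: T_def)
qed

text \<open>Keeps only the disks near the ball: a local Sobolev function guarantees square
  summability of just these oscillations.\<close>

definition lsupp :: "complex \<Rightarrow> real \<Rightarrow> (complex \<Rightarrow> real) \<Rightarrow> nat \<Rightarrow> ennreal" where
  "lsupp x R v k = ennreal (if k \<in> hit (ball x R) then pO v k else 0)"

lemma psum_lsupp:
  assumes "X \<subseteq> ball x R"
  shows "psum (eO v) (hit X) = psum (lsupp x R v) (hit X)"
proof -
  have "hit X \<subseteq> hit (ball x R)" by (rule disks_meeting_mono[OF assms])
  then show ?thesis by (intro antisym psum_mono) (auto simp: lsupp_def)
qed

text \<open>On its way from a reached to an unreached point the path must pass a place that is not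
  above \<open>c\<close>. The descent to it is paid by one sum of oscillations, and by a second one
  if that place is inside a disk.\<close>

lemma leave_bound:
  assumes v: "pbdd v" and z0: "above v c z0" and A: "\<And>z. reach v c z0 z \<Longrightarrow> z \<in> ball x R0" and R: "R0 < R1"
    and tm: "tame v g a b" and a: "reach v c z0 (g a)" "g a \<in> S" and b1: "b1 \<in> {a..b}" "\<not> reach v c z0 (g b1)"
  shows "ennreal (v (g a) - c) \<le> 2 * psum (lsupp x R1 v) (hit (g ` {a..b}))"
proof -
  have cont: "continuous_on {a..b} g" and Om: "g ` {a..b} \<subseteq> \<Omega>"
    by (rule tame_by_cont[OF tm], rule tame_by_Om[OF tm])
  \<comment> \<open>The reached set stays in \<open>ball x R0\<close>, so a path that leaves
    \<open>ball x R1\<close> is already unreached when it first hits the sphere of radius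
    \<open>R0\<close>. It is stopped there, which keeps the sums local.\<close>
  obtain b2 where b2: "b2 \<in> {a..b}" "\<not> reach v c z0 (g b2)" "g ` {a..b2} \<subseteq> ball x R1"
  proof (cases "g ` {a..b1} \<subseteq> ball x R1")
    case True
    then show ?thesis using that b1 by blast
  next
    case False
    then obtain t where t: "t \<in> {a..b1}" "R1 \<le> dist x (g t)" by force
    have "continuous_on {a..t} g" using t b1 by (intro continuous_on_subset[OF cont]) auto
    then obtain t' where t': "t' \<in> {a..t}" "dist x (g t') = R0" "\<forall>r\<in>{a..t'}. dist x (g r) \<le> R0"
      using first_sphere[of a t g x R0] t A[OF a(1)] R by auto
    show ?thesis
    proof (rule that[of t'])
      show "t' \<in> {a..b}" using t t' b1 by auto
      show "\<not> reach v c z0 (g t')" using A[of "g t'"] t' by auto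
      show "g ` {a..t'} \<subseteq> ball x R1" using t'(3) R by force
    qed
  qed
  have tm2: "tame v g a b2" using b2 by (intro tame_by_sub[OF tm]) auto
  obtain t where t: "t \<in> {a..b2}" "\<not> above v c (g t)"
  proof -
    have "\<not> (\<forall>r\<in>{a..b2}. above v c (g r))"
    proof
      assume "\<forall>r\<in>{a..b2}. above v c (g r)"
      then have "reach v c z0 (g b2)"
        using b2(1) by (intro reach.path[OF a(1) tm2, of b2]) auto
      then show False using b2 by blast
    qed
    then show ?thesis using that by blast
  qed
  define P where "P = psum (lsupp x R1 v) (hit (g ` {a..b}))"
  have le: "ennreal \<bar>v (g a) - v (g r)\<bar> \<le> P" if r: "r \<in> {a..t}" "g r \<in> S" for r
  proof -
    have "ennreal \<bar>v (g a) - v (g r)\<bar> \<le> psum (eO v) (hit (g ` {a..r}))"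
      using r t b2 a by (intro tame_byD[OF tm]) auto
    also have "\<dots> = psum (lsupp x R1 v) (hit (g ` {a..r}))"
    proof (rule psum_lsupp)
      have "g ` {a..r} \<subseteq> g ` {a..b2}" using r t by (intro image_mono) auto
      then show "g ` {a..r} \<subseteq> ball x R1" using b2(3) by blast
    qed
    also have "\<dots> \<le> P" unfolding P_def using r t b2 by (intro psum_hit_mono image_mono) auto
    finally show ?thesis .
  qed
  have PP: "y \<le> P \<Longrightarrow> y \<le> 2 * P" for y
    by (metis (no_types) dual_order.trans mult.left_neutral mult_right_mono one_le_numeral zero_le)
  have gt: "g t \<in> \<Omega>" using Om t b2 by auto
  show ?thesis unfolding P_def[symmetric]
  proof (cases "g t \<in> S")
    case True
    then have "v (g t) \<le> c" using t(2) gt S_not_Q by (auto simp: above_def)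
    then have "ennreal (v (g a) - c) \<le> ennreal \<bar>v (g a) - v (g t)\<bar>" by (intro ennreal_leI) auto
    also have "\<dots> \<le> P" using t True by (intro le) auto
    finally show "ennreal (v (g a) - c) \<le> 2 * P" by (rule PP)
  next
    case False
    then obtain k where k: "g t \<in> Q k" "pm v k \<le> c" using t(2) gt by (auto simp: above_def not_less)
    have "continuous_on {a..t} g" using t b2 by (intro continuous_on_subset[OF cont]) auto
    then obtain r where r: "r \<in> {a..t}" "g r \<in> frontier (Q k)"
      using path_enters[of a t g k] t k a(2) S_not_Q subsetD[OF closure_subset k(1)] by auto
    have vr: "v (g r) - c \<le> pO v k" using pM_ge[OF v r(2)] k(2) by (auto simp: pO_def)
    have "k \<in> hit (g ` {a..b2})" using k t by (auto simp: disks_meeting_def)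
    then have "k \<in> hit (ball x R1)" using disks_meeting_mono[OF b2(3)] by blast
    then have "ennreal (pO v k) = lsupp x R1 v k" by (simp add: lsupp_def)
    also have "\<dots> \<le> P" unfolding P_def using k t b2 by (intro psum_ge) (auto simp: disks_meeting_def)
    finally have 2: "ennreal (pO v k) \<le> P" .
    have 1: "ennreal \<bar>v (g a) - v (g r)\<bar> \<le> P" using r front_S by (intro le) auto
    have "ennreal (v (g a) - c) \<le> ennreal (\<bar>v (g a) - v (g r)\<bar> + pO v k)" using vr by (intro ennreal_leI) auto
    also have "\<dots> = ennreal \<bar>v (g a) - v (g r)\<bar> + ennreal (pO v k)" using pO_nonneg[OF v] by (simp add: ennreal_plus)
    also have "\<dots> \<le> P + P" by (intro add_mono 1 2)
    also have "\<dots> = 2 * P" by (rule mult_2[symmetric])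
    finally show "ennreal (v (g a) - c) \<le> 2 * P" .
  qed
qed

text \<open>Adding this function cuts \<open>v\<close> off at the level \<open>c\<close> on a single component.\<close>

definition trunc :: "(complex \<Rightarrow> real) \<Rightarrow> real \<Rightarrow> complex \<Rightarrow> complex \<Rightarrow> real" where
  "trunc v c z0 z = (if reach v c z0 z then - max (v z - c) 0 else 0)"

lemma trunc_pbdd:
  assumes v: "pbdd v"
  shows "pbdd (trunc v c z0)"
  unfolding pbdd_def
proof
  fix k
  have "\<bar>trunc v c z0 z\<bar> \<le> \<bar>pM v k\<bar> + \<bar>c\<bar>" if "z \<in> frontier (Q k)" for z
    using pM_ge[OF v that] by (auto simp: trunc_def max_def)
  then show "bounded (trunc v c z0 ` frontier (Q k))" by (intro boundedI[of _ "\<bar>pM v k\<bar> + \<bar>c\<bar>"]) auto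
qed

text \<open>If the whole piece is reached, the truncation varies no more than \<open>v\<close>;
  otherwise its values at both ends are small by \<open>leave_bound\<close>. This gives four local
  sums, which \<open>tame_self_improve\<close> replaces by the oscillations of the truncation
  itself.\<close>

lemma trunc_tame:
  assumes v: "pbdd v" and z0: "above v c z0" and A: "\<And>z. reach v c z0 z \<Longrightarrow> z \<in> ball x R0" and R: "R0 < R1"
    and tm: "tame v g s t" and fin: "psum (lsupp x R1 v) (hit (g ` {s..t})) < \<infinity>"
  shows "tame (trunc v c z0) g s t"
proof -
  define h where "h = trunc v c z0"
  have "tame_by (\<lambda>k. 4 * lsupp x R1 v k) h g s t"
  proof (rule tame_by_swap)
    show "continuous_on {s..t} g" "g ` {s..t} \<subseteq> \<Omega>" by (rule tame_by_cont[OF tm], rule tame_by_Om[OF tm])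
    fix a b assume ab: "s \<le> a" "a \<le> b" "b \<le> t" "g a \<in> S" "g b \<in> S"
    define P where "P = psum (lsupp x R1 v) (hit (g ` {a..b}))"
    have tab: "tame v g a b" using ab by (intro tame_by_sub[OF tm]) auto
    have "ennreal \<bar>h (g a) - h (g b)\<bar> \<le> 4 * P"
    proof (cases "\<forall>r\<in>{a..b}. reach v c z0 (g r)")
      case True
      then have "reach v c z0 (g a)" "reach v c z0 (g b)" using ab by auto
      then have "ennreal \<bar>h (g a) - h (g b)\<bar> \<le> ennreal \<bar>v (g a) - v (g b)\<bar>"
        unfolding h_def trunc_def by (intro ennreal_leI) (simp add: max_def abs_minus_commute)
      also have "\<dots> \<le> psum (eO v) (hit (g ` {a..b}))" using ab by (intro tame_byD[OF tab]) auto
      also have "\<dots> = P"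
      proof -
        have "g ` {a..b} \<subseteq> ball x R1" using True A R by force
        then show ?thesis unfolding P_def by (rule psum_lsupp)
      qed
      also have "P \<le> 4 * P"
        by (metis (no_types) mult.left_neutral mult_right_mono one_le_numeral zero_le)
      finally show ?thesis .
    next
      case False
      then obtain b1 where b1: "b1 \<in> {a..b}" "\<not> reach v c z0 (g b1)" by blast
      have 1: "ennreal \<bar>h (g a)\<bar> \<le> 2 * P"
      proof (cases "reach v c z0 (g a)")
        case True
        have "ennreal \<bar>h (g a)\<bar> = ennreal (v (g a) - c)"
          using True by (cases "v (g a) \<le> c") (auto simp: h_def trunc_def max_def ennreal_neg)
        then show ?thesis using leave_bound[OF v z0 A R tab True ab(4) b1] by (simp add: P_def)
      qed (simp add: h_def trunc_def)
      have 2: "ennreal \<bar>h (g b)\<bar> \<le> 2 * P"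
      proof (cases "reach v c z0 (g b)")
        case True
        have eq: "ennreal \<bar>h (g b)\<bar> = ennreal (v (g b) - c)"
          using True by (cases "v (g b) \<le> c") (auto simp: h_def trunc_def max_def ennreal_neg)
        have "ennreal (v ((\<lambda>r. g (- r)) (- b)) - c) \<le> 2 * psum (lsupp x R1 v) (hit ((\<lambda>r. g (- r)) ` {- b..- a}))"
          by (rule leave_bound[OF v z0 A R tame_by_reverse[OF tab], of "- b1"]) (use True ab b1 in auto)
        then show ?thesis using eq by (simp add: P_def image_uminus_compose)
      qed (simp add: h_def trunc_def)
      have "ennreal \<bar>h (g a) - h (g b)\<bar> \<le> ennreal (\<bar>h (g a)\<bar> + \<bar>h (g b)\<bar>)" by (intro ennreal_leI) auto
      also have "\<dots> = ennreal \<bar>h (g a)\<bar> + ennreal \<bar>h (g b)\<bar>" by (simp add: ennreal_plus)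
      also have "\<dots> \<le> 2 * P + 2 * P" by (intro add_mono 1 2)
      also have "\<dots> = (2 + 2) * P" by (rule distrib_right[symmetric])
      also have "(2 + 2 :: ennreal) = 4" by simp
      finally show ?thesis .
    qed
    then show "ennreal \<bar>h (g a) - h (g b)\<bar> \<le> psum (\<lambda>k. 4 * lsupp x R1 v k) (hit (g ` {a..b}))"
      by (simp add: psum_cmult P_def)
  qed
  moreover have "psum (\<lambda>k. 4 * lsupp x R1 v k) (hit (g ` {s..t})) < \<infinity>"
    using fin by (simp add: psum_cmult ennreal_mult_less_top)
  ultimately show ?thesis unfolding h_def by (rule tame_self_improve) (rule trunc_pbdd[OF v])
qed

lemma pt_swap: "pt b r t = pt (\<not> b) t r"
  by (auto simp: pt_def)

lemma nrm_pt: "nrm (pt b r t - z) < e \<longleftrightarrow> \<bar>r - (if b then Im z else Re z)\<bar> < e \<and> \<bar>t - (if b then Re z else Im z)\<bar> < e"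
  by (auto simp: nrm_def pt_def)

text \<open>The unexceptional lines of a small square all cross each other, so the function is constant there.\<close>

lemma grid_constant:
  assumes h: "pbdd h" and G: "open G" "G \<subseteq> \<Omega>"
    and lines: "\<And>b. AE r in lborel. \<forall>p q. p \<le> q \<and> pt b r ` {p..q} \<subseteq> G \<longrightarrow> tame h (pt b r) p q"
    and K: "\<And>k. k \<notin> K \<Longrightarrow> pO h k = 0" "\<And>k. k \<in> K \<Longrightarrow> G \<inter> Q k = {}"
    and C: "connected C" "C \<subseteq> G" "z0 \<in> C" "y0 \<in> C"
    and e0: "e0 > 0" "\<And>w r. w \<in> ball z0 e0 \<Longrightarrow> val h w r \<Longrightarrow> r = \<kappa>0"
    and e1: "e1 > 0" "\<And>w r. w \<in> ball y0 e1 \<Longrightarrow> val h w r \<Longrightarrow> r = \<kappa>1"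
  shows "\<kappa>0 = \<kappa>1"
proof -
  define T where "T b r \<longleftrightarrow> (\<forall>p q. p \<le> q \<and> pt b r ` {p..q} \<subseteq> G \<longrightarrow> tame h (pt b r) p q)" for b r
  have AET: "AE r in lborel. T b r" for b using lines by (simp add: T_def)
  \<comment> \<open>\<open>\<kappa>\<close> is the local constant at \<open>z\<close>, observed on
    generic lines only; at other points nothing is known about \<open>h\<close>.\<close>
  define N where "N z \<kappa> e \<longleftrightarrow> e > 0 \<and> (\<forall>b r t w. T b r \<and> nrm (pt b r t - z) < e \<and> val h (pt b r t) w \<longrightarrow> w = \<kappa>)" for z \<kappa> e
  \<comment> \<open>The disks that meet \<open>G\<close> have oscillation 0, so the value cannot
    change along one generic line.\<close>
  have same: "w = w'" if sq: "\<And>z'. nrm (z' - z) < e \<Longrightarrow> z' \<in> G" and Tr: "T b r"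
     and t: "nrm (pt b r t - z) < e" "nrm (pt b r t' - z) < e" and w: "val h (pt b r t) w" "val h (pt b r t') w'"
     for z e b r t t' w w'
  proof -
    have sub: "pt b r ` {min t t'..max t t'} \<subseteq> G"
    proof
      fix z' assume "z' \<in> pt b r ` {min t t'..max t t'}"
      then obtain s where s: "s \<in> {min t t'..max t t'}" "z' = pt b r s" by blast
      have "nrm (pt b r s - z) < e" using t s(1) unfolding nrm_pt by (auto simp: min_def max_def split: if_splits)
      then show "z' \<in> G" using sq s by blast
    qed
    then have tm: "tame h (pt b r) (min t t') (max t t')" using Tr unfolding T_def by simp
    have "psum (eO h) (hit (pt b r ` {min t t'..max t t'})) = psum (\<lambda>_. 0) (hit (pt b r ` {min t t'..max t t'}))"
    proof (intro antisym psum_mono)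
      fix k assume "k \<in> hit (pt b r ` {min t t'..max t t'})"
      then have "k \<notin> K" using sub K(2)[of k] by (auto simp: disks_meeting_def)
      then show "ennreal (pO h k) \<le> 0" "0 \<le> ennreal (pO h k)" using K(1) by auto
    qed auto
    then have z: "psum (eO h) (hit (pt b r ` {min t t'..max t t'})) = 0" by (simp add: psum_def)
    show "w = w'"
    proof (cases "t \<le> t'")
      case True
      then show ?thesis using tame_val[OF tm h _ , of w w'] w z by (simp add: min_def max_def)
    next
      case False
      then show ?thesis using tame_val[OF tm h _ , of w' w] w z by (simp add: min_def max_def)
    qed
  qed
  \<comment> \<open>Perpendicular generic lines share a value at their crossing point.\<close>
  have opp: "w = w'" if sq: "\<And>z'. nrm (z' - z) < e \<Longrightarrow> z' \<in> G" and Tr: "T b r" "T (\<not> b) r'"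
     and t: "nrm (pt b r t - z) < e" "nrm (pt (\<not> b) r' t' - z) < e" and w: "val h (pt b r t) w" "val h (pt (\<not> b) r' t') w'"
     for z e b r t r' t' w w'
  proof -
    have cr: "pt b r r' = pt (\<not> b) r' r" using pt_swap by blast
    have nc: "nrm (pt b r r' - z) < e" using t unfolding nrm_pt by (auto split: if_splits)
    then have "pt b r r' \<in> \<Omega>" using sq G by blast
    then obtain w'' where w'': "val h (pt b r r') w''" using val_ex[OF h] by blast
    have "w = w''" by (rule same[OF sq Tr(1) t(1) nc w(1) w''])
    moreover have "w' = w''" by (rule same[OF sq Tr(2) t(2) _ w(2)]) (use nc w'' cr in auto)
    ultimately show ?thesis by simp
  qed
  have dense: "\<exists>r. T b r \<and> \<bar>r - a\<bar> < e" if "e > 0" for b a e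
    using AE_dense[OF AET, of "a - e" "a + e" b] that by (auto simp: abs_less_iff)
  \<comment> \<open>Two parallel lines are compared by means of a perpendicular generic line, which
    exists by density.\<close>
  have const: "w = w'" if sq: "\<And>z'. nrm (z' - z) < e \<Longrightarrow> z' \<in> G" and Tr: "T b r" "T b' r'"
     and t: "nrm (pt b r t - z) < e" "nrm (pt b' r' t' - z) < e" and w: "val h (pt b r t) w" "val h (pt b' r' t') w'"
     for z e b r t b' r' t' w w'
  proof (cases "b' = (\<not> b)")
    case True
    then show ?thesis using opp[OF sq Tr(1) _ t(1) _ w(1)] Tr(2) t(2) w(2) by blast
  next
    case False
    then have b: "b' = b" by blast
    have "e > 0" using t(1) nrm_nonneg by (meson order_le_less_trans)
    obtain r'' where r'': "T (\<not> b) r''" "\<bar>r'' - (if \<not> b then Im z else Re z)\<bar> < e" using dense[OF \<open>e > 0\<close>] by blast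
    have n: "nrm (pt (\<not> b) r'' r - z) < e" using t(1) r''(2) unfolding nrm_pt by (auto split: if_splits)
    then obtain w'' where w'': "val h (pt (\<not> b) r'' r) w''" using val_ex[OF h] sq G by blast
    have "w = w''" by (rule opp[OF sq Tr(1) r''(1) t(1) n w(1) w''])
    moreover have "w' = w''" using opp[OF sq _ r''(1) _ n _ w''] Tr(2) t(2) w(2) b by blast
    ultimately show ?thesis by simp
  qed
  have sqG: "\<exists>e>0. \<forall>z'. nrm (z' - z) < e \<longrightarrow> z' \<in> G" if zG: "z \<in> G" for z
  proof -
    obtain d where d: "d > 0" "ball z d \<subseteq> G" using G(1) zG open_contains_ball by blast
    have "z' \<in> G" if "nrm (z' - z) < d/2" for z'
      using that cmod_le_nrm[of "z' - z"] d by (auto simp: dist_norm norm_minus_commute subset_iff)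
    then show ?thesis using d by (intro exI[of _ "d/2"]) auto
  qed
  have gen: "\<exists>b r t w. T b r \<and> nrm (pt b r t - z) < e \<and> val h (pt b r t) w" if ze: "z \<in> G" "e > 0" for z e
  proof -
    obtain d where d: "d > 0" "\<And>z'. nrm (z' - z) < d \<Longrightarrow> z' \<in> G" using sqG[OF ze(1)] by blast
    obtain r where r: "T True r" "\<bar>r - Im z\<bar> < min d e" using dense[of "min d e" True "Im z"] d ze by auto
    have n: "nrm (pt True r (Re z) - z) < min d e" using r d ze unfolding nrm_pt by simp
    then have "pt True r (Re z) \<in> \<Omega>" using d G by auto
    then obtain w where "val h (pt True r (Re z)) w" using val_ex[OF h] by blast
    then show ?thesis using r n by (intro exI[of _ True] exI[of _ r] exI[of _ "Re z"] exI[of _ w]) auto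
  qed
  have ex: "\<exists>\<kappa> e. N z \<kappa> e" if z: "z \<in> G" for z
  proof -
    obtain e where e: "e > 0" "\<And>z'. nrm (z' - z) < e \<Longrightarrow> z' \<in> G" using sqG[OF z] by blast
    obtain b r t w where g: "T b r" "nrm (pt b r t - z) < e" "val h (pt b r t) w" using gen[OF z e(1)] by blast
    have "N z w e" unfolding N_def using e(1) const[OF e(2) _ g(1) _ g(2) _ g(3)] by blast
    then show ?thesis by blast
  qed
  have uniq: "\<kappa> = \<kappa>'" if z: "z \<in> G" and n: "N z \<kappa> e" "N z \<kappa>' e'" for z \<kappa> \<kappa>' e e'
  proof -
    have "min e e' > 0" using n by (simp add: N_def)
    then obtain b r t w where g: "T b r" "nrm (pt b r t - z) < min e e'" "val h (pt b r t) w" using gen[OF z] by blast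
    then have "w = \<kappa>" "w = \<kappa>'" using n unfolding N_def by (meson min_less_iff_conj)+
    then show ?thesis by simp
  qed
  have shift: "N z' \<kappa> (e/2)" if n: "N z \<kappa> e" "nrm (z' - z) < e/2" for z z' \<kappa> e
    unfolding N_def
  proof (intro conjI allI impI)
    show "0 < e/2" using n by (simp add: N_def)
    fix b r t w assume H: "T b r \<and> nrm (pt b r t - z') < e/2 \<and> val h (pt b r t) w"
    have "nrm (pt b r t - z) < e"
    proof -
      have "nrm (pt b r t - z') < e/2" using H by blast
      then show ?thesis using nrm_diff[of "pt b r t - z" "z' - z"] n(2) by simp
    qed
    then show "w = \<kappa>" using n(1) H unfolding N_def by blast
  qed
  have nb: "\<exists>d>0. ball z d \<subseteq> {z'. nrm (z' - z) < e/2}" if "e > 0" for z e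
  proof -
    have "nrm (z' - z) < e/2" if "z' \<in> ball z (e/2)" for z'
      using that nrm_le_cmod[of "z' - z"] by (auto simp: dist_norm norm_minus_commute)
    then show ?thesis using \<open>e > 0\<close> by (intro exI[of _ "e/2"]) auto
  qed
  have nsb: "w \<in> ball z e" if "nrm (w - z) < e/2" for w z e
    using that cmod_le_nrm[of "w - z"] by (simp add: dist_norm norm_minus_commute)
  \<comment> \<open>The local constant does not change from \<open>z\<close> to nearby points, so
    \<open>X\<close> and \<open>Y\<close> are open, and connectedness of \<open>C\<close> carries
    the constant from \<open>z0\<close> to \<open>y0\<close>.\<close>
  define X where "X = {z\<in>G. \<exists>e. N z \<kappa>0 e}"
  define Y where "Y = {z\<in>G. \<exists>\<kappa> e. \<kappa> \<noteq> \<kappa>0 \<and> N z \<kappa> e}"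
  have opN: "open {z\<in>G. \<exists>\<kappa>\<in>Z. \<exists>e. N z \<kappa> e}" for Z
    unfolding open_contains_ball
  proof
    fix z assume "z \<in> {z\<in>G. \<exists>\<kappa>\<in>Z. \<exists>e. N z \<kappa> e}"
    then obtain \<kappa> e where ze: "z \<in> G" "\<kappa> \<in> Z" "N z \<kappa> e" by blast
    then have "e > 0" by (simp add: N_def)
    then obtain d where d: "d > 0" "ball z d \<subseteq> {z'. nrm (z' - z) < e/2}" using nb by blast
    obtain d' where d': "d' > 0" "ball z d' \<subseteq> G" using G(1) ze(1) open_contains_ball by blast
    have "ball z (min d d') \<subseteq> {z\<in>G. \<exists>\<kappa>\<in>Z. \<exists>e. N z \<kappa> e}"
    proof
      fix t assume "t \<in> ball z (min d d')"
      then have "nrm (t - z) < e/2" "t \<in> G" using d(2) d'(2) by auto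
      then show "t \<in> {z\<in>G. \<exists>\<kappa>\<in>Z. \<exists>e. N z \<kappa> e}" using shift[OF ze(3)] ze(2) by blast
    qed
    then show "\<exists>e>0. ball z e \<subseteq> {z\<in>G. \<exists>\<kappa>\<in>Z. \<exists>e. N z \<kappa> e}" using d d' by (intro exI[of _ "min d d'"]) auto
  qed
  have "open X" using opN[of "{\<kappa>0}"] by (simp add: X_def)
  moreover have "open Y"
  proof -
    have "Y = {z\<in>G. \<exists>\<kappa>\<in>-{\<kappa>0}. \<exists>e. N z \<kappa> e}" by (auto simp: Y_def)
    then show ?thesis using opN by simp
  qed
  moreover have "X \<inter> Y \<inter> C = {}" using uniq by (auto simp: X_def Y_def)
  moreover have "C \<subseteq> X \<union> Y"
  proof
    fix z assume "z \<in> C"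
    then have z: "z \<in> G" using C by blast
    then obtain \<kappa> e where "N z \<kappa> e" using ex by blast
    then show "z \<in> X \<union> Y" using z by (cases "\<kappa> = \<kappa>0") (auto simp: X_def Y_def)
  qed
  moreover have "z0 \<in> X"
  proof -
    have "N z0 \<kappa>0 (e0/2)"
      unfolding N_def using e0(1) e0(2)[OF nsb] by auto
    then show ?thesis using C by (auto simp: X_def)
  qed
  then have "X \<inter> C \<noteq> {}" using C by blast
  ultimately have "Y \<inter> C = {}" using connectedD[OF C(1)] by blast
  then have "y0 \<in> X" using C \<open>C \<subseteq> X \<union> Y\<close> by blast
  then obtain e where e: "N y0 \<kappa>0 e" by (auto simp: X_def)
  have "N y0 \<kappa>1 (e1/2)"
    unfolding N_def using e1(1) e1(2)[OF nsb] by auto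
  then show ?thesis using uniq[OF _ e] C by blast
qed

end

section \<open>Superlevel components are not compactly contained\<close>

context rel_carpet
begin

text \<open>Minimality for balls and real test functions. Requiring both \<open>h\<close> and
  \<open>- h\<close> to be Sobolev makes the property symmetric under a change of sign, so that
  sublevel sets need no separate treatment.\<close>

definition lmin :: "version \<Rightarrow> (complex \<Rightarrow> ereal) \<Rightarrow> bool" where
  "lmin ver u \<longleftrightarrow> u \<in> sobolev_loc ver \<Omega> Q \<and>
     (\<forall>x R h. 0 < R \<and> cball x R \<subseteq> \<Omega> \<and> pbdd h \<and>
        (\<lambda>z. ereal (h z)) \<in> sobolev ver \<Omega> Q \<and> (\<lambda>z. ereal (- h z)) \<in> sobolev ver \<Omega> Q \<and>
        (\<forall>z\<in>S - ball x R. h z = 0) \<longrightarrow>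
        psum (\<lambda>k. ennreal ((pO (rl u) k)\<^sup>2)) (hit (ball x R)) \<le>
        psum (\<lambda>k. ennreal ((pO (\<lambda>z. rl u z + h z) k)\<^sup>2)) (hit (ball x R)))"

lemma pO_cong: "(\<And>z. z \<in> frontier (Q k) \<Longrightarrow> f z = g z) \<Longrightarrow> pO f k = pO g k"
  unfolding pO_def pM_def pm_def by (simp cong: image_cong)

lemma pbdd_add: "pbdd f \<Longrightarrow> pbdd g \<Longrightarrow> pbdd (\<lambda>z. f z + g z)"
  unfolding pbdd_def using bounded_plus_comp by blast

lemma dirichlet_real:
  assumes u: "u \<in> sobolev_loc ver \<Omega> Q" and h: "pbdd h"
  shows "dirichlet_energy Q V (\<lambda>z. u z + ereal (h z)) = psum (\<lambda>k. ennreal ((pO (\<lambda>z. rl u z + h z) k)\<^sup>2)) (hit V)"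
proof -
  have b: "pbdd (\<lambda>z. rl u z + h z)" using sobolev_loc_peri(5)[OF u] h by (rule pbdd_add)
  have "peri_osc Q (\<lambda>z. u z + ereal (h z)) k = peri_osc Q (\<lambda>z. ereal (rl u z + h z)) k" for k
  proof -
    have "u z + ereal (h z) = ereal (rl u z + h z)" if "z \<in> frontier (Q k)" for z
      using sobolev_loc_peri(1)[OF u that] by (metis plus_ereal.simps(1))
    then show ?thesis unfolding peri_osc_def peri_max_def peri_min_def by (simp cong: SUP_cong INF_cong)
  qed
  then show ?thesis
    unfolding dirichlet_energy_def sq_osc_def infsum_psum
    using peri_ereal(3)[OF b] pO_nonneg[OF b] by (simp add: ennreal_power)
qed

lemma harmonic_lmin:
  assumes "carpet_harmonic ver \<Omega> Q u"
  shows "lmin ver u"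
  unfolding lmin_def
proof (intro conjI allI impI)
  show u: "u \<in> sobolev_loc ver \<Omega> Q" using assms by (simp add: carpet_harmonic_def)
  fix x R h
  assume H: "0 < R \<and> cball x R \<subseteq> \<Omega> \<and> pbdd h \<and>
        (\<lambda>z. ereal (h z)) \<in> sobolev ver \<Omega> Q \<and> (\<lambda>z. ereal (- h z)) \<in> sobolev ver \<Omega> Q \<and>
        (\<forall>z\<in>S - ball x R. h z = 0)"
  have "dirichlet_energy Q (ball x R) u \<le> dirichlet_energy Q (ball x R) (\<lambda>z. u z + ereal (h z))"
    using assms H ball_cc[of x R] unfolding carpet_harmonic_def by (auto simp: zero_ereal_def)
  moreover have "dirichlet_energy Q (ball x R) u = psum (\<lambda>k. ennreal ((pO (rl u) k)\<^sup>2)) (hit (ball x R))"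
    unfolding dirichlet_energy_def sq_osc_def infsum_psum
    using sobolev_loc_peri(4)[OF u] pO_nonneg[OF sobolev_loc_peri(5)[OF u]] by (simp add: ennreal_power)
  moreover have "pbdd h" using H by blast
  ultimately show "psum (\<lambda>k. ennreal ((pO (rl u) k)\<^sup>2)) (hit (ball x R)) \<le>
        psum (\<lambda>k. ennreal ((pO (\<lambda>z. rl u z + h z) k)\<^sup>2)) (hit (ball x R))"
    using dirichlet_real[OF u, of h "ball x R"] by (simp only:)
qed

lemma rl_uminus: "rl (\<lambda>z. - u z) = (\<lambda>z. - rl u z)"
  by (simp add: rl_def fun_eq_iff)

text \<open>The mass condition speaks of maxima, so for \<open>- u\<close> the minima have to be
  bounded by maxima and oscillations; the bound \<open>D\<close> on the squared diameters absorbs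
  the latter.\<close>

lemma uminus_sobolev_loc:
  assumes u: "u \<in> sobolev_loc ver \<Omega> Q"
  shows "(\<lambda>z. - u z) \<in> sobolev_loc ver \<Omega> Q"
proof -
  have mx: "peri_max Q (\<lambda>z. - u z) k = - peri_min Q u k" "peri_min Q (\<lambda>z. - u z) k = - peri_max Q u k" for k
    unfolding peri_max_def peri_min_def by (simp_all add: ereal_SUP_uminus_eq ereal_INF_uminus_eq)
  have fin: "\<bar>peri_max Q (\<lambda>z. - u z) k\<bar> \<noteq> \<infinity> \<and> \<bar>peri_min Q (\<lambda>z. - u z) k\<bar> \<noteq> \<infinity>" for k
    using sobolev_loc_peri(2,3)[OF u] by (simp add: mx)
  have osc: "peri_osc Q (\<lambda>z. - u z) = peri_osc Q u"
    using sobolev_loc_peri(2,3)[OF u] by (simp add: peri_osc_def mx fun_eq_iff)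
  have mass: "sq_mass Q (\<lambda>z. - u z) (hit (ball x r)) < \<infinity>" if r: "0 < r" "compactly_contained (ball x r) \<Omega>" for x r
  proof -
    have cb: "cball x r \<subseteq> \<Omega>" using r by (simp add: compactly_contained_def)
    define I where "I = hit (ball x r)"
    obtain D where D: "D \<ge> 0" "psum (\<lambda>k. ennreal ((dm k)\<^sup>2)) I = ennreal D"
      using ennreal_finite_ex[OF dm_sq_sum[of x r]] by (auto simp: I_def)
    have dD: "(dm k)\<^sup>2 \<le> D" if "k \<in> I" for k
      using psum_ge[OF that, of "\<lambda>k. ennreal ((dm k)\<^sup>2)"] D by simp
    have bd: "(pm (rl u) k * dm k)\<^sup>2 \<le> 2 * (pM (rl u) k * dm k)\<^sup>2 + (2 * D) * (pO (rl u) k)\<^sup>2" if "k \<in> I" for k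
    proof -
      have "(pm (rl u) k)\<^sup>2 = (pM (rl u) k - pO (rl u) k)\<^sup>2" by (simp add: pO_def)
      also have "\<dots> \<le> 2 * (pM (rl u) k)\<^sup>2 + 2 * (pO (rl u) k)\<^sup>2"
      proof -
        have "0 \<le> (pM (rl u) k + pO (rl u) k)\<^sup>2" by simp
        then show ?thesis by (simp add: power2_eq_square algebra_simps)
      qed
      finally have "(pm (rl u) k)\<^sup>2 * (dm k)\<^sup>2 \<le> (2 * (pM (rl u) k)\<^sup>2 + 2 * (pO (rl u) k)\<^sup>2) * (dm k)\<^sup>2"
        by (intro mult_right_mono) auto
      also have "\<dots> = 2 * (pM (rl u) k * dm k)\<^sup>2 + 2 * (pO (rl u) k)\<^sup>2 * (dm k)\<^sup>2"
        by (simp add: algebra_simps power_mult_distrib)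
      also have "2 * (pO (rl u) k)\<^sup>2 * (dm k)\<^sup>2 \<le> 2 * (pO (rl u) k)\<^sup>2 * D" using dD[OF that] by (intro mult_left_mono) auto
      finally show ?thesis by (simp add: power_mult_distrib mult_ac)
    qed
    have "sq_mass Q (\<lambda>z. - u z) I = psum (\<lambda>k. ennreal ((pm (rl u) k * dm k)\<^sup>2)) I"
      using sobolev_loc_peri(3)[OF u]
      by (simp add: sq_mass_def infsum_psum mx e2ennreal_ereal power2_eq_square ennreal_mult[symmetric] mult_ac)
    also have "\<dots> \<le> psum (\<lambda>k. ennreal 2 * ennreal ((pM (rl u) k * dm k)\<^sup>2) + ennreal (2 * D) * ennreal ((pO (rl u) k)\<^sup>2)) I"
    proof (rule psum_mono)
      fix k assume k: "k \<in> I"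
      have "ennreal ((pm (rl u) k * dm k)\<^sup>2) \<le> ennreal (2 * (pM (rl u) k * dm k)\<^sup>2 + (2 * D) * (pO (rl u) k)\<^sup>2)"
        by (rule ennreal_leI[OF bd[OF k]])
      also have "\<dots> = ennreal 2 * ennreal ((pM (rl u) k * dm k)\<^sup>2) + ennreal (2 * D) * ennreal ((pO (rl u) k)\<^sup>2)"
        using D(1) by (simp add: ennreal_plus ennreal_mult)
      finally show "ennreal ((pm (rl u) k * dm k)\<^sup>2) \<le> \<dots>" .
    qed simp
    also have "\<dots> = ennreal 2 * psum (\<lambda>k. ennreal ((pM (rl u) k * dm k)\<^sup>2)) I + ennreal (2 * D) * psum (\<lambda>k. ennreal ((pO (rl u) k)\<^sup>2)) I"
      by (simp only: psum_add psum_cmult)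
    also have "\<dots> < \<infinity>"
    proof -
      have fin: "ennreal c * X < top" if "X < \<infinity>" for c X using that by (simp add: ennreal_mult_less_top)
      show ?thesis unfolding infinity_ennreal_def ennreal_add_less_top I_def
        using fin[OF sobolev_loc_sums(1)[OF u cb]] fin[OF sobolev_loc_sums(2)[OF u cb]] by blast
    qed
    finally show ?thesis by (simp add: I_def)
  qed
  have ug: "upper_gradient ver \<Omega> Q (peri_osc Q (\<lambda>z. - u z)) (\<lambda>z. - u z)"
  proof -
    have "upper_gradient ver \<Omega> Q (peri_osc Q u) u" using u by (simp add: sobolev_loc_def)
    moreover have "\<bar>- a - - b\<bar> = \<bar>a - b\<bar>" if "\<bar>a\<bar> \<noteq> \<infinity>" "\<bar>b\<bar> \<noteq> \<infinity>" for a b :: ereal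
      using that by (cases a; cases b) auto
    ultimately show ?thesis unfolding upper_gradient_def osc by (simp cong: conj_cong)
  qed
  show ?thesis
    using fin mass ug u unfolding sobolev_loc_def sq_osc_def by (simp add: osc)
qed

lemma lmin_uminus:
  assumes "lmin ver u"
  shows "lmin ver (\<lambda>z. - u z)"
  unfolding lmin_def
proof (intro conjI allI impI)
  have u: "u \<in> sobolev_loc ver \<Omega> Q" using assms by (simp add: lmin_def)
  then show "(\<lambda>z. - u z) \<in> sobolev_loc ver \<Omega> Q" by (rule uminus_sobolev_loc)
  fix x R h
  assume H: "0 < R \<and> cball x R \<subseteq> \<Omega> \<and> pbdd h \<and>
        (\<lambda>z. ereal (h z)) \<in> sobolev ver \<Omega> Q \<and> (\<lambda>z. ereal (- h z)) \<in> sobolev ver \<Omega> Q \<and>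
        (\<forall>z\<in>S - ball x R. h z = 0)"
  then have "psum (\<lambda>k. ennreal ((pO (rl u) k)\<^sup>2)) (hit (ball x R)) \<le>
        psum (\<lambda>k. ennreal ((pO (\<lambda>z. rl u z + - h z) k)\<^sup>2)) (hit (ball x R))"
    using assms pbdd_uminus[of h] unfolding lmin_def by (elim conjE allE[of _ x] allE[of _ R] allE[of _ "\<lambda>z. - h z"]) simp
  moreover have "pO (\<lambda>z. - rl u z + h z) k = pO (\<lambda>z. rl u z + - h z) k" for k
    using pO_uminus[of "\<lambda>z. rl u z + - h z" k] by simp
  ultimately show "psum (\<lambda>k. ennreal ((pO (rl (\<lambda>z. - u z)) k)\<^sup>2)) (hit (ball x R)) \<le>
        psum (\<lambda>k. ennreal ((pO (\<lambda>z. rl (\<lambda>z. - u z) z + h z) k)\<^sup>2)) (hit (ball x R))"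
    by (simp add: rl_uminus pO_uminus)
qed

lemma val_const:
  assumes "pbdd v" "val v z r" "\<And>y. y \<in> frontier (Q k) \<Longrightarrow> v y = a" "z \<in> closure (Q k)"
  shows "r = a"
proof (cases "z \<in> S")
  case True
  then show ?thesis using assms S_cl_front S_not_Q by (auto simp: val_def)
next
  case False
  then obtain j where j: "z \<in> Q j" "pm v j \<le> r" "r \<le> pM v j" using assms(2) by (auto simp: val_def)
  then have "j = k" using assms(4) cl_disj closure_subset by blast
  moreover have "pM v k \<le> a" "a \<le> pm v k" using assms(3) by (auto intro: pM_least pm_greatest)
  ultimately show ?thesis using j by auto
qed

text \<open>If the reached set \<open>A\<close> stayed in the small ball, subtracting the excess
  over \<open>c\<close> on \<open>A\<close> would give an admissible competitor. Minimality forces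
  the disks in \<open>A\<close> to have oscillation 0, so \<open>u\<close> equals a constant
  \<open>a > c\<close> on the carpet part of \<open>A\<close>, and the subtracted function has only
  two values. Its jumps sit on finitely many disks, which can be bypassed along generic lines, so
  the two values coincide.\<close>

theorem reach_exit:
  assumes lm: "lmin ver u" and cb: "cball x R1 \<subseteq> \<Omega>" and R: "0 < R0" "R0 < R1"
    and c: "c < pm (rl u) j0" and z0: "z0 \<in> Q j0"
  shows "\<exists>C. compact C \<and> connected C \<and> z0 \<in> C \<and> \<not> C \<subseteq> ball x R0 \<and> (\<forall>w\<in>C. above (rl u) c w)"
proof -
  define v where "v = rl u"
  have u: "u \<in> sobolev_loc ver \<Omega> Q" using lm by (simp add: lmin_def)
  have v: "pbdd v" using sobolev_loc_peri(5)[OF u] by (simp add: v_def)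
  have cv: "c < pm v j0" using c by (simp add: v_def)
  have ab0: "above v c z0" using above_disk[OF v cv] z0 closure_subset by blast
  define A where "A = {z. reach v c z0 z}"
  have "\<not> A \<subseteq> ball x R0"
  proof
    assume sub: "A \<subseteq> ball x R0"
    then have AR: "\<And>z. reach v c z0 z \<Longrightarrow> z \<in> ball x R0" by (auto simp: A_def)
    define I where "I = hit (ball x R1)"
    define h where "h = trunc v c z0"
    have hA: "h z = c - v z" if "z \<in> A" "z \<in> S" for z
      using reach_above[OF _ v ab0, of z] that by (auto simp: h_def trunc_def A_def above_def)
    have hnA: "h z = 0" if "z \<notin> A" for z using that by (simp add: h_def trunc_def A_def)
    have hb: "pbdd h" unfolding h_def by (rule trunc_pbdd[OF v])
    have full: "closure (Q k) \<subseteq> A" if k: "z \<in> A" "z \<in> closure (Q k)" "c < pm v k" for k z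
      using reach.disk[of v c z0 z k] k by (auto simp: A_def)
    have AI: "k \<in> I" if k: "z \<in> A" "z \<in> closure (Q k)" for k z
    proof -
      have "z \<in> ball x R1" using k sub R by auto
      then have "ball x R1 \<inter> Q k \<noteq> {}"
        using k(2) open_Int_closure_eq_empty[of "ball x R1" "Q k"] by blast
      then show ?thesis by (auto simp: I_def disks_meeting_def)
    qed
    have hfr: "h z \<in> {c - v z, 0}" if "z \<in> frontier (Q k)" for z k
      using hA[of z] hnA[of z] front_S that by blast
    have hle: "h z \<le> 0" for z by (simp add: h_def trunc_def)
    \<comment> \<open>A circle is reached entirely, or not at all, or its minimum is at most
      \<open>c\<close>. In each case neither the truncation nor the truncated function oscillates
      more than \<open>v\<close>.\<close>
    have hO: "pO h k \<le> pO v k" and hsO: "pO (\<lambda>z. v z + h z) k \<le> pO v k" for k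
    proof -
      have ge: "c - pM v k \<le> h z" if "z \<in> frontier (Q k)" "h z \<noteq> 0" for z
        using hfr[OF that(1)] that(2) pM_ge[OF v that(1)] by auto
      have "(\<forall>z\<in>frontier (Q k). h z = c - v z) \<or> (\<forall>z\<in>frontier (Q k). h z = 0) \<or> pm v k \<le> c"
      proof (cases "pm v k \<le> c \<or> frontier (Q k) \<inter> A = {}")
        case True
        then show ?thesis using hnA by blast
      next
        case False
        then obtain z where z: "z \<in> frontier (Q k)" "z \<in> A" by blast
        then have "closure (Q k) \<subseteq> A" using full[of z k] False front_iff by auto
        then show ?thesis using hA front_iff front_S by blast
      qed
      then consider "\<forall>z\<in>frontier (Q k). h z = c - v z" | "\<forall>z\<in>frontier (Q k). h z = 0"
        | "pm v k \<le> c" "\<not> (\<forall>z\<in>frontier (Q k). h z = 0)" by blast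
      then have "pO h k \<le> pO v k \<and> pO (\<lambda>z. v z + h z) k \<le> pO v k"
      proof cases
        case 1
        have "c - pM v k \<le> pm h k" "pM h k \<le> c - pm v k"
          using 1 pM_ge[OF v] pm_le[OF v] by (auto intro!: pm_greatest pM_least)
        moreover have "pO (\<lambda>z. v z + h z) k = pO (\<lambda>_. c) k" using 1 by (intro pO_cong) auto
        moreover have "pO (\<lambda>_. c) k = 0" using front_ne[of k] by (simp add: pO_def pM_def pm_def image_constant_conv)
        ultimately show ?thesis using pO_nonneg[OF v, of k] by (simp add: pO_def)
      next
        case 2
        have "pO h k = pO (\<lambda>_. 0) k" "pO (\<lambda>z. v z + h z) k = pO v k" using 2 by (auto intro!: pO_cong)
        moreover have "pO (\<lambda>_. 0) k = 0" using front_ne[of k] by (simp add: pO_def pM_def pm_def image_constant_conv)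
        ultimately show ?thesis using pO_nonneg[OF v, of k] by simp
      next
        case 3
        then obtain y where y: "y \<in> frontier (Q k)" "h y \<noteq> 0" by blast
        then have "y \<in> A" using hnA by blast
        then have "c < v y" using reach_above[OF _ v ab0, of y] y front_S by (auto simp: A_def above_def)
        then have cM: "c < pM v k" using pM_ge[OF v y(1)] by linarith
        have "c - pM v k \<le> h z" if "z \<in> frontier (Q k)" for z using ge[OF that] cM by force
        then have "c - pM v k \<le> pm h k" by (rule pm_greatest)
        moreover have "pM h k \<le> 0" using hle by (intro pM_least)
        moreover have "pm v k \<le> v z + h z \<and> v z + h z \<le> pM v k" if "z \<in> frontier (Q k)" for z
          using hfr[OF that] pM_ge[OF v that] pm_le[OF v that] 3 cM by auto
        then have "pm v k \<le> pm (\<lambda>z. v z + h z) k" "pM (\<lambda>z. v z + h z) k \<le> pM v k"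
          by (auto intro!: pm_greatest pM_least)
        ultimately show ?thesis using 3 by (simp add: pO_def)
      qed
      then show "pO h k \<le> pO v k" "pO (\<lambda>z. v z + h z) k \<le> pO v k" by blast+
    qed
    have h0: "h z = 0" if "k \<notin> I" "z \<in> frontier (Q k)" for k z
      using AI[of z k] that hnA front_iff by blast
    have hbd: "\<bar>h z\<bar> \<le> \<bar>rl u z\<bar> + \<bar>c\<bar>" for z by (auto simp: h_def trunc_def v_def max_def)
    have tt: "tame h g s t" if "tame (rl u) g s t"
        "psum (\<lambda>k. ennreal (if k \<in> hit (ball x R1) then pO (rl u) k else 0)) (hit (g ` {s..t})) < \<infinity>" for g s t
      unfolding h_def
      by (rule trunc_tame[OF v ab0 AR R(2)]) (use that in \<open>auto simp: v_def lsupp_def[abs_def]\<close>)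
    have s1: "(\<lambda>z. ereal (h z)) \<in> sobolev ver \<Omega> Q"
      by (rule sobolev_of_real[OF u cb hb _ hbd]) (use hO h0 tt in \<open>auto simp: v_def I_def\<close>)
    have s2: "(\<lambda>z. ereal (- h z)) \<in> sobolev ver \<Omega> Q"
    proof (rule sobolev_of_real[OF u cb pbdd_uminus[OF hb], of "\<bar>c\<bar>"])
      show "pO (\<lambda>z. - h z) k \<le> pO (rl u) k" for k using hO by (simp add: pO_uminus v_def)
      show "\<bar>- h z\<bar> \<le> \<bar>rl u z\<bar> + \<bar>c\<bar>" for z using hbd by simp
      show "- h z = 0" if "k \<notin> hit (ball x R1)" "z \<in> frontier (Q k)" for k z using h0 that by (simp add: I_def)
      show "tame (\<lambda>z. - h z) g s t" if "tame (rl u) g s t"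
        "psum (\<lambda>k. ennreal (if k \<in> hit (ball x R1) then pO (rl u) k else 0)) (hit (g ` {s..t})) < \<infinity>" for g s t
        using tame_by_uminus[OF tt[OF that]] by (simp add: pO_uminus)
    qed
    have hz: "h z = 0" if "z \<in> S - ball x R1" for z using that subsetD[OF sub, of z] R hnA[of z] by auto
    have en: "psum (\<lambda>k. ennreal ((pO v k)\<^sup>2)) I \<le> psum (\<lambda>k. ennreal ((pO (\<lambda>z. v z + h z) k)\<^sup>2)) I"
      using lm cb R hb s1 s2 hz unfolding lmin_def I_def v_def by simp
    have fin: "psum (\<lambda>k. ennreal ((pO v k)\<^sup>2)) I < \<infinity>"
      unfolding I_def v_def by (rule sobolev_loc_sums(1)[OF u cb])
    \<comment> \<open>On a fully reached circle \<open>v + h\<close> equals \<open>c\<close>, so the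
      competitor saves the whole term of this disk, and minimality allows no saving. Finiteness of
      the energy permits cancelling the other terms.\<close>
    have O0: "pO v k = 0" if k: "closure (Q k) \<subseteq> A" for k
    proof -
      obtain y where "y \<in> Q k" using ne_Q by blast
      then have kI: "k \<in> I" using AI[of y k] k closure_subset by blast
      have "pO (\<lambda>z. v z + h z) k = pO (\<lambda>_. c) k"
        using hA k front_iff front_S by (intro pO_cong) force
      then have "pO (\<lambda>z. v z + h z) k = 0" using front_ne[of k] by (simp add: pO_def pM_def pm_def image_constant_conv)
      then have a1: "psum (\<lambda>k. ennreal ((pO (\<lambda>z. v z + h z) k)\<^sup>2)) I \<le> psum (\<lambda>k. ennreal ((pO v k)\<^sup>2)) (I - {k})"
        unfolding psum_def using hsO pO_nonneg[OF pbdd_add[OF v hb]]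
        by (intro suminf_le) (auto intro!: ennreal_leI power_mono)
      have a2: "psum (\<lambda>k. ennreal ((pO v k)\<^sup>2)) I = ennreal ((pO v k)\<^sup>2) + psum (\<lambda>k. ennreal ((pO v k)\<^sup>2)) (I - {k})"
        using psum_Un_disjoint[of "{k}" "I - {k}" "\<lambda>k. ennreal ((pO v k)\<^sup>2)"] kI by (simp add: insert_absorb psum_finite)
      have le: "ennreal ((pO v k)\<^sup>2) + psum (\<lambda>k. ennreal ((pO v k)\<^sup>2)) (I - {k}) \<le> 0 + psum (\<lambda>k. ennreal ((pO v k)\<^sup>2)) (I - {k})"
        using order_trans[OF en a1] a2 by (simp only: add_0)
      have "psum (\<lambda>k. ennreal ((pO v k)\<^sup>2)) (I - {k}) < \<infinity>"
        using fin by (rule order_le_less_trans[rotated]) (rule psum_mono_set, blast)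
      then have "ennreal ((pO v k)\<^sup>2) \<le> 0" using le by (auto simp: add.commute)
      then show ?thesis by simp
    qed
    define a where "a = pm v j0"
    \<comment> \<open>Each step of \<open>reach\<close> meets only disks of oscillation 0, so the
      value \<open>a\<close> is propagated from the disk of \<open>z0\<close>.\<close>
    have const: "\<And>r. val v z r \<Longrightarrow> r = a" if "reach v c z0 z" for z
      using that
    proof induction
      case base
      have "closure (Q j0) \<subseteq> A"
        using full[of z0 j0] reach.base[of v c z0] z0 cv closure_subset by (auto simp: A_def)
      then have "pM v j0 = a" using O0[of j0] by (simp add: pO_def a_def)
      then have "\<And>y. y \<in> frontier (Q j0) \<Longrightarrow> v y = a" using pM_ge[OF v] pm_le[OF v] by (force simp: a_def)
      then show ?case using val_const[OF v base, of j0 a] z0 closure_subset by blast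
    next
      case (path g p s t q)
      have rg: "reach v c z0 (g r)" if "r \<in> {s..t}" for r
        using reach.path[OF path(1,2,3) that] path(5) by blast
      have z: "psum (eO v) (hit (g ` {s..t})) = 0"
      proof -
        have "psum (eO v) (hit (g ` {s..t})) \<le> psum (\<lambda>_. 0) (hit (g ` {s..t}))"
        proof (rule psum_mono)
          fix k assume "k \<in> hit (g ` {s..t})"
          then obtain r where r: "r \<in> {s..t}" "g r \<in> Q k" unfolding disks_meeting_def by blast
          then have "c < pm v k" using path(5)[OF r(1)] by (auto simp: above_def)
          then have "closure (Q k) \<subseteq> A" using full[of "g r" k] rg[OF r(1)] r(2) closure_subset by (auto simp: A_def)
          then show "ennreal (pO v k) \<le> 0" using O0 by simp
        qed simp
        then show ?thesis by (simp add: psum_def)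
      qed
      have "g p \<in> \<Omega>" using tame_by_Om[OF path(2)] path(3) by blast
      then obtain r0 where r0: "val v (g p) r0" using val_ex[OF v] by blast
      then have "r0 = a" by (rule path.IH)
      have sub: "hit (g ` {p'..q'}) \<subseteq> hit (g ` {s..t})" if "s \<le> p'" "q' \<le> t" for p' q'
        using that by (intro disks_meeting_mono image_mono) auto
      show ?case
      proof (cases "p \<le> q")
        case True
        have "ennreal \<bar>r0 - r\<bar> \<le> 3 * psum (eO v) (hit (g ` {p..q}))"
          using path True r0 by (intro tame_val v tame_by_sub[OF path(2)]) auto
        also have "\<dots> \<le> 3 * psum (eO v) (hit (g ` {s..t}))"
          using path sub by (intro mult_left_mono psum_mono_set) auto
        finally show ?thesis using z \<open>r0 = a\<close> by simp
      next
        case False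
        have "ennreal \<bar>r - r0\<bar> \<le> 3 * psum (eO v) (hit (g ` {q..p}))"
          using path False r0 by (intro tame_val v tame_by_sub[OF path(2)]) auto
        also have "\<dots> \<le> 3 * psum (eO v) (hit (g ` {s..t}))"
          using path sub by (intro mult_left_mono psum_mono_set) auto
        finally show ?thesis using z \<open>r0 = a\<close> by simp
      qed
    next
      case (disk z k w)
      have "closure (Q k) \<subseteq> A" using full[of z k] disk by (auto simp: A_def)
      then have eq: "pM v k = pm v k" using O0[of k] by (simp add: pO_def)
      have "val v z (pm v k)"
      proof (cases "z \<in> Q k")
        case True
        then show ?thesis using eq by (auto simp: val_def)
      next
        case False
        then have "z \<in> frontier (Q k)" using disk front_iff by blast
        then show ?thesis using eq front_S pM_ge[OF v] pm_le[OF v] by (force simp: val_def)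
      qed
      then have "pm v k = a" by (rule disk.IH)
      then have "\<And>y. y \<in> frontier (Q k) \<Longrightarrow> v y = a" using eq pM_ge[OF v] pm_le[OF v] by force
      then show ?case using val_const[OF v disk.prems, of k a] disk by blast
    qed
    have hAc: "h z = c - a" if "z \<in> A" "z \<in> S" for z
      using hA[OF that] const[of z "v z"] that by (simp add: A_def val_def)
    have ca: "c < a" using cv by (simp add: a_def)
    \<comment> \<open>The disks across whose circle \<open>h\<close> jumps. Each has oscillation at
      least \<open>a - c\<close>, and the energy near the ball is finite, so there are only finitely
      many.\<close>
    define K where "K = {k. pO h k \<noteq> 0}"
    have Kge: "a - c \<le> pO h k" and Kmix: "\<exists>z\<in>frontier (Q k). z \<in> A" if k: "k \<in> K" for k
    proof -
      have h2: "h z = c - a \<and> z \<in> A \<or> h z = 0 \<and> z \<notin> A" if "z \<in> frontier (Q k)" for z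
        using hAc[of z] hnA[of z] that front_S by blast
      have "\<exists>z\<in>frontier (Q k). h z = c - a \<and> z \<in> A"
      proof (rule ccontr)
        assume "\<not> ?thesis"
        then have "pO h k = pO (\<lambda>_. 0) k" using h2 by (intro pO_cong) blast
        then show False using k front_ne[of k] by (simp add: K_def pO_def pM_def pm_def image_constant_conv)
      qed
      moreover have "\<exists>z\<in>frontier (Q k). h z = 0"
      proof (rule ccontr)
        assume "\<not> ?thesis"
        then have "pO h k = pO (\<lambda>_. c - a) k" using h2 by (intro pO_cong) blast
        then show False using k front_ne[of k] by (simp add: K_def pO_def pM_def pm_def image_constant_conv)
      qed
      ultimately show "a - c \<le> pO h k" "\<exists>z\<in>frontier (Q k). z \<in> A"
        using pO_ge[OF hb, of _ k] by force+
    qed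
    have KI: "K \<subseteq> I" using Kmix AI front_iff by blast
    have finK: "finite K"
    proof -
      have "finite {k\<in>I. ennreal ((a - c)\<^sup>2) \<le> ennreal ((pO v k)\<^sup>2)}"
        using ca by (intro psum_finite_ge[OF fin]) auto
      moreover have "K \<subseteq> {k\<in>I. ennreal ((a - c)\<^sup>2) \<le> ennreal ((pO v k)\<^sup>2)}"
        using KI Kge hO ca by (auto intro!: ennreal_leI power_mono intro: order_trans)
      ultimately show ?thesis by (rule rev_finite_subset)
    qed
    define D where "D = - (\<Union>k\<in>K. closure (Q k))"
    have D: "open D" "connected D" unfolding D_def
      using complement_disks_connected[OF finK] finK by (auto intro!: open_Compl closed_UN)
    have j0A: "closure (Q j0) \<subseteq> A"
      using full[of z0 j0] reach.base[of v c z0] z0 cv closure_subset by (auto simp: A_def)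
    have j0K: "j0 \<notin> K"
    proof -
      have "pO h j0 = pO (\<lambda>_. c - a) j0" using hAc j0A front_iff front_S by (intro pO_cong) blast
      then show ?thesis using front_ne[of j0] by (simp add: K_def pO_def pM_def pm_def image_constant_conv)
    qed
    have z0D: "z0 \<in> D"
    proof -
      have "z0 \<notin> closure (Q k)" if "k \<in> K" for k
        using that j0K z0 cl_disj[of z0 k j0] closure_subset by blast
      then show ?thesis by (auto simp: D_def)
    qed
    obtain q where q: "q \<in> D" "q \<notin> ball x R1"
    proof -
      have "bounded ((\<Union>k\<in>K. closure (Q k)) \<union> ball x R1)"
        using finK compact_cl_Q compact_imp_bounded by (auto intro!: bounded_UN)
      then have "(\<Union>k\<in>K. closure (Q k)) \<union> ball x R1 \<noteq> UNIV" using not_bounded_UNIV by metis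
      then obtain q0 where "q0 \<notin> (\<Union>k\<in>K. closure (Q k)) \<union> ball x R1" by blast
      then show ?thesis using that[of q0] by (simp add: D_def)
    qed
    obtain p where p: "path p" "path_image p \<subseteq> D" "pathstart p = z0" "pathfinish p = q"
      using connected_open_path_connected[OF D] z0D q unfolding path_connected_def by blast
    \<comment> \<open>The path from \<open>z0\<close> is followed only to an intermediate radius:
      there it is outside \<open>cball x R0\<close>, hence off the reached set, but still in
      \<open>ball x R1\<close> and thus in \<open>\<Omega>\<close>.\<close>
    define R' where "R' = (R0 + R1) / 2"
    have R': "R0 < R'" "R' < R1" using R by (auto simp: R'_def)
    have pc: "continuous_on {0..1} p" using p(1) by (simp add: path_def)
    have "dist x (p 0) < R'" using AR[OF reach.base] p(3) R' by (auto simp: pathstart_def)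
    moreover have "R' \<le> dist x (p 1)" using p(4) q R' by (auto simp: pathfinish_def)
    ultimately obtain t where t: "t \<in> {0..1}" "dist x (p t) = R'" "\<forall>r\<in>{0..t}. dist x (p r) \<le> R'"
      using first_sphere[OF pc, of x R'] by auto
    define C where "C = p ` {0..t}"
    have C: "connected C" "z0 \<in> C" "p t \<in> C"
    proof -
      have "continuous_on {0..t} p" using t by (intro continuous_on_subset[OF pc]) auto
      then show "connected C" unfolding C_def by (intro connected_continuous_image) auto
      show "z0 \<in> C" "p t \<in> C" using p(3) t by (auto simp: C_def pathstart_def)
    qed
    define G where "G = ball x R1 \<inter> D"
    have CG: "C \<subseteq> G"
    proof
      fix z assume "z \<in> C"
      then obtain r where r: "r \<in> {0..t}" "z = p r" by (auto simp: C_def)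
      then have "z \<in> path_image p" using t by (auto simp: path_image_def)
      moreover have "dist x z \<le> R'" using t r by blast
      ultimately show "z \<in> G" using p R' by (auto simp: G_def)
    qed
    have G: "open G" "G \<subseteq> \<Omega>" using D cb ball_subset_cball by (auto simp: G_def)
    obtain e0 where e0: "e0 > 0" "ball z0 e0 \<subseteq> Q j0" using z0 open_Q open_contains_ball by blast
    have "p t \<in> - cball x R0" using t R' by auto
    moreover have "p t \<in> G" using CG C(3) by blast
    moreover have "open (- cball x R0 \<inter> G)" using G(1) by (simp add: open_Int open_Compl)
    ultimately obtain e1 where e1: "e1 > 0" "ball (p t) e1 \<subseteq> - cball x R0 \<inter> G"
      using open_contains_ball[of "- cball x R0 \<inter> G"] by blast
    have "c - a = 0"
    proof (rule grid_constant[OF hb G _ _ _ C(1) CG C(2,3) e0(1) _ e1(1)])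
      show "AE r in lborel. \<forall>p q. p \<le> q \<and> pt b r ` {p..q} \<subseteq> G \<longrightarrow> tame h (pt b r) p q" for b
        using AE_gline[OF u, of b]
      proof (rule eventually_mono, intro allI impI)
        fix r p q assume gl: "gline (rl u) b r" and pq: "p \<le> q \<and> pt b r ` {p..q} \<subseteq> G"
        have sub: "pt b r ` {p..q} \<subseteq> \<Omega>" using pq G(2) by blast
        have "psum (\<lambda>k. ennreal (if k \<in> hit (ball x R1) then pO (rl u) k else 0)) (hit (pt b r ` {p..q})) \<le>
            psum (eO (rl u)) (hit (pt b r ` {p..q}))"
          by (intro psum_mono) auto
        then show "tame h (pt b r) p q"
          using gline_tame[OF gl] gline_sum[OF gl] pq sub by (intro tt) (auto intro: order_le_less_trans)
      qed
      show "pO h k = 0" if "k \<notin> K" for k using that by (simp add: K_def)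
      show "G \<inter> Q k = {}" if "k \<in> K" for k using that closure_subset by (auto simp: G_def D_def)
      show "r = c - a" if w: "w \<in> ball z0 e0" "val h w r" for w r
      proof (rule val_const[OF hb w(2), of j0])
        show "h y = c - a" if "y \<in> frontier (Q j0)" for y using hAc j0A front_iff front_S that by blast
        show "w \<in> closure (Q j0)" using w e0 closure_subset by blast
      qed
      \<comment> \<open>Near \<open>p t\<close> nothing is reached. A disk there is not in
        \<open>K\<close>, so a single reached point on its circle would imply that the whole disk is
        reached.\<close>
      show "r = 0" if w: "w \<in> ball (p t) e1" "val h w r" for w r
      proof (cases "w \<in> S")
        case True
        have "w \<notin> ball x R0" using w(1) e1(2) ball_subset_cball by blast
        then have "w \<notin> A" using sub by blast
        then show ?thesis using True w(2) hnA S_not_Q by (auto simp: val_def)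
      next
        case False
        then obtain k where k: "w \<in> Q k" using w(2) by (auto simp: val_def)
        have "w \<in> G" using w(1) e1(2) by blast
        then have kK: "k \<notin> K" using k closure_subset[of "Q k"] by (auto simp: G_def D_def)
        have "frontier (Q k) \<inter> A = {}"
        proof (rule ccontr)
          assume "frontier (Q k) \<inter> A \<noteq> {}"
          then obtain y where y: "y \<in> frontier (Q k)" "y \<in> A" by blast
          have "y' \<in> A" if "y' \<in> frontier (Q k)" for y'
          proof (rule ccontr)
            assume "y' \<notin> A"
            then have "h y' = 0" by (rule hnA)
            moreover have "h y = c - a" using hAc[of y] y front_S by blast
            ultimately have "\<bar>h y - h y'\<bar> = a - c" using ca by simp
            then have "a - c \<le> pO h k" using pO_ge[OF hb y(1) that] by simp
            then show False using kK ca by (simp add: K_def)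
          qed
          then have "v y' = a" if "y' \<in> frontier (Q k)" for y'
            using that const[of y' "v y'"] front_S by (auto simp: A_def val_def)
          then have "a \<le> pm v k" by (intro pm_greatest) simp
          then have "closure (Q k) \<subseteq> A" using full[of y k] y ca front_iff by auto
          then have "w \<in> A" using k closure_subset by blast
          then have "w \<in> cball x R0" using sub ball_subset_cball by blast
          then show False using w(1) e1(2) by blast
        qed
        then have "\<And>y. y \<in> frontier (Q k) \<Longrightarrow> h y = 0" using hnA by blast
        then show ?thesis using val_const[OF hb w(2), of k 0] k closure_subset by blast
      qed
    qed
    then show False using ca by simp
  qed
  then obtain z where z: "reach v c z0 z" "z \<notin> ball x R0" unfolding A_def by blast
  then show ?thesis using reach_compact[OF z(1) v ab0] unfolding v_def by blast
qed

end

section \<open>Limits along shrinking disks\<close>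

lemma AE_shift:
  fixes P :: "real \<Rightarrow> bool"
  assumes "AE r in lborel. P r" "c \<noteq> 0"
  shows "AE s in lborel. P (t + c * s)"
proof -
  obtain N where N: "N \<in> null_sets lborel" "{r. \<not> P r} \<subseteq> N"
    using assms(1) by (auto simp: eventually_ae_filter)
  have "AE r in lborel. r \<notin> N" by (rule AE_not_in[OF N(1)])
  moreover have "Measurable.pred borel (\<lambda>r. r \<notin> N)"
  proof -
    have [measurable]: "N \<in> sets borel" using N(1) by auto
    show ?thesis by measurable
  qed
  ultimately have "AE s in lborel. t + c * s \<notin> N" using assms(2) by (intro AE_borel_affine)
  then show ?thesis by (rule eventually_mono) (use N in blast)
qed

context rel_carpet
begin

lemma AE_sides:
  assumes "u \<in> sobolev_loc ver \<Omega> Q"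
  shows "AE s in lborel. \<forall>(b, r)\<in>sides x s. gline (rl u) b r"
proof -
  have "AE s in lborel. gline (rl u) b (t + c * s)" if "c \<noteq> 0" for b t c
    by (rule AE_shift[OF AE_gline[OF assms] that])
  from this[of 1 False "Re x"] this[of "-1" False "Re x"] this[of 1 True "Im x"] this[of "-1" True "Im x"]
  have "AE s in lborel. gline (rl u) False (Re x + s)" "AE s in lborel. gline (rl u) False (Re x - s)"
    "AE s in lborel. gline (rl u) True (Im x + s)" "AE s in lborel. gline (rl u) True (Im x - s)" by auto
  then show ?thesis by eventually_elim (auto simp: sides_def)
qed

text \<open>Fifteen sums, each below \<open>g / 15\<close>. The arc has to avoid a disk with
  \<open>x\<close> in its closure, because the smallness assumption leaves that disk out.\<close>

lemma square_gap:
  assumes s: "0 < s" and sd: "\<forall>(b, r)\<in>sides x s. gline v b r" and v: "pbdd v"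
    and sm: "psum (eO v) {k \<in> hit (sqr x s). x \<notin> closure (Q k)} < ennreal (g / 15)" and Om: "sqr x s \<subseteq> \<Omega>"
    and ab: "a \<le> b" "b \<le> a + 2 * pi" and av: "\<And>k. x \<in> closure (Q k) \<Longrightarrow> sqp x s ` {a..b} \<inter> Q k = {}"
    and y: "val v (sqp x s a) y" "val v (sqp x s b) y'"
  shows "\<bar>y - y'\<bar> < g"
proof -
  have sub: "sqp x s ` {a..b} \<subseteq> sqr x s" using sqp_in_sqr s by (auto intro: less_imp_le)
  have "ennreal \<bar>y - y'\<bar> \<le> 15 * psum (eO v) (hit (sqp x s ` {a..b}))"
    using sd sub Om by (intro square_val[OF s _ v ab _ y]) (auto simp: gline_def)
  also have "\<dots> \<le> 15 * psum (eO v) {k \<in> hit (sqr x s). x \<notin> closure (Q k)}"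
  proof (intro mult_left_mono psum_mono_set subsetI)
    fix k assume k: "k \<in> hit (sqp x s ` {a..b})"
    then have "x \<notin> closure (Q k)" using av[of k] unfolding disks_meeting_def by blast
    then show "k \<in> {k \<in> hit (sqr x s). x \<notin> closure (Q k)}" using k disks_meeting_mono[OF sub] by blast
  qed simp
  also have "\<dots> < 15 * ennreal (g / 15)"
    using sm by (intro ennreal_mult_strict_left_mono) auto
  also have "\<dots> = ennreal g"
  proof -
    have "0 < g" using order_le_less_trans[OF zero_le sm] by (simp add: ennreal_less_zero_iff)
    have "15 * ennreal (g / 15) = ennreal 15 * ennreal (g / 15)" by simp
    also have "\<dots> = ennreal (15 * (g / 15))" using \<open>0 < g\<close> by (intro ennreal_mult[symmetric]) auto
    finally show ?thesis by simp
  qed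
  finally show ?thesis by (simp add: ennreal_less_iff)
qed

text \<open>All filters \<open>disks_to_along\<close> at \<open>x\<close> are finer, so a limit
  along this one determines the values at accessible points whatever path is used. Any fixed disk is
  eventually left out, in particular one with \<open>x\<close> on its boundary.\<close>

definition dto :: "complex \<Rightarrow> nat filter" where
  "dto x = (INF \<epsilon>\<in>{0<..}. principal {i. Q i \<subseteq> ball x \<epsilon>})"

lemma eventually_dto: "eventually P (dto x) \<longleftrightarrow> (\<exists>\<epsilon>>0. \<forall>i. Q i \<subseteq> ball x \<epsilon> \<longrightarrow> P i)"
proof -
  have "eventually P (dto x) \<longleftrightarrow> (\<exists>\<epsilon>\<in>{0<..}. eventually P (principal {i. Q i \<subseteq> ball x \<epsilon>}))"
    unfolding dto_def
  proof (rule eventually_INF_base)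
    fix a b :: real assume "a \<in> {0<..}" "b \<in> {0<..}"
    then show "\<exists>x'\<in>{0<..}. principal {i. Q i \<subseteq> ball x x'} \<le> inf (principal {i. Q i \<subseteq> ball x a}) (principal {i. Q i \<subseteq> ball x b})"
      by (intro bexI[of _ "min a b"]) (auto simp: subset_iff)
  qed auto
  then show ?thesis by (auto simp: eventually_principal)
qed

lemma outside_near:
  assumes "x \<in> frontier (Q i)" "\<delta> > 0"
  shows "\<exists>w\<in>ball x \<delta>. w \<notin> closure (Q i)"
proof -
  obtain c where c: "simple_path c" "pathfinish c = pathstart c" "frontier (Q i) = path_image c" "- closure (Q i) = outside (path_image c)"
    using jordan_props[OF jordan_Q[of i]] by metis
  have "x \<in> closure (- closure (Q i))"
    using Jordan_inside_outside[OF c(1,2)] assms(1) c by (simp add: closure_Un_frontier)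
  then obtain w where "w \<in> - closure (Q i)" "dist w x < \<delta>" using assms(2) unfolding closure_approachable by blast
  then show ?thesis by (intro bexI[of _ w]) (auto simp: dist_commute)
qed

text \<open>The carpet has empty interior, so disks accumulate at \<open>x\<close>. If
  \<open>x\<close> lies on a circle, the search is confined to the exterior of that disk, which
  comes arbitrarily close to \<open>x\<close> by the Jordan curve theorem.\<close>

lemma disk_near:
  assumes "x \<in> S" "\<epsilon> > 0"
  shows "\<exists>i. Q i \<subseteq> ball x \<epsilon> \<and> x \<notin> closure (Q i)"
proof -
  obtain \<delta> where \<delta>: "\<delta> > 0" "\<forall>i\<in>hit (ball x \<delta>). x \<notin> closure (Q i) \<longrightarrow> Q i \<subseteq> ball x \<epsilon>"
    using small_near[OF assms(2)] by blast
  have "\<exists>i\<in>hit (ball x \<delta>). x \<notin> closure (Q i)"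
  proof -
    have xO: "x \<in> ball x \<delta> \<inter> \<Omega>" using assms S_sub \<delta> by auto
    have hitO: "\<exists>j. Q j \<inter> O' \<noteq> {}" if O': "open O'" "O' \<subseteq> \<Omega>" "O' \<noteq> {}" for O'
    proof (rule ccontr)
      assume "\<not> ?thesis"
      then have "O' \<subseteq> S" using O' by (auto simp: carpet_def)
      then have "O' \<subseteq> interior S" using O' by (simp add: interior_maximal)
      then show False using int_S O' by auto
    qed
    show ?thesis
    proof (cases "\<exists>i0. x \<in> closure (Q i0)")
      case True
      then obtain i0 where i0: "x \<in> closure (Q i0)" by blast
      obtain e where e: "e > 0" "ball x e \<subseteq> ball x \<delta> \<inter> \<Omega>"
        using xO open_Om open_contains_ball[of "ball x \<delta> \<inter> \<Omega>"] by blast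
      obtain w where w: "w \<in> ball x e" "w \<notin> closure (Q i0)"
        using outside_near[OF S_cl_front[OF assms(1) i0] e(1)] by blast
      have "\<exists>j. Q j \<inter> (ball x e - closure (Q i0)) \<noteq> {}"
      proof -
        have "ball x e - closure (Q i0) \<noteq> {}" "ball x e - closure (Q i0) \<subseteq> \<Omega>" using w e by blast+
        then show ?thesis by (intro hitO) (auto simp: open_Diff simp del: Diff_eq_empty_iff)
      qed
      then obtain j where j: "Q j \<inter> (ball x e - closure (Q i0)) \<noteq> {}" by blast
      then have "j \<noteq> i0" using closure_subset by blast
      then have "x \<notin> closure (Q j)" using cl_disj[of x j i0] i0 by blast
      then show ?thesis using j e by (auto simp: disks_meeting_def)
    next
      case False
      obtain j where "Q j \<inter> (ball x \<delta> \<inter> \<Omega>) \<noteq> {}"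
        using hitO[of "ball x \<delta> \<inter> \<Omega>"] xO open_Om by (metis Int_lower2 emptyE open_Int open_ball)
      then have "j \<in> hit (ball x \<delta>)" unfolding disks_meeting_def by blast
      then show ?thesis using False by blast
    qed
  qed
  then show ?thesis using \<delta> by blast
qed

lemma dto_nonbot: "x \<in> S \<Longrightarrow> dto x \<noteq> bot"
  unfolding trivial_limit_def eventually_dto using disk_near by blast

lemma dm_of_sub_ball: "Q i \<subseteq> ball x \<epsilon> \<Longrightarrow> dm i \<le> 2 * \<epsilon>"
proof -
  assume s: "Q i \<subseteq> ball x \<epsilon>"
  obtain z where "z \<in> Q i" using ne_Q by blast
  then have e: "\<epsilon> > 0" using s by (metis mem_ball subsetD zero_le_dist order_le_less_trans)
  show "dm i \<le> 2 * \<epsilon>"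
  proof (rule diameter_le)
    show "norm (a - b) \<le> 2 * \<epsilon>" if "a \<in> Q i" "b \<in> Q i" for a b
    proof -
      have "dist x a < \<epsilon>" "dist x b < \<epsilon>" using s that by auto
      then show ?thesis using dist_triangle3[of a b x] by (simp add: dist_norm)
    qed
  qed (use e in auto)
qed

text \<open>Square summability leaves only finitely many disks near \<open>x\<close> with
  oscillation at least \<open>e\<close>. A ball whose radius is at most a third of their diameters
  contains none of them.\<close>

lemma dto_osc:
  assumes f: "f \<in> sobolev_loc ver \<Omega> Q" and x: "x \<in> \<Omega>" and "e > 0"
  shows "eventually (\<lambda>i. pO (rl f) i < e) (dto x)"
proof -
  obtain r where r: "r > 0" "cball x r \<subseteq> \<Omega>" using x open_Om open_contains_cball by blast
  define F where "F = {i\<in>hit (ball x r). e \<le> pO (rl f) i}"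
  have "finite {i\<in>hit (ball x r). ennreal (e\<^sup>2) \<le> ennreal ((pO (rl f) i)\<^sup>2)}"
    using \<open>e > 0\<close> by (intro psum_finite_ge[OF sobolev_loc_sums(1)[OF f r(2)]]) auto
  moreover have "F \<subseteq> {i\<in>hit (ball x r). ennreal (e\<^sup>2) \<le> ennreal ((pO (rl f) i)\<^sup>2)}"
    using \<open>e > 0\<close> by (auto simp: F_def intro!: ennreal_leI power_mono)
  ultimately have F: "finite F" by (rule rev_finite_subset)
  define \<epsilon> where "\<epsilon> = Min (insert r ((\<lambda>i. dm i / 3) ` F))"
  have \<epsilon>: "\<epsilon> > 0" "\<epsilon> \<le> r" using F r dm_pos by (auto simp: \<epsilon>_def)
  have \<epsilon>3: "\<epsilon> \<le> dm i / 3" if "i \<in> F" for i unfolding \<epsilon>_def using F that by (intro Min_le) auto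
  have "pO (rl f) i < e" if i: "Q i \<subseteq> ball x \<epsilon>" for i
  proof -
    have "i \<notin> F" using dm_of_sub_ball[OF i] \<epsilon>3[of i] dm_pos[of i] by auto
    moreover have "Q i \<subseteq> ball x r" using i \<epsilon>(2) by (auto simp: subset_iff)
    then have "i \<in> hit (ball x r)" using ne_Q[of i] by (auto simp: disks_meeting_def)
    ultimately show ?thesis by (auto simp: F_def not_le)
  qed
  then show ?thesis unfolding eventually_dto using \<epsilon>(1) by blast
qed

section \<open>Continua of high and low values around a point\<close>

lemma above_val: "above v c z \<Longrightarrow> val v z y \<Longrightarrow> c < y"
  unfolding above_def val_def by force

text \<open>Oscillations tend to 0 along the filter, so some disk near \<open>x\<close> with maximum
  above \<open>c'\<close> has its minimum above \<open>c\<close> and can serve as the start of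
  \<open>reach_exit\<close>.\<close>

lemma exit_near:
  assumes lm: "lmin ver u" and fr: "frequently (\<lambda>i. c' < pM (rl u) i) (dto x)" and x: "x \<in> \<Omega>"
    and c: "c < c'" and R: "0 < R0" "R0 < R1" "cball x R1 \<subseteq> \<Omega>" and "\<delta> > 0"
  shows "\<exists>C z0. compact C \<and> connected C \<and> z0 \<in> C \<and> z0 \<in> ball x \<delta> \<and> \<not> C \<subseteq> ball x R0 \<and> (\<forall>w\<in>C. above (rl u) c w)"
proof -
  have u: "u \<in> sobolev_loc ver \<Omega> Q" using lm by (simp add: lmin_def)
  have "eventually (\<lambda>i. pO (rl u) i < c' - c) (dto x)" using dto_osc[OF u x, of "c' - c"] c by auto
  moreover have "eventually (\<lambda>i. Q i \<subseteq> ball x \<delta>) (dto x)" unfolding eventually_dto using \<open>\<delta> > 0\<close> by blast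
  ultimately have "eventually (\<lambda>i. pO (rl u) i < c' - c \<and> Q i \<subseteq> ball x \<delta>) (dto x)" by (rule eventually_conj)
  from frequently_eventually_conj[OF fr this] have "frequently (\<lambda>i. c' < pM (rl u) i \<and> pO (rl u) i < c' - c \<and> Q i \<subseteq> ball x \<delta>) (dto x)"
    by (rule frequently_elim1) auto
  then obtain j where j: "c' < pM (rl u) j" "pO (rl u) j < c' - c" "Q j \<subseteq> ball x \<delta>"
    using frequently_ex by blast
  obtain z0 where z0: "z0 \<in> Q j" using ne_Q by blast
  have "c < pm (rl u) j" using j by (simp add: pO_def)
  from reach_exit[OF lm R(3,1,2) this z0] show ?thesis using z0 j(3) by blast
qed

lemma meets_square:
  assumes "connected C" "z0 \<in> C" "z0 \<in> ball x s" "\<not> C \<subseteq> ball x R0" "2 * s < R0"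
  shows "C \<inter> sqr x s \<noteq> {}"
proof -
  obtain q where q: "q \<in> C" "q \<notin> ball x R0" using assms by blast
  have "nrm (z0 - x) < s" using assms(3) nrm_le_cmod[of "z0 - x"] by (auto simp: dist_norm norm_minus_commute)
  moreover have "s < nrm (q - x)" using q cmod_le_nrm[of "q - x"] assms(5) by (auto simp: dist_norm norm_minus_commute)
  ultimately show ?thesis using connected_meets_sqr[OF assms(1,2) q(1)] by blast
qed

text \<open>\<open>Q i0\<close> itself plays the part of the continuum with high values. A continuum
  of low values meets a good square outside \<open>Q i0\<close>; the arc of the square from there to
  its first point on the circle avoids \<open>Q i0\<close>, and its small sum contradicts the
  difference of the values.\<close>

lemma not_below_wall:
  assumes lm: "lmin ver u" and x: "x \<in> frontier (Q i0)" and c: "c < c'" "c' < pm (rl u) i0"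
    and fr: "frequently (\<lambda>i. pM (rl u) i < c) (dto x)"
  shows False
proof -
  define v where "v = rl u"
  have u: "u \<in> sobolev_loc ver \<Omega> Q" using lm by (simp add: lmin_def)
  have v: "pbdd v" using sobolev_loc_peri(5)[OF u] by (simp add: v_def)
  have xO: "x \<in> \<Omega>" using x front_S S_sub by blast
  obtain R1 where R1: "R1 > 0" "cball x R1 \<subseteq> \<Omega>" using xO open_Om open_contains_cball by blast
  define R0 where "R0 = R1 / 2"
  have R0: "0 < R0" "R0 < R1" using R1 by (auto simp: R0_def)
  obtain y0 where y0: "y0 \<in> Q i0" using ne_Q by blast
  have "y0 - x \<noteq> 0" using x y0 front_iff by auto
  then have ny: "0 < nrm (y0 - x)" by (rule nrm_pos)
  \<comment> \<open>\<open>Q i0\<close> has points inside every square around \<open>x\<close>; the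
    bound by \<open>nrm (y0 - x)\<close> puts \<open>y0\<close> outside, so that \<open>Q i0\<close>
    meets the square.\<close>
  define r where "r = min (R0 / 2) (nrm (y0 - x))"
  have r: "r > 0" using R0 ny by (simp add: r_def)
  have fin: "psum (\<lambda>k. ennreal ((pO v k)\<^sup>2)) (hit (ball x R1)) < \<infinity>"
    unfolding v_def by (rule sobolev_loc_sums(1)[OF u R1(2)])
  have fin': "psum (\<lambda>k. ennreal ((pO v k)\<^sup>2)) (hit (ball x r)) < \<infinity>"
    using fin by (rule order_le_less_trans[rotated]) (use R0 in \<open>auto intro!: psum_hit_mono simp: r_def R0_def\<close>)
  \<comment> \<open>The low continuum has values below \<open>c + g\<close>, the circle has values
    above \<open>c' = c + 2 * g\<close>.\<close>
  define g where "g = (c' - c) / 2"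
  have g: "g > 0" using c by (simp add: g_def)
  obtain s where s: "0 < s" "s < r" "\<forall>(b, t)\<in>sides x s. gline v b t"
      "psum (eO v) {k \<in> hit (sqr x s). x \<notin> closure (Q k)} < ennreal (g / 15)"
    using good_square[OF v fin' r _ AE_sides[OF u, folded v_def], of "g / 15"] g by auto
  have s2: "2 * s < R0" using s(2) by (simp add: r_def)
  have sOm: "sqr x s \<subseteq> \<Omega>"
    using sqr_sub_cball[of x s] s2 R1(2) R0 by (auto simp: subset_iff)
  have lm': "lmin ver (\<lambda>z. - u z)" by (rule lmin_uminus[OF lm])
  have fr': "frequently (\<lambda>i. - c < pM (rl (\<lambda>z. - u z)) i) (dto x)"
  proof -
    have "- c < - pm v k" if "pM v k < c" for k using pm_le_pM[OF v, of k] that by simp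
    then show ?thesis using fr unfolding rl_uminus pM_uminus v_def[symmetric] by (auto elim!: frequently_elim1)
  qed
  have lc: "- c - g < - c" using g by simp
  obtain C z0 where C: "compact C" "connected C" "z0 \<in> C" "z0 \<in> ball x s" "\<not> C \<subseteq> ball x R0"
      and ab: "\<forall>w\<in>C. above (\<lambda>z. - v z) (- c - g) w"
    using exit_near[OF lm' fr' xO lc R0 R1(2) s(1)] unfolding rl_uminus v_def[symmetric] by blast
  obtain w where w: "w \<in> C" "w \<in> sqr x s" using meets_square[OF C(2-5) s2] by blast
  have wn: "w \<notin> Q i0"
  proof
    assume "w \<in> Q i0"
    then have "- c - g < pm (\<lambda>z. - v z) i0" using ab w(1) unfolding above_def by blast
    then have "pM v i0 < c + g" by (simp add: pm_uminus)
    then show False using pm_le_pM[OF v, of i0] c by (simp add: v_def g_def field_simps)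
  qed
  obtain a where a: "sqp x s a = w" using sqp_surj[OF s(1) w(2)] by blast
  obtain y1 where y1: "y1 \<in> Q i0" "y1 \<in> ball x s"
    using x s(1) unfolding front_iff closure_approachable by (auto simp: dist_commute)
  have "nrm (y1 - x) < s" using y1(2) nrm_le_cmod[of "y1 - x"] by (auto simp: dist_norm norm_minus_commute)
  moreover have "s < nrm (y0 - x)" using s(2) by (simp add: r_def)
  ultimately obtain q where q: "q \<in> Q i0" "q \<in> sqr x s" using connected_meets_sqr[OF conn_Q y1(1) y0] by blast
  obtain b where b: "a \<le> b" "b < a + 2 * pi" "sqp x s b = q" using sqp_surj[OF s(1) q(2)] by blast
  have "q \<in> closure (Q i0)" using q(1) closure_subset by blast
  then obtain t where t: "t \<in> {a..b}" "sqp x s t \<in> frontier (Q i0)" "sqp x s ` {a..t} \<inter> Q i0 = {}"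
    using path_enters[OF continuous_sqp b(1), of x s i0] a wn b(3) by blast
  have wO: "w \<in> \<Omega>" using w(2) sOm by blast
  obtain y where y: "val v w y" using val_ex[OF v wO] by blast
  have "val (\<lambda>z. - v z) w (- y)"
    using y unfolding val_def pm_uminus pM_uminus by auto
  then have yc: "y < c + g" using above_val[of "\<lambda>z. - v z" "- c - g" w "- y"] ab w(1) by simp
  have tS: "sqp x s t \<in> S" using t(2) front_S by blast
  then have vt: "val v (sqp x s t) (v (sqp x s t))" by (simp add: val_def)
  have "pm v i0 \<le> v (sqp x s t)" by (rule pm_le[OF v t(2)])
  then have vc: "c' < v (sqp x s t)" using c by (simp add: v_def)
  have "\<bar>y - v (sqp x s t)\<bar> < g"
  proof (rule square_gap[OF s(1,3) v s(4) sOm _ _ _ _ vt])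
    show "a \<le> t" "t \<le> a + 2 * pi" using t(1) b by auto
    show "val v (sqp x s a) y" using y a by simp
    show "sqp x s ` {a..t} \<inter> Q k = {}" if "x \<in> closure (Q k)" for k
      using t(3) cl_disj[OF that, of i0] x front_iff by auto
  qed
  moreover have "2 * g = c' - c" by (simp add: g_def)
  ultimately show False using yc vc by linarith
qed

lemma val_uminus: "val v z y \<Longrightarrow> val (\<lambda>z. - v z) z (- y)"
  unfolding val_def pm_uminus pM_uminus by auto

lemma arc_levels:
  assumes s: "0 < s" and sd: "\<forall>(b, r)\<in>sides x s. gline v b r" and v: "pbdd v"
    and sm: "psum (eO v) {k \<in> hit (sqr x s). x \<notin> closure (Q k)} < ennreal (g / 15)" and Om: "sqr x s \<subseteq> \<Omega>"
    and ab: "a \<le> b" "b \<le> a + 2 * pi" and av: "\<And>k. x \<in> closure (Q k) \<Longrightarrow> sqp x s ` {a..b} \<inter> Q k = {}"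
    and lev: "above v c' (sqp x s a) \<and> above (\<lambda>z. - v z) (- c) (sqp x s b) \<or>
      above v c' (sqp x s b) \<and> above (\<lambda>z. - v z) (- c) (sqp x s a)"
  shows "c' < c + g"
proof -
  have O: "sqp x s t \<in> \<Omega>" for t using Om sqp_in_sqr s by (meson less_imp_le subsetD)
  obtain y y' where y: "val v (sqp x s a) y" "val v (sqp x s b) y'" using val_ex[OF v O] by metis
  have "\<bar>y - y'\<bar> < g" by (rule square_gap[OF s sd v sm Om ab av y])
  then show ?thesis
    using lev above_val[OF _ y(1)] above_val[OF _ y(2)] above_val[OF _ val_uminus[OF y(1)]] above_val[OF _ val_uminus[OF y(2)]]
    by force
qed

lemma frequently_low:
  assumes u: "u \<in> sobolev_loc ver \<Omega> Q" and x: "x \<in> \<Omega>" and fr: "frequently (\<lambda>i. c' < pM (rl u) i) (dto x)" and "e > 0"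
  shows "frequently (\<lambda>i. pM (rl (\<lambda>z. - u z)) i < - c' + e) (dto x)"
proof -
  from frequently_eventually_conj[OF fr dto_osc[OF u x \<open>e > 0\<close>]] show ?thesis unfolding rl_uminus pM_uminus by (rule frequently_elim1) (auto simp: pO_def)
qed

lemma frequently_high:
  assumes u: "u \<in> sobolev_loc ver \<Omega> Q" and fr: "frequently (\<lambda>i. pM (rl u) i < c) (dto x)"
  shows "frequently (\<lambda>i. - c < pM (rl (\<lambda>z. - u z)) i) (dto x)"
proof -
  have "- c < - pm (rl u) k" if "pM (rl u) k < c" for k
    using pm_le_pM[OF sobolev_loc_peri(5)[OF u], of k] that by simp
  then show ?thesis using fr unfolding rl_uminus pM_uminus by (auto elim!: frequently_elim1)
qed

text \<open>If \<open>x\<close> is on no circle, any arc of the square between the two continua will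
  do. If \<open>x\<close> is on the circle of \<open>Q i0\<close>, \<open>not_below_wall\<close> for
  \<open>u\<close> and for \<open>- u\<close> shows that this circle has minimum at most
  \<open>c\<close> and maximum at least \<open>c'\<close>. Hence neither continuum can enter
  \<open>Q i0\<close>, and \<open>square_arc\<close> provides an arc outside it.\<close>

lemma levels_contra:
  assumes lm: "lmin ver u" and x: "x \<in> S" and c: "c < c'"
    and hi: "frequently (\<lambda>i. c' < pM (rl u) i) (dto x)"
    and lo: "frequently (\<lambda>i. pM (rl u) i < c) (dto x)"
  shows False
proof -
  define v where "v = rl u"
  \<comment> \<open>The continua have values above \<open>c' - g\<close> and below
    \<open>c + g\<close>, two levels that are exactly \<open>g\<close> apart.\<close>
  define g where "g = (c' - c) / 3"
  have g: "g > 0" using c by (simp add: g_def)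
  have u: "u \<in> sobolev_loc ver \<Omega> Q" using lm by (simp add: lmin_def)
  have v: "pbdd v" using sobolev_loc_peri(5)[OF u] by (simp add: v_def)
  have xO: "x \<in> \<Omega>" using x S_sub by blast
  have lm': "lmin ver (\<lambda>z. - u z)" by (rule lmin_uminus[OF lm])
  have hi': "frequently (\<lambda>i. - c < pM (rl (\<lambda>z. - u z)) i) (dto x)" by (rule frequently_high[OF u lo])
  obtain R1 where R1: "R1 > 0" "cball x R1 \<subseteq> \<Omega>" using xO open_Om open_contains_cball by blast
  define R0 where "R0 = R1 / 2"
  have R0: "0 < R0" "R0 < R1" using R1 by (auto simp: R0_def)
  have fin: "psum (\<lambda>k. ennreal ((pO v k)\<^sup>2)) (hit (ball x R1)) < \<infinity>"
    unfolding v_def by (rule sobolev_loc_sums(1)[OF u R1(2)])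
  have sq: "\<exists>s. 0 < s \<and> s < r \<and> (\<forall>(b, t)\<in>sides x s. gline v b t) \<and>
      psum (eO v) {k \<in> hit (sqr x s). x \<notin> closure (Q k)} < ennreal (g / 15)" if r: "0 < r" "r \<le> R1" for r
  proof -
    have "psum (\<lambda>k. ennreal ((pO v k)\<^sup>2)) (hit (ball x r)) < \<infinity>"
      using fin by (rule order_le_less_trans[rotated]) (use r in \<open>auto intro!: psum_hit_mono\<close>)
    from good_square[OF v this r(1) _ AE_sides[OF u, folded v_def], of "g / 15"] g show ?thesis by simp
  qed
  have ex1: "\<exists>C z0. compact C \<and> connected C \<and> z0 \<in> C \<and> z0 \<in> ball x \<delta> \<and> \<not> C \<subseteq> ball x R0 \<and> (\<forall>w\<in>C. above v (c' - g) w)"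
    if "\<delta> > 0" for \<delta>
    using exit_near[OF lm hi xO _ R0 R1(2) that, of "c' - g"] g unfolding v_def by simp
  have ex2: "\<exists>C z0. compact C \<and> connected C \<and> z0 \<in> C \<and> z0 \<in> ball x \<delta> \<and> \<not> C \<subseteq> ball x R0 \<and>
      (\<forall>w\<in>C. above (\<lambda>z. - v z) (- (c + g)) w)"
    if "\<delta> > 0" for \<delta>
    using exit_near[OF lm' hi' xO _ R0 R1(2) that, of "- (c + g)"] g unfolding rl_uminus v_def[symmetric] by simp
  have no: "\<not> c' - g < c + g + g" by (simp add: g_def field_simps)
  show False
  proof (cases "\<exists>i0. x \<in> frontier (Q i0)")
    case False
    then have xk: "x \<notin> closure (Q k)" for k using S_cl_front[OF x] by blast
    obtain s where s: "0 < s" "s < R0 / 2" "\<forall>(b, t)\<in>sides x s. gline v b t"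
        "psum (eO v) {k \<in> hit (sqr x s). x \<notin> closure (Q k)} < ennreal (g / 15)"
      using sq[of "R0 / 2"] R0 by auto
    have s2: "2 * s < R0" using s(2) by simp
    have sOm: "sqr x s \<subseteq> \<Omega>" using sqr_sub_cball[of x s] s2 R1(2) R0 by (auto simp: subset_iff)
    obtain C z where C: "connected C" "z \<in> C" "z \<in> ball x s" "\<not> C \<subseteq> ball x R0" and Cl: "\<forall>w\<in>C. above v (c' - g) w"
      using ex1[OF s(1)] by blast
    obtain D z' where D: "connected D" "z' \<in> D" "z' \<in> ball x s" "\<not> D \<subseteq> ball x R0" and Dl: "\<forall>w\<in>D. above (\<lambda>z. - v z) (- (c + g)) w"
      using ex2[OF s(1)] by blast
    obtain w where w: "w \<in> C" "w \<in> sqr x s" using meets_square[OF C s2] by blast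
    obtain w' where w': "w' \<in> D" "w' \<in> sqr x s" using meets_square[OF D s2] by blast
    obtain a where a: "sqp x s a = w" using sqp_surj[OF s(1) w(2)] by blast
    obtain b where b: "a \<le> b" "b < a + 2 * pi" "sqp x s b = w'" using sqp_surj[OF s(1) w'(2)] by blast
    have "c' - g < c + g + g"
    proof (rule arc_levels[OF s(1,3) v s(4) sOm b(1)])
      show "b \<le> a + 2 * pi" using b by simp
      show "above v (c' - g) (sqp x s a) \<and> above (\<lambda>z. - v z) (- (c + g)) (sqp x s b) \<or>
          above v (c' - g) (sqp x s b) \<and> above (\<lambda>z. - v z) (- (c + g)) (sqp x s a)"
        using a b Cl Dl w w' by blast
    qed (use xk in blast)
    then show False using no by blast
  next
    case True
    then obtain i0 where i0: "x \<in> frontier (Q i0)" by blast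
    have lowwall: "pm v i0 \<le> c"
    proof (rule ccontr)
      assume "\<not> pm v i0 \<le> c"
      then have "c < (c + pm v i0) / 2" "(c + pm v i0) / 2 < pm v i0" by simp_all
      then show False using not_below_wall[OF lm i0 _ _ lo] unfolding v_def by blast
    qed
    have highwall: "c' \<le> pM v i0"
    proof (rule ccontr)
      assume nh: "\<not> c' \<le> pM v i0"
      define e where "e = (c' - pM v i0) / 3"
      have e: "e > 0" using nh by (simp add: e_def)
      have "frequently (\<lambda>i. pM (rl (\<lambda>z. - u z)) i < - c' + e) (dto x)"
        by (rule frequently_low[OF u xO hi e])
      moreover have "- c' + e < - c' + 2 * e" using e by simp
      moreover have "- c' + 2 * e < pm (rl (\<lambda>z. - u z)) i0"
        unfolding rl_uminus pm_uminus v_def[symmetric] using nh by (simp add: e_def field_simps)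
      ultimately show False using not_below_wall[OF lm' i0] by blast
    qed
    obtain s0 where s0: "s0 > 0" "s0 < R0"
      "\<And>s. 0 < s \<Longrightarrow> s < s0 \<Longrightarrow> \<exists>\<delta>>0. \<forall>A B. compact A \<and> compact B \<and> connected A \<and> connected B \<and>
        A \<inter> Q i0 = {} \<and> B \<inter> Q i0 = {} \<and>
        A \<inter> ball x \<delta> \<noteq> {} \<and> B \<inter> ball x \<delta> \<noteq> {} \<and> \<not> A \<subseteq> ball x R0 \<and> \<not> B \<subseteq> ball x R0 \<longrightarrow>
        (\<exists>a b. a \<le> b \<and> b \<le> a + 2 * pi \<and> sqp x s ` {a..b} \<inter> Q i0 = {} \<and>
            (sqp x s a \<in> A \<and> sqp x s b \<in> B \<or> sqp x s a \<in> B \<and> sqp x s b \<in> A))"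
      using square_arc[OF jordan_Q i0 R0(1)] by blast
    have m: "0 < min s0 (R0 / 2)" "min s0 (R0 / 2) \<le> R1" using s0 R0 by auto
    obtain s where s: "0 < s" "s < min s0 (R0 / 2)" "\<forall>(b, t)\<in>sides x s. gline v b t"
        "psum (eO v) {k \<in> hit (sqr x s). x \<notin> closure (Q k)} < ennreal (g / 15)"
      using sq[OF m] by blast
    have s2: "2 * s < R0" "s < s0" using s(2) by simp_all
    have sOm: "sqr x s \<subseteq> \<Omega>" using sqr_sub_cball[of x s] s2 R1(2) R0 by (auto simp: subset_iff)
    obtain \<delta> where \<delta>: "\<delta> > 0" and arc: "\<And>A B. compact A \<and> compact B \<and> connected A \<and> connected B \<and>
        A \<inter> Q i0 = {} \<and> B \<inter> Q i0 = {} \<and>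
        A \<inter> ball x \<delta> \<noteq> {} \<and> B \<inter> ball x \<delta> \<noteq> {} \<and> \<not> A \<subseteq> ball x R0 \<and> \<not> B \<subseteq> ball x R0 \<Longrightarrow>
        (\<exists>a b. a \<le> b \<and> b \<le> a + 2 * pi \<and> sqp x s ` {a..b} \<inter> Q i0 = {} \<and>
            (sqp x s a \<in> A \<and> sqp x s b \<in> B \<or> sqp x s a \<in> B \<and> sqp x s b \<in> A))"
      using s0(3)[OF s(1) s2(2)] by blast
    obtain C z where C: "compact C" "connected C" "z \<in> C" "z \<in> ball x \<delta>" "\<not> C \<subseteq> ball x R0" and Cl: "\<forall>w\<in>C. above v (c' - g) w"
      using ex1[OF \<delta>] by blast
    obtain D z' where D: "compact D" "connected D" "z' \<in> D" "z' \<in> ball x \<delta>" "\<not> D \<subseteq> ball x R0" and Dl: "\<forall>w\<in>D. above (\<lambda>z. - v z) (- (c + g)) w"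
      using ex2[OF \<delta>] by blast
    have Ci: "C \<inter> Q i0 = {}"
    proof (rule ccontr)
      assume "C \<inter> Q i0 \<noteq> {}"
      then have "c' - g < pm v i0" using Cl unfolding above_def by blast
      then show False using lowwall g no by simp
    qed
    have Di: "D \<inter> Q i0 = {}"
    proof (rule ccontr)
      assume "D \<inter> Q i0 \<noteq> {}"
      then have "- (c + g) < pm (\<lambda>z. - v z) i0" using Dl unfolding above_def by blast
      then show False using highwall g no by (simp add: pm_uminus)
    qed
    have "C \<inter> ball x \<delta> \<noteq> {}" "D \<inter> ball x \<delta> \<noteq> {}" using C D by blast+
    then obtain a b where ab: "a \<le> b" "b \<le> a + 2 * pi" "sqp x s ` {a..b} \<inter> Q i0 = {}"
      "sqp x s a \<in> C \<and> sqp x s b \<in> D \<or> sqp x s a \<in> D \<and> sqp x s b \<in> C"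
      using arc[of C D] C(1,2,5) D(1,2,5) Ci Di by blast
    have "c' - g < c + g + g"
    proof (rule arc_levels[OF s(1,3) v s(4) sOm ab(1,2)])
      show "above v (c' - g) (sqp x s a) \<and> above (\<lambda>z. - v z) (- (c + g)) (sqp x s b) \<or>
          above v (c' - g) (sqp x s b) \<and> above (\<lambda>z. - v z) (- (c + g)) (sqp x s a)"
        using ab(4) Cl Dl by blast
      show "sqp x s ` {a..b} \<inter> Q k = {}" if "x \<in> closure (Q k)" for k
        using ab(3) cl_disj[OF that, of i0] i0 front_iff by auto
    qed
    then show False using no by blast
  qed
qed

text \<open>If lower and upper limit differed, two reals strictly between them would be levels as
  excluded by \<open>levels_contra\<close>.\<close>

theorem disk_limit:
  assumes lm: "lmin ver u" and x: "x \<in> S"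
  shows "\<exists>L. ((\<lambda>i. ereal (pM (rl u) i)) \<longlongrightarrow> L) (dto x)"
proof (cases "Liminf (dto x) (\<lambda>i. ereal (pM (rl u) i)) < Limsup (dto x) (\<lambda>i. ereal (pM (rl u) i))")
  case False
  then have "Liminf (dto x) (\<lambda>i. ereal (pM (rl u) i)) = Limsup (dto x) (\<lambda>i. ereal (pM (rl u) i))"
    using Liminf_le_Limsup[OF dto_nonbot[OF x], of "\<lambda>i. ereal (pM (rl u) i)"] by simp
  then have "((\<lambda>i. ereal (pM (rl u) i)) \<longlongrightarrow> Limsup (dto x) (\<lambda>i. ereal (pM (rl u) i))) (dto x)"
    using tendsto_iff_Liminf_eq_Limsup[OF dto_nonbot[OF x], of "\<lambda>i. ereal (pM (rl u) i)"] by simp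
  then show ?thesis by blast
next
  case True
  then obtain c where c: "Liminf (dto x) (\<lambda>i. ereal (pM (rl u) i)) < ereal c" "ereal c < Limsup (dto x) (\<lambda>i. ereal (pM (rl u) i))"
    using ereal_dense2[OF True] by blast
  obtain c' where c': "c < c'" "ereal c' < Limsup (dto x) (\<lambda>i. ereal (pM (rl u) i))"
    using ereal_dense2[OF c(2)] by auto
  have "frequently (\<lambda>i. c' < pM (rl u) i) (dto x)"
  proof (rule ccontr)
    assume "\<not> ?thesis"
    then have "eventually (\<lambda>i. ereal (pM (rl u) i) \<le> ereal c') (dto x)" by (simp add: not_frequently not_less)
    then have "Limsup (dto x) (\<lambda>i. ereal (pM (rl u) i)) \<le> ereal c'" by (rule Limsup_bounded)
    then show False using c'(2) by simp
  qed
  moreover have "frequently (\<lambda>i. pM (rl u) i < c) (dto x)"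
  proof (rule ccontr)
    assume "\<not> ?thesis"
    then have "eventually (\<lambda>i. ereal c \<le> ereal (pM (rl u) i)) (dto x)" by (simp add: not_frequently not_less)
    then have "ereal c \<le> Liminf (dto x) (\<lambda>i. ereal (pM (rl u) i))" by (rule Liminf_bounded)
    then show False using c(1) by simp
  qed
  ultimately show ?thesis using levels_contra[OF lm x c'(1)] by blast
qed

end

section \<open>Accessible points\<close>

context rel_carpet
begin

lemma AE_pt_not_S:
  assumes "gline v b r"
  shows "AE t in lborel. t \<in> {p..q} \<longrightarrow> pt b r t \<notin> S"
proof -
  define \<phi> where "\<phi> z = (if b then Re z else Im z)" for z
  have "\<bar>\<phi> z - \<phi> w\<bar> \<le> dist z w" for z w
    using abs_Re_le_cmod[of "z - w"] abs_Im_le_cmod[of "z - w"] by (auto simp: \<phi>_def dist_norm)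
  moreover have "hausdorff1 (pt b r ` {p..q} \<inter> S) = 0" using assms by (simp add: gline_def)
  ultimately have "AE t in lborel. t \<notin> \<phi> ` (pt b r ` {p..q} \<inter> S)" by (intro hausdorff1_null_lipschitz) auto
  then show ?thesis
  proof (rule eventually_mono, intro impI notI)
    fix t assume t: "t \<notin> \<phi> ` (pt b r ` {p..q} \<inter> S)" "t \<in> {p..q}" "pt b r t \<in> S"
    have "\<phi> (pt b r t) = t" by (simp add: \<phi>_def pt_def)
    then show False using t by (metis IntI imageI)
  qed
qed

text \<open>No factor 3 is allowed here, since good paths are defined with the plain sum. From
  leaving the first disk to entering the second the path avoids both, so their oscillations are
  still free to pay for the two ends.\<close>

lemma tame_pM:
  assumes tm: "tame v f a b" and v: "pbdd v" and ab: "a \<le> b" and i: "f a \<in> Q i" and j: "f b \<in> Q j"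
  shows "ennreal \<bar>pM v i - pM v j\<bar> \<le> psum (eO v) (hit (f ` {a..b}))"
proof (cases "i = j")
  case False
  have f: "continuous_on {a..b} f" by (rule tame_by_cont[OF tm])
  have "f a \<in> closure (Q i)" "f b \<notin> Q i" using i j closure_subset cl_disj[of "f b" i j] False by blast+
  then obtain c1 where c1: "c1 \<in> {a..b}" "f c1 \<in> frontier (Q i)" "f ` {c1..b} \<inter> Q i = {}"
    using path_leaves[OF f ab] by blast
  have f1: "continuous_on {c1..b} f" by (rule continuous_on_subset[OF f]) (use c1 in auto)
  have "f c1 \<notin> Q j" using c1(2) front_S S_not_Q by blast
  moreover have "f b \<in> closure (Q j)" using j closure_subset by blast
  ultimately obtain c2 where c2: "c2 \<in> {c1..b}" "f c2 \<in> frontier (Q j)" "f ` {c1..c2} \<inter> Q j = {}"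
    using path_enters[OF f1, of j] c1(1) by auto
  have "ennreal \<bar>v (f c1) - v (f c2)\<bar> \<le> psum (eO v) (hit (f ` {c1..c2}))"
  proof (rule tame_byD[OF tm])
    show "f c1 \<in> S" "f c2 \<in> S" using c1(2) c2(2) front_S by blast+
  qed (use c1(1) c2(1) in auto)
  moreover have "\<bar>pM v i - pM v j\<bar> \<le> pO v i + pO v j + \<bar>v (f c1) - v (f c2)\<bar>"
    using pM_ge[OF v c1(2)] pm_le[OF v c1(2)] pM_ge[OF v c2(2)] pm_le[OF v c2(2)] by (simp add: pO_def abs_if)
  then have "ennreal \<bar>pM v i - pM v j\<bar> \<le> ennreal (pO v i) + ennreal (pO v j) + ennreal \<bar>v (f c1) - v (f c2)\<bar>"
    using pO_nonneg[OF v, of i] pO_nonneg[OF v, of j] by (simp add: ennreal_leI flip: ennreal_plus)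
  ultimately have "ennreal \<bar>pM v i - pM v j\<bar> \<le> psum (eO v) {i, j} + psum (eO v) (hit (f ` {c1..c2}))"
    using False by (simp add: psum_finite) (meson add_left_mono order_trans)
  also have "\<dots> = psum (eO v) ({i, j} \<union> hit (f ` {c1..c2}))"
  proof (rule psum_Un_disjoint[symmetric])
    have "f ` {c1..c2} \<subseteq> f ` {c1..b}" using c2(1) by (intro image_mono) auto
    then show "{i, j} \<inter> hit (f ` {c1..c2}) = {}" using c1(3) c2(3) unfolding disks_meeting_def by blast
  qed
  also have "\<dots> \<le> psum (eO v) (hit (f ` {a..b}))"
  proof (intro psum_mono_set Un_least)
    have "f ` {c1..c2} \<subseteq> f ` {a..b}" using c1(1) c2(1) by (intro image_mono) auto
    then show "hit (f ` {c1..c2}) \<subseteq> hit (f ` {a..b})" by (rule disks_meeting_mono)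
    have "f a \<in> f ` {a..b}" "f b \<in> f ` {a..b}" using ab by auto
    then show "{i, j} \<subseteq> hit (f ` {a..b})" using i j unfolding disks_meeting_def by blast
  qed
  finally show ?thesis .
qed simp

lemma good_segment:
  assumes g: "g \<in> sobolev_loc ver \<Omega> Q" and gl: "gline (rl g) b r" and pq: "p < q" "pt b r ` {p..q} \<subseteq> \<Omega>"
  shows "({p..q}, pt b r) \<in> good_paths \<Omega> Q g"
proof -
  note per = sobolev_loc_peri[OF g]
  have fin: "psum (eO (rl g)) (hit (pt b r ` {p..q})) < \<infinity>" using gline_sum[OF gl _ pq(2)] pq(1) by simp
  have oe: "peri_osc Q g = eO (rl g)" using per(4) by (intro ext) simp
  have pl: "({p..q}, pt b r) \<in> paths_in \<Omega>"
    using pq continuous_pt[of "{p..q}" b r] by (auto simp: paths_in_def is_planar_path_def path_trace_def is_interval_cc)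
  have nc: "nonconstant ({p..q}, pt b r)"
  proof -
    have "p \<in> {p..q}" "q \<in> {p..q}" "pt b r p \<noteq> pt b r q" using pq by auto
    then show ?thesis unfolding nonconstant_def fst_conv snd_conv by metis
  qed
  have h1: "hausdorff1 (path_trace ({p..q}, pt b r) \<inter> S) = 0"
    using gl by (simp add: gline_def path_trace_def)
  have sub: "path_trace \<gamma>' \<subseteq> pt b r ` {p..q}" if "is_subpath \<gamma>' ({p..q}, pt b r)" for \<gamma>'
    using that unfolding is_subpath_def path_trace_def by fastforce
  have osc: "e2ennreal \<bar>peri_max Q g i - peri_max Q g j\<bar> \<le> (\<Sum>\<^sub>\<infinity>k\<in>hit (path_trace \<gamma>'). peri_osc Q g k)"
    if s: "is_subpath \<gamma>' ({p..q}, pt b r)" and ij: "i \<in> hit (path_trace \<gamma>')" "j \<in> hit (path_trace \<gamma>')" for \<gamma>' i j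
  proof -
    obtain I f where \<gamma>: "\<gamma>' = (I, f)" by fastforce
    have I: "is_interval I" "I \<subseteq> {p..q}" "\<And>t. t \<in> I \<Longrightarrow> f t = pt b r t" using s by (auto simp: is_subpath_def \<gamma>)
    have tr: "path_trace \<gamma>' = pt b r ` I" unfolding path_trace_def \<gamma> using I(3) by (auto intro!: image_cong)
    obtain a where a: "a \<in> I" "pt b r a \<in> Q i" using ij(1) unfolding tr disks_meeting_def by blast
    obtain c where c: "c \<in> I" "pt b r c \<in> Q j" using ij(2) unfolding tr disks_meeting_def by blast
    have seg: "ennreal \<bar>pM (rl g) i - pM (rl g) j\<bar> \<le> psum (eO (rl g)) (hit (pt b r ` I))"
      if ac: "a \<le> c" "a \<in> I" "c \<in> I" "pt b r a \<in> Q i" "pt b r c \<in> Q j" for a c i j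
    proof -
      have "{a..c} \<subseteq> I" using I(1) ac(2,3) unfolding is_interval_1 by (metis atLeastAtMost_iff subsetI)
      then have s: "pt b r ` {a..c} \<subseteq> pt b r ` I" "pt b r ` {a..c} \<subseteq> \<Omega>" using I(2) pq(2) by blast+
      have "ennreal \<bar>pM (rl g) i - pM (rl g) j\<bar> \<le> psum (eO (rl g)) (hit (pt b r ` {a..c}))"
        by (rule tame_pM[OF gline_tame[OF gl ac(1) s(2)] per(5) ac(1,4,5)])
      also have "\<dots> \<le> psum (eO (rl g)) (hit (pt b r ` I))" by (rule psum_hit_mono[OF s(1)])
      finally show ?thesis .
    qed
    have "ennreal \<bar>pM (rl g) i - pM (rl g) j\<bar> \<le> psum (eO (rl g)) (hit (pt b r ` I))"
    proof (cases "a \<le> c")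
      case True
      then show ?thesis using seg a c by blast
    next
      case False
      then have "ennreal \<bar>pM (rl g) j - pM (rl g) i\<bar> \<le> psum (eO (rl g)) (hit (pt b r ` I))"
        using seg[of c a j i] a c by simp
      then show ?thesis by (simp add: abs_minus_commute)
    qed
    moreover have "e2ennreal \<bar>peri_max Q g i - peri_max Q g j\<bar> = ennreal \<bar>pM (rl g) i - pM (rl g) j\<bar>"
      by (simp add: per(2) ennreal.rep_eq flip: e2ennreal_ereal)
    ultimately show ?thesis by (simp add: infsum_psum oe tr)
  qed
  have fs: "(\<Sum>\<^sub>\<infinity>k\<in>hit (path_trace \<gamma>'). peri_osc Q g k) < \<infinity>" if "path_trace \<gamma>' \<subseteq> pt b r ` {p..q}" for \<gamma>'
    using psum_hit_mono[OF that, of "eO (rl g)"] fin unfolding infsum_psum oe by (rule order_le_less_trans)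
  have fs': "(\<Sum>\<^sub>\<infinity>k\<in>hit (path_trace ({p..q}, pt b r)). peri_osc Q g k) < \<infinity>"
    by (rule fs) (simp add: path_trace_def)
  show ?thesis unfolding good_paths_def using pl nc h1 osc fs[OF sub] fs' by blast
qed

section \<open>Approach along good paths\<close>

lemma eventually_along:
  "eventually P (disks_to_along Q x \<gamma>) \<longleftrightarrow> (\<exists>\<epsilon>>0. \<forall>i\<in>hit (path_trace \<gamma>). Q i \<subseteq> ball x \<epsilon> \<longrightarrow> P i)"
proof -
  have "eventually P (disks_to_along Q x \<gamma>) \<longleftrightarrow>
      (\<exists>\<epsilon>\<in>{0<..}. eventually P (principal {i \<in> hit (path_trace \<gamma>). Q i \<subseteq> ball x \<epsilon>}))"
    unfolding disks_to_along_def
  proof (rule eventually_INF_base)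
    fix a b :: real assume "a \<in> {0<..}" "b \<in> {0<..}"
    then show "\<exists>x'\<in>{0<..}. principal {i \<in> hit (path_trace \<gamma>). Q i \<subseteq> ball x x'} \<le>
        inf (principal {i \<in> hit (path_trace \<gamma>). Q i \<subseteq> ball x a}) (principal {i \<in> hit (path_trace \<gamma>). Q i \<subseteq> ball x b})"
      by (intro bexI[of _ "min a b"]) (auto simp: subset_iff)
  qed auto
  then show ?thesis unfolding eventually_principal by blast
qed

lemma good_pathD:
  assumes "\<gamma> \<in> good_paths \<Omega> Q g"
  shows "\<gamma> \<in> paths_in \<Omega>" "nonconstant \<gamma>" "hausdorff1 (path_trace \<gamma> \<inter> S) = 0"
    "\<And>\<gamma>' i j. is_subpath \<gamma>' \<gamma> \<Longrightarrow> i \<in> hit (path_trace \<gamma>') \<Longrightarrow> j \<in> hit (path_trace \<gamma>') \<Longrightarrow>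
       e2ennreal \<bar>peri_max Q g i - peri_max Q g j\<bar> \<le> (\<Sum>\<^sub>\<infinity>k\<in>hit (path_trace \<gamma>'). peri_osc Q g k)"
    "\<And>\<gamma>'. is_subpath \<gamma>' \<gamma> \<Longrightarrow> compactly_contained (path_trace \<gamma>') \<Omega> \<Longrightarrow>
       (\<Sum>\<^sub>\<infinity>k\<in>hit (path_trace \<gamma>'). peri_osc Q g k) < \<infinity>"
  using assms unfolding good_paths_def by blast+

text \<open>Common consequences of both kinds of accessibility. In the first kind \<open>x\<close>
  is in no closed disk, so that the last claim is vacuous.\<close>

lemma accessible_alongD:
  assumes \<gamma>0: "\<gamma>\<^sub>0 \<in> good_paths \<Omega> Q g" and ac: "accessible_along \<Omega> Q x \<gamma>\<^sub>0 \<gamma>"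
  shows "x \<in> S" "is_subpath \<gamma> \<gamma>\<^sub>0" "x \<in> closure (path_trace \<gamma>)" "\<exists>w\<in>path_trace \<gamma>. w \<noteq> x"
    "x \<in> closure (Q i) \<Longrightarrow> path_trace \<gamma> \<inter> Q i = {}"
proof -
  have pl: "fst \<gamma>\<^sub>0 \<noteq> {}" "is_interval (fst \<gamma>\<^sub>0)" using good_pathD(1)[OF \<gamma>0] by (auto simp: paths_in_def is_planar_path_def)
  have "x \<in> S \<and> is_subpath \<gamma> \<gamma>\<^sub>0 \<and> x \<in> closure (path_trace \<gamma>) \<and> (\<exists>w\<in>path_trace \<gamma>. w \<noteq> x) \<and>
      (\<forall>i. x \<in> closure (Q i) \<longrightarrow> path_trace \<gamma> \<inter> Q i = {})"
  proof (cases "x \<in> path_trace \<gamma>\<^sub>0 \<inter> carpet_core \<Omega> Q")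
    case True
    then have e: "\<gamma> = \<gamma>\<^sub>0" using ac by (simp add: accessible_along_def)
    have xS: "x \<in> S" "\<And>i. x \<notin> frontier (Q i)" using True by (auto simp: carpet_core_def)
    have "\<exists>w\<in>path_trace \<gamma>\<^sub>0. w \<noteq> x"
      using good_pathD(2)[OF \<gamma>0] unfolding nonconstant_def path_trace_def by blast
    moreover have "is_subpath \<gamma>\<^sub>0 \<gamma>\<^sub>0" using pl by (simp add: is_subpath_def)
    moreover have "x \<in> closure (path_trace \<gamma>\<^sub>0)" using True closure_subset by blast
    ultimately show ?thesis using e xS S_cl_front by blast
  next
    case False
    then have a: "x \<in> S" "is_subpath \<gamma> \<gamma>\<^sub>0" "x \<in> closure (path_trace \<gamma>) - path_trace \<gamma>"
        "\<forall>i. x \<in> frontier (Q i) \<longrightarrow> path_trace \<gamma> \<inter> Q i = {}"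
      using ac unfolding accessible_along_def by (simp_all split: if_splits)
    have "path_trace \<gamma> \<noteq> {}" using a(2) by (auto simp: is_subpath_def path_trace_def)
    then obtain w where w: "w \<in> path_trace \<gamma>" by blast
    then have "w \<noteq> x" using a(3) by auto
    with w have "\<exists>w\<in>path_trace \<gamma>. w \<noteq> x" by blast
    then show ?thesis using a S_cl_front[OF a(1)] by blast
  qed
  then show "x \<in> S" "is_subpath \<gamma> \<gamma>\<^sub>0" "x \<in> closure (path_trace \<gamma>)" "\<exists>w\<in>path_trace \<gamma>. w \<noteq> x"
    "x \<in> closure (Q i) \<Longrightarrow> path_trace \<gamma> \<inter> Q i = {}" by blast+
qed

lemma subpath_trace:
  assumes \<gamma>0: "\<gamma>\<^sub>0 \<in> good_paths \<Omega> Q g" and s: "is_subpath \<gamma> \<gamma>\<^sub>0"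
  shows "path_trace \<gamma> \<subseteq> path_trace \<gamma>\<^sub>0" "path_trace \<gamma> \<subseteq> \<Omega>" "connected (path_trace \<gamma>)" "hausdorff1 (path_trace \<gamma> \<inter> S) = 0"
proof -
  have pl: "is_planar_path \<gamma>\<^sub>0" "path_trace \<gamma>\<^sub>0 \<subseteq> \<Omega>" using good_pathD(1)[OF \<gamma>0] by (auto simp: paths_in_def)
  have tr: "path_trace \<gamma> = snd \<gamma>\<^sub>0 ` fst \<gamma>" using s unfolding is_subpath_def path_trace_def by (auto intro!: image_cong)
  show t: "path_trace \<gamma> \<subseteq> path_trace \<gamma>\<^sub>0" unfolding tr using s unfolding path_trace_def is_subpath_def by blast
  then show "path_trace \<gamma> \<subseteq> \<Omega>" using pl(2) by blast
  obtain f where f: "continuous_on (closure (fst \<gamma>\<^sub>0)) f" "\<forall>t\<in>fst \<gamma>\<^sub>0. f t = snd \<gamma>\<^sub>0 t"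
    using pl(1) unfolding is_planar_path_def by blast
  have sub: "fst \<gamma> \<subseteq> fst \<gamma>\<^sub>0" "is_interval (fst \<gamma>)" using s by (auto simp: is_subpath_def)
  have "connected (f ` fst \<gamma>)"
    using sub closure_subset by (intro connected_continuous_image continuous_on_subset[OF f(1)]) (auto simp: is_interval_connected)
  moreover have "f ` fst \<gamma> = path_trace \<gamma>" unfolding tr using f(2) sub(1) by (intro image_cong) auto
  ultimately show "connected (path_trace \<gamma>)" by simp
  have "hausdorff1 (path_trace \<gamma> \<inter> S) \<le> hausdorff1 (path_trace \<gamma>\<^sub>0 \<inter> S)" using t by (intro hausdorff1_mono) auto
  then show "hausdorff1 (path_trace \<gamma> \<inter> S) = 0" using good_pathD(3)[OF \<gamma>0] by simp
qed

text \<open>The set crosses every square that separates \<open>x\<close> from \<open>w\<close>, and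
  for almost every size no crossing point is on the carpet, so all of them are in disks.\<close>

lemma AE_square_disk:
  assumes T: "connected T" "T \<subseteq> \<Omega>" "x \<in> closure T" "w \<in> T" and h: "hausdorff1 (T \<inter> S) = 0"
  shows "AE s in lborel. 0 < s \<and> s < nrm (w - x) \<longrightarrow> (\<exists>k. T \<inter> sqr x s \<inter> Q k \<noteq> {})"
proof -
  have "AE s in lborel. s \<notin> (\<lambda>z. nrm (z - x)) ` (T \<inter> S)"
  proof (rule hausdorff1_null_lipschitz[OF h])
    show "\<bar>nrm (z - x) - nrm (w - x)\<bar> \<le> dist z w" for z w
      using nrm_diff[of "z - x" "w - x"] nrm_le_cmod[of "z - w"] by (simp add: dist_norm)
  qed
  then show ?thesis
  proof (rule eventually_mono, intro impI)
    fix s assume s: "s \<notin> (\<lambda>z. nrm (z - x)) ` (T \<inter> S)" "0 < s \<and> s < nrm (w - x)"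
    obtain z where z: "z \<in> T" "dist z x < s" using T(3) s(2) unfolding closure_approachable by blast
    have "nrm (z - x) < s" using z(2) nrm_le_cmod[of "z - x"] by (simp add: dist_norm)
    then obtain y where y: "y \<in> T" "y \<in> sqr x s" using connected_meets_sqr[OF T(1) z(1) T(4)] s(2) by blast
    have "y \<notin> S" using s(1) y by (auto simp: sqr_def)
    then obtain k where "y \<in> Q k" using Om_cases T(2) y(1) by blast
    then show "\<exists>k. T \<inter> sqr x s \<inter> Q k \<noteq> {}" using y by blast
  qed
qed

text \<open>Over the trivial filter a Liminf would be \<infinity>, so disks met by the path have to
  shrink to \<open>x\<close>. Small squares produce such disks, and \<open>small_near\<close>
  applies to them because the path avoids any disk with \<open>x\<close> in its closure.\<close>

lemma along_nonbot:
  assumes \<gamma>0: "\<gamma>\<^sub>0 \<in> good_paths \<Omega> Q g" and ac: "accessible_along \<Omega> Q x \<gamma>\<^sub>0 \<gamma>"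
  shows "disks_to_along Q x \<gamma> \<noteq> bot"
proof -
  note D = accessible_alongD[OF \<gamma>0 ac]
  note T = subpath_trace[OF \<gamma>0 D(2)]
  obtain w where w: "w \<in> path_trace \<gamma>" "w \<noteq> x" using D(4) by blast
  have "\<exists>i\<in>hit (path_trace \<gamma>). Q i \<subseteq> ball x \<epsilon>" if e: "\<epsilon> > 0" for \<epsilon>
  proof -
    obtain \<delta> where \<delta>: "\<delta> > 0" "\<forall>i\<in>hit (ball x \<delta>). x \<notin> closure (Q i) \<longrightarrow> Q i \<subseteq> ball x \<epsilon>"
      using small_near[OF e] by blast
    have "0 < min (\<delta> / 2) (nrm (w - x))" using \<delta>(1) nrm_pos[of "w - x"] w(2) by simp
    then obtain s where s: "0 < s" "s < min (\<delta> / 2) (nrm (w - x))"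
        "0 < s \<and> s < nrm (w - x) \<longrightarrow> (\<exists>k. path_trace \<gamma> \<inter> sqr x s \<inter> Q k \<noteq> {})"
      using AE_dense[OF AE_square_disk[OF T(3,2) D(3) w(1) T(4)]] by blast
    then obtain k y where k: "y \<in> path_trace \<gamma>" "y \<in> sqr x s" "y \<in> Q k" by auto
    have "y \<in> cball x (2 * s)" using k(2) sqr_sub_cball by blast
    then have "y \<in> ball x \<delta>" using s(2) by simp
    then have "k \<in> hit (ball x \<delta>)" using k(3) unfolding disks_meeting_def by blast
    moreover have "k \<in> hit (path_trace \<gamma>)" using k unfolding disks_meeting_def by blast
    moreover have "x \<notin> closure (Q k)" using D(5)[of k] k by blast
    ultimately show ?thesis using \<delta>(2) by blast
  qed
  then show ?thesis unfolding trivial_limit_def eventually_along by blast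
qed

text \<open>Counterpart of \<open>tail_small\<close> for good paths. The parameter
  \<open>\<sigma>\<close> may be an end point missing from the interval, hence the continuous
  extension \<open>f\<close>.\<close>

lemma good_path_tail:
  assumes g: "g \<in> sobolev_loc ver \<Omega> Q" and \<gamma>0: "\<gamma>\<^sub>0 \<in> good_paths \<Omega> Q g" and s: "is_subpath \<gamma> \<gamma>\<^sub>0"
    and f: "continuous_on (closure (fst \<gamma>)) f" "\<And>t. t \<in> fst \<gamma> \<Longrightarrow> f t = snd \<gamma> t"
    and \<sigma>: "\<sigma> \<in> closure (fst \<gamma>)" "f \<sigma> = z" and z: "z \<in> \<Omega>" "\<And>k. z \<notin> closure (Q k)" and \<eta>: "\<eta> > 0"
  shows "\<exists>h>0. psum (eO (rl g)) (hit (f ` (fst \<gamma> \<inter> ball \<sigma> h))) < ennreal \<eta>"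
proof -
  have oe: "peri_osc Q g = eO (rl g)" using sobolev_loc_peri(4)[OF g] by (intro ext) simp
  obtain e where e: "e > 0" "cball z e \<subseteq> \<Omega>" using z(1) open_Om open_contains_cball by blast
  have near: "\<exists>h>0. \<forall>t\<in>fst \<gamma> \<inter> ball \<sigma> h. dist (f t) z < d" if d: "d > 0" for d
  proof -
    obtain h where "h > 0" "\<forall>t\<in>closure (fst \<gamma>). dist t \<sigma> < h \<longrightarrow> dist (f t) (f \<sigma>) < d"
      using f(1) \<sigma>(1) d unfolding continuous_on_iff by blast
    then show ?thesis using closure_subset[of "fst \<gamma>"] \<sigma>(2) by (intro exI[of _ h]) (auto simp: dist_commute)
  qed
  obtain h1 where h1: "h1 > 0" "\<forall>t\<in>fst \<gamma> \<inter> ball \<sigma> h1. dist (f t) z < e" using near[OF e(1)] by blast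
  define I where "I h = fst \<gamma> \<inter> ball \<sigma> h" for h
  have ne: "I h \<noteq> {}" if h: "h > 0" for h
  proof -
    obtain t where "t \<in> fst \<gamma>" "dist t \<sigma> < h" using \<sigma>(1) h unfolding closure_approachable by blast
    then have "t \<in> I h" by (simp add: I_def dist_commute)
    then show ?thesis by blast
  qed
  have int: "is_interval (I h)" for h
    using s unfolding I_def is_subpath_def ball_eq_greaterThanLessThan by (intro is_interval_Int) auto
  have sp: "is_subpath (I h, f) \<gamma>\<^sub>0" if "h > 0" for h
    using s ne[OF that] int f(2) unfolding is_subpath_def by (auto simp: I_def)
  have "f ` I h1 \<subseteq> cball z e" using h1(2) by (force simp: I_def dist_commute)
  then have "closure (f ` I h1) \<subseteq> cball z e" by (intro closure_minimal) auto
  then have "compactly_contained (path_trace (I h1, f)) \<Omega>"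
    using e(2) compact_cball[of z e] unfolding compactly_contained_def path_trace_def fst_conv snd_conv
    by (meson bounded_cball bounded_subset closed_closure compact_eq_bounded_closed order_trans)
  from good_pathD(5)[OF \<gamma>0 sp[OF h1(1)] this]
  have fin: "psum (eO (rl g)) (hit (f ` I h1)) < \<infinity>" by (simp add: infsum_psum oe path_trace_def)
  obtain F where F: "finite F" "F \<subseteq> hit (f ` I h1)" "psum (eO (rl g)) (hit (f ` I h1) - F) < ennreal \<eta>"
    using psum_tail[OF fin, of "ennreal \<eta>"] \<eta> by auto
  have "closed (\<Union>k\<in>F. closure (Q k))" using F by (intro closed_UN) auto
  then have "open (- (\<Union>k\<in>F. closure (Q k)))" by (rule open_Compl)
  moreover have "z \<in> - (\<Union>k\<in>F. closure (Q k))" using z(2) by blast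
  ultimately obtain d where d: "d > 0" "ball z d \<subseteq> - (\<Union>k\<in>F. closure (Q k))"
    unfolding open_contains_ball by blast
  obtain h2 where h2: "h2 > 0" "\<forall>t\<in>fst \<gamma> \<inter> ball \<sigma> h2. dist (f t) z < d" using near[OF d(1)] by blast
  define h where "h = min h1 h2"
  have "hit (f ` I h) \<subseteq> hit (f ` I h1) - F"
  proof
    fix k assume "k \<in> hit (f ` I h)"
    then obtain t where t: "t \<in> I h" "f t \<in> Q k" unfolding disks_meeting_def by blast
    have "t \<in> fst \<gamma> \<inter> ball \<sigma> h2" "t \<in> I h1" using t(1) by (auto simp: I_def h_def)
    then have "f t \<in> ball z d" "k \<in> hit (f ` I h1)" using h2(2) t(2) unfolding disks_meeting_def by (auto simp: dist_commute)
    then have "f t \<notin> (\<Union>k\<in>F. closure (Q k))" using d(2) by blast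
    then have "k \<notin> F" using t(2) closure_subset by blast
    then show "k \<in> hit (f ` I h1) - F" using \<open>k \<in> hit (f ` I h1)\<close> by blast
  qed
  then have "psum (eO (rl g)) (hit (f ` I h)) < ennreal \<eta>"
    using F(3) by (meson order_le_less_trans psum_mono_set)
  moreover have "h > 0" using h1 h2 by (simp add: h_def)
  ultimately show ?thesis unfolding I_def by blast
qed

text \<open>A generic segment through \<open>z\<close> meets every small square around
  \<open>z\<close>, on at least one side even if \<open>z\<close> is an end point. This carries the
  value \<open>v z\<close> over to the square.\<close>

lemma gline_point:
  assumes gl: "gline v b r" and v: "pbdd v" and z: "z = pt b r t" "z \<in> S" "\<And>k. z \<notin> closure (Q k)" and pq: "p \<le> t" "t \<le> q" "p < q"
    "pt b r ` {p..q} \<subseteq> \<Omega>" and \<eta>: "\<eta> > 0"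
  shows "\<exists>h>0. \<forall>s. 0 < s \<and> s < h \<longrightarrow> (\<exists>w\<in>sqr z s. \<forall>y. val v w y \<longrightarrow> \<bar>y - v z\<bar> < \<eta>)"
proof -
  have pq': "p \<le> q" using pq by simp
  obtain h where h: "h > 0" "\<And>a c. p \<le> a \<and> c \<le> q \<and> \<bar>a - t\<bar> < h \<and> \<bar>c - t\<bar> < h \<Longrightarrow>
      psum (eO v) {k \<in> hit (pt b r ` {a..c}). pt b r t \<notin> closure (Q k)} < ennreal (\<eta> / 3)"
    using tail_small[OF continuous_pt gline_sum[OF gl pq' pq(4)], of t "ennreal (\<eta> / 3)"] pq(1,2) \<eta> by auto
  define h' where "h' = min h ((q - p) / 2)"
  have "\<exists>w\<in>sqr z s. \<forall>y. val v w y \<longrightarrow> \<bar>y - v z\<bar> < \<eta>" if s: "0 < s" "s < h'" for s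
  proof -
    define t' where "t' = (if t + s \<le> q then t + s else t - s)"
    have t': "p \<le> t'" "t' \<le> q" "\<bar>t' - t\<bar> = s" using s pq by (auto simp: t'_def h'_def)
    have "nrm (pt b r t' - z) = s" using t'(3) s by (auto simp: z pt_def nrm_def)
    then have w: "pt b r t' \<in> sqr z s" by (simp add: sqr_def)
    have "\<bar>y - v z\<bar> < \<eta>" if y: "val v (pt b r t') y" for y
    proof -
      have vz: "val v (pt b r t) (v z)" using z by (simp add: val_def)
      have sub: "pt b r ` {min t' t..max t' t} \<subseteq> \<Omega>" using pq t' by (intro subset_trans[OF image_mono pq(4)]) auto
      have "ennreal \<bar>y - v z\<bar> \<le> 3 * psum (eO v) (hit (pt b r ` {min t' t..max t' t}))"
        using gl by (intro tame_line_val[OF _ v sub y vz]) (simp add: gline_def)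
      also have "hit (pt b r ` {min t' t..max t' t}) = {k \<in> hit (pt b r ` {min t' t..max t' t}). pt b r t \<notin> closure (Q k)}"
        using z(1,3) by auto
      also have "3 * psum (eO v) {k \<in> hit (pt b r ` {min t' t..max t' t}). pt b r t \<notin> closure (Q k)} < 3 * ennreal (\<eta> / 3)"
      proof (rule ennreal_mult_strict_left_mono)
        show "psum (eO v) {k \<in> hit (pt b r ` {min t' t..max t' t}). pt b r t \<notin> closure (Q k)} < ennreal (\<eta> / 3)"
        proof (rule h(2))
          have "s < h" using s by (simp add: h'_def)
          then show "p \<le> min t' t \<and> max t' t \<le> q \<and> \<bar>min t' t - t\<bar> < h \<and> \<bar>max t' t - t\<bar> < h"
            using t' pq h(1) by (auto simp: min_def max_def)
        qed
      qed auto
      also have "\<dots> = ennreal \<eta>"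
      proof -
        have "3 * ennreal (\<eta> / 3) = ennreal 3 * ennreal (\<eta> / 3)" by simp
        also have "\<dots> = ennreal (3 * (\<eta> / 3))" using \<eta> by (intro ennreal_mult[symmetric]) auto
        finally show ?thesis by simp
      qed
      finally show ?thesis by (simp add: ennreal_less_iff)
    qed
    then show ?thesis using w by blast
  qed
  moreover have "h' > 0" using h pq by (simp add: h'_def)
  ultimately show ?thesis by blast
qed

lemma square_near:
  assumes s: "0 < s" and sd: "\<forall>(b, r)\<in>sides x s. gline v b r" and v: "pbdd v"
    and sm: "psum (eO v) {k \<in> hit (sqr x s). x \<notin> closure (Q k)} < ennreal (g / 15)" and Om: "sqr x s \<subseteq> \<Omega>"
    and x: "\<And>k. x \<notin> closure (Q k)" and w: "w \<in> sqr x s" "w' \<in> sqr x s" and y: "val v w y" "val v w' y'"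
  shows "\<bar>y - y'\<bar> < g"
proof -
  obtain a where a: "sqp x s a = w" using sqp_surj[OF s w(1)] by blast
  obtain b where b: "a \<le> b" "b < a + 2 * pi" "sqp x s b = w'" using sqp_surj[OF s w(2)] by blast
  show ?thesis
    by (rule square_gap[OF s sd v sm Om b(1)]) (use a b x y in auto)
qed

text \<open>The normalized version uses some accessing path, not the line at hand. Both meet a good
  square around \<open>z\<close>, the path inside a disk, the line in a point; so the values agree
  up to small sums along the path, across the square and along the line.\<close>

lemma core_value:
  assumes g: "g \<in> sobolev_loc ver \<Omega> Q" and gl: "gline (rl g) b r" and zt: "z = pt b r t"
    and pq: "p \<le> t" "t \<le> q" "p < q" "pt b r ` {p..q} \<subseteq> \<Omega>" and z: "z \<in> carpet_core \<Omega> Q"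
  shows "normalized_version \<Omega> Q g z = ereal (rl g z)"
proof -
  define v where "v = rl g"
  note per = sobolev_loc_peri[OF g]
  have v: "pbdd v" using per(5) by (simp add: v_def)
  have oe: "peri_osc Q g = eO v" using per(4) by (intro ext) (simp add: v_def)
  have zS: "z \<in> S" "z \<in> \<Omega>" using z S_sub by (auto simp: carpet_core_def)
  have zk: "z \<notin> closure (Q k)" for k using z S_cl_front[OF zS(1)] by (auto simp: carpet_core_def)
  have "accessible_along \<Omega> Q z ({p..q}, pt b r) ({p..q}, pt b r)"
    using z pq zt by (simp add: accessible_along_def path_trace_def)
  then have ex: "\<exists>\<gamma>. \<exists>\<gamma>0\<in>good_paths \<Omega> Q g. accessible_along \<Omega> Q z \<gamma>0 \<gamma>"
    using good_segment[OF g gl pq(3,4)] by blast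
  define \<gamma> where "\<gamma> = (SOME \<gamma>. \<exists>\<gamma>\<^sub>0\<in>good_paths \<Omega> Q g. accessible_along \<Omega> Q z \<gamma>\<^sub>0 \<gamma>)"
  have "\<exists>\<gamma>\<^sub>0\<in>good_paths \<Omega> Q g. accessible_along \<Omega> Q z \<gamma>\<^sub>0 \<gamma>" unfolding \<gamma>_def by (rule someI_ex[OF ex])
  then obtain \<gamma>0 where \<gamma>0: "\<gamma>0 \<in> good_paths \<Omega> Q g" and ac: "accessible_along \<Omega> Q z \<gamma>0 \<gamma>" by blast
  note D = accessible_alongD[OF \<gamma>0 ac]
  note T = subpath_trace[OF \<gamma>0 D(2)]
  have val: "normalized_version \<Omega> Q g z = Liminf (disks_to_along Q z \<gamma>) (peri_max Q g)"
  proof -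
    have "z \<in> accessible_points \<Omega> Q g" using ex unfolding accessible_points_def by blast
    then show ?thesis unfolding normalized_version_def accessible_value_def \<gamma>_def by (rule if_P)
  qed
  have pl0: "is_planar_path \<gamma>0" using good_pathD(1)[OF \<gamma>0] by (simp add: paths_in_def)
  have sub: "fst \<gamma> \<subseteq> fst \<gamma>0" "is_interval (fst \<gamma>)" "\<And>t. t \<in> fst \<gamma> \<Longrightarrow> snd \<gamma> t = snd \<gamma>0 t" using D(2) by (auto simp: is_subpath_def)
  obtain f where f0: "continuous_on (closure (fst \<gamma>0)) f" "\<forall>t\<in>fst \<gamma>0. f t = snd \<gamma>0 t"
    using pl0 unfolding is_planar_path_def by blast
  have f: "continuous_on (closure (fst \<gamma>)) f" by (rule continuous_on_subset[OF f0(1)]) (rule closure_mono[OF sub(1)])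
  have fe: "f t = snd \<gamma> t" if "t \<in> fst \<gamma>" for t using f0(2) sub that by auto
  have bd: "bounded (fst \<gamma>)" using pl0 bounded_subset[OF _ sub(1)] by (simp add: is_planar_path_def)
  have main: "\<exists>\<epsilon>>0. \<forall>i\<in>hit (path_trace \<gamma>). Q i \<subseteq> ball z \<epsilon> \<longrightarrow> \<bar>pM v i - v z\<bar> < \<eta>" if \<eta>: "\<eta> > 0" for \<eta>
  proof (rule ccontr)
    assume neg: "\<not> ?thesis"
    have "\<exists>i\<in>hit (path_trace \<gamma>). Q i \<subseteq> ball z (1 / real (Suc n)) \<and> \<not> \<bar>pM v i - v z\<bar> < \<eta>" for n
      using neg by (metis of_nat_0_less_iff zero_less_Suc zero_less_divide_1_iff)
    then obtain i where i: "\<And>n. i n \<in> hit (path_trace \<gamma>)" "\<And>n. Q (i n) \<subseteq> ball z (1 / real (Suc n))" "\<And>n. \<not> \<bar>pM v (i n) - v z\<bar> < \<eta>"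
      by metis
    have "\<exists>\<tau>\<in>fst \<gamma>. f \<tau> \<in> Q (i n)" for n
      using i(1)[of n] fe unfolding disks_meeting_def path_trace_def by fastforce
    then obtain \<tau> where \<tau>: "\<And>n. \<tau> n \<in> fst \<gamma>" "\<And>n. f (\<tau> n) \<in> Q (i n)" by metis
    \<comment> \<open>The offending disks are met at times that accumulate at some
      \<open>\<sigma>\<close> with \<open>f \<sigma> = z\<close>. The path may pass through
      \<open>z\<close> more than once, so only its part near \<open>\<sigma>\<close> is used for the
      comparison.\<close>
    have cp: "compact (closure (fst \<gamma>))" using bd by (simp add: compact_closure)
    have "\<tau> n \<in> closure (fst \<gamma>)" for n using \<tau>(1) closure_subset by blast
    then obtain \<sigma> \<phi> where \<sigma>: "\<sigma> \<in> closure (fst \<gamma>)" "strict_mono \<phi>" "(\<tau> \<circ> \<phi>) \<longlonglongrightarrow> \<sigma>"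
      using cp unfolding compact_def by meson
    have "(\<lambda>n. f ((\<tau> \<circ> \<phi>) n)) \<longlonglongrightarrow> f \<sigma>"
      using \<tau>(1) closure_subset by (intro continuous_on_tendsto_compose[OF f \<sigma>(3,1)]) (auto intro!: always_eventually)
    moreover have "(\<lambda>n. f ((\<tau> \<circ> \<phi>) n)) \<longlonglongrightarrow> z"
    proof (rule metric_LIMSEQ_I)
      fix e :: real assume "e > 0"
      then obtain N where N: "1 / real (Suc N) < e" using nat_approx_posE by blast
      have "dist (f ((\<tau> \<circ> \<phi>) n)) z < e" if "n \<ge> N" for n
      proof -
        have "f ((\<tau> \<circ> \<phi>) n) \<in> ball z (1 / real (Suc (\<phi> n)))" using \<tau>(2)[of "\<phi> n"] i(2)[of "\<phi> n"] by auto
        moreover have "1 / real (Suc (\<phi> n)) \<le> 1 / real (Suc N)"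
          using seq_suble[OF \<sigma>(2), of n] that by (intro divide_left_mono) auto
        ultimately show ?thesis using N by (simp add: dist_commute)
      qed
      then show "\<exists>N. \<forall>n\<ge>N. dist (f ((\<tau> \<circ> \<phi>) n)) z < e" by blast
    qed
    ultimately have fz: "f \<sigma> = z" using LIMSEQ_unique by blast
    \<comment> \<open>Three differences, each below this bound, are added at the end.\<close>
    have \<eta>4: "\<eta> / 4 > 0" using \<eta> by simp
    obtain h where h: "h > 0" "psum (eO v) (hit (f ` (fst \<gamma> \<inter> ball \<sigma> h))) < ennreal (\<eta> / 4)"
      using good_path_tail[OF g \<gamma>0 D(2) f fe \<sigma>(1) fz zS(2) zk \<eta>4] unfolding v_def by blast
    define I where "I = fst \<gamma> \<inter> ball \<sigma> h"
    obtain N where N: "\<forall>n\<ge>N. dist ((\<tau> \<circ> \<phi>) n) \<sigma> < h" using metric_LIMSEQ_D[OF \<sigma>(3) h(1)] by blast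
    define n where "n = \<phi> N"
    have \<tau>I: "\<tau> n \<in> I" using N \<tau>(1)[of n] by (auto simp: I_def n_def dist_commute)
    have "is_interval I" using sub(2) unfolding I_def ball_eq_greaterThanLessThan by (intro is_interval_Int) auto
    then have sp: "is_subpath (I, f) \<gamma>0"
      using \<tau>I sub f0(2) unfolding is_subpath_def by (auto simp: I_def)
    note T' = subpath_trace[OF \<gamma>0 sp, unfolded path_trace_def[of "(I, f)"] fst_conv snd_conv]
    have zc: "z \<in> closure (f ` I)"
      unfolding closure_approachable
    proof (intro allI impI)
      fix e :: real assume "e > 0"
      obtain M where M: "\<forall>n\<ge>M. dist (f ((\<tau> \<circ> \<phi>) n)) z < e"
        using metric_LIMSEQ_D[OF \<open>(\<lambda>n. f ((\<tau> \<circ> \<phi>) n)) \<longlonglongrightarrow> z\<close> \<open>e > 0\<close>] by blast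
      have "(\<tau> \<circ> \<phi>) (max M N) \<in> I" using N \<tau>(1) by (auto simp: I_def dist_commute)
      then show "\<exists>y\<in>f ` I. dist y z < e" using M by (intro bexI[of _ "f ((\<tau> \<circ> \<phi>) (max M N))"]) auto
    qed
    define w where "w = f (\<tau> n)"
    have w: "w \<in> f ` I" "w \<in> Q (i n)" using \<tau>I \<tau>(2) by (auto simp: w_def)
    have "w \<noteq> z" using w(2) zk closure_subset by blast
    then have nw: "0 < nrm (w - z)" using nrm_pos[of "w - z"] by simp
    obtain h2 where h2: "h2 > 0" "\<And>s. 0 < s \<Longrightarrow> s < h2 \<Longrightarrow> (\<exists>w\<in>sqr z s. \<forall>y. val v w y \<longrightarrow> \<bar>y - v z\<bar> < \<eta> / 4)"
      using gline_point[OF gl[folded v_def] v zt zS(1) zk pq \<eta>4] by blast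
    obtain R1 where R1: "R1 > 0" "cball z R1 \<subseteq> \<Omega>" using zS(2) open_Om open_contains_cball by blast
    define r where "r = min (min (nrm (w - z)) h2) (R1 / 2)"
    have r: "0 < r" "r \<le> R1" using nw h2 R1 by (auto simp: r_def)
    have "psum (\<lambda>k. ennreal ((pO v k)\<^sup>2)) (hit (ball z R1)) < \<infinity>"
      unfolding v_def by (rule sobolev_loc_sums(1)[OF g R1(2)])
    then have fin: "psum (\<lambda>k. ennreal ((pO v k)\<^sup>2)) (hit (ball z r)) < \<infinity>"
      by (rule order_le_less_trans[rotated]) (use r in \<open>auto intro!: psum_hit_mono\<close>)
    have ae: "AE s in lborel. (\<forall>(b, r)\<in>sides z s. gline v b r) \<and>
        (0 < s \<and> s < nrm (w - z) \<longrightarrow> (\<exists>k. f ` I \<inter> sqr z s \<inter> Q k \<noteq> {}))"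
      using AE_sides[OF g, folded v_def] AE_square_disk[OF T'(3,2) zc w(1) T'(4)] by eventually_elim blast
    have "0 < \<eta> / 4 / 15" using \<eta> by simp
    then obtain s where s: "0 < s" "s < r" "\<forall>(b, r)\<in>sides z s. gline v b r"
        "0 < s \<and> s < nrm (w - z) \<longrightarrow> (\<exists>k. f ` I \<inter> sqr z s \<inter> Q k \<noteq> {})"
        "psum (eO v) {k \<in> hit (sqr z s). z \<notin> closure (Q k)} < ennreal (\<eta> / 4 / 15)"
      using good_square[OF v fin r(1) _ ae] by blast
    have sr: "s < nrm (w - z)" "s < h2" "2 * s < R1" using s(2) by (auto simp: r_def)
    have sOm: "sqr z s \<subseteq> \<Omega>" using sqr_sub_cball[of z s] sr(3) R1(2) by (auto simp: subset_iff)
    obtain k a where k: "a \<in> f ` I" "a \<in> sqr z s" "a \<in> Q k" using s(1,4) sr(1) by blast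
    obtain c where c: "c \<in> sqr z s" "\<And>y. val v c y \<Longrightarrow> \<bar>y - v z\<bar> < \<eta> / 4" using h2(2)[OF s(1) sr(2)] by blast
    have "c \<in> \<Omega>" using c(1) sOm by blast
    then obtain y where y: "val v c y" using val_ex[OF v] by blast
    have "val v a (pM v k)" using k(3) pm_le_pM[OF v, of k] unfolding val_def by blast
    then have 1: "\<bar>pM v k - y\<bar> < \<eta> / 4"
      by (rule square_near[OF s(1,3) v s(5) sOm zk k(2) c(1) _ y])
    have 2: "\<bar>y - v z\<bar> < \<eta> / 4" by (rule c(2)[OF y])
    have "i n \<in> hit (f ` I)" "k \<in> hit (f ` I)" using w k unfolding disks_meeting_def by blast+
    then have "e2ennreal \<bar>peri_max Q g (i n) - peri_max Q g k\<bar> \<le> (\<Sum>\<^sub>\<infinity>k\<in>hit (f ` I). peri_osc Q g k)"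
      using good_pathD(4)[OF \<gamma>0 sp] unfolding path_trace_def fst_conv snd_conv by blast
    also have "\<dots> < ennreal (\<eta> / 4)" using h(2) by (simp add: infsum_psum oe I_def)
    finally have "ennreal \<bar>pM v (i n) - pM v k\<bar> < ennreal (\<eta> / 4)" by (simp add: per(2) v_def)
    then have 3: "\<bar>pM v (i n) - pM v k\<bar> < \<eta> / 4" by (simp add: ennreal_less_iff)
    have "\<bar>pM v (i n) - v z\<bar> < \<eta>" using 1 2 3 \<eta> by linarith
    then show False using i(3) by blast
  qed
  have "((\<lambda>i. pM v i) \<longlongrightarrow> v z) (disks_to_along Q z \<gamma>)"
    unfolding tendsto_iff eventually_along using main by (simp add: dist_real_def)
  then have "((\<lambda>i. ereal (pM v i)) \<longlongrightarrow> ereal (v z)) (disks_to_along Q z \<gamma>)" by simp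
  moreover have "peri_max Q g = (\<lambda>i. ereal (pM v i))" using per(2) by (intro ext) (simp add: v_def)
  ultimately have "(peri_max Q g \<longlongrightarrow> ereal (v z)) (disks_to_along Q z \<gamma>)" by simp
  then show ?thesis unfolding val v_def[symmetric] using along_nonbot[OF \<gamma>0 ac] lim_imp_Liminf by blast
qed

end

section \<open>Continuity\<close>

context rel_carpet
begin

text \<open>Otherwise the segment would be the union of countably many, but at least two, disjoint closed
  sets, which is impossible by a theorem of Sierpinski.\<close>

lemma core_on_segment:
  assumes gl: "gline v b r" and pq: "p < q" "pt b r ` {p..q} \<subseteq> \<Omega>"
    and e: "pt b r ` {p..q} \<inter> Q i = {}" "pt b r p \<in> frontier (Q i) \<or> pt b r q \<in> frontier (Q i)"
  shows "\<exists>t\<in>{p..q}. pt b r t \<in> carpet_core \<Omega> Q"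
proof (rule ccontr)
  assume n: "\<not> ?thesis"
  define A where "A k = {t\<in>{p..q}. pt b r t \<in> closure (Q k)}" for k
  define \<U> where "\<U> = range A - {{}}"
  have clA: "closed (A k)" for k
    using continuous_closed_preimage[OF continuous_pt closed_atLeastAtMost closed_closure, of p q b r "Q k"]
    by (simp add: A_def vimage_def Int_def)
  have cov: "\<exists>k. t \<in> A k" if t: "t \<in> {p..q}" for t
  proof -
    have tO: "pt b r t \<in> \<Omega>" using t pq(2) by blast
    show ?thesis
    proof (cases "pt b r t \<in> S")
      case True
      then obtain k where "pt b r t \<in> frontier (Q k)" using n t unfolding carpet_core_def by blast
      then show ?thesis using t by (auto simp: A_def front_iff)
    next
      case False
      then obtain k where "pt b r t \<in> Q k" using Om_cases tO by blast
      then have "pt b r t \<in> closure (Q k)" using closure_subset by blast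
      then show ?thesis using t by (auto simp: A_def)
    qed
  qed
  have "\<U> = {{p..q}}"
  proof (rule real_Sierpinski_lemma)
    show "p \<le> q" using pq by simp
    show "countable \<U>" by (simp add: \<U>_def)
    show "pairwise disjnt \<U>"
    proof (rule pairwiseI)
      fix X Y assume XY: "X \<in> \<U>" "Y \<in> \<U>" "X \<noteq> Y"
      then obtain k l where "X = A k" "Y = A l" by (auto simp: \<U>_def)
      with XY(3) show "disjnt X Y" unfolding disjnt_def A_def using cl_disj by blast
    qed
    show "closed C \<and> C \<noteq> {}" if "C \<in> \<U>" for C using that clA by (auto simp: \<U>_def)
    show "\<Union> \<U> = {p..q}"
    proof
      show "\<Union> \<U> \<subseteq> {p..q}" by (auto simp: \<U>_def A_def)
      show "{p..q} \<subseteq> \<Union> \<U>" using cov unfolding \<U>_def by blast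
    qed
  qed
  moreover have "p \<in> A i \<or> q \<in> A i" using e(2) pq(1) by (auto simp: A_def front_iff)
  then have "A i \<noteq> {}" by blast
  then have "A i \<in> \<U>" by (simp add: \<U>_def)
  ultimately have "A i = {p..q}" by blast
  \<comment> \<open>Only \<open>Q i\<close> is left, and the segment would run along its circle; but
    almost every point of a generic line is off the carpet.\<close>
  then have in_S: "pt b r t \<in> S" if t: "t \<in> {p..q}" for t
  proof -
    have "t \<in> A i" using t \<open>A i = {p..q}\<close> by simp
    then have "pt b r t \<in> closure (Q i)" by (simp add: A_def)
    moreover have "pt b r t \<notin> Q i" using t e(1) by blast
    ultimately show ?thesis using front_iff front_S by blast
  qed
  obtain t where "p < t" "t < q" "t \<in> {p..q} \<longrightarrow> pt b r t \<notin> S"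
    using AE_dense[OF AE_pt_not_S[OF gl] pq(1)] by blast
  then show False using in_S by simp
qed

text \<open>The corner of an L-shaped path is moved off the carpet, so that one of its two legs crosses the circle.\<close>

lemma crossing_segment:
  assumes ae: "\<And>b. AE r in lborel. P b r" and gl: "\<And>b r. P b r \<Longrightarrow> gline v b r"
    and x: "x \<in> frontier (Q i)" and "\<eta> > 0" "ball x \<eta> \<subseteq> \<Omega>"
  shows "\<exists>b r p q. P b r \<and> pt b r p \<in> Q i \<and> pt b r q \<notin> closure (Q i) \<and> pt b r ` {min p q..max p q} \<subseteq> ball x \<eta> \<and> x \<notin> range (pt b r)"
proof -
  define d where "d = \<eta> / 4"
  have d: "d > 0" using assms by (simp add: d_def)
  have x_cl: "x \<in> closure (Q i)" using x by (simp add: front_iff)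
  obtain y where y: "y \<in> Q i" "y \<in> ball x d" using x_cl d unfolding closure_approachable by (auto simp: dist_commute)
  obtain w where w: "w \<in> ball x d" "w \<notin> closure (Q i)" using outside_near[OF x d] by blast
  have "\<exists>e1>0. ball y e1 \<subseteq> Q i \<inter> ball x d"
  proof -
    have "open (Q i \<inter> ball x d)" "y \<in> Q i \<inter> ball x d" using y open_Q by auto
    then show ?thesis unfolding open_contains_ball by blast
  qed
  then obtain e1 where e1: "e1 > 0" "ball y e1 \<subseteq> Q i \<inter> ball x d" by blast
  have "\<exists>e2>0. ball w e2 \<subseteq> - closure (Q i) \<inter> ball x d"
  proof -
    have "open (- closure (Q i) \<inter> ball x d)" "w \<in> - closure (Q i) \<inter> ball x d" using w by auto
    then show ?thesis unfolding open_contains_ball by blast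
  qed
  then obtain e2 where e2: "e2 > 0" "ball w e2 \<subseteq> - closure (Q i) \<inter> ball x d" by blast
  \<comment> \<open>The position \<open>Re x\<close> is excluded so that the line misses
    \<open>x\<close>; landing points on it are then different from \<open>x\<close>.\<close>
  have aeA: "AE r in lborel. P False r \<and> r \<noteq> Re x"
  proof -
    have "AE r in lborel. r \<notin> {Re x}" by (intro AE_not_in finite_imp_null_set_lborel) simp
    then show ?thesis using ae[of False] by eventually_elim simp
  qed
  have "Re w < Re w + e2" using e2(1) by simp
  from AE_dense[OF aeA this] obtain a where a: "Re w < a" "a < Re w + e2" "P False a \<and> a \<noteq> Re x" by blast
  have w1: "Complex a (Im w) \<in> ball w e2"
  proof -
    have "w - Complex a (Im w) = complex_of_real (Re w - a)" by (simp add: complex_eq_iff)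
    then have "cmod (w - Complex a (Im w)) = \<bar>Re w - a\<bar>" by (simp only: norm_of_real)
    then show ?thesis using a by (simp add: dist_norm)
  qed
  have ga: "gline v False a" using gl a(3) by blast
  \<comment> \<open>With the corner off the carpet it is in a disk: either in \<open>Q i\<close>,
    and the vertical leg towards \<open>w\<close> crosses the circle, or in another disk, and the
    horizontal leg from \<open>y\<close> does.\<close>
  have aeC: "AE r in lborel. P True r \<and> r \<noteq> Im x \<and> (r \<in> {Im y..Im y + e1} \<longrightarrow> pt False a r \<notin> S)"
  proof -
    have "AE r in lborel. r \<notin> {Im x}" by (intro AE_not_in finite_imp_null_set_lborel) simp
    then show ?thesis using ae[of True] AE_pt_not_S[OF ga] by eventually_elim simp
  qed
  have "Im y < Im y + e1" using e1(1) by simp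
  from AE_dense[OF aeC this] obtain c where c: "Im y < c" "c < Im y + e1" "P True c \<and> c \<noteq> Im x \<and> (c \<in> {Im y..Im y + e1} \<longrightarrow> pt False a c \<notin> S)" by blast
  have y1: "Complex (Re y) c \<in> ball y e1"
  proof -
    have "y - Complex (Re y) c = \<i> * complex_of_real (Im y - c)" by (simp add: complex_eq_iff)
    then have "cmod (y - Complex (Re y) c) = \<bar>Im y - c\<bar>" by (simp add: norm_mult del: of_real_diff)
    then show ?thesis using c by (simp add: dist_norm)
  qed
  have yQ: "Complex (Re y) c \<in> Q i" "Complex (Re y) c \<in> ball x d" using y1 e1(2) by blast+
  have wQ: "Complex a (Im w) \<notin> closure (Q i)" "Complex a (Im w) \<in> ball x d" using w1 e2(2) by blast+
  have near: "\<bar>Re y - Re x\<bar> < d" "\<bar>c - Im x\<bar> < d" "\<bar>a - Re x\<bar> < d" "\<bar>Im w - Im x\<bar> < d"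
    using yQ(2) wQ(2) abs_Re_le_cmod[of "x - Complex (Re y) c"] abs_Im_le_cmod[of "x - Complex (Re y) c"]
      abs_Re_le_cmod[of "x - Complex a (Im w)"] abs_Im_le_cmod[of "x - Complex a (Im w)"]
    by (auto simp: dist_norm)
  have box: "Complex s t \<in> ball x \<eta>" if "\<bar>s - Re x\<bar> < d" "\<bar>t - Im x\<bar> < d" for s t
  proof -
    have "cmod (x - Complex s t) \<le> \<bar>Re x - s\<bar> + \<bar>Im x - t\<bar>" using cmod_le[of "x - Complex s t"] by simp
    also have "\<dots> < d + d" using that by linarith
    finally have "cmod (x - Complex s t) < \<eta>" using d by (simp add: d_def)
    then show ?thesis by (simp add: dist_norm)
  qed
  have corner: "Complex a c \<in> \<Omega>" "Complex a c \<notin> S" using box[OF near(3,2)] assms(5) c by (auto simp: pt_def)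
  show ?thesis
  proof (cases "Complex a c \<in> Q i")
    case True
    show ?thesis
    proof (intro exI conjI)
      show "P False a" using a by blast
      show "pt False a c \<in> Q i" using True by (simp add: pt_def)
      show "pt False a (Im w) \<notin> closure (Q i)" using wQ by (simp add: pt_def)
      show "x \<notin> range (pt False a)" using a(3) by (auto simp: pt_def)
      show "pt False a ` {min c (Im w)..max c (Im w)} \<subseteq> ball x \<eta>"
      proof (rule image_subsetI)
        fix t assume "t \<in> {min c (Im w)..max c (Im w)}"
        then have "\<bar>t - Im x\<bar> < d" using near by (auto simp: min_def max_def abs_if split: if_splits)
        then show "pt False a t \<in> ball x \<eta>" using box near by (simp add: pt_def del: mem_ball)
      qed
    qed
  next
    case False
    then obtain k where k: "Complex a c \<in> Q k" "k \<noteq> i" using Om_cases corner by blast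
    then have nc: "Complex a c \<notin> closure (Q i)" using cl_disj closure_subset by blast
    show ?thesis
    proof (intro exI conjI)
      show "P True c" using c by blast
      show "pt True c (Re y) \<in> Q i" using yQ by (simp add: pt_def)
      show "pt True c a \<notin> closure (Q i)" using nc by (simp add: pt_def)
      show "x \<notin> range (pt True c)" using c(3) by (auto simp: pt_def)
      show "pt True c ` {min (Re y) a..max (Re y) a} \<subseteq> ball x \<eta>"
      proof (rule image_subsetI)
        fix t assume "t \<in> {min (Re y) a..max (Re y) a}"
        then have "\<bar>t - Re x\<bar> < d" using near by (auto simp: min_def max_def abs_if split: if_splits)
        then show "pt True c t \<in> ball x \<eta>" using box near by (simp add: pt_def del: mem_ball)
      qed
    qed
  qed
qed

text \<open>Cuts the segment at its last point on the circle before \<open>q\<close>, so that the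
  rest avoids the disk, as accessibility demands.\<close>

lemma landing_segment:
  assumes "pt b r p \<in> Q i" "pt b r q \<notin> closure (Q i)"
  shows "\<exists>c. pt b r c \<in> frontier (Q i) \<and> c \<noteq> q \<and> {min c q..max c q} \<subseteq> {min p q..max p q} \<and>
    pt b r ` {min c q..max c q} \<inter> Q i = {}"
proof -
  have p: "pt b r p \<in> closure (Q i)" "pt b r q \<notin> Q i" using assms closure_subset by blast+
  have "\<exists>c\<in>{min p q..max p q}. pt b r c \<in> frontier (Q i) \<and> pt b r ` {min c q..max c q} \<inter> Q i = {}"
  proof (cases "p \<le> q")
    case True
    then obtain c where "c \<in> {p..q}" "pt b r c \<in> frontier (Q i)" "pt b r ` {c..q} \<inter> Q i = {}"
      using path_leaves[OF continuous_pt True p] by blast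
    then show ?thesis using True by (intro bexI[of _ c]) auto
  next
    case False
    then have "q \<le> p" by simp
    then obtain c where "c \<in> {q..p}" "pt b r c \<in> frontier (Q i)" "pt b r ` {q..c} \<inter> Q i = {}"
      using path_enters[OF continuous_pt _ p(2,1)] by blast
    then show ?thesis using False by (intro bexI[of _ c]) auto
  qed
  then obtain c where c: "c \<in> {min p q..max p q}" "pt b r c \<in> frontier (Q i)" "pt b r ` {min c q..max c q} \<inter> Q i = {}" by blast
  have "c \<noteq> q" using c(2) assms(2) front_iff by blast
  moreover have "{min c q..max c q} \<subseteq> {min p q..max p q}" using c(1) by auto
  ultimately show ?thesis using c by blast
qed

text \<open>At a non-accessible boundary point the normalized version is a Liminf over other
  accessible points of the same circle. Generic segments that land near \<open>x\<close> but miss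
  \<open>x\<close> supply them.\<close>

lemma landing_accessible:
  assumes g: "g \<in> sobolev_loc ver \<Omega> Q" and x: "x \<in> frontier (Q i)" and "\<eta> > 0"
  shows "\<exists>y\<in>accessible_points \<Omega> Q g \<inter> frontier (Q i) \<inter> ball x \<eta>. y \<noteq> x"
proof -
  have "x \<in> \<Omega>" using x front_S S_sub by blast
  then obtain e where e: "e > 0" "ball x e \<subseteq> \<Omega>" using open_Om open_contains_ball by blast
  define \<eta>' where "\<eta>' = min \<eta> e"
  have \<eta>': "\<eta>' > 0" "ball x \<eta>' \<subseteq> \<Omega>" "ball x \<eta>' \<subseteq> ball x \<eta>" using e assms by (auto simp: \<eta>'_def)
  obtain b r p q where s: "gline (rl g) b r" "pt b r p \<in> Q i" "pt b r q \<notin> closure (Q i)"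
      "pt b r ` {min p q..max p q} \<subseteq> ball x \<eta>'" "x \<notin> range (pt b r)"
    using crossing_segment[of "gline (rl g)" "rl g", OF AE_gline[OF g] _ x \<eta>'(1,2)] by blast
  obtain c where c: "pt b r c \<in> frontier (Q i)" "c \<noteq> q" "{min c q..max c q} \<subseteq> {min p q..max p q}"
    "pt b r ` {min c q..max c q} \<inter> Q i = {}" using landing_segment[OF s(2,3)] by blast
  define m M where "m = min c q" and "M = max c q"
  have mM: "m < M" "c = m \<or> c = M" using c(2) by (auto simp: m_def M_def)
  have sub: "pt b r ` {m..M} \<subseteq> ball x \<eta>'" using s(4) c(3) unfolding m_def M_def by blast
  have gp: "({m..M}, pt b r) \<in> good_paths \<Omega> Q g"
    using sub \<eta>'(2) by (intro good_segment[OF g s(1) mM(1)]) auto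
  have "accessible_along \<Omega> Q (pt b r c) ({m..M}, pt b r) ({m<..<M}, pt b r)"
  proof -
    have nc: "pt b r c \<notin> carpet_core \<Omega> Q" using c(1) by (auto simp: carpet_core_def)
    have cl: "pt b r c \<in> closure (pt b r ` {m<..<M})"
    proof -
      have "c \<in> closure {m<..<M}" using mM by auto
      moreover have "pt b r ` closure {m<..<M} \<subseteq> closure (pt b r ` {m<..<M})"
        by (intro image_closure_subset[OF continuous_pt]) (auto simp: closure_subset)
      ultimately show ?thesis by blast
    qed
    have ni: "pt b r c \<notin> pt b r ` {m<..<M}" using mM by auto
    have dj: "pt b r ` {m<..<M} \<inter> Q j = {}" if "pt b r c \<in> frontier (Q j)" for j
    proof -
      have "j = i" using that c(1) cl_disj front_iff by blast
      moreover have "pt b r ` {m<..<M} \<subseteq> pt b r ` {m..M}" by (intro image_mono) auto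
      ultimately show ?thesis using c(4) unfolding m_def M_def by blast
    qed
    have "is_subpath ({m<..<M}, pt b r) ({m..M}, pt b r)" using mM(1) by (auto simp: is_subpath_def is_interval_oo)
    moreover have "pt b r c \<in> S" using c(1) front_S by blast
    ultimately show ?thesis using nc cl ni dj by (simp add: accessible_along_def path_trace_def)
  qed
  then have "pt b r c \<in> accessible_points \<Omega> Q g" using gp unfolding accessible_points_def by blast
  moreover have "c \<in> {m..M}" by (auto simp: m_def M_def)
  then have "pt b r c \<in> ball x \<eta>" using sub \<eta>'(3) by blast
  moreover have "pt b r c \<noteq> x" using s(5) by blast
  ultimately show ?thesis using c(1) by blast
qed

text \<open>Both functions agree at core points of generic segments, and such points accumulate at the point
  where the segment lands.\<close>

lemma peri_agree:
  assumes g: "g \<in> sobolev_loc ver \<Omega> Q" and u: "u \<in> sobolev_loc ver \<Omega> Q"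
    and nv: "\<forall>x\<in>S. u x = normalized_version \<Omega> Q g x"
  shows "\<exists>y\<in>frontier (Q i). rl u y = rl g y"
proof -
  obtain x where x: "x \<in> frontier (Q i)" using front_ne by blast
  then have "x \<in> \<Omega>" using front_S S_sub by blast
  then obtain e where e: "e > 0" "ball x e \<subseteq> \<Omega>" using open_Om open_contains_ball by blast
  have "AE r in lborel. gline (rl g) b r \<and> gline (rl u) b r" for b
    using AE_gline[OF g, of b] AE_gline[OF u, of b] by eventually_elim simp
  then obtain b r p q where s: "gline (rl g) b r" "gline (rl u) b r" "pt b r p \<in> Q i" "pt b r q \<notin> closure (Q i)"
      "pt b r ` {min p q..max p q} \<subseteq> ball x e"
    using crossing_segment[of "\<lambda>b r. gline (rl g) b r \<and> gline (rl u) b r" "rl g", OF _ _ x e(1,2)] by blast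
  obtain c where c: "pt b r c \<in> frontier (Q i)" "c \<noteq> q" "{min c q..max c q} \<subseteq> {min p q..max p q}"
    "pt b r ` {min c q..max c q} \<inter> Q i = {}" using landing_segment[OF s(3,4)] by blast
  define m M where "m = min c q" and "M = max c q"
  have mM: "m < M" "c = m \<or> c = M" using c(2) by (auto simp: m_def M_def)
  have sub: "pt b r ` {m..M} \<subseteq> \<Omega>" using s(5) c(3) e(2) unfolding m_def M_def by blast
  have av: "pt b r ` {m..M} \<inter> Q i = {}" using c(4) by (simp add: m_def M_def)
  have cS: "pt b r c \<in> S" using c(1) front_S by blast
  define y where "y = pt b r c"
  \<comment> \<open>The only disk with \<open>y\<close> in its closure is avoided by the segment, so
    along it \<open>v\<close> is continuous at \<open>y\<close> through carpet points.\<close>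
  have close: "\<exists>h>0. \<forall>t\<in>{m..M}. \<bar>t - c\<bar> < h \<and> pt b r t \<in> S \<longrightarrow> \<bar>v (pt b r t) - v y\<bar> < \<eta>"
    if v: "gline v b r" and \<eta>: "\<eta> > 0" for v \<eta>
  proof -
    have mM': "m \<le> M" using mM by simp
    have cm: "c \<in> {m..M}" by (auto simp: m_def M_def)
    obtain h where h: "h > 0" "\<And>a d. m \<le> a \<and> d \<le> M \<and> \<bar>a - c\<bar> < h \<and> \<bar>d - c\<bar> < h \<Longrightarrow>
        psum (eO v) {k \<in> hit (pt b r ` {a..d}). pt b r c \<notin> closure (Q k)} < ennreal \<eta>"
      using tail_small[OF continuous_pt gline_sum[OF v mM' sub] cm, of "ennreal \<eta>"] \<eta> by auto
    have "\<bar>v (pt b r t) - v y\<bar> < \<eta>" if t: "t \<in> {m..M}" "\<bar>t - c\<bar> < h" "pt b r t \<in> S" for t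
    proof -
      have "ennreal \<bar>v (pt b r (min t c)) - v (pt b r (max t c))\<bar> \<le> psum (eO v) (hit (pt b r ` {min t c..max t c}))"
        using t cm cS by (intro tame_byD[OF gline_tame[OF v mM' sub]]) (auto simp: min_def max_def)
      also have "hit (pt b r ` {min t c..max t c}) = {k \<in> hit (pt b r ` {min t c..max t c}). pt b r c \<notin> closure (Q k)}"
      proof -
        have "pt b r c \<notin> closure (Q k)" if k: "k \<in> hit (pt b r ` {min t c..max t c})" for k
        proof
          assume "pt b r c \<in> closure (Q k)"
          then have "k = i" using c(1) cl_disj front_iff by blast
          moreover have "pt b r ` {min t c..max t c} \<subseteq> pt b r ` {m..M}" using t cm by (intro image_mono) auto
          ultimately show False using k av unfolding disks_meeting_def by blast
        qed
        then show ?thesis by blast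
      qed
      also have "psum (eO v) {k \<in> hit (pt b r ` {min t c..max t c}). pt b r c \<notin> closure (Q k)} < ennreal \<eta>"
        using t cm h(1) by (intro h(2)) (auto simp: min_def max_def)
      finally have "\<bar>v (pt b r (min t c)) - v (pt b r (max t c))\<bar> < \<eta>" by (simp add: ennreal_less_iff)
      then show ?thesis by (auto simp: y_def min_def max_def abs_minus_commute split: if_splits)
    qed
    then show ?thesis using h(1) by blast
  qed
  have "\<bar>rl u y - rl g y\<bar> < 2 * \<eta>" if \<eta>: "\<eta> > 0" for \<eta>
  proof -
    obtain h1 where h1: "h1 > 0" "\<forall>t\<in>{m..M}. \<bar>t - c\<bar> < h1 \<and> pt b r t \<in> S \<longrightarrow> \<bar>rl g (pt b r t) - rl g y\<bar> < \<eta>"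
      using close[OF s(1) \<eta>] by blast
    obtain h2 where h2: "h2 > 0" "\<forall>t\<in>{m..M}. \<bar>t - c\<bar> < h2 \<and> pt b r t \<in> S \<longrightarrow> \<bar>rl u (pt b r t) - rl u y\<bar> < \<eta>"
      using close[OF s(2) \<eta>] by blast
    define h where "h = min (min h1 h2 / 2) (M - m)"
    have h: "h > 0" "h < h1" "h < h2" "h \<le> M - m" using h1 h2 mM by (auto simp: h_def)
    define m' M' where "m' = (if c = m then c else c - h)" and "M' = (if c = m then c + h else c)"
    have m': "m' < M'" "{m'..M'} \<subseteq> {m..M}" "c = m' \<or> c = M'" "\<And>t. t \<in> {m'..M'} \<Longrightarrow> \<bar>t - c\<bar> \<le> h"
      using h mM by (auto simp: m'_def M'_def)
    have s': "pt b r ` {m'..M'} \<subseteq> \<Omega>" "pt b r ` {m'..M'} \<inter> Q i = {}" using sub av m'(2) by blast+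
    have "pt b r m' \<in> frontier (Q i) \<or> pt b r M' \<in> frontier (Q i)" using c(1) m'(3) by auto
    then obtain t where t: "t \<in> {m'..M'}" "pt b r t \<in> carpet_core \<Omega> Q"
      using core_on_segment[OF s(1) m'(1) s'] by blast
    have tS: "pt b r t \<in> S" using t(2) by (simp add: carpet_core_def)
    have tm: "m \<le> t" "t \<le> M" using t(1) m'(2) by auto
    have "u (pt b r t) = ereal (rl g (pt b r t))"
      using core_value[OF g s(1) refl tm mM(1) sub t(2)] nv tS by simp
    then have "rl u (pt b r t) = rl g (pt b r t)" by (simp add: rl_def)
    moreover have "\<bar>rl g (pt b r t) - rl g y\<bar> < \<eta>" "\<bar>rl u (pt b r t) - rl u y\<bar> < \<eta>"
      using h1(2) h2(2) m'(4)[OF t(1)] h tm tS by auto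
    ultimately show ?thesis by linarith
  qed
  from this[of "\<bar>rl u y - rl g y\<bar> / 2"] have "rl u y = rl g y" by (cases "rl u y = rl g y") auto
  then show ?thesis using c(1) unfolding y_def by blast
qed

text \<open>A common value on the circle forces the two ranges to overlap.\<close>

lemma peri_close:
  assumes g: "g \<in> sobolev_loc ver \<Omega> Q" and u: "u \<in> sobolev_loc ver \<Omega> Q"
    and nv: "\<forall>x\<in>S. u x = normalized_version \<Omega> Q g x"
  shows "\<bar>pM (rl g) i - pM (rl u) i\<bar> \<le> pO (rl g) i + pO (rl u) i"
proof -
  obtain y where y: "y \<in> frontier (Q i)" "rl u y = rl g y" using peri_agree[OF assms] by blast
  note G = sobolev_loc_peri(5)[OF g] and U = sobolev_loc_peri(5)[OF u]
  show ?thesis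
    using pM_ge[OF G y(1)] pm_le[OF G y(1)] pM_ge[OF U y(1)] pm_le[OF U y(1)] y(2) by (simp add: pO_def abs_if)
qed

text \<open>The limit is known for \<open>u\<close>, while the normalized version is built from
  \<open>g\<close>; by \<open>peri_close\<close> and \<open>dto_osc\<close> the difference of the
  maxima tends to 0.\<close>

lemma disk_limit_normal:
  assumes lm: "lmin ver u" and g: "g \<in> sobolev_loc ver \<Omega> Q"
    and nv: "\<forall>x\<in>S. u x = normalized_version \<Omega> Q g x" and x: "x \<in> S"
  shows "\<exists>L. (peri_max Q g \<longlongrightarrow> L) (dto x)"
proof -
  have u: "u \<in> sobolev_loc ver \<Omega> Q" using lm by (simp add: lmin_def)
  have xO: "x \<in> \<Omega>" using x S_sub by blast
  obtain L where L: "((\<lambda>i. ereal (pM (rl u) i)) \<longlongrightarrow> L) (dto x)" using disk_limit[OF lm x] by blast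
  have d: "((\<lambda>i. pM (rl g) i - pM (rl u) i) \<longlongrightarrow> 0) (dto x)"
    unfolding tendsto_iff
  proof (intro allI impI)
    fix e :: real assume "e > 0"
    then have "e / 2 > 0" by simp
    from dto_osc[OF g xO this] dto_osc[OF u xO this]
    show "eventually (\<lambda>i. dist (pM (rl g) i - pM (rl u) i) 0 < e) (dto x)"
    proof eventually_elim
      case (elim i)
      then show ?case using peri_close[OF g u nv, of i] by (simp add: dist_real_def)
    qed
  qed
  have "((\<lambda>i. ereal (pM (rl u) i) + ereal (pM (rl g) i - pM (rl u) i)) \<longlongrightarrow> L + ereal 0) (dto x)"
    using d by (intro tendsto_add_ereal_general L) auto
  moreover have "(\<lambda>i. ereal (pM (rl u) i) + ereal (pM (rl g) i - pM (rl u) i)) = peri_max Q g"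
    using sobolev_loc_peri(2)[OF g] by (intro ext) simp
  ultimately show ?thesis by auto
qed

text \<open>Disks close to a point \<open>y\<close> near \<open>x\<close> are also close to
  \<open>x\<close>. So a bound that holds eventually at \<open>x\<close> holds eventually at
  \<open>y\<close>, and passes to the limit there.\<close>

lemma limit_continuous:
  fixes F :: "nat \<Rightarrow> ereal"
  assumes L: "\<And>x. x \<in> S \<Longrightarrow> (F \<longlongrightarrow> L x) (dto x)" and x: "x \<in> S"
  shows "(L \<longlongrightarrow> L x) (at x within S)"
proof -
  have near: "eventually (\<lambda>y. eventually P (dto y)) (at x within S)" if P: "eventually P (dto x)" for P
  proof -
    obtain \<epsilon> where \<epsilon>: "\<epsilon> > 0" "\<And>i. Q i \<subseteq> ball x \<epsilon> \<Longrightarrow> P i" using P unfolding eventually_dto by blast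
    have "eventually P (dto y)" if "dist y x < \<epsilon> / 2" for y
    proof -
      have "ball y (\<epsilon> / 2) \<subseteq> ball x \<epsilon>"
        using that by (intro subsetI) (metis dist_commute dist_triangle_half_r mem_ball)
      then show ?thesis unfolding eventually_dto using \<epsilon> by (intro exI[of _ "\<epsilon> / 2"]) (auto intro: order_trans)
    qed
    then show ?thesis unfolding eventually_at using \<epsilon>(1) by (intro exI[of _ "\<epsilon> / 2"]) auto
  qed
  have inS: "eventually (\<lambda>y. y \<in> S) (at x within S)" by (simp add: eventually_at_filter)
  show ?thesis
  proof (rule order_tendstoI)
    fix a assume "a < L x"
    then obtain b where b: "a < b" "b < L x" using dense by blast
    have "eventually (\<lambda>i. b < F i) (dto x)" using order_tendstoD(1)[OF L[OF x] b(2)] .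
    from near[OF this] inS show "eventually (\<lambda>y. a < L y) (at x within S)"
    proof eventually_elim
      case (elim y)
      have "b \<le> L y" using elim by (intro tendsto_lowerbound[OF L _ dto_nonbot]) (auto elim: eventually_mono)
      then show ?case using b by simp
    qed
  next
    fix a assume "L x < a"
    then obtain b where b: "L x < b" "b < a" using dense by blast
    have "eventually (\<lambda>i. F i < b) (dto x)" using order_tendstoD(2)[OF L[OF x] b(1)] .
    from near[OF this] inS show "eventually (\<lambda>y. L y < a) (at x within S)"
    proof eventually_elim
      case (elim y)
      have "L y \<le> b" using elim by (intro tendsto_upperbound[OF L _ dto_nonbot]) (auto elim: eventually_mono)
      then show ?case using b by simp
    qed
  qed
qed

lemma along_le_dto: "disks_to_along Q x \<gamma> \<le> dto x"
  unfolding le_filter_def eventually_dto eventually_along by blast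

text \<open>The chosen path is immaterial, since the filter along it is non-trivial and finer than
  \<open>dto x\<close>.\<close>

lemma accessible_value_limit:
  assumes L: "(peri_max Q g \<longlongrightarrow> L) (dto x)" and x: "x \<in> accessible_points \<Omega> Q g"
  shows "accessible_value \<Omega> Q g x = L"
proof -
  define \<gamma> where "\<gamma> = (SOME \<gamma>. \<exists>\<gamma>\<^sub>0\<in>good_paths \<Omega> Q g. accessible_along \<Omega> Q x \<gamma>\<^sub>0 \<gamma>)"
  have "\<exists>\<gamma>. \<exists>\<gamma>\<^sub>0\<in>good_paths \<Omega> Q g. accessible_along \<Omega> Q x \<gamma>\<^sub>0 \<gamma>"
    using x unfolding accessible_points_def by blast
  then have "\<exists>\<gamma>\<^sub>0\<in>good_paths \<Omega> Q g. accessible_along \<Omega> Q x \<gamma>\<^sub>0 \<gamma>" unfolding \<gamma>_def by (rule someI_ex)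
  then have "disks_to_along Q x \<gamma> \<noteq> bot" using along_nonbot by blast
  moreover have "(peri_max Q g \<longlongrightarrow> L) (disks_to_along Q x \<gamma>)" by (rule tendsto_mono[OF along_le_dto L])
  ultimately show ?thesis unfolding accessible_value_def \<gamma>_def[symmetric] by (rule lim_imp_Liminf)
qed

lemma accessible_in_S: "accessible_points \<Omega> Q g \<subseteq> S"
  using accessible_alongD(1) unfolding accessible_points_def by blast

text \<open>At accessible points the value is the limit \<open>L\<close> itself. Elsewhere it is a
  Liminf over accessible points that accumulate at \<open>x\<close>, and there the continuity of
  \<open>L\<close> on the carpet gives \<open>L x\<close>.\<close>

lemma normalized_limit:
  assumes g: "g \<in> sobolev_loc ver \<Omega> Q" and L: "\<And>x. x \<in> S \<Longrightarrow> (peri_max Q g \<longlongrightarrow> L x) (dto x)" and x: "x \<in> S"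
  shows "normalized_version \<Omega> Q g x = L x"
proof (cases "x \<in> accessible_points \<Omega> Q g")
  case True
  then show ?thesis using accessible_value_limit[OF L[OF x] True] by (simp add: normalized_version_def)
next
  case False
  have lim: "Liminf (at x within A) (accessible_value \<Omega> Q g) = L x"
    if A: "A \<subseteq> accessible_points \<Omega> Q g" and nb: "\<And>\<eta>. \<eta> > 0 \<Longrightarrow> \<exists>y\<in>A. y \<noteq> x \<and> dist y x < \<eta>" for A
  proof -
    have "x islimpt A" using nb unfolding islimpt_approachable by blast
    then have "at x within A \<noteq> bot" by (simp add: trivial_limit_within)
    moreover have AS: "A \<subseteq> S" using A accessible_in_S by blast
    have "(L \<longlongrightarrow> L x) (at x within A)" by (rule tendsto_within_subset[OF limit_continuous[OF L x] AS])
    then have "(accessible_value \<Omega> Q g \<longlongrightarrow> L x) (at x within A)"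
    proof (rule Lim_transform_eventually)
      have "L y = accessible_value \<Omega> Q g y" if y: "y \<in> A" for y
      proof -
        have "y \<in> S" "y \<in> accessible_points \<Omega> Q g" using y A AS by blast+
        then show ?thesis using accessible_value_limit[OF L] by simp
      qed
      then show "eventually (\<lambda>y. L y = accessible_value \<Omega> Q g y) (at x within A)" by (simp add: eventually_at_filter)
    qed
    ultimately show ?thesis by (rule lim_imp_Liminf)
  qed
  show ?thesis
  proof (cases "\<exists>i. x \<in> frontier (Q i)")
    case True
    then obtain i where i: "x \<in> frontier (Q i)" by blast
    have the: "(THE i. x \<in> frontier (Q i)) = i"
      using i cl_disj front_iff by (intro the_equality) blast+
    have "Liminf (at x within accessible_points \<Omega> Q g \<inter> frontier (Q i)) (accessible_value \<Omega> Q g) = L x"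
    proof (rule lim)
      fix \<eta> :: real assume \<eta>: "\<eta> > 0"
      obtain y where "y \<in> accessible_points \<Omega> Q g \<inter> frontier (Q i) \<inter> ball x \<eta>" "y \<noteq> x"
        using landing_accessible[OF g i \<eta>] by blast
      then show "\<exists>y\<in>accessible_points \<Omega> Q g \<inter> frontier (Q i). y \<noteq> x \<and> dist y x < \<eta>"
        by (intro bexI[of _ y]) (auto simp: dist_commute)
    qed blast
    then show ?thesis unfolding normalized_version_def using False True the by simp
  next
    case nofr: False
    have "Liminf (at x within accessible_points \<Omega> Q g) (accessible_value \<Omega> Q g) = L x"
    proof (rule lim)
      fix \<eta> :: real assume \<eta>: "\<eta> > 0"
      then have "\<eta> / 2 > 0" by simp
      then obtain i where i: "Q i \<subseteq> ball x (\<eta> / 2)" using disk_near[OF x] by blast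
      have "closure (Q i) \<subseteq> cball x (\<eta> / 2)" using i ball_subset_cball by (intro closure_minimal) blast+
      moreover obtain z where z: "z \<in> frontier (Q i)" using front_ne by blast
      moreover obtain y where y: "y \<in> accessible_points \<Omega> Q g" "y \<in> frontier (Q i)"
        using landing_accessible[OF g z zero_less_one] by blast
      ultimately have "y \<in> cball x (\<eta> / 2)" using front_iff by blast
      then have "dist y x < \<eta>" using \<eta> by (simp add: dist_commute)
      moreover have "y \<noteq> x" using y(2) nofr by blast
      ultimately show "\<exists>y\<in>accessible_points \<Omega> Q g. y \<noteq> x \<and> dist y x < \<eta>" using y(1) by blast
    qed blast
    then show ?thesis unfolding normalized_version_def using False nofr by simp
  qed
qed

theorem normalized_continuous:
  assumes lm: "lmin ver u" and n: "is_normalized ver \<Omega> Q u"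
  shows "continuous_on S u"
proof -
  obtain g where g: "g \<in> sobolev_loc ver \<Omega> Q" and nv: "\<forall>x\<in>S. u x = normalized_version \<Omega> Q g x"
    using n unfolding is_normalized_def by blast
  have "\<forall>x\<in>S. \<exists>L. (peri_max Q g \<longlongrightarrow> L) (dto x)" using disk_limit_normal[OF lm g nv] by blast
  then obtain L where L: "\<forall>x\<in>S. (peri_max Q g \<longlongrightarrow> L x) (dto x)" by metis
  have "continuous_on S L" unfolding continuous_on_def using limit_continuous[of "peri_max Q g" L] L by blast
  moreover have "L x = u x" if "x \<in> S" for x using normalized_limit[OF g, of L] L nv that by simp
  ultimately show ?thesis by (metis continuous_on_cong)
qed

end

theorem theorem2p63:
  fixes \<Omega> :: "complex set" and Q :: "nat \<Rightarrow> complex set" and ver :: version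
    and u :: "complex \<Rightarrow> ereal"
  assumes "relative_sierpinski_carpet \<Omega> Q"
    and "carpet_harmonic ver \<Omega> Q u"
    and "is_normalized ver \<Omega> Q u"
  shows "continuous_on (carpet \<Omega> Q) u"
proof -
  interpret rel_carpet \<Omega> Q by unfold_locales (rule assms(1))
  show ?thesis by (rule normalized_continuous[OF harmonic_lmin[OF assms(2)] assms(3)])
qed

end
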